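(* Let $\mathcal{B}$ be a finitely accessible additive category. Then the homotopy category of complexes $\mathbf{K}(\mathcal{B})$ is a locally well generated triangulated category.
   Context: Coproducts are indexed by arbitrary sets. Finitely accessible: let $\mathcal{B}$ be an additive category which admits arbitrary filtered colimits. An object $X\in\mathcal{B}$ is finitely presentable if $\mathcal{B}(X,-):\mathcal{B}\to\mathrm{Ab}$ preserves filtered colimits. $\mathcal{B}$ is finitely accessible if there is a set $\mathcal{A}$ of finitely presentable objects of $\mathcal{B}$ such that every object of $\mathcal{B}$ is a filtered colimit of objects from $\mathcal{A}$. $\mathbf{C}(\mathcal{B})$ is the category of ($\mathbb{Z}$-indexed, unbounded) chain complexes over $\mathcal{B}$, and $\mathbf{K}(\mathcal{B})$ is its quotient by the ideal of null-homotopic morphisms, with its usual triangulated structure given by mapping cones; coproducts in $\mathbf{K}(\mathcal{B})$ are computed componentwise. Let $\mathcal{T}$ be a triangulated category with arbitrary coproducts. A localizing subcategory of $\mathcal{T}$ is a full triangulated subcategory closed under coproducts; for a class $\mathcal{S}$ of objects, $\mathrm{Loc}\,\mathcal{S}$ is the smallest localizing subcategory of $\mathcal{T}$ containing $\mathcal{S}$. For a regular cardinal $\kappa$, an object $Y$ is $\kappa$-small if every morphism $Y\to\coprod_{i\in I}X_i$ factorizes through a subcoproduct $\coprod_{i\in J}X_i$ with $|J|<\kappa$. $\mathcal{T}$ is $\kappa$-well generated if there is a set $\mathcal{S}$ of objects of $\mathcal{T}$ such that: (1) if $X\in\mathcal{T}$ satisfies $\mathcal{T}(Y,X)=0$ for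 each $Y\in\mathcal{S}$, then $X=0$; (2) each $Y\in\mathcal{S}$ is $\kappa$-small; (3) for any morphism $f:Y\to\coprod_{i\in I}X_i$ in $\mathcal{T}$ with $Y\in\mathcal{S}$ there is a family of morphisms $f_i:Y_i\to X_i$ ($i\in I$) with $Y_i\in\mathcal{S}$ such that $f$ factorizes as $Y\to\coprod_{i\in I}Y_i\xrightarrow{\coprod f_i}\coprod_{i\in I}X_i$. $\mathcal{T}$ is well generated if it is $\kappa$-well generated for some regular cardinal $\kappa$. $\mathcal{T}$ is locally well generated if $\mathrm{Loc}\,\mathcal{S}$ is well generated for every set $\mathcal{S}$ of objects of $\mathcal{T}$. *)

theory Defs
  imports "HOL-Algebra.Coset"
begin

unbundle cardinal_syntax

section \<open>Smallness\<close>

text \<open>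
  HOL has no proper classes, so "set" versus "class" is made relative to a universe
  \<open>U :: 'u set\<close> of (uncountable) strongly inaccessible cardinality: a "set" is a HOL set of
  cardinality less than that of \<open>U\<close>, a "class" is an arbitrary HOL set. Every small set is in
  bijection with a small subset of \<open>'u\<close>; hence index sets, the objects and arrows of small
  index categories, and the elements of abelian groups can be taken in \<open>'u\<close>.
\<close>

definition inaccessible :: "'u set \<Rightarrow> bool" where
  "inaccessible U \<longleftrightarrow>
     natLeq <o |U| \<and> regularCard |U| \<and> (\<forall>A :: 'u set. |A| <o |U| \<longrightarrow> |Pow A| <o |U| )"

definition small :: "'u set \<Rightarrow> 'a set \<Rightarrow> bool" where
  "small U A \<longleftrightarrow> |A| <o |U|"

text \<open>Cardinals are represented by well-orders on subsets of \<open>'u\<close>; regular cardinals are infinite.\<close>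

definition small_regular_cardinal :: "'u set \<Rightarrow> 'u rel \<Rightarrow> bool" where
  "small_regular_cardinal U \<kappa> \<longleftrightarrow> Cinfinite \<kappa> \<and> regularCard \<kappa> \<and> \<kappa> <o |U|"

section \<open>Categories and functors\<close>

text \<open>
  Hom-sets for different pairs of objects need not be disjoint; composition therefore takes
  the objects involved: \<open>Cmp C X Y Z g f\<close> is the composite of \<open>f : X \<rightarrow> Y\<close> and \<open>g : Y \<rightarrow> Z\<close>.
  In particular, every category with small hom-sets has an isomorphic copy whose arrows are
  elements of \<open>'u\<close>.
\<close>

record ('o, 'm) cat =
  Ob :: "'o set"
  Arr :: "'o \<Rightarrow> 'o \<Rightarrow> 'm set"
  Ident :: "'o \<Rightarrow> 'm"
  Cmp :: "'o \<Rightarrow> 'o \<Rightarrow> 'o \<Rightarrow> 'm \<Rightarrow> 'm \<Rightarrow> 'm"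

locale category =
  fixes C :: "('o, 'm, 'z) cat_scheme"
  assumes Ident_closed: "X \<in> Ob C \<Longrightarrow> Ident C X \<in> Arr C X X"
    and Cmp_closed:
      "\<lbrakk>X \<in> Ob C; Y \<in> Ob C; Z \<in> Ob C; f \<in> Arr C X Y; g \<in> Arr C Y Z\<rbrakk>
        \<Longrightarrow> Cmp C X Y Z g f \<in> Arr C X Z"
    and Cmp_Ident_left:
      "\<lbrakk>X \<in> Ob C; Y \<in> Ob C; f \<in> Arr C X Y\<rbrakk> \<Longrightarrow> Cmp C X Y Y (Ident C Y) f = f"
    and Cmp_Ident_right:
      "\<lbrakk>X \<in> Ob C; Y \<in> Ob C; f \<in> Arr C X Y\<rbrakk> \<Longrightarrow> Cmp C X X Y f (Ident C X) = f"
    and Cmp_assoc: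
      "\<lbrakk>W \<in> Ob C; X \<in> Ob C; Y \<in> Ob C; Z \<in> Ob C; f \<in> Arr C W X; g \<in> Arr C X Y; h \<in> Arr C Y Z\<rbrakk>
        \<Longrightarrow> Cmp C W Y Z h (Cmp C W X Y g f) = Cmp C W X Z (Cmp C X Y Z h g) f"

definition locally_small :: "'u set \<Rightarrow> ('o, 'm, 'z) cat_scheme \<Rightarrow> bool" where
  "locally_small U C \<longleftrightarrow> (\<forall>X\<in>Ob C. \<forall>Y\<in>Ob C. small U (Arr C X Y))"

definition small_category :: "'u set \<Rightarrow> ('o, 'm, 'z) cat_scheme \<Rightarrow> bool" where
  "small_category U C \<longleftrightarrow> category C \<and> small U (Ob C) \<and> locally_small U C"

definition isomorphism :: "('o, 'm, 'z) cat_scheme \<Rightarrow> 'o \<Rightarrow> 'o \<Rightarrow> 'm \<Rightarrow> bool" where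
  "isomorphism C X Y f \<longleftrightarrow>
     f \<in> Arr C X Y \<and>
     (\<exists>g\<in>Arr C Y X. Cmp C X Y X g f = Ident C X \<and> Cmp C Y X Y f g = Ident C Y)"

record ('a, 'f, 'b, 'g) func =
  fob :: "'a \<Rightarrow> 'b"
  fmor :: "'a \<Rightarrow> 'a \<Rightarrow> 'f \<Rightarrow> 'g"

definition is_functor ::
  "('a, 'f, 'y) cat_scheme \<Rightarrow> ('b, 'g, 'z) cat_scheme \<Rightarrow> ('a, 'f, 'b, 'g) func \<Rightarrow> bool" where
  "is_functor C D F \<longleftrightarrow>
     (\<forall>X\<in>Ob C. fob F X \<in> Ob D) \<and>
     (\<forall>X\<in>Ob C. \<forall>Y\<in>Ob C. \<forall>f\<in>Arr C X Y. fmor F X Y f \<in> Arr D (fob F X) (fob F Y)) \<and>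
     (\<forall>X\<in>Ob C. fmor F X X (Ident C X) = Ident D (fob F X)) \<and>
     (\<forall>X\<in>Ob C. \<forall>Y\<in>Ob C. \<forall>Z\<in>Ob C. \<forall>f\<in>Arr C X Y. \<forall>g\<in>Arr C Y Z.
        fmor F X Z (Cmp C X Y Z g f) =
        Cmp D (fob F X) (fob F Y) (fob F Z) (fmor F Y Z g) (fmor F X Y f))"

definition func_comp ::
  "('b, 'g, 'c, 'h) func \<Rightarrow> ('a, 'f, 'b, 'g) func \<Rightarrow> ('a, 'f, 'c, 'h) func" where
  "func_comp G F =
     \<lparr>fob = \<lambda>X. fob G (fob F X), fmor = \<lambda>X Y f. fmor G (fob F X) (fob F Y) (fmor F X Y f)\<rparr>"

definition is_equivalence ::
  "('a, 'f, 'y) cat_scheme \<Rightarrow> ('b, 'g, 'z) cat_scheme \<Rightarrow> ('a, 'f, 'b, 'g) func \<Rightarrow> bool" where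
  "is_equivalence C D F \<longleftrightarrow>
     is_functor C D F \<and>
     (\<forall>X\<in>Ob C. \<forall>Y\<in>Ob C. bij_betw (fmor F X Y) (Arr C X Y) (Arr D (fob F X) (fob F Y))) \<and>
     (\<forall>Z\<in>Ob D. \<exists>X\<in>Ob C. \<exists>f. isomorphism D (fob F X) Z f)"

section \<open>Colimits and coproducts\<close>

definition is_cocone ::
  "('j, 'k, 'y) cat_scheme \<Rightarrow> ('o, 'm, 'z) cat_scheme \<Rightarrow> ('j, 'k, 'o, 'm) func
    \<Rightarrow> 'o \<Rightarrow> ('j \<Rightarrow> 'm) \<Rightarrow> bool" where
  "is_cocone J C F L c \<longleftrightarrow>
     L \<in> Ob C \<and>
     (\<forall>j\<in>Ob J. c j \<in> Arr C (fob F j) L) \<and>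
     (\<forall>i\<in>Ob J. \<forall>j\<in>Ob J. \<forall>a\<in>Arr J i j.
        Cmp C (fob F i) (fob F j) L (c j) (fmor F i j a) = c i)"

definition is_colimit ::
  "('j, 'k, 'y) cat_scheme \<Rightarrow> ('o, 'm, 'z) cat_scheme \<Rightarrow> ('j, 'k, 'o, 'm) func
    \<Rightarrow> 'o \<Rightarrow> ('j \<Rightarrow> 'm) \<Rightarrow> bool" where
  "is_colimit J C F L c \<longleftrightarrow>
     is_cocone J C F L c \<and>
     (\<forall>M d. is_cocone J C F M d \<longrightarrow>
        (\<exists>!h. h \<in> Arr C L M \<and> (\<forall>j\<in>Ob J. Cmp C (fob F j) L M h (c j) = d j)))"

definition filtered :: "('j, 'k, 'z) cat_scheme \<Rightarrow> bool" where
  "filtered J \<longleftrightarrow>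
     Ob J \<noteq> {} \<and>
     (\<forall>i\<in>Ob J. \<forall>j\<in>Ob J. \<exists>k\<in>Ob J. Arr J i k \<noteq> {} \<and> Arr J j k \<noteq> {}) \<and>
     (\<forall>i\<in>Ob J. \<forall>j\<in>Ob J. \<forall>a\<in>Arr J i j. \<forall>b\<in>Arr J i j.
        \<exists>k\<in>Ob J. \<exists>c\<in>Arr J j k. Cmp J i j k c a = Cmp J i j k c b)"

definition filtered_diagram ::
  "'u set \<Rightarrow> ('u, 'u) cat \<Rightarrow> ('o, 'm, 'z) cat_scheme \<Rightarrow> ('u, 'u, 'o, 'm) func \<Rightarrow> bool" where
  "filtered_diagram U J C F \<longleftrightarrow> small_category U J \<and> filtered J \<and> is_functor J C F"

definition has_filtered_colimits :: "'u set \<Rightarrow> ('o, 'm, 'z) cat_scheme \<Rightarrow> bool" where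
  "has_filtered_colimits U C \<longleftrightarrow>
     (\<forall>J F. filtered_diagram U J C F \<longrightarrow> (\<exists>L c. is_colimit J C F L c))"

definition preserves_filtered_colimits ::
  "'u set \<Rightarrow> ('a, 'f, 'y) cat_scheme \<Rightarrow> ('b, 'g, 'z) cat_scheme \<Rightarrow> ('a, 'f, 'b, 'g) func \<Rightarrow> bool" where
  "preserves_filtered_colimits U C D G \<longleftrightarrow>
     (\<forall>J F L c. filtered_diagram U J C F \<longrightarrow> is_colimit J C F L c \<longrightarrow>
        is_colimit J D (func_comp G F) (fob G L) (\<lambda>j. fmor G (fob F j) L (c j)))"

definition is_coproduct ::
  "('o, 'm, 'z) cat_scheme \<Rightarrow> 'i set \<Rightarrow> ('i \<Rightarrow> 'o) \<Rightarrow> 'o \<Rightarrow> ('i \<Rightarrow> 'm) \<Rightarrow> bool" where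
  "is_coproduct C I X P \<iota> \<longleftrightarrow>
     P \<in> Ob C \<and> (\<forall>i\<in>I. \<iota> i \<in> Arr C (X i) P) \<and>
     (\<forall>Z\<in>Ob C. \<forall>f. (\<forall>i\<in>I. f i \<in> Arr C (X i) Z) \<longrightarrow>
        (\<exists>!h. h \<in> Arr C P Z \<and> (\<forall>i\<in>I. Cmp C (X i) P Z h (\<iota> i) = f i)))"

definition has_coproducts :: "'u set \<Rightarrow> ('o, 'm, 'z) cat_scheme \<Rightarrow> bool" where
  "has_coproducts U C \<longleftrightarrow>
     (\<forall>(I :: 'u set) X. small U I \<longrightarrow> (\<forall>i\<in>I. X i \<in> Ob C) \<longrightarrow> (\<exists>P \<iota>. is_coproduct C I X P \<iota>))"

section \<open>Additive categories\<close>

record ('o, 'm) preadd_cat = "('o, 'm) cat" +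
  Add :: "'o \<Rightarrow> 'o \<Rightarrow> 'm \<Rightarrow> 'm \<Rightarrow> 'm"
  Nul :: "'o \<Rightarrow> 'o \<Rightarrow> 'm"

definition hom_group :: "('o, 'm, 'z) preadd_cat_scheme \<Rightarrow> 'o \<Rightarrow> 'o \<Rightarrow> 'm monoid" where
  "hom_group C X Y = \<lparr>carrier = Arr C X Y, mult = Add C X Y, one = Nul C X Y\<rparr>"

abbreviation Neg :: "('o, 'm, 'z) preadd_cat_scheme \<Rightarrow> 'o \<Rightarrow> 'o \<Rightarrow> 'm \<Rightarrow> 'm" where
  "Neg C X Y f \<equiv> inv\<^bsub>hom_group C X Y\<^esub> f"

locale preadditive_category = category C
  for C :: "('o, 'm, 'z) preadd_cat_scheme" +
  assumes hom_group: "\<lbrakk>X \<in> Ob C; Y \<in> Ob C\<rbrakk> \<Longrightarrow> comm_group (hom_group C X Y)"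
    and Cmp_Add_left:
      "\<lbrakk>X \<in> Ob C; Y \<in> Ob C; Z \<in> Ob C; f \<in> Arr C X Y; g \<in> Arr C Y Z; g' \<in> Arr C Y Z\<rbrakk>
        \<Longrightarrow> Cmp C X Y Z (Add C Y Z g g') f = Add C X Z (Cmp C X Y Z g f) (Cmp C X Y Z g' f)"
    and Cmp_Add_right:
      "\<lbrakk>X \<in> Ob C; Y \<in> Ob C; Z \<in> Ob C; f \<in> Arr C X Y; f' \<in> Arr C X Y; g \<in> Arr C Y Z\<rbrakk>
        \<Longrightarrow> Cmp C X Y Z g (Add C X Y f f') = Add C X Z (Cmp C X Y Z g f) (Cmp C X Y Z g f')"

definition is_zero :: "('o, 'm, 'z) cat_scheme \<Rightarrow> 'o \<Rightarrow> bool" where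
  "is_zero C X \<longleftrightarrow>
     X \<in> Ob C \<and> (\<forall>Y\<in>Ob C. (\<exists>!f. f \<in> Arr C X Y) \<and> (\<exists>!f. f \<in> Arr C Y X))"

definition is_biproduct ::
  "('o, 'm, 'z) preadd_cat_scheme \<Rightarrow> 'o \<Rightarrow> 'o \<Rightarrow> 'o \<Rightarrow> 'm \<Rightarrow> 'm \<Rightarrow> 'm \<Rightarrow> 'm \<Rightarrow> bool" where
  "is_biproduct C X Y P i\<^sub>X i\<^sub>Y p\<^sub>X p\<^sub>Y \<longleftrightarrow>
     P \<in> Ob C \<and>
     i\<^sub>X \<in> Arr C X P \<and> i\<^sub>Y \<in> Arr C Y P \<and> p\<^sub>X \<in> Arr C P X \<and> p\<^sub>Y \<in> Arr C P Y \<and>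
     Cmp C X P X p\<^sub>X i\<^sub>X = Ident C X \<and> Cmp C Y P Y p\<^sub>Y i\<^sub>Y = Ident C Y \<and>
     Cmp C Y P X p\<^sub>X i\<^sub>Y = Nul C Y X \<and> Cmp C X P Y p\<^sub>Y i\<^sub>X = Nul C X Y \<and>
     Add C P P (Cmp C P X P i\<^sub>X p\<^sub>X) (Cmp C P Y P i\<^sub>Y p\<^sub>Y) = Ident C P"

locale additive_category = preadditive_category C
  for C :: "('o, 'm, 'z) preadd_cat_scheme" +
  assumes zero_object: "\<exists>X. is_zero C X"
    and biproducts:
      "\<lbrakk>X \<in> Ob C; Y \<in> Ob C\<rbrakk> \<Longrightarrow> \<exists>P i\<^sub>X i\<^sub>Y p\<^sub>X p\<^sub>Y. is_biproduct C X Y P i\<^sub>X i\<^sub>Y p\<^sub>X p\<^sub>Y"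

definition is_additive_functor ::
  "('a, 'f, 'y) preadd_cat_scheme \<Rightarrow> ('b, 'g, 'z) preadd_cat_scheme \<Rightarrow> ('a, 'f, 'b, 'g) func \<Rightarrow> bool"
  where
  "is_additive_functor C D F \<longleftrightarrow>
     is_functor C D F \<and>
     (\<forall>X\<in>Ob C. \<forall>Y\<in>Ob C.
        fmor F X Y \<in> hom (hom_group C X Y) (hom_group D (fob F X) (fob F Y)))"

section \<open>Finitely accessible additive categories\<close>

text \<open>
  The category of small abelian groups with elements in \<open>'u\<close>. Homomorphisms are taken
  extensional so that equality of arrows is equality on the carrier.
\<close>

definition Ab :: "'u set \<Rightarrow> ('u monoid, 'u \<Rightarrow> 'u) cat" where
  "Ab U =
     \<lparr>Ob = {G. comm_group G \<and> small U (carrier G)},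
      Arr = \<lambda>G H. hom G H \<inter> extensional (carrier G),
      Ident = \<lambda>G. \<lambda>x\<in>carrier G. x,
      Cmp = \<lambda>G H K g f. compose (carrier G) g f\<rparr>"

definition hom_functor ::
  "('o, 'u, 'z) preadd_cat_scheme \<Rightarrow> 'o \<Rightarrow> ('o, 'u, 'u monoid, 'u \<Rightarrow> 'u) func" where
  "hom_functor C X =
     \<lparr>fob = \<lambda>Y. hom_group C X Y, fmor = \<lambda>Y Z f. \<lambda>g\<in>Arr C X Y. Cmp C X Y Z f g\<rparr>"

definition finitely_presentable ::
  "'u set \<Rightarrow> ('o, 'u, 'z) preadd_cat_scheme \<Rightarrow> 'o \<Rightarrow> bool" where
  "finitely_presentable U C X \<longleftrightarrow>
     X \<in> Ob C \<and> preserves_filtered_colimits U C (Ab U) (hom_functor C X)"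

definition finitely_accessible :: "'u set \<Rightarrow> ('o, 'u, 'z) preadd_cat_scheme \<Rightarrow> bool" where
  "finitely_accessible U C \<longleftrightarrow>
     additive_category C \<and> locally_small U C \<and> has_filtered_colimits U C \<and>
     (\<exists>A. small U A \<and> (\<forall>X\<in>A. finitely_presentable U C X) \<and>
        (\<forall>X\<in>Ob C. \<exists>J F c.
           filtered_diagram U J C F \<and> (\<forall>j\<in>Ob J. fob F j \<in> A) \<and> is_colimit J C F X c))"

section \<open>Triangulated categories\<close>

text \<open>A candidate triangle \<open>(X, Y, Z, u, v, w)\<close> is \<open>X \<rightarrow> Y \<rightarrow> Z \<rightarrow> \<Sigma>X\<close> with arrows \<open>u\<close>, \<open>v\<close>, \<open>w\<close>.\<close>

type_synonym ('o, 'm) triangle = "'o \<times> 'o \<times> 'o \<times> 'm \<times> 'm \<times> 'm"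

record ('o, 'm) tri_cat = "('o, 'm) preadd_cat" +
  Shift :: "('o, 'm, 'o, 'm) func"
  Tri :: "('o, 'm) triangle set"

fun is_triangle ::
  "('o, 'm, 'z) cat_scheme \<Rightarrow> ('o, 'm, 'o, 'm) func \<Rightarrow> ('o, 'm) triangle \<Rightarrow> bool" where
  "is_triangle C S (X, Y, Z, u, v, w) \<longleftrightarrow>
     X \<in> Ob C \<and> Y \<in> Ob C \<and> Z \<in> Ob C \<and>
     u \<in> Arr C X Y \<and> v \<in> Arr C Y Z \<and> w \<in> Arr C Z (fob S X)"

fun triangle_map ::
  "('o, 'm, 'z) cat_scheme \<Rightarrow> ('o, 'm, 'o, 'm) func \<Rightarrow> ('o, 'm) triangle \<Rightarrow> ('o, 'm) triangle
    \<Rightarrow> 'm \<times> 'm \<times> 'm \<Rightarrow> bool" where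
  "triangle_map C S (X, Y, Z, u, v, w) (X', Y', Z', u', v', w') (a, b, c) \<longleftrightarrow>
     a \<in> Arr C X X' \<and> b \<in> Arr C Y Y' \<and> c \<in> Arr C Z Z' \<and>
     Cmp C X Y Y' b u = Cmp C X X' Y' u' a \<and>
     Cmp C Y Z Z' c v = Cmp C Y Y' Z' v' b \<and>
     Cmp C Z (fob S X) (fob S X') (fmor S X X' a) w = Cmp C Z Z' (fob S X') w' c"

fun triangle_iso ::
  "('o, 'm, 'z) cat_scheme \<Rightarrow> ('o, 'm, 'o, 'm) func \<Rightarrow> ('o, 'm) triangle \<Rightarrow> ('o, 'm) triangle
    \<Rightarrow> bool" where
  "triangle_iso C S (X, Y, Z, u, v, w) (X', Y', Z', u', v', w') \<longleftrightarrow>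
     (\<exists>a b c. triangle_map C S (X, Y, Z, u, v, w) (X', Y', Z', u', v', w') (a, b, c) \<and>
        isomorphism C X X' a \<and> isomorphism C Y Y' b \<and> isomorphism C Z Z' c)"

locale triangulated_category = additive_category T
  for T :: "('o, 'm, 'z) tri_cat_scheme" +
  assumes shift_additive: "is_additive_functor T T (Shift T)"
    and shift_equivalence: "is_equivalence T T (Shift T)"
    and Tri_triangles: "t \<in> Tri T \<Longrightarrow> is_triangle T (Shift T) t"
    and Tri_iso_closed:
      "\<lbrakk>t \<in> Tri T; is_triangle T (Shift T) t'; triangle_iso T (Shift T) t t'\<rbrakk> \<Longrightarrow> t' \<in> Tri T"
    and Tri_Ident:
      "\<lbrakk>X \<in> Ob T; is_zero T N\<rbrakk> \<Longrightarrow> (X, X, N, Ident T X, Nul T X N, Nul T N (fob (Shift T) X)) \<in> Tri T"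
    and Tri_complete:
      "\<lbrakk>X \<in> Ob T; Y \<in> Ob T; u \<in> Arr T X Y\<rbrakk> \<Longrightarrow> \<exists>Z v w. (X, Y, Z, u, v, w) \<in> Tri T"
    and Tri_rotate:
      "is_triangle T (Shift T) (X, Y, Z, u, v, w) \<Longrightarrow>
        (X, Y, Z, u, v, w) \<in> Tri T \<longleftrightarrow>
        (Y, Z, fob (Shift T) X, v, w,
          Neg T (fob (Shift T) X) (fob (Shift T) Y) (fmor (Shift T) X Y u)) \<in> Tri T"
    and Tri_fill:
      "\<lbrakk>(X, Y, Z, u, v, w) \<in> Tri T; (X', Y', Z', u', v', w') \<in> Tri T;
        a \<in> Arr T X X'; b \<in> Arr T Y Y'; Cmp T X Y Y' b u = Cmp T X X' Y' u' a\<rbrakk>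
        \<Longrightarrow> \<exists>c. triangle_map T (Shift T) (X, Y, Z, u, v, w) (X', Y', Z', u', v', w') (a, b, c)"
    and octahedral:
      "\<lbrakk>(X, Y, Z', u, i, i') \<in> Tri T; (Y, Z, X', v, j, j') \<in> Tri T;
        (X, Z, Y', Cmp T X Y Z v u, k, k') \<in> Tri T\<rbrakk>
        \<Longrightarrow> \<exists>f g.
          (Z', Y', X', f, g, Cmp T X' (fob (Shift T) Y) (fob (Shift T) Z') (fmor (Shift T) Y Z' i) j')
            \<in> Tri T \<and>
          Cmp T Y Z' Y' f i = Cmp T Y Z Y' k v \<and>
          Cmp T Z' Y' (fob (Shift T) X) k' f = i' \<and>
          Cmp T Z Y' X' g k = j \<and>
          Cmp T Y' X' (fob (Shift T) Y) j' g =
            Cmp T Y' (fob (Shift T) X) (fob (Shift T) Y) (fmor (Shift T) X Y u) k'"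

text \<open>Triangulated categories with arbitrary coproducts, with the standing convention that hom-sets are sets.\<close>

definition triangulated_with_coproducts :: "'u set \<Rightarrow> ('o, 'm, 'z) tri_cat_scheme \<Rightarrow> bool" where
  "triangulated_with_coproducts U T \<longleftrightarrow>
     triangulated_category T \<and> locally_small U T \<and> has_coproducts U T"

section \<open>Localizing subcategories\<close>

text \<open>Full triangulated subcategories are given by their classes of objects and are closed under isomorphism.\<close>

definition triangulated_subcategory :: "('o, 'm, 'z) tri_cat_scheme \<Rightarrow> 'o set \<Rightarrow> bool" where
  "triangulated_subcategory T A \<longleftrightarrow>
     A \<subseteq> Ob T \<and>
     (\<forall>N. is_zero T N \<longrightarrow> N \<in> A) \<and>
     (\<forall>X\<in>A. \<forall>Y\<in>Ob T. (\<exists>f. isomorphism T X Y f) \<longrightarrow> Y \<in> A) \<and>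
     (\<forall>X\<in>Ob T. X \<in> A \<longleftrightarrow> fob (Shift T) X \<in> A) \<and>
     (\<forall>X Y Z u v w. (X, Y, Z, u, v, w) \<in> Tri T \<longrightarrow> X \<in> A \<longrightarrow> Y \<in> A \<longrightarrow> Z \<in> A)"

definition localizing_subcategory ::
  "'u set \<Rightarrow> ('o, 'm, 'z) tri_cat_scheme \<Rightarrow> 'o set \<Rightarrow> bool" where
  "localizing_subcategory U T A \<longleftrightarrow>
     triangulated_subcategory T A \<and>
     (\<forall>(I :: 'u set) X P \<iota>.
        small U I \<longrightarrow> (\<forall>i\<in>I. X i \<in> A) \<longrightarrow> is_coproduct T I X P \<iota> \<longrightarrow> P \<in> A)"

definition Loc :: "'u set \<Rightarrow> ('o, 'm, 'z) tri_cat_scheme \<Rightarrow> 'o set \<Rightarrow> 'o set" where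
  "Loc U T S = \<Inter>{A. localizing_subcategory U T A \<and> S \<subseteq> A}"

definition full_subcategory :: "('o, 'm, 'z) tri_cat_scheme \<Rightarrow> 'o set \<Rightarrow> ('o, 'm, 'z) tri_cat_scheme"
  where
  "full_subcategory T A =
     T\<lparr>Ob := A, Tri := {(X, Y, Z, u, v, w). (X, Y, Z, u, v, w) \<in> Tri T \<and> X \<in> A \<and> Y \<in> A \<and> Z \<in> A}\<rparr>"

section \<open>Well generated triangulated categories\<close>

text \<open>
  Coproducts are specified by their universal property rather than chosen; \<open>h\<close> below is the
  canonical map between coproducts, determined by its composites with the injections.
\<close>

definition \<kappa>_small_object ::
  "'u set \<Rightarrow> 'u rel \<Rightarrow> ('o, 'm, 'z) cat_scheme \<Rightarrow> 'o \<Rightarrow> bool" where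
  "\<kappa>_small_object U \<kappa> T Y \<longleftrightarrow>
     (\<forall>(I :: 'u set) X P \<iota> f.
        small U I \<longrightarrow> (\<forall>i\<in>I. X i \<in> Ob T) \<longrightarrow> is_coproduct T I X P \<iota> \<longrightarrow> f \<in> Arr T Y P \<longrightarrow>
        (\<exists>J Q \<iota>' g h.
           J \<subseteq> I \<and> |J| <o \<kappa> \<and> is_coproduct T J X Q \<iota>' \<and>
           g \<in> Arr T Y Q \<and>
           h \<in> Arr T Q P \<and> (\<forall>i\<in>J. Cmp T (X i) Q P h (\<iota>' i) = \<iota> i) \<and>
           f = Cmp T Y Q P h g))"

definition \<kappa>_well_generated ::
  "'u set \<Rightarrow> 'u rel \<Rightarrow> ('o, 'm, 'z) tri_cat_scheme \<Rightarrow> bool" where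
  "\<kappa>_well_generated U \<kappa> T \<longleftrightarrow>
     triangulated_with_coproducts U T \<and>
     (\<exists>S. S \<subseteq> Ob T \<and> small U S \<and>
        (\<forall>X\<in>Ob T. (\<forall>Y\<in>S. Arr T Y X = {Nul T Y X}) \<longrightarrow> is_zero T X) \<and>
        (\<forall>Y\<in>S. \<kappa>_small_object U \<kappa> T Y) \<and>
        (\<forall>Y\<in>S. \<forall>(I :: 'u set) X P \<iota> f.
           small U I \<longrightarrow> (\<forall>i\<in>I. X i \<in> Ob T) \<longrightarrow> is_coproduct T I X P \<iota> \<longrightarrow> f \<in> Arr T Y P \<longrightarrow>
           (\<exists>Y' f' Q \<iota>' g h.
              (\<forall>i\<in>I. Y' i \<in> S \<and> f' i \<in> Arr T (Y' i) (X i)) \<and>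
              is_coproduct T I Y' Q \<iota>' \<and>
              g \<in> Arr T Y Q \<and>
              h \<in> Arr T Q P \<and>
              (\<forall>i\<in>I. Cmp T (Y' i) Q P h (\<iota>' i) = Cmp T (Y' i) (X i) P (\<iota> i) (f' i)) \<and>
              f = Cmp T Y Q P h g)))"

definition well_generated :: "'u set \<Rightarrow> ('o, 'm, 'z) tri_cat_scheme \<Rightarrow> bool" where
  "well_generated U T \<longleftrightarrow> (\<exists>\<kappa>. small_regular_cardinal U \<kappa> \<and> \<kappa>_well_generated U \<kappa> T)"

definition locally_well_generated :: "'u set \<Rightarrow> ('o, 'm, 'z) tri_cat_scheme \<Rightarrow> bool" where
  "locally_well_generated U T \<longleftrightarrow>
     triangulated_with_coproducts U T \<and>
     (\<forall>S. S \<subseteq> Ob T \<and> small U S \<longrightarrow> well_generated U (full_subcategory T (Loc U T S)))"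

section \<open>Complexes and the homotopy category\<close>

text \<open>Differentials raise degree: \<open>cdiff X n : cob X n \<rightarrow> cob X (n + 1)\<close>.\<close>

record ('o, 'm) cpx =
  cob :: "int \<Rightarrow> 'o"
  cdiff :: "int \<Rightarrow> 'm"

definition complexes :: "('o, 'm, 'z) preadd_cat_scheme \<Rightarrow> ('o, 'm) cpx set" where
  "complexes B =
     {X. \<forall>n. cob X n \<in> Ob B \<and> cdiff X n \<in> Arr B (cob X n) (cob X (n + 1)) \<and>
        Cmp B (cob X n) (cob X (n + 1)) (cob X (n + 2)) (cdiff X (n + 1)) (cdiff X n) =
        Nul B (cob X n) (cob X (n + 2))}"

definition chain_maps ::
  "('o, 'm, 'z) preadd_cat_scheme \<Rightarrow> ('o, 'm) cpx \<Rightarrow> ('o, 'm) cpx \<Rightarrow> (int \<Rightarrow> 'm) set" where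
  "chain_maps B X Y =
     {f. \<forall>n. f n \<in> Arr B (cob X n) (cob Y n) \<and>
        Cmp B (cob X n) (cob X (n + 1)) (cob Y (n + 1)) (f (n + 1)) (cdiff X n) =
        Cmp B (cob X n) (cob Y n) (cob Y (n + 1)) (cdiff Y n) (f n)}"

definition C_cat :: "('o, 'm, 'z) preadd_cat_scheme \<Rightarrow> (('o, 'm) cpx, int \<Rightarrow> 'm) preadd_cat" where
  "C_cat B =
     \<lparr>Ob = complexes B,
      Arr = chain_maps B,
      Ident = \<lambda>X n. Ident B (cob X n),
      Cmp = \<lambda>X Y Z g f n. Cmp B (cob X n) (cob Y n) (cob Z n) (g n) (f n),
      Add = \<lambda>X Y f g n. Add B (cob X n) (cob Y n) (f n) (g n),
      Nul = \<lambda>X Y n. Nul B (cob X n) (cob Y n)\<rparr>"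

definition null_homotopic ::
  "('o, 'm, 'z) preadd_cat_scheme \<Rightarrow> ('o, 'm) cpx \<Rightarrow> ('o, 'm) cpx \<Rightarrow> (int \<Rightarrow> 'm) set" where
  "null_homotopic B X Y =
     {f \<in> chain_maps B X Y. \<exists>s.
        (\<forall>n. s n \<in> Arr B (cob X n) (cob Y (n - 1))) \<and>
        (\<forall>n. f n = Add B (cob X n) (cob Y n)
           (Cmp B (cob X n) (cob Y (n - 1)) (cob Y n) (cdiff Y (n - 1)) (s n))
           (Cmp B (cob X n) (cob X (n + 1)) (cob Y n) (s (n + 1)) (cdiff X n)))}"

text \<open>
  The quotient of a preadditive category by an ideal \<open>I\<close>: hom-groups are the factor groups
  by \<open>I X Y\<close>, so arrows are cosets. The composite of two cosets is the union of the (equal)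
  cosets of all composites of representatives.
\<close>

definition ideal_class ::
  "('o, 'm, 'z) preadd_cat_scheme \<Rightarrow> ('o \<Rightarrow> 'o \<Rightarrow> 'm set) \<Rightarrow> 'o \<Rightarrow> 'o \<Rightarrow> 'm \<Rightarrow> 'm set" where
  "ideal_class C I X Y f = I X Y #>\<^bsub>hom_group C X Y\<^esub> f"

definition quotient_category ::
  "('o, 'm, 'z) preadd_cat_scheme \<Rightarrow> ('o \<Rightarrow> 'o \<Rightarrow> 'm set) \<Rightarrow> ('o, 'm set) preadd_cat" where
  "quotient_category C I =
     \<lparr>Ob = Ob C,
      Arr = \<lambda>X Y. carrier (hom_group C X Y Mod I X Y),
      Ident = \<lambda>X. ideal_class C I X X (Ident C X),
      Cmp = \<lambda>X Y Z G F. (\<Union>g\<in>G. \<Union>f\<in>F. ideal_class C I X Z (Cmp C X Y Z g f)),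
      Add = \<lambda>X Y. mult (hom_group C X Y Mod I X Y),
      Nul = \<lambda>X Y. one (hom_group C X Y Mod I X Y)\<rparr>"

definition homotopy_category ::
  "('o, 'm, 'z) preadd_cat_scheme \<Rightarrow> (('o, 'm) cpx, (int \<Rightarrow> 'm) set) preadd_cat" where
  "homotopy_category B = quotient_category (C_cat B) (null_homotopic B)"

abbreviation homotopy_class ::
  "('o, 'm, 'z) preadd_cat_scheme \<Rightarrow> ('o, 'm) cpx \<Rightarrow> ('o, 'm) cpx \<Rightarrow> (int \<Rightarrow> 'm) \<Rightarrow> (int \<Rightarrow> 'm) set"
  where
  "homotopy_class B \<equiv> ideal_class (C_cat B) (null_homotopic B)"

text \<open>On arrows the shift reindexes each representative; it maps homotopy classes to homotopy classes.\<close>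

definition K_shift ::
  "('o, 'm, 'z) preadd_cat_scheme
    \<Rightarrow> (('o, 'm) cpx, (int \<Rightarrow> 'm) set, ('o, 'm) cpx, (int \<Rightarrow> 'm) set) func" where
  "K_shift B =
     \<lparr>fob = \<lambda>X. \<lparr>cob = \<lambda>n. cob X (n + 1),
                 cdiff = \<lambda>n. Neg B (cob X (n + 1)) (cob X (n + 2)) (cdiff X (n + 1))\<rparr>,
      fmor = \<lambda>X Y F. (\<lambda>f n. f (n + 1)) ` F\<rparr>"

text \<open>
  \<open>Z\<close> is a mapping cone of \<open>f : X \<rightarrow> Y\<close>: \<open>Z n\<close> is a biproduct of \<open>X (n + 1)\<close> and \<open>Y n\<close>, and
  the differential has the matrix \<open>(-d 0; f d)\<close>.
\<close>

definition is_mapping_cone ::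
  "('o, 'm, 'z) preadd_cat_scheme \<Rightarrow> ('o, 'm) cpx \<Rightarrow> ('o, 'm) cpx \<Rightarrow> (int \<Rightarrow> 'm)
    \<Rightarrow> ('o, 'm) cpx \<Rightarrow> (int \<Rightarrow> 'm) \<Rightarrow> (int \<Rightarrow> 'm) \<Rightarrow> (int \<Rightarrow> 'm) \<Rightarrow> (int \<Rightarrow> 'm) \<Rightarrow> bool" where
  "is_mapping_cone B X Y f Z i\<^sub>X i\<^sub>Y p\<^sub>X p\<^sub>Y \<longleftrightarrow>
     Z \<in> complexes B \<and>
     (\<forall>n. is_biproduct B (cob X (n + 1)) (cob Y n) (cob Z n) (i\<^sub>X n) (i\<^sub>Y n) (p\<^sub>X n) (p\<^sub>Y n) \<and>
        Cmp B (cob X (n + 1)) (cob Z n) (cob Z (n + 1)) (cdiff Z n) (i\<^sub>X n) =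
          Add B (cob X (n + 1)) (cob Z (n + 1))
            (Cmp B (cob X (n + 1)) (cob X (n + 2)) (cob Z (n + 1)) (i\<^sub>X (n + 1))
              (Neg B (cob X (n + 1)) (cob X (n + 2)) (cdiff X (n + 1))))
            (Cmp B (cob X (n + 1)) (cob Y (n + 1)) (cob Z (n + 1)) (i\<^sub>Y (n + 1)) (f (n + 1))) \<and>
        Cmp B (cob Y n) (cob Z n) (cob Z (n + 1)) (cdiff Z n) (i\<^sub>Y n) =
          Cmp B (cob Y n) (cob Y (n + 1)) (cob Z (n + 1)) (i\<^sub>Y (n + 1)) (cdiff Y n))"

definition cone_triangles ::
  "('o, 'm, 'z) preadd_cat_scheme \<Rightarrow> (('o, 'm) cpx, (int \<Rightarrow> 'm) set) triangle set" where
  "cone_triangles B =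
     {(X, Y, Z, homotopy_class B X Y f, homotopy_class B Y Z i\<^sub>Y,
         homotopy_class B Z (fob (K_shift B) X) p\<^sub>X) |X Y Z f i\<^sub>X i\<^sub>Y p\<^sub>X p\<^sub>Y.
       X \<in> complexes B \<and> Y \<in> complexes B \<and> f \<in> chain_maps B X Y \<and>
       is_mapping_cone B X Y f Z i\<^sub>X i\<^sub>Y p\<^sub>X p\<^sub>Y}"

definition K_cat :: "('o, 'm, 'z) preadd_cat_scheme \<Rightarrow> (('o, 'm) cpx, (int \<Rightarrow> 'm) set) tri_cat" where
  "K_cat B =
     preadd_cat.extend (homotopy_category B)
       (tri_cat.fields (K_shift B)
         {t. is_triangle (homotopy_category B) (K_shift B) t \<and>
             (\<exists>t'\<in>cone_triangles B. triangle_iso (homotopy_category B) (K_shift B) t' t)})"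

end

theory Submission
  imports Defs "HOL-Library.Function_Algebras"
begin

text \<open>
  For a small set \<open>S\<close> of complexes choose an uncountable regular cardinal \<open>\<kappa>\<close> above \<open>|A|\<close> and the sizes of all groups
  \<open>B(a, b)\<close> and \<open>B(a, X n)\<close> with \<open>a, b \<in> A\<close>, \<open>X \<in> S\<close>, and call a complex \<open>X\<close> small if
  \<open>|B(a, X n)| < \<kappa>\<close> throughout. Small complexes form, up to isomorphism, a small class closed under
  shifts, cones and coproducts of fewer than \<open>\<kappa>\<close> objects. An element of a coproduct has only finitely
  many nonzero components, and fewer than \<open>\<kappa>\<close> elements of a complex lie in a small subcomplex; so
  a map from a small complex to \<open>\<Coprod> X i\<close> in \<open>K(B)\<close> factors through \<open>\<Coprod> Y i\<close> for small
  \<open>Y i \<rightarrow> X i\<close>. Such a factorization property passes to any localizing subcategory generated by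
  small objects: the objects \<open>X\<close> of \<open>Loc S\<close> such that every map from a small object to \<open>X\<close> factors through a
  small object of \<open>Loc S\<close> form a localizing subcategory, hence contain \<open>Loc S\<close>. Therefore the small
  objects in \<open>Loc S\<close> witness that \<open>Loc S\<close> is \<open>\<kappa>\<close>-well generated.

  The triangulated structure of \<open>K(B)\<close> is obtained from a differential graded category whose
  arrows live in one ring, so that identities between homotopies become ring identities.
\<close>

section \<open>Regular cardinals and the universe\<close>

text \<open>No kernels, images or subobjects are available in \<open>B\<close>; the tool at hand is
  the set \<open>A\<close>. Arrows \<open>a -> X\<close> with \<open>a \<in> A\<close> therefore
  serve as elements of \<open>X\<close>: they detect equality of arrows, and every natural
  assignment on elements comes from a unique arrow. A subobject is obtained as the colimit of a
  family of elements. Only filtered colimits are given, so such a family has to contain the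
  witnesses of its own filteredness, and this dictates the closure process behind small
  subcomplexes.

  A map in the homotopy category into a coproduct is represented by a chain map into the degreewise
  coproduct. Factorizations are constructed strictly for this chain map, and no homotopies have to
  be followed.

  The delicate condition is the third one for \<open>Loc S\<close>: the complexes \<open>Y i\<close>
  cut out of the \<open>X i\<close> may lie outside \<open>Loc S\<close>. A second factorization, of
  \<open>Y i -> X i\<close>, brings them back; its existence is the content of the statement about
  maps from small objects to objects of \<open>Loc S\<close>.\<close>

locale regular_cardinal =
 fixes \<kappa> :: "'k rel"
 assumes cinf: "Cinfinite \<kappa>" and reg: "regularCard \<kappa>"
begin

lemma card_order: "Card_order \<kappa>" and inf_Field: "infinite (Field \<kappa>)"
 using cinf by (auto simp: cinfinite_def)

lemma stable: "stable \<kappa>"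
 using regularCard_stable[OF card_order inf_Field reg] .

lemma lt_subset: "A \<subseteq> B \<Longrightarrow> |B| <o \<kappa> \<Longrightarrow> |A| <o \<kappa>"
 using card_of_mono1 ordLeq_ordLess_trans by blast

lemma lt_image: "|A| <o \<kappa> \<Longrightarrow> |f ` A| <o \<kappa>"
 using card_of_image ordLeq_ordLess_trans by blast

lemma lt_inj: "inj_on f A \<Longrightarrow> f ` A \<subseteq> B \<Longrightarrow> |B| <o \<kappa> \<Longrightarrow> |A| <o \<kappa>"
 using card_of_ordLeq[of A B] ordLeq_ordLess_trans by blast

lemma lt_finite: "finite A \<Longrightarrow> |A| <o \<kappa>"
 using finite_ordLess_infinite[OF card_of_Well_order, of \<kappa> A] card_order inf_Field
 by (auto simp: Field_card_of card_order_on_def)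

lemma lt_UN: "|I| <o \<kappa> \<Longrightarrow> (\<And>i. i \<in> I \<Longrightarrow> |A i| <o \<kappa>) \<Longrightarrow> |\<Union>i\<in>I. A i| <o \<kappa>"
 using stable_UNION[OF stable] .

lemma lt_Sigma: "|I| <o \<kappa> \<Longrightarrow> (\<And>i. i \<in> I \<Longrightarrow> |A i| <o \<kappa>) \<Longrightarrow> |Sigma I A| <o \<kappa>"
 using stable_elim[OF stable] by blast

lemma lt_Un: assumes "|A| <o \<kappa>" "|B| <o \<kappa>" shows "|A \<union> B| <o \<kappa>"
proof -
 have "A \<union> B = (\<Union>b\<in>(UNIV :: bool set). if b then A else B)" by auto
 moreover have "|\<Union>b\<in>(UNIV :: bool set). if b then A else B| <o \<kappa>"
  by (rule lt_UN[OF lt_finite]) (use assms in auto)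
 ultimately show ?thesis by simp
qed

lemma lt_countable:
 assumes "natLeq <o \<kappa>" shows "|UNIV :: int set| <o \<kappa>" "|UNIV :: nat set| <o \<kappa>"
proof -
 show *: "|UNIV :: nat set| <o \<kappa>" using assms card_of_nat ordIso_ordLess_trans by blast
 have "|range (\<lambda>(a, b). int a - int b)| <o \<kappa>"
  by (rule lt_image) (use lt_Sigma[OF * *] in simp)
 moreover have "range (\<lambda>(a, b). int a - int b) = UNIV"
  by (auto simp: image_iff) (metis int_diff_cases)
 ultimately show "|UNIV :: int set| <o \<kappa>" by simp
qed

text \<open>Finite subsets are sorted by cardinality: those with \<open>n + 1\<close> elements arise
  from those with \<open>n\<close> by inserting a point, and the countable union over
  \<open>n\<close> stays below \<kappa> because \<kappa> is regular and uncountable. It counts the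
  finite supports of elements of coproducts.\<close>

lemma lt_Fpow:
 assumes unc: "natLeq <o \<kappa>" and A: "|A| <o \<kappa>" shows "|Fpow A| <o \<kappa>"
proof -
 define P where "P n = {X. X \<subseteq> A \<and> finite X \<and> card X = n}" for n
 have "|P n| <o \<kappa>" for n
 proof (induction n)
  case 0
  have "P 0 \<subseteq> {{}}" by (auto simp: P_def)
  then show ?case by (rule lt_subset) (simp add: lt_finite)
 next
  case (Suc n)
  have "P (Suc n) \<subseteq> (\<lambda>(a, X). insert a X) ` (A \<times> P n)"
  proof
   fix X assume X: "X \<in> P (Suc n)"
   then obtain a Y where "X = insert a Y" "a \<notin> Y" "card Y = n" "finite Y"
    by (auto simp: P_def card_Suc_eq_finite)
   with X show "X \<in> (\<lambda>(a, X). insert a X) ` (A \<times> P n)" by (auto simp: P_def)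
  qed
  with lt_image[OF lt_Sigma[OF A Suc]] show ?case using lt_subset by blast
 qed
 then have "|\<Union>n. P n| <o \<kappa>" using lt_UN lt_countable(2)[OF unc] by blast
 moreover have "Fpow A \<subseteq> (\<Union>n. P n)" by (auto simp: Fpow_def P_def)
 ultimately show ?thesis using lt_subset by blast
qed

text \<open>\<open>\<Phi>\<close> adjoins all values of \<open>F\<close>; iterating it over the
  natural numbers suffices because the stages increase, so any two points of the union occur in a
  common stage. \<open>F\<close> takes two arguments because upper bounds of pairs of elements have
  to be adjoined.\<close>

lemma closure_lt:
 assumes unc: "natLeq <o \<kappa>" and E: "|E| <o \<kappa>" "E \<subseteq> M"
  and F: "\<And>x y. x \<in> M \<Longrightarrow> y \<in> M \<Longrightarrow> F x y \<subseteq> M \<and> |F x y| <o \<kappa>"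
 shows "\<exists>P. E \<subseteq> P \<and> P \<subseteq> M \<and> |P| <o \<kappa> \<and> (\<forall>x\<in>P. \<forall>y\<in>P. F x y \<subseteq> P)"
proof -
 define \<Phi> where "\<Phi> X = X \<union> (\<Union>(x, y)\<in>X \<times> X. F x y)" for X
 define Q where "Q n = (\<Phi> ^^ n) E" for n
 have Q: "Q n \<subseteq> M \<and> |Q n| <o \<kappa>" for n
 proof (induction n)
  case (Suc n)
  have "|\<Phi> (Q n)| <o \<kappa>" unfolding \<Phi>_def
   by (rule lt_Un[OF _ lt_UN[OF lt_Sigma]]) (use Suc F in auto)
  moreover have "\<Phi> (Q n) \<subseteq> M" using Suc F by (fastforce simp: \<Phi>_def)
  ultimately show ?case by (simp add: Q_def)
 qed (use E in \<open>simp add: Q_def\<close>)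
 have mono: "Q m \<subseteq> Q n" if "m \<le> n" for m n
  using that by (induction n rule: dec_induct) (auto simp: Q_def \<Phi>_def)
 have "F x y \<subseteq> (\<Union>n. Q n)" if "x \<in> Q m" "y \<in> Q n" for x y m n
 proof -
  have "x \<in> Q (max m n)" "y \<in> Q (max m n)" using that mono by (meson max.cobounded1 max.cobounded2 subsetD)+
  then have "F x y \<subseteq> \<Phi> (Q (max m n))" by (auto simp: \<Phi>_def)
  also have "\<dots> = Q (Suc (max m n))" by (simp add: Q_def)
  finally show ?thesis by blast
 qed
 moreover have "|\<Union>n. Q n| <o \<kappa>" using Q lt_UN lt_countable(2)[OF unc] by blast
 moreover have "E \<subseteq> (\<Union>n. Q n)" using Q_def[of 0] by auto
 ultimately show ?thesis using Q by (intro exI[of _ "\<Union>n. Q n"]) blast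
qed

end

locale universe =
 fixes U :: "'u set"
 assumes inacc: "inaccessible U"

sublocale universe \<subseteq> regular_cardinal "|U|"
proof
 have inf: "infinite U"
  using inacc ordLess_imp_ordLeq infinite_iff_natLeq_ordLeq by (auto simp: inaccessible_def)
 then show "Cinfinite |U|" by (auto simp add: cinfinite_def Field_card_of card_of_card_order_on)
 show "regularCard |U|" using inacc by (simp add: inaccessible_def)
qed

context universe
begin

lemma natLeq_less: "natLeq <o |U|"
 using inacc by (simp add: inaccessible_def)

lemma small_ex_inj:
 assumes "small U A" obtains f :: "'a \<Rightarrow> 'u" where "inj_on f A" "f ` A \<subseteq> U"
 using assms card_of_ordLeq[of A U] ordLess_imp_ordLeq unfolding small_def by blast

lemma small_Pow:
 assumes "small U (A :: 'a set)" shows "small U (Pow A)"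
proof -
 obtain f :: "'a \<Rightarrow> 'u" where f: "inj_on f A" using small_ex_inj[OF assms] by blast
 have "|Pow (f ` A)| <o |U|"
  using lt_image[OF assms[unfolded small_def]] inacc by (auto simp: inaccessible_def)
 moreover have "inj_on ((`) f) (Pow A)" using f by (rule inj_on_image_Pow)
 moreover have "(`) f ` Pow A \<subseteq> Pow (f ` A)" by auto
 ultimately show ?thesis unfolding small_def by (metis lt_inj)
qed

text \<open>Coproducts are indexed by sets over \<open>'u\<close>; two distinct indices present a
  binary biproduct as such a coproduct.\<close>

lemma two_elements: "\<exists>a b :: 'u. a \<noteq> b"
proof -
 have "infinite U" using inf_Field by (simp add: Field_card_of)
 then obtain T where "T \<subseteq> U" "card T = 2" by (meson infinite_arbitrarily_large)
 then show ?thesis by (auto simp: card_2_iff)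
qed

text \<open>The successor cardinal of the disjoint union of \<open>M\<close> with the natural
  numbers is regular and uncountable; inaccessibility keeps it below \<open>|U|\<close> because it
  is bounded by a power set.\<close>

lemma ex_regular_cardinal:
 assumes "small U M"
 shows "\<exists>\<kappa> :: 'u rel. small_regular_cardinal U \<kappa> \<and> |M| <o \<kappa> \<and> natLeq <o \<kappa>"
proof -
 have "|M <+> (UNIV :: nat set)| <o |U|"
  using card_of_Plus_ordLess_infinite_Field[OF inf_Field card_order] assms lt_countable(2)[OF natLeq_less]
  by (auto simp: small_def)
 then obtain f :: "'a + nat \<Rightarrow> 'u" where f: "inj_on f (M <+> UNIV)" "f ` (M <+> UNIV) \<subseteq> U"
  using small_ex_inj by (metis small_def)
 define N where "N = f ` (M <+> UNIV)"
 have N: "|M <+> (UNIV :: nat set)| =o |N|"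
  using f(1) unfolding N_def by (meson card_of_ordIsoI inj_on_imp_bij_betw)
 have MN: "|M| \<le>o |N|" using card_of_Plus1 N ordLeq_ordIso_trans by blast
 have nN: "natLeq \<le>o |N|"
  using card_of_Plus2 N ordLeq_ordIso_trans card_of_nat ordIso_ordLeq_trans ordIso_symmetric by blast
 have Nsm: "|N| <o |U|"
  unfolding N_def by (rule lt_image) (rule \<open>|M <+> UNIV| <o |U|\<close>)
 have inf: "infinite N" using nN infinite_iff_natLeq_ordLeq by blast
 have CN: "Cinfinite |N|" using inf by (auto simp add: cinfinite_def Field_card_of card_of_card_order_on)
 define c where "c = cardSuc |N|"
 have "|Pow N| <o |U|" using Nsm inacc by (auto simp: inaccessible_def)
 moreover have "c \<le>o |Pow N|" unfolding c_def
  by (rule cardSuc_least) (simp_all only: card_of_Pow card_of_Card_order)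
 ultimately have cU: "c <o |U|" using ordLeq_ordLess_trans by blast
 have Cc: "Cinfinite c" unfolding c_def by (rule Cinfinite_cardSuc[OF CN])
 \<comment> \<open>\<open>c\<close> is a well-order on sets over \<open>'u\<close>, while cardinals
   are relations on \<open>'u\<close>; an injection of its field into \<open>'u\<close> moves it
   there.\<close>
 have "|Field c| =o c" using Cc card_of_Field_ordIso by blast
 moreover have FU: "|Field c| <o |U|" using \<open>|Field c| =o c\<close> cU ordIso_ordLess_trans by blast
 then obtain g :: "'u set \<Rightarrow> 'u" where g: "inj_on g (Field c)" using small_ex_inj unfolding small_def by blast
 define \<kappa> where "\<kappa> = |g ` Field c|"
 have "|Field c| =o \<kappa>" using g unfolding \<kappa>_def by (meson card_of_ordIsoI inj_on_imp_bij_betw)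
 then have c\<kappa>: "c =o \<kappa>" using \<open>|Field c| =o c\<close> ordIso_symmetric ordIso_transitive by blast
 have "Cinfinite \<kappa>" using c\<kappa> Cc Cinfinite_cong by (metis)
 moreover have "regularCard \<kappa>"
  using regularCard_ordIso[OF c\<kappa> Cc] regularCard_cardSuc[OF CN] c_def by simp
 moreover have "\<kappa> <o |U|" using c\<kappa> cU ordIso_ordLess_trans ordIso_symmetric by blast
 moreover have "|N| <o \<kappa>" using cardSuc_greater[of "|N|"] c\<kappa> ordLess_ordIso_trans
  unfolding c_def by (metis card_of_Card_order)
 moreover have "|M| <o \<kappa>" "natLeq <o \<kappa>" using \<open>|N| <o \<kappa>\<close> MN nN ordLeq_ordLess_trans by blast+
 ultimately show ?thesis unfolding small_regular_cardinal_def by blast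
qed

end

section \<open>Graded arrows as ring elements\<close>

text \<open>A type cannot depend on the category at hand, so a vector selects an arrow
  \<open>Z -> X\<close> for all preadditive categories and all objects \<open>Z\<close>,
  \<open>X\<close> at once. The fixed value \<open>undefined\<close> elsewhere makes equality of
  vectors a statement about arrows, and componentwise addition gives an abelian group.\<close>

definition valid_vec :: "(('o, 'm) preadd_cat \<times> 'o \<times> 'o \<Rightarrow> 'm) \<Rightarrow> bool" where
 "valid_vec v \<longleftrightarrow> (\<forall>C Z X.
   if preadditive_category C \<and> Z \<in> Ob C \<and> X \<in> Ob C then v (C, Z, X) \<in> Arr C Z X
   else v (C, Z, X) = undefined)"

lemma valid_vec_const:
 assumes "\<And>C Z X. \<lbrakk>preadditive_category C; Z \<in> Ob C; X \<in> Ob C\<rbrakk> \<Longrightarrow> f C Z X \<in> Arr C Z X"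
 shows "valid_vec (\<lambda>(C, Z, X). if preadditive_category C \<and> Z \<in> Ob C \<and> X \<in> Ob C then f C Z X else undefined)"
 using assms by (auto simp: valid_vec_def)

context preadditive_category
begin

lemma hom_closed: "\<lbrakk>X \<in> Ob C; Y \<in> Ob C; f \<in> Arr C X Y; g \<in> Arr C X Y\<rbrakk> \<Longrightarrow> Add C X Y f g \<in> Arr C X Y"
 and Nul_closed: "\<lbrakk>X \<in> Ob C; Y \<in> Ob C\<rbrakk> \<Longrightarrow> Nul C X Y \<in> Arr C X Y"
 and Neg_closed: "\<lbrakk>X \<in> Ob C; Y \<in> Ob C; f \<in> Arr C X Y\<rbrakk> \<Longrightarrow> Neg C X Y f \<in> Arr C X Y"
 and Add_commute: "\<lbrakk>X \<in> Ob C; Y \<in> Ob C; f \<in> Arr C X Y; g \<in> Arr C X Y\<rbrakk> \<Longrightarrow> Add C X Y f g = Add C X Y g f"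
 and Add_assoc: "\<lbrakk>X \<in> Ob C; Y \<in> Ob C; f \<in> Arr C X Y; g \<in> Arr C X Y; h \<in> Arr C X Y\<rbrakk>
  \<Longrightarrow> Add C X Y (Add C X Y f g) h = Add C X Y f (Add C X Y g h)"
 and Add_Nul: "\<lbrakk>X \<in> Ob C; Y \<in> Ob C; f \<in> Arr C X Y\<rbrakk> \<Longrightarrow> Add C X Y (Nul C X Y) f = f"
 and Add_Neg: "\<lbrakk>X \<in> Ob C; Y \<in> Ob C; f \<in> Arr C X Y\<rbrakk> \<Longrightarrow> Add C X Y (Neg C X Y f) f = Nul C X Y"
proof -
 assume XY: "X \<in> Ob C" "Y \<in> Ob C"
 interpret G: comm_group "hom_group C X Y" using XY by (rule hom_group)
 have [simp]: "carrier (hom_group C X Y) = Arr C X Y" "mult (hom_group C X Y) = Add C X Y"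
  "one (hom_group C X Y) = Nul C X Y" by (simp_all add: hom_group_def)
 show "Nul C X Y \<in> Arr C X Y" using G.one_closed by simp
 show "Add C X Y f g \<in> Arr C X Y" if "f \<in> Arr C X Y" "g \<in> Arr C X Y" using that G.m_closed by simp
 show "Neg C X Y f \<in> Arr C X Y" if "f \<in> Arr C X Y" using that G.inv_closed by simp
 show "Add C X Y f g = Add C X Y g f" if "f \<in> Arr C X Y" "g \<in> Arr C X Y" using that G.m_comm by simp
 show "Add C X Y (Add C X Y f g) h = Add C X Y f (Add C X Y g h)"
  if "f \<in> Arr C X Y" "g \<in> Arr C X Y" "h \<in> Arr C X Y" using that G.m_assoc by simp
 show "Add C X Y (Nul C X Y) f = f" if "f \<in> Arr C X Y" using that G.l_one by simp
 show "Add C X Y (Neg C X Y f) f = Nul C X Y" if "f \<in> Arr C X Y" using that G.l_inv by simp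
qed

end

lemmas preadditive_hom_simps =
 preadditive_category.hom_closed preadditive_category.Nul_closed preadditive_category.Neg_closed
 preadditive_category.Add_Nul preadditive_category.Add_Neg

typedef ('o, 'm) vec = "{v :: ('o, 'm) preadd_cat \<times> 'o \<times> 'o \<Rightarrow> 'm. valid_vec v}"
proof
 show "(\<lambda>(C, Z, X). if preadditive_category C \<and> Z \<in> Ob C \<and> X \<in> Ob C then Nul C Z X else undefined)
  \<in> {v. valid_vec v}"
  unfolding mem_Collect_eq by (rule valid_vec_const) (simp add: preadditive_hom_simps)
qed

setup_lifting type_definition_vec

instantiation vec :: (type, type) ab_group_add
begin

lift_definition zero_vec :: "('a, 'b) vec" is
 "\<lambda>(C, Z, X). if preadditive_category C \<and> Z \<in> Ob C \<and> X \<in> Ob C then Nul C Z X else undefined"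
 by (rule valid_vec_const) (simp add: preadditive_hom_simps)

lift_definition plus_vec :: "('a, 'b) vec \<Rightarrow> ('a, 'b) vec \<Rightarrow> ('a, 'b) vec" is
 "\<lambda>v w (C, Z, X). if preadditive_category C \<and> Z \<in> Ob C \<and> X \<in> Ob C
   then Add C Z X (v (C, Z, X)) (w (C, Z, X)) else undefined"
 by (rule valid_vec_const) (simp add: preadditive_hom_simps valid_vec_def)

lift_definition uminus_vec :: "('a, 'b) vec \<Rightarrow> ('a, 'b) vec" is
 "\<lambda>v (C, Z, X). if preadditive_category C \<and> Z \<in> Ob C \<and> X \<in> Ob C
   then Neg C Z X (v (C, Z, X)) else undefined"
 by (rule valid_vec_const) (simp add: preadditive_hom_simps valid_vec_def)

definition minus_vec :: "('a, 'b) vec \<Rightarrow> ('a, 'b) vec \<Rightarrow> ('a, 'b) vec" where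
 "minus_vec v w = v + - w"

instance
proof
 fix a b c :: "('a, 'b) vec"
 show "a + b + c = a + (b + c)"
  by transfer (auto simp: fun_eq_iff valid_vec_def preadditive_hom_simps preadditive_category.Add_assoc)
 show "a + b = b + a"
  by transfer (auto simp: fun_eq_iff valid_vec_def preadditive_category.Add_commute)
 show "0 + a = a"
  by transfer (auto simp: fun_eq_iff valid_vec_def preadditive_hom_simps)
 show "- a + a = 0"
  by transfer (auto simp: fun_eq_iff valid_vec_def preadditive_hom_simps)
 show "a - b = a + - b" by (rule minus_vec_def)
qed

end

text \<open>The ring that houses all graded maps. It is taken in class \<open>ring\<close>, without
  a global unit: the identities of complexes become idempotents of it.\<close>

typedef (overloaded) ('a :: ab_group_add) endo = "{f :: 'a \<Rightarrow> 'a. \<forall>x y. f (x + y) = f x + f y}"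
 by (intro exI[of _ id]) simp

setup_lifting type_definition_endo

instantiation endo :: (ab_group_add) ring
begin

lift_definition zero_endo :: "'a endo" is "\<lambda>x. 0" by simp
lift_definition plus_endo :: "'a endo \<Rightarrow> 'a endo \<Rightarrow> 'a endo" is "\<lambda>f g x. f x + g x"
 by (simp add: algebra_simps)
lift_definition uminus_endo :: "'a endo \<Rightarrow> 'a endo" is "\<lambda>f x. - f x" by (simp add: algebra_simps)
lift_definition minus_endo :: "'a endo \<Rightarrow> 'a endo \<Rightarrow> 'a endo" is "\<lambda>f g x. f x - g x"
 by (simp add: algebra_simps)
lift_definition times_endo :: "'a endo \<Rightarrow> 'a endo \<Rightarrow> 'a endo" is "\<lambda>f g x. f (g x)" by simp

instance
proof
 fix a b c :: "'a endo"
 show "a + b + c = a + (b + c)" by transfer (simp add: add.assoc)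
 show "a + b = b + a" by transfer (simp add: add.commute)
 show "0 + a = a" by transfer simp
 show "- a + a = 0" by transfer simp
 show "a - b = a + - b" by transfer simp
 show "a * b * c = a * (b * c)" by transfer simp
 show "(a + b) * c = a * c + b * c" by transfer simp
 show "a * (b + c) = a * b + a * c" by transfer simp
qed

end

text \<open>
 Sequences of arrows \<open>f n : X n \<rightarrow> Y (n + k)\<close> act on sequences of vectors by postcomposition;
 this represents graded maps faithfully by elements of a ring, in which
 the identities of the homological algebra can be verified by ring normalisation.
\<close>

definition graded_arrows :: "('o, 'm, 'z) preadd_cat_scheme \<Rightarrow> int \<Rightarrow> (int \<Rightarrow> 'o) \<Rightarrow> (int \<Rightarrow> 'o) \<Rightarrow> (int \<Rightarrow> 'm) set"
 where "graded_arrows C k X Y = {f. \<forall>n. f n \<in> Arr C (X n) (Y (n + k))}"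

context preadditive_category
begin

lemma Cmp_Nul_right: "\<lbrakk>X \<in> Ob C; Y \<in> Ob C; Z \<in> Ob C; g \<in> Arr C Y Z\<rbrakk> \<Longrightarrow> Cmp C X Y Z g (Nul C X Y) = Nul C X Z"
proof -
 assume a: "X \<in> Ob C" "Y \<in> Ob C" "Z \<in> Ob C" "g \<in> Arr C Y Z"
 interpret G: comm_group "hom_group C X Z" using a by (simp add: hom_group)
 let ?a = "Cmp C X Y Z g (Nul C X Y)"
 have "Add C X Z ?a ?a = ?a"
  using a by (metis Cmp_Add_right Nul_closed Add_Nul)
 then have "mult (hom_group C X Z) ?a ?a = ?a" by (simp add: hom_group_def)
 moreover have "?a \<in> carrier (hom_group C X Z)" using a by (simp add: hom_group_def Cmp_closed Nul_closed)
 ultimately have "?a = one (hom_group C X Z)" by (metis G.l_cancel_one')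
 then show ?thesis by (simp add: hom_group_def)
qed

lemma Cmp_Nul_left: "\<lbrakk>X \<in> Ob C; Y \<in> Ob C; Z \<in> Ob C; f \<in> Arr C X Y\<rbrakk> \<Longrightarrow> Cmp C X Y Z (Nul C Y Z) f = Nul C X Z"
proof -
 assume a: "X \<in> Ob C" "Y \<in> Ob C" "Z \<in> Ob C" "f \<in> Arr C X Y"
 interpret G: comm_group "hom_group C X Z" using a by (simp add: hom_group)
 let ?a = "Cmp C X Y Z (Nul C Y Z) f"
 have "Add C X Z ?a ?a = ?a"
  using a by (metis Cmp_Add_left Nul_closed Add_Nul)
 then have "mult (hom_group C X Z) ?a ?a = ?a" by (simp add: hom_group_def)
 moreover have "?a \<in> carrier (hom_group C X Z)" using a by (simp add: hom_group_def Cmp_closed Nul_closed)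
 ultimately have "?a = one (hom_group C X Z)" by (metis G.l_cancel_one')
 then show ?thesis by (simp add: hom_group_def)
qed

end

text \<open>In degree \<open>n\<close> the result is postcomposition with \<open>f (n - k)\<close>,
  applied to the component of \<open>v (n - k)\<close> at \<open>X (n - k)\<close>. The zero arrow
  is the value wherever category or target do not match, or \<open>f (n - k)\<close> is no arrow; so
  the map is total, and additive in \<open>v\<close>, for arbitrary \<open>f\<close>.\<close>

lift_definition graded_action ::
 "('o, 'm) preadd_cat \<Rightarrow> int \<Rightarrow> (int \<Rightarrow> 'o) \<Rightarrow> (int \<Rightarrow> 'o) \<Rightarrow> (int \<Rightarrow> 'm)
  \<Rightarrow> (int \<Rightarrow> ('o, 'm) vec) \<Rightarrow> int \<Rightarrow> ('o, 'm) vec" is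
 "\<lambda>C k X Y f v n (C', Z, W).
   if preadditive_category C' \<and> Z \<in> Ob C' \<and> W \<in> Ob C' then
    if C' = C \<and> W = Y n \<and> X (n - k) \<in> Ob C \<and> f (n - k) \<in> Arr C (X (n - k)) (Y n)
    then Cmp C Z (X (n - k)) (Y n) (f (n - k)) (v (n - k) (C, Z, X (n - k)))
    else Nul C' Z W
   else undefined"
 by (rule valid_vec_const)
  (auto simp: valid_vec_def preadditive_hom_simps category.Cmp_closed preadditive_category.axioms(1))

lift_definition graded_op ::
 "('o, 'm) preadd_cat \<Rightarrow> int \<Rightarrow> (int \<Rightarrow> 'o) \<Rightarrow> (int \<Rightarrow> 'o) \<Rightarrow> (int \<Rightarrow> 'm)
  \<Rightarrow> (int \<Rightarrow> ('o, 'm) vec) endo" is graded_action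
 unfolding plus_fun_def
 apply (intro allI ext)
 apply transfer
 apply (auto simp: fun_eq_iff valid_vec_def preadditive_hom_simps preadditive_category.Cmp_Add_right)
 done


text \<open>The test vector of a Yoneda argument: applied to it, the operator of \<open>f\<close>
  shows \<open>f n\<close> in the component from \<open>X n\<close> to \<open>Y (n + k)\<close>.
  Hence distinct graded maps give distinct ring elements.\<close>

lift_definition ident_vec :: "('o, 'm) vec" is
 "\<lambda>(C, Z, X). if preadditive_category C \<and> Z \<in> Ob C \<and> X \<in> Ob C
   then if Z = X then Ident C Z else Nul C Z X else undefined"
 by (rule valid_vec_const)
  (simp add: preadditive_hom_simps category.Ident_closed preadditive_category.axioms(1))

lemma Rep_vec_closed:
 "\<lbrakk>preadditive_category C; Z \<in> Ob C; X \<in> Ob C\<rbrakk> \<Longrightarrow> Rep_vec v (C, Z, X) \<in> Arr C Z X"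
 using Rep_vec[of v] by (simp add: valid_vec_def)

lemma Rep_vec_outside:
 "\<not> (preadditive_category C \<and> Z \<in> Ob C \<and> X \<in> Ob C) \<Longrightarrow> Rep_vec v (C, Z, X) = undefined"
 using Rep_vec[of v] by (simp add: valid_vec_def)

lemma vec_eqI:
 assumes "\<And>C Z X. \<lbrakk>preadditive_category C; Z \<in> Ob C; X \<in> Ob C\<rbrakk> \<Longrightarrow> Rep_vec v (C, Z, X) = Rep_vec w (C, Z, X)"
 shows "v = w"
proof -
 have "Rep_vec v t = Rep_vec w t" for t
 proof (cases t)
  case (fields C Z X)
  then show ?thesis
   using assms[of C Z X] Rep_vec_outside[of C Z X]
   by (cases "preadditive_category C \<and> Z \<in> Ob C \<and> X \<in> Ob C") auto
 qed
 then show ?thesis by (simp add: Rep_vec_inject[symmetric] fun_eq_iff)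
qed

lemma endo_eqI: "(\<And>v n. Rep_endo a v n = Rep_endo b v n) \<Longrightarrow> a = (b :: (int \<Rightarrow> 'a :: ab_group_add) endo)"
 by (simp add: Rep_endo_inject[symmetric] fun_eq_iff)

locale graded_category = preadditive_category C for C :: "('o, 'm) preadd_cat"
begin

abbreviation objs :: "(int \<Rightarrow> 'o) \<Rightarrow> bool" where "objs X \<equiv> (\<forall>n. X n \<in> Ob C)"

lemma Rep_graded_op:
 assumes "objs X" "f \<in> graded_arrows C k X Y" "preadditive_category C'" "Z \<in> Ob C'" "W \<in> Ob C'"
 shows "Rep_vec (Rep_endo (graded_op C k X Y f) v n) (C', Z, W) =
  (if C' = C \<and> W = Y n then Cmp C Z (X (n - k)) (Y n) (f (n - k)) (Rep_vec (v (n - k)) (C, Z, X (n - k)))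
   else Nul C' Z W)"
proof -
 have "f (n - k) \<in> Arr C (X (n - k)) (Y n)"
  using assms(2) by (auto simp: graded_arrows_def dest: spec[of _ "n - k"])
 then show ?thesis using assms by (simp add: graded_op.rep_eq graded_action.rep_eq)
qed

lemma graded_op_inject:
 assumes X: "objs X" and Y: "objs Y" and f: "f \<in> graded_arrows C k X Y" and g: "g \<in> graded_arrows C k X Y"
  and eq: "graded_op C k X Y f = graded_op C k X Y g"
 shows "f = g"
proof
 fix n
 let ?v = "\<lambda>_. ident_vec"
 have "Rep_vec (Rep_endo (graded_op C k X Y h) ?v (n + k)) (C, X n, Y (n + k)) = h n"
  if h: "h \<in> graded_arrows C k X Y" for h
 proof -
  have "h n \<in> Arr C (X n) (Y (n + k))" using h by (simp add: graded_arrows_def)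
  then show ?thesis
   using Rep_graded_op[OF X h preadditive_category_axioms, of "X n" "Y (n + k)" ?v "n + k"] X Y
   by (simp add: ident_vec.rep_eq preadditive_category_axioms Cmp_Ident_right)
 qed
 from this[OF f] this[OF g] eq show "f n = g n" by metis
qed

lemma graded_op_Add:
 assumes X: "objs X" and Y: "objs Y" and f: "f \<in> graded_arrows C k X Y" and g: "g \<in> graded_arrows C k X Y"
 shows "(\<lambda>n. Add C (X n) (Y (n + k)) (f n) (g n)) \<in> graded_arrows C k X Y" (is "?h \<in> _")
  and "graded_op C k X Y (\<lambda>n. Add C (X n) (Y (n + k)) (f n) (g n)) = graded_op C k X Y f + graded_op C k X Y g"
proof -
 show h: "?h \<in> graded_arrows C k X Y"
  using assms by (simp add: graded_arrows_def hom_closed)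
 have fg: "f (n - k) \<in> Arr C (X (n - k)) (Y n)" "g (n - k) \<in> Arr C (X (n - k)) (Y n)" for n
  using f g by (auto simp: graded_arrows_def dest: spec[of _ "n - k"])
 show "graded_op C k X Y ?h = graded_op C k X Y f + graded_op C k X Y g"
  by (intro endo_eqI vec_eqI)
   (use X Y fg in \<open>auto simp: plus_endo.rep_eq plus_vec.rep_eq Rep_graded_op[OF X h] Rep_graded_op[OF X f]
     Rep_graded_op[OF X g] Cmp_Add_left Rep_vec_closed preadditive_category_axioms preadditive_hom_simps\<close>)
qed

lemma graded_op_Nul:
 assumes X: "objs X" and Y: "objs Y"
 shows "(\<lambda>n. Nul C (X n) (Y (n + k))) \<in> graded_arrows C k X Y" (is "?h \<in> _")
  and "graded_op C k X Y (\<lambda>n. Nul C (X n) (Y (n + k))) = 0"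
proof -
 show h: "?h \<in> graded_arrows C k X Y"
  using assms by (simp add: graded_arrows_def Nul_closed)
 show "graded_op C k X Y ?h = 0"
  by (intro endo_eqI vec_eqI)
   (use X Y in \<open>auto simp: zero_endo.rep_eq zero_vec.rep_eq Rep_graded_op[OF X h]
     Cmp_Nul_left Rep_vec_closed preadditive_category_axioms\<close>)
qed

lemma graded_op_Neg:
 assumes X: "objs X" and Y: "objs Y" and f: "f \<in> graded_arrows C k X Y"
 shows "(\<lambda>n. Neg C (X n) (Y (n + k)) (f n)) \<in> graded_arrows C k X Y" (is "?h \<in> _")
  and "graded_op C k X Y (\<lambda>n. Neg C (X n) (Y (n + k)) (f n)) = - graded_op C k X Y f"
proof -
 show h: "?h \<in> graded_arrows C k X Y"
  using assms by (simp add: graded_arrows_def Neg_closed)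
 have "graded_op C k X Y ?h + graded_op C k X Y f = 0"
  using graded_op_Add(2)[OF X Y h f] graded_op_Nul(2)[OF X Y] f X Y
  by (simp add: graded_arrows_def Add_Neg)
 then show "graded_op C k X Y ?h = - graded_op C k X Y f" by (simp add: eq_neg_iff_add_eq_0)
qed

lemma graded_op_Cmp:
 assumes X: "objs X" and Y: "objs Y" and Z: "objs Z"
  and f: "f \<in> graded_arrows C k X Y" and g: "g \<in> graded_arrows C l Y Z"
 shows "(\<lambda>n. Cmp C (X n) (Y (n + k)) (Z (n + (k + l))) (g (n + k)) (f n)) \<in> graded_arrows C (k + l) X Z"
   (is "?h \<in> _")
  and "graded_op C (k + l) X Z (\<lambda>n. Cmp C (X n) (Y (n + k)) (Z (n + (k + l))) (g (n + k)) (f n)) =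
   graded_op C l Y Z g * graded_op C k X Y f"
proof -
 have fn: "f n \<in> Arr C (X n) (Y (n + k))" and gn: "g (n + k) \<in> Arr C (Y (n + k)) (Z (n + (k + l)))" for n
  using f g by (auto simp: graded_arrows_def dest: spec[of _ "n + k"] simp: add.assoc)
 show h: "?h \<in> graded_arrows C (k + l) X Z"
  unfolding graded_arrows_def using X Y Z fn gn by (auto intro: Cmp_closed)
 have "Rep_vec (Rep_endo (graded_op C (k + l) X Z ?h) v n) (C', W, V) =
  Rep_vec (Rep_endo (graded_op C l Y Z g * graded_op C k X Y f) v n) (C', W, V)"
  if C': "preadditive_category C'" "W \<in> Ob C'" "V \<in> Ob C'" for v n C' W V
 proof (cases "C' = C \<and> V = Z n")
  case True
  have e: "n - l - k = n - (k + l)" by simp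
  show ?thesis
   using True C' X Y Z fn[of "n - (k + l)"] gn[of "n - (k + l)"]
   by (simp add: times_endo.rep_eq Rep_graded_op[OF X h] Rep_graded_op[OF X f] Rep_graded_op[OF Y g] e
     Cmp_assoc Rep_vec_closed preadditive_category_axioms)
 next
  case False
  then show ?thesis
   using C' by (auto simp: times_endo.rep_eq Rep_graded_op[OF X h] Rep_graded_op[OF Y g])
 qed
 then show "graded_op C (k + l) X Z ?h = graded_op C l Y Z g * graded_op C k X Y f"
  by (intro endo_eqI vec_eqI)
qed

end

section \<open>Pretriangulated categories\<close>

context category
begin

lemma isomorphism_Ident: "X \<in> Ob C \<Longrightarrow> isomorphism C X X (Ident C X)"
 unfolding isomorphism_def using Ident_closed Cmp_Ident_left by blast

lemma isomorphism_Cmp: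
 assumes "X \<in> Ob C" "Y \<in> Ob C" "Z \<in> Ob C" "isomorphism C X Y f" "isomorphism C Y Z g"
 shows "isomorphism C X Z (Cmp C X Y Z g f)"
proof -
 from assms(4) obtain f' where f: "f \<in> Arr C X Y" "f' \<in> Arr C Y X"
  "Cmp C X Y X f' f = Ident C X" "Cmp C Y X Y f f' = Ident C Y" by (auto simp: isomorphism_def)
 from assms(5) obtain g' where g: "g \<in> Arr C Y Z" "g' \<in> Arr C Z Y"
  "Cmp C Y Z Y g' g = Ident C Y" "Cmp C Z Y Z g g' = Ident C Z" by (auto simp: isomorphism_def)
 have "Cmp C X Z X (Cmp C Z Y X f' g') (Cmp C X Y Z g f) = Cmp C X Y X f' (Cmp C X Y Y (Cmp C Y Z Y g' g) f)"
  using assms(1-3) f(1,2) g(1,2) by (simp add: Cmp_assoc Cmp_closed)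
 moreover have "Cmp C Z X Z (Cmp C X Y Z g f) (Cmp C Z Y X f' g') = Cmp C Z Y Z g (Cmp C Z Y Y (Cmp C Y X Y f f') g')"
  using assms(1-3) f(1,2) g(1,2) by (simp add: Cmp_assoc Cmp_closed)
 ultimately show ?thesis unfolding isomorphism_def using assms(1-3) f g
  by (intro conjI bexI[of _ "Cmp C Z Y X f' g'"]) (simp_all add: Cmp_Ident_left Cmp_closed)
qed

lemma isomorphism_inverse:
 assumes "isomorphism C X Y f"
 obtains g where "isomorphism C Y X g" "g \<in> Arr C Y X" "Cmp C X Y X g f = Ident C X" "Cmp C Y X Y f g = Ident C Y"
 using assms unfolding isomorphism_def by blast

lemma triangle_iso_trans:
 assumes S: "is_functor C C S" and iso: "triangle_iso C S t t'" "triangle_iso C S t' t''"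
  and tri: "is_triangle C S t" "is_triangle C S t'" "is_triangle C S t''"
 shows "triangle_iso C S t t''"
proof -
 obtain X Y Z u v w where t: "t = (X, Y, Z, u, v, w)" by (cases t)
 obtain X' Y' Z' u' v' w' where t': "t' = (X', Y', Z', u', v', w')" by (cases t')
 obtain X'' Y'' Z'' u'' v'' w'' where t'': "t'' = (X'', Y'', Z'', u'', v'', w'')" by (cases t'')
 obtain a b c where abc: "triangle_map C S t t' (a, b, c)"
  "isomorphism C X X' a" "isomorphism C Y Y' b" "isomorphism C Z Z' c"
  using iso(1) unfolding t t' by (auto simp del: triangle_map.simps)
 obtain a' b' c' where abc': "triangle_map C S t' t'' (a', b', c')"
  "isomorphism C X' X'' a'" "isomorphism C Y' Y'' b'" "isomorphism C Z' Z'' c'"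
  using iso(2) unfolding t' t'' by (auto simp del: triangle_map.simps)
 have SX: "fob S X \<in> Ob C" "fob S X' \<in> Ob C" "fob S X'' \<in> Ob C"
  using S tri unfolding t t' t'' by (auto simp: is_functor_def)
 have a: "a \<in> Arr C X X'" "a' \<in> Arr C X' X''" using abc abc' unfolding t t' t'' by auto
 have Sa: "fmor S X X' a \<in> Arr C (fob S X) (fob S X')" "fmor S X' X'' a' \<in> Arr C (fob S X') (fob S X'')"
  "fmor S X X'' (Cmp C X X' X'' a' a) = Cmp C (fob S X) (fob S X') (fob S X'') (fmor S X' X'' a') (fmor S X X' a)"
  using S tri a unfolding t t' t'' by (auto simp: is_functor_def)
 have "triangle_map C S t t'' (Cmp C X X' X'' a' a, Cmp C Y Y' Y'' b' b, Cmp C Z Z' Z'' c' c)"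
  using abc abc' tri SX Sa unfolding t t' t''
  by (simp add: Cmp_closed Cmp_assoc[symmetric]) (simp add: Cmp_assoc)
 moreover have "isomorphism C X X'' (Cmp C X X' X'' a' a)" "isomorphism C Y Y'' (Cmp C Y Y' Y'' b' b)"
  "isomorphism C Z Z'' (Cmp C Z Z' Z'' c' c)"
  using abc abc' tri isomorphism_Cmp unfolding t t' t'' by (simp_all del: triangle_map.simps)
 ultimately show ?thesis unfolding t t'' triangle_iso.simps by blast
qed

end

text \<open>The axioms of a triangulated category without the octahedron and with rotation in the
  forward direction only. They yield exactness of the Hom functors and the comparison of cones, from
  which backward rotation follows; a concrete model has to check only this weaker list and the
  octahedron.\<close>

locale pretriangulated_category = additive_category T
 for T :: "('o, 'm, 'z) tri_cat_scheme" +
 assumes shift_additive: "is_additive_functor T T (Shift T)"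
  and shift_equivalence: "is_equivalence T T (Shift T)"
  and Tri_triangles: "t \<in> Tri T \<Longrightarrow> is_triangle T (Shift T) t"
  and Tri_iso_closed:
   "\<lbrakk>t \<in> Tri T; is_triangle T (Shift T) t'; triangle_iso T (Shift T) t t'\<rbrakk> \<Longrightarrow> t' \<in> Tri T"
  and Tri_Ident:
   "\<lbrakk>X \<in> Ob T; is_zero T N\<rbrakk> \<Longrightarrow> (X, X, N, Ident T X, Nul T X N, Nul T N (fob (Shift T) X)) \<in> Tri T"
  and Tri_complete:
   "\<lbrakk>X \<in> Ob T; Y \<in> Ob T; u \<in> Arr T X Y\<rbrakk> \<Longrightarrow> \<exists>Z v w. (X, Y, Z, u, v, w) \<in> Tri T"
  and Tri_rotate_forward:
   "(X, Y, Z, u, v, w) \<in> Tri T \<Longrightarrow>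
    (Y, Z, fob (Shift T) X, v, w,
     Neg T (fob (Shift T) X) (fob (Shift T) Y) (fmor (Shift T) X Y u)) \<in> Tri T"
  and Tri_fill:
   "\<lbrakk>(X, Y, Z, u, v, w) \<in> Tri T; (X', Y', Z', u', v', w') \<in> Tri T;
    a \<in> Arr T X X'; b \<in> Arr T Y Y'; Cmp T X Y Y' b u = Cmp T X X' Y' u' a\<rbrakk>
    \<Longrightarrow> \<exists>c. triangle_map T (Shift T) (X, Y, Z, u, v, w) (X', Y', Z', u', v', w') (a, b, c)"

sublocale triangulated_category \<subseteq> pretriangulated_category
proof unfold_locales
 show "(Y, Z, fob (Shift T) X, v, w, Neg T (fob (Shift T) X) (fob (Shift T) Y) (fmor (Shift T) X Y u)) \<in> Tri T"
  if "(X, Y, Z, u, v, w) \<in> Tri T" for X Y Z u v w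
  using Tri_rotate[OF Tri_triangles[OF that]] that by (rule iffD1)
qed (fact shift_additive shift_equivalence Tri_triangles Tri_iso_closed Tri_Ident Tri_complete Tri_fill)+

context preadditive_category
begin

lemma Neg_unique:
 assumes "X \<in> Ob C" "Y \<in> Ob C" "f \<in> Arr C X Y" "g \<in> Arr C X Y" "Add C X Y g f = Nul C X Y"
 shows "g = Neg C X Y f"
proof -
 interpret G: comm_group "hom_group C X Y" using assms by (simp add: hom_group)
 show ?thesis using assms G.inv_equality[of g f] by (simp add: hom_group_def)
qed

lemma Cmp_Neg_left:
 "\<lbrakk>X \<in> Ob C; Y \<in> Ob C; Z \<in> Ob C; f \<in> Arr C X Y; g \<in> Arr C Y Z\<rbrakk>
  \<Longrightarrow> Cmp C X Y Z (Neg C Y Z g) f = Neg C X Z (Cmp C X Y Z g f)"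
 by (rule Neg_unique) (simp_all add: Cmp_closed Neg_closed Cmp_Add_left[symmetric] Add_Neg Cmp_Nul_left)

lemma Cmp_Neg_right:
 "\<lbrakk>X \<in> Ob C; Y \<in> Ob C; Z \<in> Ob C; f \<in> Arr C X Y; g \<in> Arr C Y Z\<rbrakk>
  \<Longrightarrow> Cmp C X Y Z g (Neg C X Y f) = Neg C X Z (Cmp C X Y Z g f)"
 by (rule Neg_unique) (simp_all add: Cmp_closed Neg_closed Cmp_Add_right[symmetric] Add_Neg Cmp_Nul_right)

lemma Neg_Neg: "\<lbrakk>X \<in> Ob C; Y \<in> Ob C; f \<in> Arr C X Y\<rbrakk> \<Longrightarrow> Neg C X Y (Neg C X Y f) = f"
 by (rule Neg_unique[symmetric]) (simp_all add: Neg_closed Add_commute[of X Y f] Add_Neg)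

lemma Neg_Nul: "\<lbrakk>X \<in> Ob C; Y \<in> Ob C\<rbrakk> \<Longrightarrow> Neg C X Y (Nul C X Y) = Nul C X Y"
 by (rule Neg_unique[symmetric]) (simp_all add: Nul_closed Add_Nul)

lemma Neg_inject: "\<lbrakk>X \<in> Ob C; Y \<in> Ob C; f \<in> Arr C X Y; g \<in> Arr C X Y; Neg C X Y f = Neg C X Y g\<rbrakk> \<Longrightarrow> f = g"
 by (metis Neg_Neg)

lemma is_zero_hom:
 assumes "is_zero C N" "X \<in> Ob C" shows "f \<in> Arr C X N \<Longrightarrow> f = Nul C X N" "f \<in> Arr C N X \<Longrightarrow> f = Nul C N X"
 using assms Nul_closed unfolding is_zero_def by blast+

lemma is_zero_iff: "X \<in> Ob C \<Longrightarrow> is_zero C X \<longleftrightarrow> Ident C X = Nul C X X"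
proof
 show "is_zero C X \<Longrightarrow> X \<in> Ob C \<Longrightarrow> Ident C X = Nul C X X" using is_zero_hom Ident_closed by blast
 assume X: "X \<in> Ob C" and e: "Ident C X = Nul C X X"
 have "f = Nul C X Y" if "Y \<in> Ob C" "f \<in> Arr C X Y" for f Y
  using Cmp_Ident_right[OF X that] Cmp_Nul_right[OF X X that] e by simp
 moreover have "f = Nul C Y X" if "Y \<in> Ob C" "f \<in> Arr C Y X" for f Y
  using Cmp_Ident_left[OF that(1) X that(2)] Cmp_Nul_left[OF that(1) X X that(2)] e by simp
 ultimately show "is_zero C X" unfolding is_zero_def using X Nul_closed by metis
qed

end

lemma (in pretriangulated_category) shift_functor: "is_functor T T (Shift T)"
 using shift_equivalence by (simp add: is_equivalence_def)

section \<open>Exactness, comparison of cones and backward rotation\<close>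

context pretriangulated_category
begin

abbreviation (input) "S \<equiv> fob (Shift T)"
abbreviation (input) "SM \<equiv> fmor (Shift T)"

lemma S_closed: "X \<in> Ob T \<Longrightarrow> S X \<in> Ob T"
 and SM_closed: "\<lbrakk>X \<in> Ob T; Y \<in> Ob T; f \<in> Arr T X Y\<rbrakk> \<Longrightarrow> SM X Y f \<in> Arr T (S X) (S Y)"
 and SM_Ident: "X \<in> Ob T \<Longrightarrow> SM X X (Ident T X) = Ident T (S X)"
 and SM_Cmp: "\<lbrakk>X \<in> Ob T; Y \<in> Ob T; Z \<in> Ob T; f \<in> Arr T X Y; g \<in> Arr T Y Z\<rbrakk> \<Longrightarrow>
  SM X Z (Cmp T X Y Z g f) = Cmp T (S X) (S Y) (S Z) (SM Y Z g) (SM X Y f)"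
 using shift_functor unfolding is_functor_def by blast+

lemma SM_inject: "\<lbrakk>X \<in> Ob T; Y \<in> Ob T; f \<in> Arr T X Y; g \<in> Arr T X Y; SM X Y f = SM X Y g\<rbrakk> \<Longrightarrow> f = g"
 using shift_equivalence unfolding is_equivalence_def bij_betw_def inj_on_def by blast

lemma SM_surj: "\<lbrakk>X \<in> Ob T; Y \<in> Ob T; f \<in> Arr T (S X) (S Y)\<rbrakk> \<Longrightarrow> \<exists>g\<in>Arr T X Y. f = SM X Y g"
 using shift_equivalence unfolding is_equivalence_def bij_betw_def by blast

lemma S_ess_surj: "X \<in> Ob T \<Longrightarrow> \<exists>Y\<in>Ob T. \<exists>f. isomorphism T (S Y) X f"
 using shift_equivalence unfolding is_equivalence_def by blast

lemma SM_Nul: "\<lbrakk>X \<in> Ob T; Y \<in> Ob T\<rbrakk> \<Longrightarrow> SM X Y (Nul T X Y) = Nul T (S X) (S Y)"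
proof -
 assume XY: "X \<in> Ob T" "Y \<in> Ob T"
 interpret G: comm_group "hom_group T X Y" using XY by (rule hom_group)
 interpret G': comm_group "hom_group T (S X) (S Y)" using XY S_closed by (simp add: hom_group)
 have "SM X Y \<in> hom (hom_group T X Y) (hom_group T (S X) (S Y))"
  using shift_additive XY by (simp add: is_additive_functor_def)
 then have "SM X Y (one (hom_group T X Y)) = one (hom_group T (S X) (S Y))"
  by (rule hom_one) unfold_locales
 then show ?thesis by (simp add: hom_group_def)
qed

lemma S_reflects_isomorphism:
 assumes X: "X \<in> Ob T" and Y: "Y \<in> Ob T" and f: "f \<in> Arr T X Y" and iso: "isomorphism T (S X) (S Y) (SM X Y f)"
 shows "isomorphism T X Y f"
proof -
 obtain g where g: "g \<in> Arr T Y X" "Cmp T (S X) (S Y) (S X) (SM Y X g) (SM X Y f) = Ident T (S X)"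
  "Cmp T (S Y) (S X) (S Y) (SM X Y f) (SM Y X g) = Ident T (S Y)"
  using iso SM_surj[OF Y X] unfolding isomorphism_def by metis
 have "Cmp T X Y X g f = Ident T X"
  by (rule SM_inject[of X X]) (use X Y f g in \<open>simp_all add: Cmp_closed Ident_closed SM_Cmp SM_Ident\<close>)
 moreover have "Cmp T Y X Y f g = Ident T Y"
  by (rule SM_inject[of Y Y]) (use X Y f g in \<open>simp_all add: Cmp_closed Ident_closed SM_Cmp SM_Ident\<close>)
 ultimately show ?thesis using f g by (auto simp: isomorphism_def)
qed

lemma TriD:
 assumes "(X, Y, Z, u, v, w) \<in> Tri T"
 shows "X \<in> Ob T" "Y \<in> Ob T" "Z \<in> Ob T" "u \<in> Arr T X Y" "v \<in> Arr T Y Z" "w \<in> Arr T Z (S X)"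
 using Tri_triangles[OF assms] by auto

lemmas closed = S_closed SM_closed Cmp_closed Ident_closed Nul_closed Neg_closed hom_closed

text \<open>Filling in a map from the triangle \<open>X -> X -> 0\<close>, with \<open>u\<close> on
  the second vertex, shows that \<open>v\<close> after \<open>u\<close> passes through a zero
  object.\<close>

lemma Tri_comp_zero:
 assumes t: "(X, Y, Z, u, v, w) \<in> Tri T" shows "Cmp T X Y Z v u = Nul T X Z"
proof -
 obtain N where N: "is_zero T N" using zero_object by blast
 note T = TriD[OF t]
 have "\<exists>c. triangle_map T (Shift T) (X, X, N, Ident T X, Nul T X N, Nul T N (S X)) (X, Y, Z, u, v, w) (Ident T X, u, c)"
  by (rule Tri_fill[OF Tri_Ident[OF T(1) N] t]) (use T in \<open>auto simp: closed Cmp_Ident_right\<close>)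
 then obtain c where c: "c \<in> Arr T N Z" "Cmp T X N Z c (Nul T X N) = Cmp T X Y Z v u" by auto
 then show ?thesis using Cmp_Nul_right[of X N Z c] T N by (simp add: is_zero_def)
qed

text \<open>Exactness of \<open>T(W, -)\<close> at \<open>Y\<close>. The arrow \<open>k\<close>
  extends to a map from the rotated triangle \<open>W -> 0 -> S W\<close> to the rotated given one;
  its third component is \<open>S\<close> of the lift since \<open>S\<close> is full, and the two
  signs cancel.\<close>

lemma weak_kernel:
 assumes t: "(X, Y, Z, u, v, w) \<in> Tri T" and W: "W \<in> Ob T" and k: "k \<in> Arr T W Y"
  and vk: "Cmp T W Y Z v k = Nul T W Z"
 shows "\<exists>x\<in>Arr T W X. Cmp T W X Y u x = k"
proof -
 obtain N where N: "is_zero T N" using zero_object by blast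
 then have NO: "N \<in> Ob T" by (simp add: is_zero_def)
 note T = TriD[OF t]
 have "\<exists>c. triangle_map T (Shift T) (W, N, S W, Nul T W N, Nul T N (S W), Neg T (S W) (S W) (SM W W (Ident T W)))
   (Y, Z, S X, v, w, Neg T (S X) (S Y) (SM X Y u)) (k, Nul T N Z, c)"
  by (rule Tri_fill[OF Tri_rotate_forward[OF Tri_Ident[OF W N]] Tri_rotate_forward[OF t]])
   (use T NO W k vk in \<open>auto simp: closed Cmp_Nul_left\<close>)
 then obtain c where c: "c \<in> Arr T (S W) (S X)"
  "Cmp T (S W) (S W) (S Y) (SM W Y k) (Neg T (S W) (S W) (SM W W (Ident T W)))
   = Cmp T (S W) (S X) (S Y) (Neg T (S X) (S Y) (SM X Y u)) c" by auto
 then obtain x where x: "x \<in> Arr T W X" "c = SM W X x" using SM_surj T W by blast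
 have "Neg T (S W) (S Y) (SM W Y k) = Neg T (S W) (S Y) (SM W Y (Cmp T W X Y u x))"
  using c x T W k by (simp add: SM_Ident Cmp_Neg_left Cmp_Neg_right closed Cmp_Ident_right SM_Cmp)
 then have "SM W Y k = SM W Y (Cmp T W X Y u x)"
  using Neg_inject[of "S W" "S Y" "SM W Y k" "SM W Y (Cmp T W X Y u x)"] T W k x by (simp add: closed)
 then have "k = Cmp T W X Y u x"
  using SM_inject[of W Y k "Cmp T W X Y u x"] T W k x by (simp add: closed)
 with x show ?thesis by blast
qed

text \<open>Exactness of \<open>T(-, W)\<close> at \<open>Y\<close>. The target triangle
  \<open>0 -> W -> W\<close> would call for a backward rotation; so \<open>W\<close> is replaced by
  an isomorphic \<open>S V\<close>, and the triangle \<open>V -> V -> 0\<close> is rotated forward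
  twice.\<close>

lemma weak_cokernel:
 assumes t: "(X, Y, Z, u, v, w) \<in> Tri T" and W: "W \<in> Ob T" and k: "k \<in> Arr T Y W"
  and ku: "Cmp T X Y W k u = Nul T X W"
 shows "\<exists>z\<in>Arr T Z W. Cmp T Y Z W z v = k"
proof -
 obtain N where N: "is_zero T N" using zero_object by blast
 then have NO: "N \<in> Ob T" by (simp add: is_zero_def)
 note T = TriD[OF t]
 obtain V f where V: "V \<in> Ob T" "isomorphism T (S V) W f" using S_ess_surj[OF W] by blast
 then obtain g where f: "f \<in> Arr T (S V) W" and g: "g \<in> Arr T W (S V)" "Cmp T W (S V) W f g = Ident T W"
  unfolding isomorphism_def by blast
 have "\<exists>c. triangle_map T (Shift T) (X, Y, Z, u, v, w) (N, S V, S V, Nul T N (S V),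
   Neg T (S V) (S V) (SM V V (Ident T V)), Neg T (S V) (S N) (SM V N (Nul T V N)))
   (Nul T X N, Cmp T Y W (S V) g k, c)"
  by (rule Tri_fill[OF t Tri_rotate_forward[OF Tri_rotate_forward[OF Tri_Ident[OF V(1) N]]]])
   (use T NO W V k ku f g in \<open>auto simp: closed Cmp_Nul_left Cmp_assoc[symmetric] Cmp_Nul_right\<close>)
 then obtain c where c: "c \<in> Arr T Z (S V)"
  "Cmp T Y Z (S V) c v = Cmp T Y (S V) (S V) (Neg T (S V) (S V) (SM V V (Ident T V))) (Cmp T Y W (S V) g k)"
  by auto
 have "Cmp T Y (S V) (S V) (Neg T (S V) (S V) (SM V V (Ident T V))) (Cmp T Y W (S V) g k)
   = Neg T Y (S V) (Cmp T Y W (S V) g k)"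
  using T W V k g by (simp add: SM_Ident Cmp_Neg_left closed Cmp_Ident_left)
 then have "Neg T Y (S V) (Cmp T Y Z (S V) c v) = Cmp T Y W (S V) g k"
  using c T W V k g by (simp add: Neg_Neg closed)
 then have "Cmp T Y (S V) W f (Cmp T Y Z (S V) (Neg T Z (S V) c) v) = Cmp T Y (S V) W f (Cmp T Y W (S V) g k)"
  using c T W V k g by (simp add: Cmp_Neg_left closed)
 also have "\<dots> = k" using T W V k f g by (simp add: Cmp_assoc closed Cmp_Ident_left)
 finally have "Cmp T Y Z W (Cmp T Z (S V) W f (Neg T Z (S V) c)) v = k"
  using c T W V f by (simp add: Cmp_assoc closed)
 moreover have "Cmp T Z (S V) W f (Neg T Z (S V) c) \<in> Arr T Z W" using c T W V f by (simp add: closed)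
 ultimately show ?thesis by blast
qed

lemma eq_if_diff_Nul:
 assumes "X \<in> Ob T" "Y \<in> Ob T" "f \<in> Arr T X Y" "g \<in> Arr T X Y" "Add T X Y f (Neg T X Y g) = Nul T X Y"
 shows "f = g"
 using Neg_unique[of X Y "Neg T X Y g" f] Neg_Neg assms Neg_closed by simp

text \<open>The five lemma carried out with weak kernels. An arrow killed by \<open>c\<close> is
  zero (\<open>mono\<close>). A lift \<open>z\<close> of \<open>w'\<close> through \<open>w\<close>
  is a right inverse of \<open>c\<close> up to the defect \<open>\<delta>\<close>, which comes from
  \<open>Y\<close>; correcting \<open>z\<close> by that arrow gives a right inverse
  \<open>s\<close>, and \<open>s\<close> after \<open>c\<close> is the identity because
  \<open>c\<close> kills only zero.\<close>

lemma cone_comparison_iso: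
 assumes t: "(X, Y, Z, u, v, w) \<in> Tri T" and t': "(X, Y, Z', u, v', w') \<in> Tri T"
  and c: "c \<in> Arr T Z Z'" and cv: "Cmp T Y Z Z' c v = v'" and wc: "Cmp T Z Z' (S X) w' c = w"
 shows "isomorphism T Z Z' c"
proof -
 note T = TriD[OF t] TriD[OF t']
 note R = Tri_rotate_forward[OF t] Tri_rotate_forward[OF t']
 note RR = Tri_rotate_forward[OF R(1)] Tri_rotate_forward[OF R(2)]
 have mono: "k = Nul T W Z" if W: "W \<in> Ob T" and k: "k \<in> Arr T W Z" and ck: "Cmp T W Z Z' c k = Nul T W Z'" for W k
 proof -
  have "Cmp T W Z (S X) w k = Nul T W (S X)"
   using ck W k T c wc[symmetric] by (simp add: Cmp_assoc[symmetric] closed Cmp_Nul_right)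
  then obtain y where y: "y \<in> Arr T W Y" "Cmp T W Y Z v y = k" using weak_kernel[OF R(1) W k] by blast
  have "Cmp T W Y Z' v' y = Nul T W Z'"
   using ck y T W c cv[symmetric] by (simp add: Cmp_assoc[symmetric])
  then obtain x where x: "x \<in> Arr T W X" "Cmp T W X Y u x = y" using weak_kernel[OF t' W y(1)] by blast
  have "k = Cmp T W X Z (Cmp T X Y Z v u) x" using x y T W by (simp add: Cmp_assoc[symmetric] closed)
  then show ?thesis using Tri_comp_zero[OF t] Cmp_Nul_left x T W by simp
 qed
 have "Cmp T Z' (S X) (S Y) (Neg T (S X) (S Y) (SM X Y u)) w' = Nul T Z' (S Y)"
  using Tri_comp_zero[OF RR(2)] .
 then obtain z where z: "z \<in> Arr T Z' Z" "Cmp T Z' Z (S X) w z = w'"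
  using weak_kernel[OF RR(1) _ T(12)] T(9) by blast
 define \<delta> where "\<delta> = Add T Z' Z' (Ident T Z') (Neg T Z' Z' (Cmp T Z' Z Z' c z))"
 have \<delta>: "\<delta> \<in> Arr T Z' Z'" using T c z by (simp add: \<delta>_def closed)
 have "Cmp T Z' Z' (S X) w' \<delta> = Add T Z' (S X) w' (Neg T Z' (S X) (Cmp T Z' Z (S X) w z))"
  using T c z wc by (simp add: \<delta>_def closed Cmp_Add_right Cmp_Ident_right Cmp_Neg_right Cmp_assoc)
 also have "\<dots> = Nul T Z' (S X)"
  using T z by (simp add: Add_commute[of Z' "S X" w'] closed Add_Neg)
 finally obtain y where y: "y \<in> Arr T Z' Y" "Cmp T Z' Y Z' v' y = \<delta>"
  using weak_kernel[OF R(2) T(9) \<delta>] by blast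
 define s where "s = Add T Z' Z z (Cmp T Z' Y Z v y)"
 have s: "s \<in> Arr T Z' Z" using T y z by (simp add: s_def closed)
 have "Cmp T Z' Z Z' c s = Add T Z' Z' (Cmp T Z' Z Z' c z) \<delta>"
  using T y z c cv by (simp add: s_def closed Cmp_Add_right Cmp_assoc)
 also have "\<dots> = Add T Z' Z' (Add T Z' Z' (Neg T Z' Z' (Cmp T Z' Z Z' c z)) (Cmp T Z' Z Z' c z)) (Ident T Z')"
 proof -
  let ?a = "Cmp T Z' Z Z' c z" let ?i = "Ident T Z'" let ?n = "Neg T Z' Z' ?a"
  have cl: "?a \<in> Arr T Z' Z'" "?i \<in> Arr T Z' Z'" "?n \<in> Arr T Z' Z'" using T c z by (simp_all add: closed)
  have "Add T Z' Z' ?a \<delta> = Add T Z' Z' (Add T Z' Z' ?i ?n) ?a"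
   unfolding \<delta>_def using cl T by (simp add: Add_commute[of Z' Z' ?a] closed)
  also have "\<dots> = Add T Z' Z' ?i (Add T Z' Z' ?n ?a)" using cl T by (simp add: Add_assoc)
  finally show ?thesis using cl T by (simp add: Add_commute[of Z' Z' ?i] closed)
 qed
 also have "\<dots> = Ident T Z'" using T c z by (simp add: closed Add_Neg Add_Nul)
 finally have cs: "Cmp T Z' Z Z' c s = Ident T Z'" .
 define \<epsilon> where "\<epsilon> = Add T Z Z (Cmp T Z Z' Z s c) (Neg T Z Z (Ident T Z))"
 have "\<epsilon> = Nul T Z Z"
 proof (rule mono)
  show "\<epsilon> \<in> Arr T Z Z" using T c s by (simp add: \<epsilon>_def closed)
  have "Cmp T Z Z Z' c \<epsilon> = Add T Z Z' c (Neg T Z Z' c)"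
   using T c s cs by (simp add: \<epsilon>_def closed Cmp_Add_right Cmp_Neg_right Cmp_assoc Cmp_Ident_right Cmp_Ident_left)
  then show "Cmp T Z Z Z' c \<epsilon> = Nul T Z Z'"
   using T c by (simp add: Add_commute[of Z Z' c] closed Add_Neg)
 qed (use T in simp)
 then have "Cmp T Z Z' Z s c = Ident T Z"
  unfolding \<epsilon>_def using eq_if_diff_Nul[of Z Z "Cmp T Z Z' Z s c" "Ident T Z"] T c s by (simp add: closed)
 with c s cs show ?thesis by (auto simp: isomorphism_def)
qed

lemma cone_comparison:
 assumes t: "(X, Y, Z, u, v, w) \<in> Tri T" and t': "(X, Y, Z', u, v', w') \<in> Tri T"
 obtains c where "isomorphism T Z Z' c" "Cmp T Y Z Z' c v = v'" "Cmp T Z Z' (S X) w' c = w"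
proof -
 note T = TriD[OF t] TriD[OF t']
 have "\<exists>c. triangle_map T (Shift T) (X, Y, Z, u, v, w) (X, Y, Z', u, v', w') (Ident T X, Ident T Y, c)"
  by (rule Tri_fill[OF t t']) (use T in \<open>simp_all add: closed Cmp_Ident_left Cmp_Ident_right\<close>)
 then obtain c where "c \<in> Arr T Z Z'" "Cmp T Y Z Z' c v = v'" "Cmp T Z Z' (S X) w' c = w"
  using T by (auto simp: SM_Ident closed Cmp_Ident_left Cmp_Ident_right)
 with cone_comparison_iso[OF t t'] that show thesis by blast
qed

text \<open>Complete \<open>u\<close> to a triangle and rotate until all vertices are shifted once:
  three forward rotations of the completed triangle, two more of the given rotated one. The
  comparison there is \<open>S\<close> of an arrow \<open>d\<close> since \<open>S\<close> is fully
  faithful, and \<open>d\<close> identifies the completed triangle with the given one.\<close>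

lemma Tri_rotate_backward:
 assumes tri: "is_triangle T (Shift T) (X, Y, Z, u, v, w)"
  and rot: "(Y, Z, S X, v, w, Neg T (S X) (S Y) (SM X Y u)) \<in> Tri T"
 shows "(X, Y, Z, u, v, w) \<in> Tri T"
proof -
 have T: "X \<in> Ob T" "Y \<in> Ob T" "Z \<in> Ob T" "u \<in> Arr T X Y" "v \<in> Arr T Y Z" "w \<in> Arr T Z (S X)"
  using tri by auto
 obtain Z' v' w' where t': "(X, Y, Z', u, v', w') \<in> Tri T" using Tri_complete T by blast
 note T' = TriD[OF t']
 obtain c where c: "isomorphism T (S Z') (S Z) c"
  "Cmp T (S Y) (S Z') (S Z) c (Neg T (S Y) (S Z') (SM Y Z' v')) = Neg T (S Y) (S Z) (SM Y Z v)"
  "Cmp T (S Z') (S Z) (S (S X)) (Neg T (S Z) (S (S X)) (SM Z (S X) w)) c = Neg T (S Z') (S (S X)) (SM Z' (S X) w')"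
  using cone_comparison[OF Tri_rotate_forward[OF Tri_rotate_forward[OF Tri_rotate_forward[OF t']]]
    Tri_rotate_forward[OF Tri_rotate_forward[OF rot]]] .
 then have "c \<in> Arr T (S Z') (S Z)" by (simp add: isomorphism_def)
 then obtain d where d: "d \<in> Arr T Z' Z" "c = SM Z' Z d" using SM_surj T T' by blast
 have iso: "isomorphism T Z' Z d" using S_reflects_isomorphism c(1) d T T' by blast
 have "Neg T (S Y) (S Z) (SM Y Z (Cmp T Y Z' Z d v')) = Neg T (S Y) (S Z) (SM Y Z v)"
  using c(2) d T T' by (simp add: Cmp_Neg_right closed SM_Cmp)
 then have 1: "Cmp T Y Z' Z d v' = v"
  using Neg_inject[of "S Y" "S Z" "SM Y Z (Cmp T Y Z' Z d v')" "SM Y Z v"]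
   SM_inject[of Y Z "Cmp T Y Z' Z d v'" v] d T T' by (simp add: closed)
 have "Neg T (S Z') (S (S X)) (SM Z' (S X) (Cmp T Z' Z (S X) w d)) = Neg T (S Z') (S (S X)) (SM Z' (S X) w')"
  using c(3) d T T' by (simp add: Cmp_Neg_left closed SM_Cmp)
 then have 2: "Cmp T Z' Z (S X) w d = w'"
  using Neg_inject[of "S Z'" "S (S X)" "SM Z' (S X) (Cmp T Z' Z (S X) w d)" "SM Z' (S X) w'"]
   SM_inject[of Z' "S X" "Cmp T Z' Z (S X) w d" w'] d T T' by (simp add: closed)
 have "triangle_map T (Shift T) (X, Y, Z', u, v', w') (X, Y, Z, u, v, w) (Ident T X, Ident T Y, d)"
  using 1 2 d T T' by (simp add: closed Cmp_Ident_left Cmp_Ident_right SM_Ident)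
 then have "triangle_iso T (Shift T) (X, Y, Z', u, v', w') (X, Y, Z, u, v, w)"
  using iso isomorphism_Ident T by (auto simp del: triangle_map.simps)
 then show ?thesis using Tri_iso_closed[OF t' tri] by blast
qed

end

section \<open>Composition and transport of triangle maps\<close>

context category
begin

lemma triangle_map_comp:
 assumes S: "is_functor C C S"
  and maps: "triangle_map C S (X, Y, Z, u, v, w) (X', Y', Z', u', v', w') (a, b, c)"
   "triangle_map C S (X', Y', Z', u', v', w') (X'', Y'', Z'', u'', v'', w'') (a', b', c')"
  and tri: "is_triangle C S (X, Y, Z, u, v, w)" "is_triangle C S (X', Y', Z', u', v', w')"
   "is_triangle C S (X'', Y'', Z'', u'', v'', w'')"
 shows "triangle_map C S (X, Y, Z, u, v, w) (X'', Y'', Z'', u'', v'', w'')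
  (Cmp C X X' X'' a' a, Cmp C Y Y' Y'' b' b, Cmp C Z Z' Z'' c' c)"
proof -
 have SX: "fob S X \<in> Ob C" "fob S X' \<in> Ob C" "fob S X'' \<in> Ob C"
  using S tri by (auto simp: is_functor_def)
 have a: "a \<in> Arr C X X'" "a' \<in> Arr C X' X''" using maps by auto
 have Sa: "fmor S X X' a \<in> Arr C (fob S X) (fob S X')" "fmor S X' X'' a' \<in> Arr C (fob S X') (fob S X'')"
  "fmor S X X'' (Cmp C X X' X'' a' a) = Cmp C (fob S X) (fob S X') (fob S X'') (fmor S X' X'' a') (fmor S X X' a)"
  using S tri a by (auto simp: is_functor_def)
 show ?thesis
  using maps tri SX Sa by (simp add: Cmp_closed Cmp_assoc[symmetric]) (simp add: Cmp_assoc)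
qed

lemma triangle_iso_inverse:
 assumes S: "is_functor C C S"
  and iso: "triangle_iso C S (X, Y, Z, u, v, w) (X', Y', Z', u', v', w')"
  and tri: "is_triangle C S (X, Y, Z, u, v, w)" "is_triangle C S (X', Y', Z', u', v', w')"
 obtains a b c a' b' c' where
  "triangle_map C S (X, Y, Z, u, v, w) (X', Y', Z', u', v', w') (a, b, c)"
  "triangle_map C S (X', Y', Z', u', v', w') (X, Y, Z, u, v, w) (a', b', c')"
  "Cmp C X X' X a' a = Ident C X" "Cmp C X' X X' a a' = Ident C X'"
  "Cmp C Y Y' Y b' b = Ident C Y" "Cmp C Y' Y Y' b b' = Ident C Y'"
  "Cmp C Z Z' Z c' c = Ident C Z" "Cmp C Z' Z Z' c c' = Ident C Z'"
proof -
 obtain a b c where abc: "triangle_map C S (X, Y, Z, u, v, w) (X', Y', Z', u', v', w') (a, b, c)"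
  "isomorphism C X X' a" "isomorphism C Y Y' b" "isomorphism C Z Z' c"
  using iso by (auto simp del: triangle_map.simps)
 obtain a' where a: "a \<in> Arr C X X'" "a' \<in> Arr C X' X" "Cmp C X X' X a' a = Ident C X" "Cmp C X' X X' a a' = Ident C X'"
  using abc(2) by (auto simp: isomorphism_def)
 obtain b' where b: "b \<in> Arr C Y Y'" "b' \<in> Arr C Y' Y" "Cmp C Y Y' Y b' b = Ident C Y" "Cmp C Y' Y Y' b b' = Ident C Y'"
  using abc(3) by (auto simp: isomorphism_def)
 obtain c' where c: "c \<in> Arr C Z Z'" "c' \<in> Arr C Z' Z" "Cmp C Z Z' Z c' c = Ident C Z" "Cmp C Z' Z Z' c c' = Ident C Z'"
  using abc(4) by (auto simp: isomorphism_def)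
 have O: "X \<in> Ob C" "Y \<in> Ob C" "Z \<in> Ob C" "X' \<in> Ob C" "Y' \<in> Ob C" "Z' \<in> Ob C" and
  m: "u \<in> Arr C X Y" "v \<in> Arr C Y Z" "w \<in> Arr C Z (fob S X)" "u' \<in> Arr C X' Y'" "v' \<in> Arr C Y' Z'" "w' \<in> Arr C Z' (fob S X')"
  using tri by auto
 have SO: "fob S X \<in> Ob C" "fob S X' \<in> Ob C" using S O by (auto simp: is_functor_def)
 have Sa: "fmor S X X' a \<in> Arr C (fob S X) (fob S X')" "fmor S X' X a' \<in> Arr C (fob S X') (fob S X)"
  "Cmp C (fob S X) (fob S X') (fob S X) (fmor S X' X a') (fmor S X X' a) = Ident C (fob S X)"
  using S O a unfolding is_functor_def by metis+
 have sq: "Cmp C X Y Y' b u = Cmp C X X' Y' u' a" "Cmp C Y Z Z' c v = Cmp C Y Y' Z' v' b"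
  "Cmp C Z (fob S X) (fob S X') (fmor S X X' a) w = Cmp C Z Z' (fob S X') w' c" using abc(1) by auto
 have "Cmp C X' Y' Y b' u' = Cmp C X' Y' Y b' (Cmp C X' X Y' (Cmp C X X' Y' u' a) a')"
  using O m a by (simp add: Cmp_assoc[symmetric] Cmp_Ident_right)
 also have "\<dots> = Cmp C X' X Y (Cmp C X Y Y (Cmp C Y Y' Y b' b) u) a'"
  using O m a b by (simp add: Cmp_assoc Cmp_closed flip: sq)
 finally have 1: "Cmp C X' Y' Y b' u' = Cmp C X' X Y u a'" using O m b by (simp add: Cmp_Ident_left)
 have "Cmp C Y' Z' Z c' v' = Cmp C Y' Z' Z c' (Cmp C Y' Y Z' (Cmp C Y Y' Z' v' b) b')"
  using O m b by (simp add: Cmp_assoc[symmetric] Cmp_Ident_right)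
 also have "\<dots> = Cmp C Y' Y Z (Cmp C Y Z Z (Cmp C Z Z' Z c' c) v) b'"
  using O m b c by (simp add: Cmp_assoc Cmp_closed flip: sq)
 finally have 2: "Cmp C Y' Z' Z c' v' = Cmp C Y' Y Z v b'" using O m c by (simp add: Cmp_Ident_left)
 have "Cmp C Z' (fob S X') (fob S X) (fmor S X' X a') w' =
   Cmp C Z' (fob S X') (fob S X) (fmor S X' X a') (Cmp C Z' Z (fob S X') (Cmp C Z Z' (fob S X') w' c) c')"
  using O SO m c by (simp add: Cmp_assoc[symmetric] Cmp_Ident_right)
 also have "\<dots> = Cmp C Z' Z (fob S X) (Cmp C Z (fob S X) (fob S X) (Cmp C (fob S X) (fob S X') (fob S X) (fmor S X' X a') (fmor S X X' a)) w) c'"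
  using O SO m Sa(1,2) c by (simp add: Cmp_assoc Cmp_closed flip: sq)
 finally have 3: "Cmp C Z' (fob S X') (fob S X) (fmor S X' X a') w' = Cmp C Z' Z (fob S X) w c'"
  using O SO m Sa by (simp add: Cmp_Ident_left)
 show thesis
  by (rule that[OF abc(1) _ a(3,4) b(3,4) c(3,4)]) (use 1 2 3 a b c in simp)
qed

text \<open>Conjugating by the two isomorphisms reduces the filling axiom to one representative of
  each isomorphism class of triangles, in practice to mapping cones.\<close>

lemma triangle_fill_transport:
 assumes S: "is_functor C C S"
  and iso: "triangle_iso C S (X0, Y0, Z0, u0, v0, w0) (X, Y, Z, u, v, w)"
  and iso': "triangle_iso C S (X0', Y0', Z0', u0', v0', w0') (X', Y', Z', u', v', w')"
  and tri: "is_triangle C S (X0, Y0, Z0, u0, v0, w0)" "is_triangle C S (X, Y, Z, u, v, w)"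
  and tri': "is_triangle C S (X0', Y0', Z0', u0', v0', w0')" "is_triangle C S (X', Y', Z', u', v', w')"
  and fill: "\<And>a b. \<lbrakk>a \<in> Arr C X0 X0'; b \<in> Arr C Y0 Y0'; Cmp C X0 Y0 Y0' b u0 = Cmp C X0 X0' Y0' u0' a\<rbrakk>
   \<Longrightarrow> \<exists>c. triangle_map C S (X0, Y0, Z0, u0, v0, w0) (X0', Y0', Z0', u0', v0', w0') (a, b, c)"
  and ab: "a \<in> Arr C X X'" "b \<in> Arr C Y Y'" "Cmp C X Y Y' b u = Cmp C X X' Y' u' a"
 shows "\<exists>c. triangle_map C S (X, Y, Z, u, v, w) (X', Y', Z', u', v', w') (a, b, c)"
proof -
 obtain a1 b1 c1 a2 b2 c2 where
  m1: "triangle_map C S (X0, Y0, Z0, u0, v0, w0) (X, Y, Z, u, v, w) (a1, b1, c1)"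
  and m2: "triangle_map C S (X, Y, Z, u, v, w) (X0, Y0, Z0, u0, v0, w0) (a2, b2, c2)"
  and e: "Cmp C X X0 X a1 a2 = Ident C X" "Cmp C Y Y0 Y b1 b2 = Ident C Y"
  using triangle_iso_inverse[OF S iso tri] by metis
 obtain a3 b3 c3 a4 b4 c4 where
  m3: "triangle_map C S (X0', Y0', Z0', u0', v0', w0') (X', Y', Z', u', v', w') (a3, b3, c3)"
  and m4: "triangle_map C S (X', Y', Z', u', v', w') (X0', Y0', Z0', u0', v0', w0') (a4, b4, c4)"
  and e': "Cmp C X' X0' X' a3 a4 = Ident C X'" "Cmp C Y' Y0' Y' b3 b4 = Ident C Y'"
  using triangle_iso_inverse[OF S iso' tri'] by metis
 have O: "X0 \<in> Ob C" "Y0 \<in> Ob C" "X \<in> Ob C" "Y \<in> Ob C" "X0' \<in> Ob C" "Y0' \<in> Ob C" "X' \<in> Ob C" "Y' \<in> Ob C"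
  and m: "u0 \<in> Arr C X0 Y0" "u0' \<in> Arr C X0' Y0'" "u \<in> Arr C X Y" "u' \<in> Arr C X' Y'"
  using tri tri' by auto
 have A: "a1 \<in> Arr C X0 X" "b1 \<in> Arr C Y0 Y" "a2 \<in> Arr C X X0" "b2 \<in> Arr C Y Y0"
  "a3 \<in> Arr C X0' X'" "b3 \<in> Arr C Y0' Y'" "a4 \<in> Arr C X' X0'" "b4 \<in> Arr C Y' Y0'"
  and sq: "Cmp C X0 Y0 Y b1 u0 = Cmp C X0 X Y u a1" "Cmp C X' Y' Y0' b4 u' = Cmp C X' X0' Y0' u0' a4"
  using m1 m2 m3 m4 by auto
 let ?a = "Cmp C X0 X X0' (Cmp C X X' X0' a4 a) a1"
 let ?b = "Cmp C Y0 Y Y0' (Cmp C Y Y' Y0' b4 b) b1"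
 have "Cmp C X0 Y0 Y0' ?b u0 = Cmp C X0 X Y0' (Cmp C X Y' Y0' b4 (Cmp C X Y Y' b u)) a1"
  using O m A ab(1,2) sq by (simp add: Cmp_closed flip: Cmp_assoc)
 also have "\<dots> = Cmp C X0 X0' Y0' u0' ?a"
  using O m A ab(1,2) sq by (simp add: ab(3) Cmp_closed Cmp_assoc)
 finally have "\<exists>c. triangle_map C S (X0, Y0, Z0, u0, v0, w0) (X0', Y0', Z0', u0', v0', w0') (?a, ?b, c)"
  by (intro fill) (use O m A ab in \<open>simp_all add: Cmp_closed\<close>)
 then obtain c where c: "triangle_map C S (X0, Y0, Z0, u0, v0, w0) (X0', Y0', Z0', u0', v0', w0') (?a, ?b, c)" ..
 note M = triangle_map_comp[OF S triangle_map_comp[OF S m2 c tri(2,1) tri'(1)] m3 tri(2) tri']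
 have "Cmp C X X0' X' a3 (Cmp C X X0 X0' ?a a2) = Cmp C X X' X' (Cmp C X' X0' X' a3 a4) (Cmp C X X X' a (Cmp C X X0 X a1 a2))"
  using O A ab by (simp add: Cmp_closed Cmp_assoc)
 also have "\<dots> = a" using O A ab e e' by (simp add: Cmp_Ident_left Cmp_Ident_right)
 finally have 1: "Cmp C X X0' X' a3 (Cmp C X X0 X0' ?a a2) = a" .
 have "Cmp C Y Y0' Y' b3 (Cmp C Y Y0 Y0' ?b b2) = Cmp C Y Y' Y' (Cmp C Y' Y0' Y' b3 b4) (Cmp C Y Y Y' b (Cmp C Y Y0 Y b1 b2))"
  using O A ab by (simp add: Cmp_closed Cmp_assoc)
 also have "\<dots> = b" using O A ab e e' by (simp add: Cmp_Ident_left Cmp_Ident_right)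
 finally show ?thesis using M 1 by metis
qed

end

text \<open>Products are normalised to right-nested form, where \<open>x * y\<close> is no subterm
  of \<open>x * (y * w)\<close>; each relation between generators is therefore also used in this
  form.\<close>

lemma mult_left_eq: "x * y = z \<Longrightarrow> x * (y * w) = z * (w :: 'r :: ring)"
 by (simp add: mult.assoc[symmetric])

text \<open>Arrows of all degrees live in one ring, with \<open>e X\<close> and \<open>D X\<close>
  the identity and the differential of \<open>X\<close>. The differential of the Hom complexes stays
  implicit: it appears as \<open>D Y * f = f * D X\<close> for cycles of degree 0 and as
  \<open>D Y * s + s * D X\<close> for boundaries of arrows of degree -1.\<close>

locale dg_category =
 fixes Obs :: "'x set" and H :: "int \<Rightarrow> 'x \<Rightarrow> 'x \<Rightarrow> 'r :: ring set" and e D :: "'x \<Rightarrow> 'r"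
 assumes H_Ob: "f \<in> H k X Y \<Longrightarrow> X \<in> Obs \<and> Y \<in> Obs"
  and H_zero: "\<lbrakk>X \<in> Obs; Y \<in> Obs\<rbrakk> \<Longrightarrow> 0 \<in> H k X Y"
  and H_add: "\<lbrakk>f \<in> H k X Y; g \<in> H k X Y\<rbrakk> \<Longrightarrow> f + g \<in> H k X Y"
  and H_uminus: "f \<in> H k X Y \<Longrightarrow> - f \<in> H k X Y"
  and H_mult: "\<lbrakk>f \<in> H k X Y; g \<in> H l Y Z\<rbrakk> \<Longrightarrow> g * f \<in> H (k + l) X Z"
  and H_e: "X \<in> Obs \<Longrightarrow> e X \<in> H 0 X X"
  and unit_left: "f \<in> H k X Y \<Longrightarrow> e Y * f = f"
  and unit_right: "f \<in> H k X Y \<Longrightarrow> f * e X = f"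
  and H_D: "X \<in> Obs \<Longrightarrow> D X \<in> H 1 X X"
  and D_D: "X \<in> Obs \<Longrightarrow> D X * D X = 0"
begin

lemma H_diff: "\<lbrakk>f \<in> H k X Y; g \<in> H k X Y\<rbrakk> \<Longrightarrow> f - g \<in> H k X Y"
 using H_add[OF _ H_uminus] by fastforce

text \<open>The degree sums are evaluated once, so that membership goals are settled without
  arithmetic on degrees.\<close>

lemma H_mults:
 "\<lbrakk>f \<in> H 0 X Y; g \<in> H 0 Y Z\<rbrakk> \<Longrightarrow> g * f \<in> H 0 X Z"
 "\<lbrakk>f \<in> H 0 X Y; g \<in> H 1 Y Z\<rbrakk> \<Longrightarrow> g * f \<in> H 1 X Z"
 "\<lbrakk>f \<in> H 1 X Y; g \<in> H 0 Y Z\<rbrakk> \<Longrightarrow> g * f \<in> H 1 X Z"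
 "\<lbrakk>f \<in> H 0 X Y; g \<in> H (- 1) Y Z\<rbrakk> \<Longrightarrow> g * f \<in> H (- 1) X Z"
 "\<lbrakk>f \<in> H (- 1) X Y; g \<in> H 0 Y Z\<rbrakk> \<Longrightarrow> g * f \<in> H (- 1) X Z"
 "\<lbrakk>f \<in> H 1 X Y; g \<in> H (- 1) Y Z\<rbrakk> \<Longrightarrow> g * f \<in> H 0 X Z"
 "\<lbrakk>f \<in> H (- 1) X Y; g \<in> H 1 Y Z\<rbrakk> \<Longrightarrow> g * f \<in> H 0 X Z"
 using H_mult[of f _ X Y g _ Z] by fastforce+

lemmas H_intros = H_mults H_add H_diff H_uminus

lemma units:
 "f \<in> H k X Y \<Longrightarrow> e Y * f = f"
 "f \<in> H k X Y \<Longrightarrow> e Y * (f * g) = f * g"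
 "f \<in> H k X Y \<Longrightarrow> f * e X = f"
 "f \<in> H k X Y \<Longrightarrow> f * (e X * g) = f * g"
 using unit_left unit_right by (metis mult.assoc)+

definition cyc :: "'x \<Rightarrow> 'x \<Rightarrow> 'r set" where
 "cyc X Y = {f \<in> H 0 X Y. D Y * f = f * D X}"

definition homotopic :: "'x \<Rightarrow> 'x \<Rightarrow> 'r \<Rightarrow> 'r \<Rightarrow> bool" where
 "homotopic X Y f g \<longleftrightarrow> (\<exists>s\<in>H (- 1) X Y. f - g = D Y * s + s * D X)"

lemma cycI: "\<lbrakk>f \<in> H 0 X Y; D Y * f = f * D X\<rbrakk> \<Longrightarrow> f \<in> cyc X Y"
 and cyc_H: "f \<in> cyc X Y \<Longrightarrow> f \<in> H 0 X Y"
 and cyc_D: "f \<in> cyc X Y \<Longrightarrow> D Y * f = f * D X"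
 and cyc_Ob: "f \<in> cyc X Y \<Longrightarrow> X \<in> Obs \<and> Y \<in> Obs"
 by (auto simp: cyc_def dest: H_Ob)

lemma cyc_add: "\<lbrakk>f \<in> cyc X Y; g \<in> cyc X Y\<rbrakk> \<Longrightarrow> f + g \<in> cyc X Y"
 and cyc_uminus: "f \<in> cyc X Y \<Longrightarrow> - f \<in> cyc X Y"
 and cyc_zero: "\<lbrakk>X \<in> Obs; Y \<in> Obs\<rbrakk> \<Longrightarrow> 0 \<in> cyc X Y"
 and cyc_e: "X \<in> Obs \<Longrightarrow> e X \<in> cyc X X"
 by (auto simp: cyc_def H_add H_uminus H_zero H_e units[OF H_D] algebra_simps)

lemma cyc_mult: "\<lbrakk>f \<in> cyc X Y; g \<in> cyc Y Z\<rbrakk> \<Longrightarrow> g * f \<in> cyc X Z"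
proof (rule cycI)
 assume f: "f \<in> cyc X Y" and g: "g \<in> cyc Y Z"
 then show "g * f \<in> H 0 X Z" by (blast intro: H_intros cyc_H)
 show "D Z * (g * f) = g * f * D X"
  using cyc_D[OF f] cyc_D[OF g, THEN mult_left_eq] by (simp add: mult.assoc)
qed

lemmas cyc_intros = cyc_add cyc_uminus cyc_zero cyc_e cyc_mult

lemma homotopicI: "\<lbrakk>s \<in> H (- 1) X Y; f - g = D Y * s + s * D X\<rbrakk> \<Longrightarrow> homotopic X Y f g"
 by (auto simp: homotopic_def)

text \<open>As a graded object \<open>C\<close> is the sum of the shift of \<open>X\<close> and of
  \<open>Y\<close>. The source stays unshifted, so its inclusion \<open>j\<close> and projection
  \<open>p\<close> have degrees -1 and 1; the last two equations are the columns of the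
  differential.\<close>

definition cone :: "'x \<Rightarrow> 'x \<Rightarrow> 'r \<Rightarrow> 'x \<Rightarrow> 'r \<Rightarrow> 'r \<Rightarrow> 'r \<Rightarrow> 'r \<Rightarrow> bool" where
 "cone X Y f C i j p r \<longleftrightarrow>
   f \<in> cyc X Y \<and> i \<in> H 0 Y C \<and> j \<in> H (- 1) X C \<and> p \<in> H 1 C X \<and> r \<in> H 0 C Y \<and>
   p * j = e X \<and> r * i = e Y \<and> p * i = 0 \<and> r * j = 0 \<and> j * p + i * r = e C \<and>
   D C * j = i * f - j * D X \<and> D C * i = i * D Y"

lemma coneD:
 assumes c: "cone X Y f C i j p r"
 shows "f \<in> cyc X Y" "i \<in> H 0 Y C" "j \<in> H (- 1) X C" "p \<in> H 1 C X" "r \<in> H 0 C Y"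
  and "p * j = e X" "r * i = e Y" "p * i = 0" "r * j = 0" "D C * j = i * f - j * D X" "D C * i = i * D Y"
  and "p * D C = - (D X * p)" "r * D C = f * p + D Y * r" "D Y * f = f * D X"
  and "f \<in> H 0 X Y" "X \<in> Obs" "Y \<in> Obs" "C \<in> Obs"
proof -
 show *: "f \<in> cyc X Y" "i \<in> H 0 Y C" "j \<in> H (- 1) X C" "p \<in> H 1 C X" "r \<in> H 0 C Y"
  and eq: "p * j = e X" "r * i = e Y" "p * i = 0" "r * j = 0" "D C * j = i * f - j * D X" "D C * i = i * D Y"
  using c by (auto simp: cone_def)
 show f: "D Y * f = f * D X" "f \<in> H 0 X Y" and O: "X \<in> Obs" "Y \<in> Obs" "C \<in> Obs"
  using * cyc_D cyc_H H_Ob by blast+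
 note U = units[OF f(2)] units[OF *(2)] units[OF *(3)] units[OF *(4)] units[OF *(5)]
  units[OF H_D[OF O(1)]] units[OF H_D[OF O(2)]] units[OF H_D[OF O(3)]]
 \<comment> \<open>Inserting this decomposition converts the equations for the columns of
   \<open>D C\<close> into those for its rows.\<close>
 have eC: "e C = j * p + i * r" using c by (simp add: cone_def)
 have "p * D C = p * (D C * e C)" by (simp add: U)
 also have "\<dots> = - (D X * p)"
  unfolding eC by (simp add: algebra_simps eq eq[THEN mult_left_eq] U)
 finally show "p * D C = - (D X * p)" .
 have "r * D C = r * (D C * e C)" by (simp add: U)
 also have "\<dots> = f * p + D Y * r"
  unfolding eC by (simp add: algebra_simps eq eq[THEN mult_left_eq] U)
 finally show "r * D C = f * p + D Y * r" .
qed

lemma cone_jp: "cone X Y f C i j p r \<Longrightarrow> j * p = e C - i * r"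
 by (simp add: cone_def eq_diff_eq)

end

section \<open>Differential graded models of triangulated categories\<close>

text \<open>Presents \<open>K\<close> as the homotopy category of a differential graded category:
  \<open>q\<close> sends a cycle to its class. The invertible arrow \<open>sg X\<close> of degree -1
  is the suspension of \<open>X\<close>; that it anticommutes with the differentials encodes the
  sign in the differential of the shift.\<close>

locale dg_model = dg_category "Ob K" H e D
 for K :: "('x, 'n, 'z) tri_cat_scheme" and H :: "int \<Rightarrow> 'x \<Rightarrow> 'x \<Rightarrow> 'r :: ring set" and e D :: "'x \<Rightarrow> 'r" +
 fixes sg sg' :: "'x \<Rightarrow> 'r" and q :: "'x \<Rightarrow> 'x \<Rightarrow> 'r \<Rightarrow> 'n"
 assumes Arr_K: "\<lbrakk>X \<in> Ob K; Y \<in> Ob K\<rbrakk> \<Longrightarrow> Arr K X Y = q X Y ` cyc X Y"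
  and q_eq: "\<lbrakk>f \<in> cyc X Y; g \<in> cyc X Y\<rbrakk> \<Longrightarrow> q X Y f = q X Y g \<longleftrightarrow> homotopic X Y f g"
  and Cmp_K: "\<lbrakk>f \<in> cyc X Y; g \<in> cyc Y Z\<rbrakk> \<Longrightarrow> Cmp K X Y Z (q Y Z g) (q X Y f) = q X Z (g * f)"
  and Ident_K: "X \<in> Ob K \<Longrightarrow> Ident K X = q X X (e X)"
  and Add_K: "\<lbrakk>f \<in> cyc X Y; g \<in> cyc X Y\<rbrakk> \<Longrightarrow> Add K X Y (q X Y f) (q X Y g) = q X Y (f + g)"
  and Nul_K: "\<lbrakk>X \<in> Ob K; Y \<in> Ob K\<rbrakk> \<Longrightarrow> Nul K X Y = q X Y 0"
  and S_Ob: "X \<in> Ob K \<Longrightarrow> fob (Shift K) X \<in> Ob K"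
  and S_surj: "X \<in> Ob K \<Longrightarrow> \<exists>Y\<in>Ob K. fob (Shift K) Y = X"
  and H_sg: "X \<in> Ob K \<Longrightarrow> sg X \<in> H (- 1) X (fob (Shift K) X)"
  and H_sg': "X \<in> Ob K \<Longrightarrow> sg' X \<in> H 1 (fob (Shift K) X) X"
  and sg_sg': "X \<in> Ob K \<Longrightarrow> sg X * sg' X = e (fob (Shift K) X)"
  and sg'_sg: "X \<in> Ob K \<Longrightarrow> sg' X * sg X = e X"
  and D_sg: "X \<in> Ob K \<Longrightarrow> D (fob (Shift K) X) * sg X = - (sg X * D X)"
  and SM_K: "f \<in> cyc X Y \<Longrightarrow> fmor (Shift K) X Y (q X Y f) = q (fob (Shift K) X) (fob (Shift K) Y) (sg Y * f * sg' X)"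
  and e_zero: "\<exists>N\<in>Ob K. e N = 0"
  and cone_exists: "f \<in> cyc X Y \<Longrightarrow> \<exists>C i j p r. cone X Y f C i j p r"
  and Tri_K: "Tri K = {t. is_triangle K (Shift K) t \<and> (\<exists>X Y f C i j p r. cone X Y f C i j p r \<and>
   triangle_iso K (Shift K) (X, Y, C, q X Y f, q Y C i, q C (fob (Shift K) X) (sg X * p)) t)}"
begin

abbreviation "sh \<equiv> fob (Shift K)"

lemma q_Arr: "f \<in> cyc X Y \<Longrightarrow> q X Y f \<in> Arr K X Y"
 using Arr_K cyc_Ob by blast

lemma Arr_q: assumes "X \<in> Ob K" "Y \<in> Ob K" "a \<in> Arr K X Y" obtains f where "f \<in> cyc X Y" "a = q X Y f"
 using assms Arr_K by auto

lemma q_homotopic: "\<lbrakk>homotopic X Y f g; f \<in> cyc X Y; g \<in> cyc X Y\<rbrakk> \<Longrightarrow> q X Y f = q X Y g"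
 by (simp add: q_eq)

lemma is_category: "category K"
proof
 fix X Y Z f g assume O: "X \<in> Ob K" "Y \<in> Ob K" "Z \<in> Ob K" and fg: "f \<in> Arr K X Y" "g \<in> Arr K Y Z"
 then obtain a b where "a \<in> cyc X Y" "b \<in> cyc Y Z" "f = q X Y a" "g = q Y Z b" by (meson Arr_q)
 then show "Cmp K X Y Z g f \<in> Arr K X Z" by (simp add: Cmp_K q_Arr cyc_mult)
next
 fix W X Y Z f g h assume O: "W \<in> Ob K" "X \<in> Ob K" "Y \<in> Ob K" "Z \<in> Ob K"
  and fg: "f \<in> Arr K W X" "g \<in> Arr K X Y" "h \<in> Arr K Y Z"
 then obtain f' g' h' where "f' \<in> cyc W X" "g' \<in> cyc X Y" "h' \<in> cyc Y Z"
  "f = q W X f'" "g = q X Y g'" "h = q Y Z h'" by (meson Arr_q)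
 then show "Cmp K W Y Z h (Cmp K W X Y g f) = Cmp K W X Z (Cmp K X Y Z h g) f"
  by (simp add: Cmp_K cyc_mult mult.assoc)
next
 fix X Y f assume O: "X \<in> Ob K" "Y \<in> Ob K" and f: "f \<in> Arr K X Y"
 from O f obtain f' where f': "f' \<in> cyc X Y" "f = q X Y f'" by (rule Arr_q)
 then show "Cmp K X Y Y (Ident K Y) f = f" "Cmp K X X Y f (Ident K X) = f"
  using O by (simp_all add: Ident_K Cmp_K cyc_e units[OF cyc_H])
qed (simp add: Ident_K q_Arr cyc_e)

lemma is_preadditive: "preadditive_category K"
proof -
 show ?thesis
 proof (intro preadditive_category.intro preadditive_category_axioms.intro is_category)
  fix X Y assume O: "X \<in> Ob K" "Y \<in> Ob K"
  show "comm_group (hom_group K X Y)"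
  proof (rule comm_groupI; simp add: hom_group_def)
   fix a b c assume abc: "a \<in> Arr K X Y" "b \<in> Arr K X Y"
   obtain f g where fg: "f \<in> cyc X Y" "g \<in> cyc X Y" "a = q X Y f" "b = q X Y g"
    using O abc by (meson Arr_q)
   show "Add K X Y a b \<in> Arr K X Y" "Add K X Y a b = Add K X Y b a"
    using fg by (simp_all add: Add_K q_Arr cyc_add add.commute)
   assume "c \<in> Arr K X Y"
   with O obtain h where "h \<in> cyc X Y" "c = q X Y h" by (meson Arr_q)
   then show "Add K X Y (Add K X Y a b) c = Add K X Y a (Add K X Y b c)"
    using fg by (simp add: Add_K cyc_add add.assoc)
  next
   show "Nul K X Y \<in> Arr K X Y" using O by (simp add: Nul_K q_Arr cyc_zero)
   fix a assume "a \<in> Arr K X Y"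
   with O obtain f where f: "f \<in> cyc X Y" "a = q X Y f" by (meson Arr_q)
   show "Add K X Y (Nul K X Y) a = a" using O f by (simp add: Add_K Nul_K cyc_zero)
   show "\<exists>b\<in>Arr K X Y. Add K X Y b a = Nul K X Y"
    using O f by (intro bexI[of _ "q X Y (- f)"]) (simp_all add: Add_K Nul_K cyc_uminus q_Arr)
  qed
 next
  fix X Y Z f g g' assume O: "X \<in> Ob K" "Y \<in> Ob K" "Z \<in> Ob K"
   and m: "f \<in> Arr K X Y" "g \<in> Arr K Y Z" "g' \<in> Arr K Y Z"
  then obtain a b c where "a \<in> cyc X Y" "b \<in> cyc Y Z" "c \<in> cyc Y Z" "f = q X Y a" "g = q Y Z b" "g' = q Y Z c"
   by (meson Arr_q)
  then show "Cmp K X Y Z (Add K Y Z g g') f = Add K X Z (Cmp K X Y Z g f) (Cmp K X Y Z g' f)"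
   by (simp add: Cmp_K Add_K cyc_intros distrib_right)
 next
  fix X Y Z f f' g assume O: "X \<in> Ob K" "Y \<in> Ob K" "Z \<in> Ob K"
   and m: "f \<in> Arr K X Y" "f' \<in> Arr K X Y" "g \<in> Arr K Y Z"
  then obtain a b c where "a \<in> cyc X Y" "b \<in> cyc X Y" "c \<in> cyc Y Z" "f = q X Y a" "f' = q X Y b" "g = q Y Z c"
   by (meson Arr_q)
  then show "Cmp K X Y Z g (Add K X Y f f') = Add K X Z (Cmp K X Y Z g f) (Cmp K X Y Z g f')"
   by (simp add: Cmp_K Add_K cyc_intros distrib_left)
 qed
qed

end

sublocale dg_model \<subseteq> preadditive_category K by (rule is_preadditive)

context dg_model
begin

lemma Neg_K: "f \<in> cyc X Y \<Longrightarrow> Neg K X Y (q X Y f) = q X Y (- f)"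
 by (rule Neg_unique[symmetric]) (simp_all add: q_Arr cyc_intros Add_K Nul_K cyc_Ob)

lemma D_sg': assumes X: "X \<in> Ob K" shows "sg' X * D (sh X) = - (D X * sg' X)"
proof -
 note U = units[OF H_sg[OF X]] units[OF H_sg'[OF X]] units[OF H_D[OF S_Ob[OF X]]] units[OF H_D[OF X]]
 have "sg' X * D (sh X) = sg' X * D (sh X) * (sg X * sg' X)" by (simp add: U sg_sg'[OF X] mult.assoc)
 also have "\<dots> = - (D X * sg' X)"
  by (simp add: mult.assoc D_sg[OF X, THEN mult_left_eq] sg'_sg[OF X, THEN mult_left_eq] U)
 finally show ?thesis .
qed

lemma D_sg'_rev: "X \<in> Ob K \<Longrightarrow> D X * sg' X = - (sg' X * D (sh X))"
 by (simp add: D_sg')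

lemmas sg_simps = sg_sg' sg'_sg D_sg D_sg'

lemma cyc_shift:
 assumes f: "f \<in> cyc X Y" shows "sg Y * f * sg' X \<in> cyc (sh X) (sh Y)"
proof (rule cycI)
 note O = cyc_Ob[OF f]
 show "sg Y * f * sg' X \<in> H 0 (sh X) (sh Y)" using O H_sg H_sg' cyc_H[OF f] by (blast intro: H_intros)
 show "D (sh Y) * (sg Y * f * sg' X) = sg Y * f * sg' X * D (sh X)"
  using O by (simp add: mult.assoc sg_simps sg_simps[THEN mult_left_eq] cyc_D[OF f, THEN mult_left_eq])
qed

lemma cyc_cone:
 assumes c: "cone X Y f C i j p r" shows "i \<in> cyc Y C" "sg X * p \<in> cyc C (sh X)"
proof -
 note c = coneD[OF c]
 show "i \<in> cyc Y C" using c by (simp add: cyc_def)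
 show "sg X * p \<in> cyc C (sh X)"
 proof (rule cycI)
  show "sg X * p \<in> H 0 C (sh X)" using c H_sg by (blast intro: H_intros)
  show "D (sh X) * (sg X * p) = sg X * p * D C"
   using c(16) by (simp add: mult.assoc c sg_simps[THEN mult_left_eq])
 qed
qed

lemma S_functor: "is_functor K K (Shift K)"
 unfolding is_functor_def
proof (intro conjI ballI)
 fix X Y Z f g assume O: "X \<in> Ob K" "Y \<in> Ob K" "Z \<in> Ob K" and "f \<in> Arr K X Y" "g \<in> Arr K Y Z"
 then obtain a b where a: "a \<in> cyc X Y" "b \<in> cyc Y Z" "f = q X Y a" "g = q Y Z b" by (meson Arr_q)
 have "sg Z * (b * a) * sg' X = (sg Z * b * sg' Y) * (sg Y * a * sg' X)"
  using O by (simp add: mult.assoc sg_simps[THEN mult_left_eq] units[OF cyc_H[OF a(1)]])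
 then show "fmor (Shift K) X Z (Cmp K X Y Z g f) = Cmp K (sh X) (sh Y) (sh Z) (fmor (Shift K) Y Z g) (fmor (Shift K) X Y f)"
  using a by (simp add: SM_K Cmp_K cyc_mult cyc_shift)
next
 fix X assume "X \<in> Ob K"
 then show "fmor (Shift K) X X (Ident K X) = Ident K (sh X)"
  by (simp add: Ident_K SM_K cyc_intros S_Ob sg_sg' mult.assoc units[OF H_sg'])
next
 fix X Y f assume "X \<in> Ob K" "Y \<in> Ob K" "f \<in> Arr K X Y"
 then obtain a where "a \<in> cyc X Y" "f = q X Y a" by (meson Arr_q)
 then show "fmor (Shift K) X Y f \<in> Arr K (sh X) (sh Y)" by (simp add: SM_K q_Arr cyc_shift)
qed (simp add: S_Ob)

lemma S_additive: "is_additive_functor K K (Shift K)"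
 unfolding is_additive_functor_def
proof (intro conjI ballI S_functor)
 fix X Y assume O: "X \<in> Ob K" "Y \<in> Ob K"
 show "fmor (Shift K) X Y \<in> hom (hom_group K X Y) (hom_group K (sh X) (sh Y))"
 proof (rule homI; simp add: hom_group_def)
  show "fmor (Shift K) X Y a \<in> Arr K (sh X) (sh Y)" if "a \<in> Arr K X Y" for a
   using S_functor O that by (simp add: is_functor_def)
  fix a b assume "a \<in> Arr K X Y" "b \<in> Arr K X Y"
  with O obtain f g where "f \<in> cyc X Y" "g \<in> cyc X Y" "a = q X Y f" "b = q X Y g" by (meson Arr_q)
  then show "fmor (Shift K) X Y (Add K X Y a b) = Add K (sh X) (sh Y) (fmor (Shift K) X Y a) (fmor (Shift K) X Y b)"
   by (simp add: SM_K Add_K cyc_add cyc_shift distrib_left distrib_right)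
 qed
qed

lemma S_equivalence: "is_equivalence K K (Shift K)"
 unfolding is_equivalence_def
proof (intro conjI ballI S_functor)
 fix X Y assume O: "X \<in> Ob K" "Y \<in> Ob K"
 note U = units[OF H_sg[OF O(1)]] units[OF H_sg[OF O(2)]] units[OF H_sg'[OF O(1)]] units[OF H_sg'[OF O(2)]]
 show "bij_betw (fmor (Shift K) X Y) (Arr K X Y) (Arr K (sh X) (sh Y))"
 proof (rule bij_betw_imageI)
  show "inj_on (fmor (Shift K) X Y) (Arr K X Y)"
  proof (rule inj_onI)
   fix a b assume ab: "a \<in> Arr K X Y" "b \<in> Arr K X Y" "fmor (Shift K) X Y a = fmor (Shift K) X Y b"
   with O obtain f g where fg: "f \<in> cyc X Y" "g \<in> cyc X Y" "a = q X Y f" "b = q X Y g" by (meson Arr_q)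
   then have "homotopic (sh X) (sh Y) (sg Y * f * sg' X) (sg Y * g * sg' X)"
    using ab(3) by (simp add: SM_K q_eq cyc_shift)
   then obtain s where s: "s \<in> H (- 1) (sh X) (sh Y)"
    "sg Y * f * sg' X - sg Y * g * sg' X = D (sh Y) * s + s * D (sh X)" by (auto simp: homotopic_def)
   \<comment> \<open>The odd arrows \<open>sg\<close> and \<open>sg'\<close> anticommute with the
     differentials, hence the homotopy between \<open>f\<close> and \<open>g\<close> is the
     conjugate of \<open>s\<close> with a minus sign.\<close>
   have "f - g = sg' Y * (sg Y * f * sg' X - sg Y * g * sg' X) * sg X"
    using O by (simp add: algebra_simps sg_simps sg_simps[THEN mult_left_eq] U units[OF cyc_H[OF fg(1)]] units[OF cyc_H[OF fg(2)]])
   also have "\<dots> = D Y * (- (sg' Y * (s * sg X))) + (- (sg' Y * (s * sg X))) * D X"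
    unfolding s(2) using O by (simp add: algebra_simps sg_simps sg_simps[THEN mult_left_eq])
   finally have eq: "f - g = D Y * (- (sg' Y * (s * sg X))) + (- (sg' Y * (s * sg X))) * D X" .
   have "- (sg' Y * s * sg X) \<in> H (- 1) X Y"
    using s(1) H_sg[OF O(1)] H_sg'[OF O(2)] by (intro H_uminus H_mults)
   then have "homotopic X Y f g"
    using eq homotopicI by (simp add: mult.assoc)
   then show "a = b" using fg by (simp add: q_homotopic)
  qed
  show "fmor (Shift K) X Y ` Arr K X Y = Arr K (sh X) (sh Y)"
  proof (intro equalityI subsetI)
   show "b \<in> Arr K (sh X) (sh Y)" if "b \<in> fmor (Shift K) X Y ` Arr K X Y" for b
    using that S_functor O by (auto simp: is_functor_def)
   fix b assume "b \<in> Arr K (sh X) (sh Y)"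
   then obtain h where h: "h \<in> cyc (sh X) (sh Y)" "b = q (sh X) (sh Y) h" using O S_Ob by (meson Arr_q)
   let ?g = "sg' Y * (h * sg X)"
   have g: "?g \<in> cyc X Y"
   proof (rule cycI)
    show "?g \<in> H 0 X Y" using cyc_H[OF h(1)] H_sg[OF O(1)] H_sg'[OF O(2)] by (intro H_mults)
    show "D Y * ?g = ?g * D X"
     using O by (simp add: mult.assoc D_sg D_sg'_rev[THEN mult_left_eq] cyc_D[OF h(1), THEN mult_left_eq])
   qed
   moreover have "sg Y * ?g * sg' X = h"
    using O by (simp add: mult.assoc sg_simps sg_simps[THEN mult_left_eq] units[OF cyc_H[OF h(1)]])
   ultimately show "b \<in> fmor (Shift K) X Y ` Arr K X Y"
    using h SM_K[OF g] q_Arr[OF g] by (intro image_eqI[of _ _ "q X Y ?g"]) simp_all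
  qed
 qed
next
 fix Z assume "Z \<in> Ob K"
 then show "\<exists>X\<in>Ob K. \<exists>f. isomorphism K (sh X) Z f"
  using S_surj isomorphism_Ident by metis
qed

lemma e_zero_is_zero: "\<lbrakk>N \<in> Ob K; e N = 0\<rbrakk> \<Longrightarrow> is_zero K N"
 by (simp add: is_zero_iff Ident_K Nul_K)

text \<open>The biproduct of \<open>X\<close> and \<open>Y\<close> is the cone of the zero map
  \<open>V -> Y\<close>, where \<open>sh V = X\<close>.\<close>

lemma is_additive: "additive_category K"
proof
 show "\<exists>X. is_zero K X" using e_zero e_zero_is_zero by blast
 fix X Y assume X: "X \<in> Ob K" and Y: "Y \<in> Ob K"
 obtain V where V: "V \<in> Ob K" "sh V = X" using S_surj[OF X] by blast
 obtain C i j p r where c: "cone V Y 0 C i j p r" using cone_exists[OF cyc_zero[OF V(1) Y]] by blast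
 note cD = coneD[OF c]
 note U = units[OF H_sg[OF V(1)]] units[OF H_sg'[OF V(1)]] units[OF cD(2)] units[OF cD(3)] units[OF cD(4)] units[OF cD(5)]
 have j: "j * sg' V \<in> cyc X C"
 proof (rule cycI)
  show "j * sg' V \<in> H 0 X C" using cD(3) H_sg'[OF V(1)] unfolding V by (intro H_mults)
  show "D C * (j * sg' V) = j * sg' V * D X"
   using V D_sg'_rev[OF V(1)] by (simp add: mult.assoc cD(6-14)[THEN mult_left_eq])
 qed
 have r: "r \<in> cyc C Y" by (rule cycI) (simp_all add: cD)
 note i = cyc_cone[OF c, unfolded V]
 have jp: "j * p \<in> cyc C C"
  using cyc_mult[OF i(2) j] by (simp add: mult.assoc sg_simps(2)[OF V(1), THEN mult_left_eq] U)
 have "j * p + i * r = e C" using c by (simp add: cone_def)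
 then have "is_biproduct K X Y C (q X C (j * sg' V)) (q Y C i) (q C X (sg V * p)) (q C Y r)"
  unfolding is_biproduct_def using i j r jp X Y cD(18) V
  by (simp add: q_Arr Cmp_K Ident_K Nul_K Add_K cyc_intros mult.assoc cD cD(6-14)[THEN mult_left_eq] U
    sg_simps sg_simps[THEN mult_left_eq])
 then show "\<exists>P i\<^sub>X i\<^sub>Y p\<^sub>X p\<^sub>Y. is_biproduct K X Y P i\<^sub>X i\<^sub>Y p\<^sub>X p\<^sub>Y" by blast
qed

lemma cone_triangle:
 assumes c: "cone X Y f C i j p r"
 shows "is_triangle K (Shift K) (X, Y, C, q X Y f, q Y C i, q C (sh X) (sg X * p))"
  and "(X, Y, C, q X Y f, q Y C i, q C (sh X) (sg X * p)) \<in> Tri K"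
proof -
 note cD = coneD[OF c]
 show t: "is_triangle K (Shift K) (X, Y, C, q X Y f, q Y C i, q C (sh X) (sg X * p))"
  using cD cyc_cone[OF c] by (simp add: q_Arr)
 have "triangle_map K (Shift K) (X, Y, C, q X Y f, q Y C i, q C (sh X) (sg X * p))
   (X, Y, C, q X Y f, q Y C i, q C (sh X) (sg X * p)) (Ident K X, Ident K Y, Ident K C)"
  using t S_functor by (simp add: Cmp_Ident_left Cmp_Ident_right Ident_closed is_functor_def)
 then have "triangle_iso K (Shift K) (X, Y, C, q X Y f, q Y C i, q C (sh X) (sg X * p))
   (X, Y, C, q X Y f, q Y C i, q C (sh X) (sg X * p))"
  using t isomorphism_Ident by (auto simp del: triangle_map.simps)
 with t c show "(X, Y, C, q X Y f, q Y C i, q C (sh X) (sg X * p)) \<in> Tri K" unfolding Tri_K by blast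
qed

lemma Tri_cases:
 assumes "(X, Y, Z, u, v, w) \<in> Tri K"
 obtains X' Y' f C i j p r where "cone X' Y' f C i j p r" "is_triangle K (Shift K) (X, Y, Z, u, v, w)"
  "triangle_iso K (Shift K) (X', Y', C, q X' Y' f, q Y' C i, q C (sh X') (sg X' * p)) (X, Y, Z, u, v, w)"
 using assms unfolding Tri_K by blast

lemma Tri_K_iso_closed:
 assumes "t \<in> Tri K" "is_triangle K (Shift K) t'" "triangle_iso K (Shift K) t t'"
 shows "t' \<in> Tri K"
proof -
 obtain X Y f C i j p r where c: "cone X Y f C i j p r" "is_triangle K (Shift K) t"
  "triangle_iso K (Shift K) (X, Y, C, q X Y f, q Y C i, q C (sh X) (sg X * p)) t"
  using assms(1) unfolding Tri_K by blast
 then have "triangle_iso K (Shift K) (X, Y, C, q X Y f, q Y C i, q C (sh X) (sg X * p)) t'"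
  using triangle_iso_trans[OF S_functor c(3) assms(3) cone_triangle(1)[OF c(1)] c(2) assms(2)] by blast
 with assms(2) c(1) show ?thesis unfolding Tri_K by blast
qed

lemma Tri_K_from_cone:
 assumes c: "cone X Y f C i j p r" and t: "is_triangle K (Shift K) (X, Y, Z, q X Y f, v, w)"
  and iso: "isomorphism K C Z \<phi>" "Cmp K Y C Z \<phi> (q Y C i) = v" "Cmp K C Z (sh X) w \<phi> = q C (sh X) (sg X * p)"
 shows "(X, Y, Z, q X Y f, v, w) \<in> Tri K"
proof (rule Tri_K_iso_closed[OF cone_triangle(2)[OF c] t])
 have "triangle_map K (Shift K) (X, Y, C, q X Y f, q Y C i, q C (sh X) (sg X * p))
   (X, Y, Z, q X Y f, v, w) (Ident K X, Ident K Y, \<phi>)"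
  using t iso S_functor cone_triangle(1)[OF c]
  by (simp add: Cmp_Ident_left Cmp_Ident_right Ident_closed is_functor_def isomorphism_def)
 then show "triangle_iso K (Shift K) (X, Y, C, q X Y f, q Y C i, q C (sh X) (sg X * p)) (X, Y, Z, q X Y f, v, w)"
  using t iso isomorphism_Ident by (auto simp del: triangle_map.simps)
qed

lemma q_isomorphism:
 assumes "\<phi> \<in> cyc X Y" "\<psi> \<in> cyc Y X" "homotopic X X (\<psi> * \<phi>) (e X)" "homotopic Y Y (\<phi> * \<psi>) (e Y)"
 shows "isomorphism K X Y (q X Y \<phi>)"
proof -
 have "Cmp K X Y X (q Y X \<psi>) (q X Y \<phi>) = Ident K X" "Cmp K Y X Y (q X Y \<phi>) (q Y X \<psi>) = Ident K Y"
  using assms cyc_Ob[OF assms(1)] by (simp_all add: Cmp_K Ident_K q_homotopic cyc_intros)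
 then show ?thesis using assms q_Arr unfolding isomorphism_def by blast
qed

lemma homotopic_refl: "\<lbrakk>f = g; X \<in> Ob K; Y \<in> Ob K\<rbrakk> \<Longrightarrow> homotopic X Y f g"
 using H_zero by (intro homotopicI[of 0]) auto

end

section \<open>The axioms of a triangulated category, checked on cones\<close>

context dg_model
begin

text \<open>The cone of the identity is contracted by \<open>j * r\<close>, so it is a zero object
  and may be exchanged for the given \<open>N\<close>.\<close>

lemma Tri_Ident_K:
 assumes X: "X \<in> Ob K" and N: "is_zero K N"
 shows "(X, X, N, Ident K X, Nul K X N, Nul K N (sh X)) \<in> Tri K"
proof -
 obtain C i j p r where c: "cone X X (e X) C i j p r" using cone_exists[OF cyc_e[OF X]] by blast
 note cD = coneD[OF c]
 note U = units[OF cD(2)] units[OF cD(3)] units[OF cD(4)] units[OF cD(5)] units[OF H_D[OF X]]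
 have jr: "j * r \<in> H (- 1) C C" using cD by (blast intro: H_mults)
 have "homotopic C C (e C) 0"
  by (rule homotopicI[OF jr])
   (simp add: algebra_simps cD(6-14) cD(6-14)[THEN mult_left_eq] U cone_jp[OF c] units(1)[OF cD(5)])
 then have "q C C (e C) = q C C 0" using cD(18) by (simp add: q_homotopic cyc_intros)
 then have C0: "is_zero K C" using cD(18) by (simp add: is_zero_iff Ident_K Nul_K)
 have NO: "N \<in> Ob K" using N by (simp add: is_zero_def)
 have z: "Nul K C N \<in> Arr K C N" "Nul K N C \<in> Arr K N C" using NO cD(18) Nul_closed by auto
 have "isomorphism K C N (Nul K C N)" unfolding isomorphism_def
  using z is_zero_hom[OF C0] is_zero_hom[OF N] NO cD(18) Cmp_closed Ident_closed by metis
 moreover have "Cmp K X C N (Nul K C N) (q X C i) = Nul K X N"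
  using z NO X cD(18) q_Arr cyc_cone[OF c] by (simp add: Cmp_Nul_left)
 moreover have "Cmp K C N (sh X) (Nul K N (sh X)) (Nul K C N) = q C (sh X) (sg X * p)"
  using is_zero_hom(2)[OF C0 S_Ob[OF X] q_Arr[OF cyc_cone(2)[OF c]]] S_Ob[OF X] NO z cD(18)
  by (simp add: Cmp_Nul_left)
 ultimately have "(X, X, N, q X X (e X), Nul K X N, Nul K N (sh X)) \<in> Tri K"
  using X NO by (intro Tri_K_from_cone[OF c]) (auto simp: q_Arr cyc_intros Nul_closed S_Ob)
 then show ?thesis using X by (simp add: Ident_K)
qed

lemma Tri_K_triangles: "t \<in> Tri K \<Longrightarrow> is_triangle K (Shift K) t"
 by (simp add: Tri_K)

lemma Tri_complete_K:
 assumes "X \<in> Ob K" "Y \<in> Ob K" "u \<in> Arr K X Y" shows "\<exists>Z v w. (X, Y, Z, u, v, w) \<in> Tri K"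
proof -
 obtain f where f: "f \<in> cyc X Y" "u = q X Y f" using assms by (rule Arr_q)
 with cone_exists cone_triangle(2) show ?thesis by blast
qed

text \<open>The cone \<open>C'\<close> of \<open>i : Y -> C\<close> is homotopy equivalent to the
  shift of \<open>X\<close>: \<open>?\<psi>\<close> after \<open>?\<phi>\<close> is the identity on
  the nose, and \<open>j' * (r * r')\<close> is, up to sign, the homotopy for the other
  composite.\<close>

lemma rotate_cone:
 assumes c: "cone X Y f C i j p r"
 shows "(Y, C, sh X, q Y C i, q C (sh X) (sg X * p), Neg K (sh X) (sh Y) (fmor (Shift K) X Y (q X Y f))) \<in> Tri K"
proof -
 note cD = coneD[OF c]
 obtain C' i' j' p' r' where c': "cone Y C i C' i' j' p' r'" using cone_exists[OF cyc_cone(1)[OF c]] by blast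
 note cD' = coneD[OF c']
 note E = cD(6-14) cD(6-14)[THEN mult_left_eq] cD'(6-14) cD'(6-14)[THEN mult_left_eq]
  sg_simps[OF cD(16)] sg_simps[OF cD(16), THEN mult_left_eq]
 note U = units[OF cD(2)] units[OF cD(3)] units[OF cD(4)] units[OF cD(5)] units[OF cD(15)]
  units[OF cD'(2)] units[OF cD'(3)] units[OF cD'(4)] units[OF cD'(5)] units[OF H_sg[OF cD(16)]] units[OF H_sg'[OF cD(16)]]
 let ?\<phi> = "i' * (j * sg' X) - j' * (f * sg' X)"
 let ?\<psi> = "sg X * (p * r')"
 have \<psi>: "?\<psi> \<in> cyc C' (sh X)"
  by (rule cycI, blast intro: H_mults cD cD' H_sg) (simp add: mult.assoc E algebra_simps)
 have fs: "f * sg' X \<in> H 1 (sh X) Y" using cD(15) H_sg'[OF cD(16)] by (rule H_mults(3)[rotated])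
 have \<phi>: "?\<phi> \<in> cyc (sh X) C'"
 proof (rule cycI)
  show "?\<phi> \<in> H 0 (sh X) C'" using fs by (blast intro: H_mults H_diff cD cD' H_sg')
  show "D C' * ?\<phi> = ?\<phi> * D (sh X)"
   by (simp add: mult.assoc E algebra_simps)
 qed
 have inv: "homotopic (sh X) (sh X) (?\<psi> * ?\<phi>) (e (sh X))"
  by (rule homotopic_refl) (use S_Ob cD(16) in \<open>simp_all add: algebra_simps E U\<close>)
 have "j' * (r * r') \<in> H (- 1) C' C'" by (blast intro: H_mults cD cD')
 then have "homotopic C' C' (?\<phi> * ?\<psi>) (e C')"
  using homotopicI[OF H_uminus, of "j' * (r * r')" C' C' "?\<phi> * ?\<psi>" "e C'"]
  by (simp add: algebra_simps E U cone_jp[OF c, THEN mult_left_eq] cone_jp[OF c'])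
 then have iso: "isomorphism K C' (sh X) (q C' (sh X) ?\<psi>)" "isomorphism K (sh X) C' (q (sh X) C' ?\<phi>)"
  using q_isomorphism \<phi> \<psi> inv by blast+
 have eq2: "q C (sh X) (?\<psi> * i') = q C (sh X) (sg X * p)" by (simp add: mult.assoc E U)
 have h2: "homotopic C' C' (?\<phi> * ?\<psi>) (e C')" by fact
 \<comment> \<open>This square commutes only up to homotopy. It becomes strict when
   \<open>sg Y * p'\<close> is composed with \<open>?\<phi> * ?\<psi>\<close>, whose class is the
   identity.\<close>
 have third: "q C' (sh Y) (- (sg Y * f * sg' X) * ?\<psi>) = q C' (sh Y) (sg Y * p')"
 proof -
  have a: "sg Y * p' * (?\<phi> * ?\<psi>) = - (sg Y * f * sg' X) * ?\<psi>"
   by (simp add: algebra_simps E U)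
  have "Cmp K C' C' (sh Y) (q C' (sh Y) (sg Y * p')) (q C' C' (?\<phi> * ?\<psi>)) = q C' (sh Y) (sg Y * p' * (?\<phi> * ?\<psi>))"
   using Cmp_K[OF cyc_mult[OF \<psi> \<phi>] cyc_cone(2)[OF c']] .
  moreover have "q C' C' (?\<phi> * ?\<psi>) = Ident K C'"
   using q_homotopic[OF h2 cyc_mult[OF \<psi> \<phi>] cyc_e] cD'(18) by (simp add: Ident_K)
  ultimately show ?thesis
   using a q_Arr[OF cyc_cone(2)[OF c']] cD'(18) S_Ob[OF cD(17)] by (simp add: Cmp_Ident_right)
 qed
 show ?thesis
 proof (rule Tri_K_from_cone[OF c' _ iso(1)])
  show "is_triangle K (Shift K) (Y, C, sh X, q Y C i, q C (sh X) (sg X * p), Neg K (sh X) (sh Y) (fmor (Shift K) X Y (q X Y f)))"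
   using cD(16-18) S_Ob cyc_cone[OF c] cD(1) by (simp add: q_Arr SM_K Neg_K cyc_shift cyc_uminus)
  show "Cmp K C C' (sh X) (q C' (sh X) ?\<psi>) (q C C' i') = q C (sh X) (sg X * p)"
   using Cmp_K[OF cyc_cone(1)[OF c'] \<psi>] eq2 by simp
  show "Cmp K C' (sh X) (sh Y) (Neg K (sh X) (sh Y) (fmor (Shift K) X Y (q X Y f))) (q C' (sh X) ?\<psi>) = q C' (sh Y) (sg Y * p')"
   using third Cmp_K[OF \<psi> cyc_uminus[OF cyc_shift[OF cD(1)]]] by (simp add: SM_K[OF cD(1)] Neg_K[OF cyc_shift[OF cD(1)]])
 qed
qed

lemma rotate_triangle_iso:
 assumes iso: "triangle_iso K (Shift K) (X, Y, Z, u, v, w) (X', Y', Z', u', v', w')"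
  and tri: "is_triangle K (Shift K) (X, Y, Z, u, v, w)" "is_triangle K (Shift K) (X', Y', Z', u', v', w')"
 shows "triangle_iso K (Shift K) (Y, Z, sh X, v, w, Neg K (sh X) (sh Y) (fmor (Shift K) X Y u))
  (Y', Z', sh X', v', w', Neg K (sh X') (sh Y') (fmor (Shift K) X' Y' u'))"
proof -
 obtain a b c where m: "triangle_map K (Shift K) (X, Y, Z, u, v, w) (X', Y', Z', u', v', w') (a, b, c)"
  "isomorphism K X X' a" "isomorphism K Y Y' b" "isomorphism K Z Z' c"
  using iso by (auto simp del: triangle_map.simps)
 note F = S_functor[unfolded is_functor_def]
 have O: "X \<in> Ob K" "Y \<in> Ob K" "X' \<in> Ob K" "Y' \<in> Ob K" "sh X \<in> Ob K" "sh Y \<in> Ob K" "sh X' \<in> Ob K" "sh Y' \<in> Ob K"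
  and A: "u \<in> Arr K X Y" "u' \<in> Arr K X' Y'" "a \<in> Arr K X X'" "b \<in> Arr K Y Y'"
  using tri m S_Ob by auto
 have SA: "fmor (Shift K) X Y u \<in> Arr K (sh X) (sh Y)" "fmor (Shift K) X' Y' u' \<in> Arr K (sh X') (sh Y')"
  "fmor (Shift K) X X' a \<in> Arr K (sh X) (sh X')" "fmor (Shift K) Y Y' b \<in> Arr K (sh Y) (sh Y')"
  using F O A by blast+
 have "fmor (Shift K) X Y' (Cmp K X Y Y' b u) = fmor (Shift K) X Y' (Cmp K X X' Y' u' a)" using m by auto
 then have "Cmp K (sh X) (sh Y) (sh Y') (fmor (Shift K) Y Y' b) (fmor (Shift K) X Y u)
  = Cmp K (sh X) (sh X') (sh Y') (fmor (Shift K) X' Y' u') (fmor (Shift K) X X' a)"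
  using F O A by metis
 then have "Cmp K (sh X) (sh Y) (sh Y') (fmor (Shift K) Y Y' b) (Neg K (sh X) (sh Y) (fmor (Shift K) X Y u))
  = Cmp K (sh X) (sh X') (sh Y') (Neg K (sh X') (sh Y') (fmor (Shift K) X' Y' u')) (fmor (Shift K) X X' a)"
  using O SA by (simp add: Cmp_Neg_left Cmp_Neg_right)
 moreover have "isomorphism K (sh X) (sh X') (fmor (Shift K) X X' a)"
  using m(2) F O unfolding isomorphism_def by metis
 ultimately show ?thesis unfolding triangle_iso.simps using m SA
  by (intro exI[of _ b] exI[of _ c] exI[of _ "fmor (Shift K) X X' a"]) simp
qed

lemma Tri_rotate_K:
 assumes t: "(X, Y, Z, u, v, w) \<in> Tri K"
 shows "(Y, Z, sh X, v, w, Neg K (sh X) (sh Y) (fmor (Shift K) X Y u)) \<in> Tri K"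
proof -
 obtain X' Y' f C i j p r where c: "cone X' Y' f C i j p r" and tri: "is_triangle K (Shift K) (X, Y, Z, u, v, w)"
  and iso: "triangle_iso K (Shift K) (X', Y', C, q X' Y' f, q Y' C i, q C (sh X') (sg X' * p)) (X, Y, Z, u, v, w)"
  using t by (rule Tri_cases)
 have "is_triangle K (Shift K) (Y, Z, sh X, v, w, Neg K (sh X) (sh Y) (fmor (Shift K) X Y u))"
  using tri S_Ob S_functor Neg_closed by (simp add: is_functor_def)
 with Tri_K_iso_closed[OF rotate_cone[OF c] _ rotate_triangle_iso[OF iso cone_triangle(1)[OF c] tri]]
 show ?thesis by blast
qed

text \<open>The given square commutes up to a homotopy \<open>s\<close>. The induced map of cones
  has diagonal entries \<open>\<alpha>\<close> and \<open>\<beta>\<close>, and \<open>s\<close> as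
  the entry from the shift of \<open>X\<close> to \<open>Y'\<close>; with it the two remaining
  squares commute strictly.\<close>

lemma fill_cones:
 assumes c: "cone X Y f C i j p r" and c': "cone X' Y' f' C' i' j' p' r'"
  and a: "a \<in> Arr K X X'" and b: "b \<in> Arr K Y Y'"
  and ab: "Cmp K X Y Y' b (q X Y f) = Cmp K X X' Y' (q X' Y' f') a"
 shows "\<exists>\<gamma>. triangle_map K (Shift K) (X, Y, C, q X Y f, q Y C i, q C (sh X) (sg X * p))
  (X', Y', C', q X' Y' f', q Y' C' i', q C' (sh X') (sg X' * p')) (a, b, \<gamma>)"
proof -
 note cD = coneD[OF c] and cD' = coneD[OF c']
 obtain \<alpha> where \<alpha>: "\<alpha> \<in> cyc X X'" "a = q X X' \<alpha>" using Arr_q[OF cD(16) cD'(16) a] .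
 obtain \<beta> where \<beta>: "\<beta> \<in> cyc Y Y'" "b = q Y Y' \<beta>" using Arr_q[OF cD(17) cD'(17) b] .
 have "homotopic X Y' (\<beta> * f) (f' * \<alpha>)"
  using ab \<alpha> \<beta> cD(1) cD'(1) by (simp add: Cmp_K q_eq cyc_mult)
 then obtain s where s: "s \<in> H (- 1) X Y'" "\<beta> * f - f' * \<alpha> = D Y' * s + s * D X" by (auto simp: homotopic_def)
 then have fa: "f' * \<alpha> = \<beta> * f - D Y' * s - s * D X" by (simp add: algebra_simps)
 note ch = cyc_H[OF \<alpha>(1)] cyc_H[OF \<beta>(1)]
 note E = cD(6-14) cD(6-14)[THEN mult_left_eq] cD'(6-14) cD'(6-14)[THEN mult_left_eq] fa[THEN mult_left_eq]
  cyc_D[OF \<alpha>(1)] cyc_D[OF \<beta>(1)] cyc_D[OF \<alpha>(1), THEN mult_left_eq] cyc_D[OF \<beta>(1), THEN mult_left_eq]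
  sg_simps[OF cD(16)] sg_simps[OF cD(16), THEN mult_left_eq]
 note U = units[OF cD(2)] units[OF cD(3)] units[OF cD(4)] units[OF cD(5)] units[OF ch(1)] units[OF ch(2)]
  units[OF cD'(2)] units[OF cD'(3)] units[OF cD'(4)] units[OF cD'(5)]
 let ?\<gamma> = "j' * (\<alpha> * p) + i' * (\<beta> * r) + i' * (s * p)"
 have \<gamma>: "?\<gamma> \<in> cyc C C'"
 proof (rule cycI)
  have "\<alpha> * p \<in> H 1 C X'" "\<beta> * r \<in> H 0 C Y'" "s * p \<in> H 0 C Y'" using ch s(1) cD by (blast intro: H_mults)+
  then show "?\<gamma> \<in> H 0 C C'" using cD' by (blast intro: H_mults H_add)
  show "D C' * ?\<gamma> = ?\<gamma> * D C" by (simp add: algebra_simps E)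
 qed
 have 1: "?\<gamma> * i = i' * \<beta>" by (simp add: algebra_simps E U)
 have 2: "sg X' * \<alpha> * sg' X * (sg X * p) = sg X' * p' * ?\<gamma>" by (simp add: algebra_simps E U)
 have "triangle_map K (Shift K) (X, Y, C, q X Y f, q Y C i, q C (sh X) (sg X * p))
  (X', Y', C', q X' Y' f', q Y' C' i', q C' (sh X') (sg X' * p')) (a, b, q C C' ?\<gamma>)"
  using ab a b \<gamma> 1 2 \<alpha> \<beta> cyc_cone[OF c] cyc_cone[OF c']
  by (simp add: q_Arr Cmp_K SM_K cyc_shift)
 then show ?thesis by blast
qed

lemma Tri_fill_K:
 assumes t: "(X, Y, Z, u, v, w) \<in> Tri K" and t': "(X', Y', Z', u', v', w') \<in> Tri K"
  and ab: "a \<in> Arr K X X'" "b \<in> Arr K Y Y'" "Cmp K X Y Y' b u = Cmp K X X' Y' u' a"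
 shows "\<exists>c. triangle_map K (Shift K) (X, Y, Z, u, v, w) (X', Y', Z', u', v', w') (a, b, c)"
proof -
 obtain X0 Y0 f C i j p r where c: "cone X0 Y0 f C i j p r" and tri: "is_triangle K (Shift K) (X, Y, Z, u, v, w)"
  and iso: "triangle_iso K (Shift K) (X0, Y0, C, q X0 Y0 f, q Y0 C i, q C (sh X0) (sg X0 * p)) (X, Y, Z, u, v, w)"
  using t by (rule Tri_cases)
 obtain X1 Y1 f' C' i' j' p' r' where c': "cone X1 Y1 f' C' i' j' p' r'" and tri': "is_triangle K (Shift K) (X', Y', Z', u', v', w')"
  and iso': "triangle_iso K (Shift K) (X1, Y1, C', q X1 Y1 f', q Y1 C' i', q C' (sh X1) (sg X1 * p')) (X', Y', Z', u', v', w')"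
  using t' by (rule Tri_cases)
 show ?thesis
  by (rule triangle_fill_transport[OF S_functor iso iso' cone_triangle(1)[OF c] tri cone_triangle(1)[OF c'] tri' _ ab])
   (rule fill_cones[OF c c'])
qed

end

sublocale dg_model \<subseteq> pretriangulated_category K
 by (intro pretriangulated_category.intro pretriangulated_category_axioms.intro)
  (fact is_additive S_additive S_equivalence Tri_K_triangles Tri_K_iso_closed Tri_Ident_K Tri_complete_K
   Tri_rotate_K Tri_fill_K)+

section \<open>The octahedral axiom\<close>

context dg_model
begin

text \<open>\<open>?F\<close> and \<open>?G\<close> are the maps of cones induced by the squares
  with vertical arrows \<open>(e X, g)\<close> and \<open>(f, e Z)\<close>. The cone
  \<open>C4\<close> of \<open>?F\<close> retracts onto \<open>C2\<close> by \<open>?\<psi>\<close>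
  with strict section \<open>?\<phi>\<close>, and \<open>j4 * (j1 * (p3 * r4))\<close> contracts the
  complement. The four commutation identities of the octahedron hold strictly.\<close>

lemma octahedral_cones:
 assumes c1: "cone X Y f C1 i1 j1 p1 r1" and c2: "cone Y Z g C2 i2 j2 p2 r2"
  and c3: "cone X Z (g * f) C3 i3 j3 p3 r3"
 shows "\<exists>F\<in>cyc C1 C3. \<exists>G\<in>cyc C3 C2.
  (C1, C3, C2, q C1 C3 F, q C3 C2 G, q C2 (sh C1) (sg C1 * (i1 * p2))) \<in> Tri K \<and>
  F * i1 = i3 * g \<and> p3 * F = p1 \<and> G * i3 = i2 \<and> p2 * G = f * p3"
proof -
 note c1D = coneD[OF c1] and c2D = coneD[OF c2] and c3D = coneD[OF c3]
 let ?F = "j3 * p1 + i3 * (g * r1)"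
 let ?G = "j2 * (f * p3) + i2 * r3"
 note E = c1D(6-14) c1D(6-14)[THEN mult_left_eq] c2D(6-14) c2D(6-14)[THEN mult_left_eq]
  c3D(6-13) c3D(6-13)[THEN mult_left_eq]
 note U = units[OF c1D(2)] units[OF c1D(3)] units[OF c1D(4)] units[OF c1D(5)] units[OF c1D(15)]
  units[OF c2D(2)] units[OF c2D(3)] units[OF c2D(4)] units[OF c2D(5)] units[OF c2D(15)]
  units[OF c3D(2)] units[OF c3D(3)] units[OF c3D(4)] units[OF c3D(5)]
 have F: "?F \<in> cyc C1 C3"
  by (rule cycI, blast intro: H_mults H_add c1D c2D c3D) (simp add: algebra_simps E U)
 have G: "?G \<in> cyc C3 C2"
  by (rule cycI, blast intro: H_mults H_add c1D c2D c3D) (simp add: algebra_simps E U)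
 have FG: "?F * i1 = i3 * g" "p3 * ?F = p1" "?G * i3 = i2" "p2 * ?G = f * p3"
  by (simp_all add: algebra_simps E U)
 obtain C4 i4 j4 p4 r4 where c4: "cone C1 C3 ?F C4 i4 j4 p4 r4" using cone_exists[OF F] by blast
 note c4D = coneD[OF c4]
 note E' = E c4D(6-13) c4D(6-13)[THEN mult_left_eq]
 note U' = U units[OF c4D(2)] units[OF c4D(3)] units[OF c4D(4)] units[OF c4D(5)]
 let ?\<psi> = "?G * r4 + j2 * (r1 * p4)"
 let ?\<phi> = "i4 * (i3 * r2) + j4 * (i1 * p2)"
 have \<psi>: "?\<psi> \<in> cyc C4 C2"
  by (rule cycI, blast intro: H_mults H_add c1D c2D c3D c4D) (simp add: algebra_simps E' U')
 have \<phi>: "?\<phi> \<in> cyc C2 C4"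
  by (rule cycI, blast intro: H_mults H_add c1D c2D c3D c4D) (simp add: algebra_simps E' U')
 have inv: "homotopic C2 C2 (?\<psi> * ?\<phi>) (e C2)"
  by (rule homotopic_refl) (use c2D(16-18) in \<open>simp_all add: algebra_simps E' U' cone_jp[OF c2]\<close>)
 have s: "j4 * (j1 * (p3 * r4)) \<in> H (- 1) C4 C4"
  by (blast intro: H_mults c1D c2D c3D c4D)
 have "e C4 - ?\<phi> * ?\<psi> = D C4 * (j4 * (j1 * (p3 * r4))) + (j4 * (j1 * (p3 * r4))) * D C4"
  by (simp add: algebra_simps E' U' cone_jp[OF c1, THEN mult_left_eq] cone_jp[OF c3, THEN mult_left_eq] cone_jp[OF c4])
 then have inv': "homotopic C4 C4 (?\<phi> * ?\<psi>) (e C4)"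
  using homotopicI[OF H_uminus[OF s], of "?\<phi> * ?\<psi>" "e C4"] by (simp add: algebra_simps)
 have iso: "isomorphism K C4 C2 (q C4 C2 ?\<psi>)" by (rule q_isomorphism[OF \<psi> \<phi> inv' inv])
 have ip: "sg C1 * (i1 * p2) \<in> cyc C2 (sh C1)"
 proof -
  have "sg C1 * i1 * sg' Y * (sg Y * p2) \<in> cyc C2 (sh C1)"
   using cyc_mult[OF cyc_cone(2)[OF c2] cyc_shift[OF cyc_cone(1)[OF c1]]] .
  then show ?thesis
   using c1D(17) by (simp add: mult.assoc sg_simps[THEN mult_left_eq] U)
 qed
 have "(C1, C3, C2, q C1 C3 ?F, q C3 C2 ?G, q C2 (sh C1) (sg C1 * (i1 * p2))) \<in> Tri K"
 proof (rule Tri_K_from_cone[OF c4 _ iso])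
  show "is_triangle K (Shift K) (C1, C3, C2, q C1 C3 ?F, q C3 C2 ?G, q C2 (sh C1) (sg C1 * (i1 * p2)))"
   using F G ip c1D(18) c2D(18) c3D(18) by (simp add: q_Arr)
  have "?\<psi> * i4 = ?G" by (simp add: algebra_simps E' U')
  then show "Cmp K C3 C4 C2 (q C4 C2 ?\<psi>) (q C3 C4 i4) = q C3 C2 ?G"
   using Cmp_K[OF cyc_cone(1)[OF c4] \<psi>] by simp
  have "p4 * ?\<phi> = i1 * p2" by (simp add: algebra_simps E' U')
  then have "Cmp K C2 C4 (sh C1) (q C4 (sh C1) (sg C1 * p4)) (q C2 C4 ?\<phi>) = q C2 (sh C1) (sg C1 * (i1 * p2))"
   using Cmp_K[OF \<phi> cyc_cone(2)[OF c4]] by (simp add: mult.assoc)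
  moreover have "Cmp K C4 C2 C4 (q C2 C4 ?\<phi>) (q C4 C2 ?\<psi>) = Ident K C4"
   using Cmp_K[OF \<psi> \<phi>] q_homotopic[OF inv' cyc_mult[OF \<psi> \<phi>] cyc_e] c4D(18) by (simp add: Ident_K)
  ultimately show "Cmp K C4 C2 (sh C1) (q C2 (sh C1) (sg C1 * (i1 * p2))) (q C4 C2 ?\<psi>) = q C4 (sh C1) (sg C1 * p4)"
   using c4D(18) c2D(18) S_Ob[OF c1D(18)] \<phi> \<psi> cyc_cone[OF c4]
   by (metis Cmp_assoc Cmp_Ident_right q_Arr)
 qed
 with F G FG show ?thesis by blast
qed

text \<open>Each given triangle is compared with the chosen cone of its first arrow by an
  isomorphism that is the identity on the first two vertices (\<open>a1\<close>, \<open>a2\<close>,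
  \<open>a3\<close>); conjugating the octahedron of the cones by them gives the required
  one.\<close>

lemma octahedral_K:
 assumes t1: "(X, Y, Z', u, i, i') \<in> Tri K" and t2: "(Y, Z, X', v, j, j') \<in> Tri K"
  and t3: "(X, Z, Y', Cmp K X Y Z v u, k, k') \<in> Tri K"
 shows "\<exists>f g. (Z', Y', X', f, g, Cmp K X' (sh Y) (sh Z') (fmor (Shift K) Y Z' i) j') \<in> Tri K \<and>
  Cmp K Y Z' Y' f i = Cmp K Y Z Y' k v \<and> Cmp K Z' Y' (sh X) k' f = i' \<and>
  Cmp K Z Y' X' g k = j \<and>
  Cmp K Y' X' (sh Y) j' g = Cmp K Y' (sh X) (sh Y) (fmor (Shift K) X Y u) k'"
proof -
 note T = TriD[OF t1] TriD[OF t2] TriD[OF t3]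
 obtain f where f: "f \<in> cyc X Y" "u = q X Y f" using Arr_q[OF T(1,2,4)] .
 obtain g where g: "g \<in> cyc Y Z" "v = q Y Z g" using Arr_q[OF T(7,8,10)] .
 have vu: "Cmp K X Y Z v u = q X Z (g * f)" using f g Cmp_K by simp
 obtain C1 i1 j1 p1 r1 where c1: "cone X Y f C1 i1 j1 p1 r1" using cone_exists[OF f(1)] by blast
 obtain C2 i2 j2 p2 r2 where c2: "cone Y Z g C2 i2 j2 p2 r2" using cone_exists[OF g(1)] by blast
 obtain C3 i3 j3 p3 r3 where c3: "cone X Z (g * f) C3 i3 j3 p3 r3"
  using cone_exists[OF cyc_mult[OF f(1) g(1)]] by blast
 note O = coneD(16-18)[OF c1] coneD(16-18)[OF c2] coneD(16-18)[OF c3]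
 note O' = T(1-3) T(7-9) T(13-15) S_Ob[OF T(1)] S_Ob[OF T(2)] S_Ob[OF T(3)]
 obtain F G where F: "F \<in> cyc C1 C3" and G: "G \<in> cyc C3 C2"
  and t: "(C1, C3, C2, q C1 C3 F, q C3 C2 G, q C2 (sh C1) (sg C1 * (i1 * p2))) \<in> Tri K"
  and FG: "F * i1 = i3 * g" "p3 * F = p1" "G * i3 = i2" "p2 * G = f * p3"
  using octahedral_cones[OF c1 c2 c3] by blast
 note cc = cyc_cone[OF c1] cyc_cone[OF c2] cyc_cone[OF c3]
 note ccA = cc[THEN q_Arr]
 let ?F = "q C1 C3 F" and ?G = "q C3 C2 G"
 have FA: "?F \<in> Arr K C1 C3" "?G \<in> Arr K C3 C2" using F G q_Arr by auto
 have e1: "Cmp K Y C1 C3 ?F (q Y C1 i1) = Cmp K Y Z C3 (q Z C3 i3) v"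
  using FG(1) F g cc by (simp add: Cmp_K)
 have e2: "Cmp K C1 C3 (sh X) (q C3 (sh X) (sg X * p3)) ?F = q C1 (sh X) (sg X * p1)"
  using FG(2) F cc by (simp add: Cmp_K mult.assoc)
 have e3: "Cmp K Z C3 C2 ?G (q Z C3 i3) = q Z C2 i2"
  using FG(3) G cc by (simp add: Cmp_K)
 have e4: "Cmp K C3 C2 (sh Y) (q C2 (sh Y) (sg Y * p2)) ?G =
   Cmp K C3 (sh X) (sh Y) (fmor (Shift K) X Y u) (q C3 (sh X) (sg X * p3))"
 proof -
  have "Cmp K C3 (sh X) (sh Y) (fmor (Shift K) X Y u) (q C3 (sh X) (sg X * p3)) =
    q C3 (sh Y) (sg Y * f * sg' X * (sg X * p3))"
   unfolding f(2) SM_K[OF f(1)] by (rule Cmp_K[OF cc(6) cyc_shift[OF f(1)]])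
  then show ?thesis
   using FG(4) G cc T(1) coneD(4)[OF c3] by (simp add: Cmp_K mult.assoc sg_simps[THEN mult_left_eq] units)
 qed
 have e5: "q C2 (sh C1) (sg C1 * (i1 * p2)) =
   Cmp K C2 (sh Y) (sh C1) (fmor (Shift K) Y C1 (q Y C1 i1)) (q C2 (sh Y) (sg Y * p2))"
 proof -
  have "Cmp K C2 (sh Y) (sh C1) (fmor (Shift K) Y C1 (q Y C1 i1)) (q C2 (sh Y) (sg Y * p2)) =
    q C2 (sh C1) (sg C1 * i1 * sg' Y * (sg Y * p2))"
   unfolding SM_K[OF cc(1)] by (rule Cmp_K[OF cc(4) cyc_shift[OF cc(1)]])
  then show ?thesis
   using T(2) coneD(4)[OF c2] by (simp add: mult.assoc sg_simps[THEN mult_left_eq] units)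
 qed
 obtain a1 where a1: "isomorphism K C1 Z' a1" "Cmp K Y C1 Z' a1 (q Y C1 i1) = i"
   "Cmp K C1 Z' (sh X) i' a1 = q C1 (sh X) (sg X * p1)"
  using cone_comparison[OF cone_triangle(2)[OF c1] t1[unfolded f(2)]] by blast
 obtain a2 where a2: "isomorphism K C2 X' a2" "Cmp K Z C2 X' a2 (q Z C2 i2) = j"
   "Cmp K C2 X' (sh Y) j' a2 = q C2 (sh Y) (sg Y * p2)"
  using cone_comparison[OF cone_triangle(2)[OF c2] t2[unfolded g(2)]] by blast
 obtain a3 where a3: "isomorphism K C3 Y' a3" "Cmp K Z C3 Y' a3 (q Z C3 i3) = k"
   "Cmp K C3 Y' (sh X) k' a3 = q C3 (sh X) (sg X * p3)"
  using cone_comparison[OF cone_triangle(2)[OF c3] t3[unfolded vu]] by blast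
 obtain b1 where b1: "a1 \<in> Arr K C1 Z'" "b1 \<in> Arr K Z' C1" "Cmp K C1 Z' C1 b1 a1 = Ident K C1" "Cmp K Z' C1 Z' a1 b1 = Ident K Z'"
  using a1(1) by (auto simp: isomorphism_def)
 obtain b3 where b3: "a3 \<in> Arr K C3 Y'" "b3 \<in> Arr K Y' C3" "Cmp K C3 Y' C3 b3 a3 = Ident K C3" "Cmp K Y' C3 Y' a3 b3 = Ident K Y'"
  using a3(1) by (auto simp: isomorphism_def)
 have a2A: "a2 \<in> Arr K C2 X'" using a2(1) by (auto simp: isomorphism_def)
 let ?f = "Cmp K Z' C3 Y' a3 (Cmp K Z' C1 C3 ?F b1)"
 let ?g = "Cmp K Y' C2 X' a2 (Cmp K Y' C3 C2 ?G b3)"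
 let ?h = "Cmp K X' (sh Y) (sh Z') (fmor (Shift K) Y Z' i) j'"
 have fA: "?f \<in> Arr K Z' Y'" and gA: "?g \<in> Arr K Y' X'"
  using O O' FA b1 b3 a2A by (simp_all add: Cmp_closed)
 have SA: "fmor (Shift K) Y Z' i \<in> Arr K (sh Y) (sh Z')" "fmor (Shift K) X Y u \<in> Arr K (sh X) (sh Y)"
  "fmor (Shift K) C1 Z' a1 \<in> Arr K (sh C1) (sh Z')" "fmor (Shift K) Y C1 (q Y C1 i1) \<in> Arr K (sh Y) (sh C1)"
  using O O' T b1 ccA SM_closed by simp_all
 have b1i: "Cmp K Y Z' C1 b1 i = q Y C1 i1"
  using O O' b1 ccA by (simp add: a1(2)[symmetric] Cmp_assoc Cmp_Ident_left)
 have b3k: "Cmp K Z Y' C3 b3 k = q Z C3 i3"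
  using O O' b3 ccA by (simp add: a3(2)[symmetric] Cmp_assoc Cmp_Ident_left)
 have b1i': "Cmp K Z' C1 (sh X) (q C1 (sh X) (sg X * p1)) b1 = i'"
  using O O' b1 T by (simp add: a1(3)[symmetric] Cmp_assoc[symmetric] Cmp_Ident_right)
 have b3k': "Cmp K Y' C3 (sh X) (q C3 (sh X) (sg X * p3)) b3 = k'"
  using O O' b3 T by (simp add: a3(3)[symmetric] Cmp_assoc[symmetric] Cmp_Ident_right)
 have fa: "Cmp K C1 Z' Y' ?f a1 = Cmp K C1 C3 Y' a3 ?F"
  using O O' b1 b3 FA by (simp add: Cmp_assoc[symmetric] Cmp_closed Cmp_Ident_right)
 have ga: "Cmp K C3 Y' X' ?g a3 = Cmp K C3 C2 X' a2 ?G"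
  using O O' b3 a2A FA by (simp add: Cmp_assoc[symmetric] Cmp_closed Cmp_Ident_right)
 have "Cmp K C2 (sh C1) (sh Z') (fmor (Shift K) C1 Z' a1) (q C2 (sh C1) (sg C1 * (i1 * p2))) =
   Cmp K C2 (sh Y) (sh Z') (Cmp K (sh Y) (sh C1) (sh Z') (fmor (Shift K) C1 Z' a1) (fmor (Shift K) Y C1 (q Y C1 i1))) (q C2 (sh Y) (sg Y * p2))"
  unfolding e5 using O O' SA ccA S_Ob by (simp add: Cmp_assoc)
 also have "Cmp K (sh Y) (sh C1) (sh Z') (fmor (Shift K) C1 Z' a1) (fmor (Shift K) Y C1 (q Y C1 i1)) = fmor (Shift K) Y Z' i"
  using O O' b1 ccA by (simp add: SM_Cmp[symmetric] a1(2))
 also have "Cmp K C2 (sh Y) (sh Z') (fmor (Shift K) Y Z' i) (q C2 (sh Y) (sg Y * p2)) = Cmp K C2 X' (sh Z') ?h a2"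
  using O O' SA T a2A by (simp add: a2(3)[symmetric] Cmp_assoc)
 finally have ha: "Cmp K C2 (sh C1) (sh Z') (fmor (Shift K) C1 Z' a1) (q C2 (sh C1) (sg C1 * (i1 * p2))) = Cmp K C2 X' (sh Z') ?h a2" .
 have tri: "is_triangle K (Shift K) (Z', Y', X', ?f, ?g, ?h)"
  using O' fA gA SA T by (simp add: Cmp_closed)
 have "triangle_map K (Shift K) (C1, C3, C2, ?F, ?G, q C2 (sh C1) (sg C1 * (i1 * p2))) (Z', Y', X', ?f, ?g, ?h) (a1, a3, a2)"
  using fa ga ha b1 b3 a2A by simp
 then have "triangle_iso K (Shift K) (C1, C3, C2, ?F, ?G, q C2 (sh C1) (sg C1 * (i1 * p2))) (Z', Y', X', ?f, ?g, ?h)"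
  unfolding triangle_iso.simps using a1(1) a2(1) a3(1) by blast
 then have "(Z', Y', X', ?f, ?g, ?h) \<in> Tri K" using Tri_K_iso_closed[OF t tri] by blast
 moreover have "Cmp K Y Z' Y' ?f i = Cmp K Y Z Y' k v"
 proof -
  have "Cmp K Y Z' Y' ?f i = Cmp K Y C3 Y' a3 (Cmp K Y C1 C3 ?F (Cmp K Y Z' C1 b1 i))"
   using O O' T b1 b3 FA by (simp add: Cmp_assoc Cmp_closed)
  also have "\<dots> = Cmp K Y Z Y' (Cmp K Z C3 Y' a3 (q Z C3 i3)) v"
   unfolding b1i e1 using O O' T b3 ccA by (simp add: Cmp_assoc)
  finally show ?thesis by (simp add: a3(2))
 qed
 moreover have "Cmp K Z' Y' (sh X) k' ?f = i'"
 proof -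
  have "Cmp K Z' Y' (sh X) k' ?f = Cmp K Z' C1 (sh X) (Cmp K C1 C3 (sh X) (Cmp K C3 Y' (sh X) k' a3) ?F) b1"
   using O O' T b1 b3 FA by (simp add: Cmp_assoc Cmp_closed)
  then show ?thesis by (simp add: a3(3) e2 b1i')
 qed
 moreover have "Cmp K Z Y' X' ?g k = j"
 proof -
  have "Cmp K Z Y' X' ?g k = Cmp K Z C2 X' a2 (Cmp K Z C3 C2 ?G (Cmp K Z Y' C3 b3 k))"
   using O O' T a2A b3 FA by (simp add: Cmp_assoc Cmp_closed)
  then show ?thesis by (simp add: b3k e3 a2(2))
 qed
 moreover have "Cmp K Y' X' (sh Y) j' ?g = Cmp K Y' (sh X) (sh Y) (fmor (Shift K) X Y u) k'"
 proof -
  have "Cmp K Y' X' (sh Y) j' ?g = Cmp K Y' C3 (sh Y) (Cmp K C3 C2 (sh Y) (Cmp K C2 X' (sh Y) j' a2) ?G) b3"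
   using O O' T a2A b3 FA by (simp add: Cmp_assoc Cmp_closed)
  also have "\<dots> = Cmp K Y' (sh X) (sh Y) (fmor (Shift K) X Y u) (Cmp K Y' C3 (sh X) (q C3 (sh X) (sg X * p3)) b3)"
   unfolding a2(3) e4 using O O' SA ccA b3 by (simp add: Cmp_assoc)
  finally show ?thesis by (simp add: b3k')
 qed
 ultimately show ?thesis by blast
qed

end

sublocale dg_model \<subseteq> triangulated_category K
proof (intro triangulated_category.intro triangulated_category_axioms.intro)
 show "(X, Y, Z, u, v, w) \<in> Tri K \<longleftrightarrow> (Y, Z, sh X, v, w, Neg K (sh X) (sh Y) (fmor (Shift K) X Y u)) \<in> Tri K"
  if "is_triangle K (Shift K) (X, Y, Z, u, v, w)" for X Y Z u v w
  using that Tri_rotate_K Tri_rotate_backward by blast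
qed (fact is_additive S_additive S_equivalence Tri_K_triangles Tri_K_iso_closed Tri_Ident_K Tri_complete_K
   Tri_fill_K octahedral_K)+

section \<open>Coproducts and localizing subcategories\<close>

lemma Ex1_eq: "\<lbrakk>\<exists>!x. P x; P a; P b\<rbrakk> \<Longrightarrow> a = b"
 by blast

context category
begin

lemma coproduct_map:
 assumes "is_coproduct C I X P \<iota>" "Z \<in> Ob C" "\<And>i. i \<in> I \<Longrightarrow> f i \<in> Arr C (X i) Z"
 obtains h where "h \<in> Arr C P Z" "\<And>i. i \<in> I \<Longrightarrow> Cmp C (X i) P Z h (\<iota> i) = f i"
 using assms unfolding is_coproduct_def by meson

lemma coproduct_eq:
 assumes P: "is_coproduct C I X P \<iota>" and X: "\<And>i. i \<in> I \<Longrightarrow> X i \<in> Ob C" and Z: "Z \<in> Ob C"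
  and h: "h \<in> Arr C P Z" "h' \<in> Arr C P Z"
  and eq: "\<And>i. i \<in> I \<Longrightarrow> Cmp C (X i) P Z h (\<iota> i) = Cmp C (X i) P Z h' (\<iota> i)"
 shows "h = h'"
proof -
 let ?f = "\<lambda>i. Cmp C (X i) P Z h' (\<iota> i)"
 have "\<forall>i\<in>I. ?f i \<in> Arr C (X i) Z"
  using P X Z h(2) by (auto simp: is_coproduct_def intro: Cmp_closed)
 with P Z have "\<exists>!k. k \<in> Arr C P Z \<and> (\<forall>i\<in>I. Cmp C (X i) P Z k (\<iota> i) = ?f i)"
  unfolding is_coproduct_def by (elim conjE) (drule bspec, assumption, drule spec, erule mp)
 moreover have "h \<in> Arr C P Z \<and> (\<forall>i\<in>I. Cmp C (X i) P Z h (\<iota> i) = ?f i)"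
  "h' \<in> Arr C P Z \<and> (\<forall>i\<in>I. Cmp C (X i) P Z h' (\<iota> i) = ?f i)" using h eq by simp_all
 ultimately show ?thesis by (rule Ex1_eq)
qed

lemma coproduct_unique:
 assumes P: "is_coproduct C I X P \<iota>" and P': "is_coproduct C I X P' \<iota>'" and X: "\<And>i. i \<in> I \<Longrightarrow> X i \<in> Ob C"
 obtains h h' where "h \<in> Arr C P P'" "h' \<in> Arr C P' P"
  "Cmp C P P' P h' h = Ident C P" "Cmp C P' P P' h h' = Ident C P'"
  "\<And>i. i \<in> I \<Longrightarrow> Cmp C (X i) P P' h (\<iota> i) = \<iota>' i" "\<And>i. i \<in> I \<Longrightarrow> Cmp C (X i) P' P h' (\<iota>' i) = \<iota> i"
proof -
 have O: "P \<in> Ob C" "P' \<in> Ob C" and \<iota>: "\<And>i. i \<in> I \<Longrightarrow> \<iota> i \<in> Arr C (X i) P" "\<And>i. i \<in> I \<Longrightarrow> \<iota>' i \<in> Arr C (X i) P'"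
  using P P' by (auto simp: is_coproduct_def)
 obtain h where h: "h \<in> Arr C P P'" "\<And>i. i \<in> I \<Longrightarrow> Cmp C (X i) P P' h (\<iota> i) = \<iota>' i"
  using coproduct_map[OF P O(2) \<iota>(2)] by blast
 obtain h' where h': "h' \<in> Arr C P' P" "\<And>i. i \<in> I \<Longrightarrow> Cmp C (X i) P' P h' (\<iota>' i) = \<iota> i"
  using coproduct_map[OF P' O(1) \<iota>(1)] by blast
 have "Cmp C P P' P h' h = Ident C P"
  by (rule coproduct_eq[OF P X O(1)])
   (use O X \<iota> h h' in \<open>simp_all add: Cmp_closed Ident_closed Cmp_assoc[symmetric] Cmp_Ident_left\<close>)
 moreover have "Cmp C P' P P' h h' = Ident C P'"
  by (rule coproduct_eq[OF P' X O(2)])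
   (use O X \<iota> h h' in \<open>simp_all add: Cmp_closed Ident_closed Cmp_assoc[symmetric] Cmp_Ident_left\<close>)
 ultimately show thesis using that h h' by blast
qed

end

lemma (in preadditive_category) biproduct_coproduct:
 assumes b: "is_biproduct C X Y P iX iY pX pY" and O: "X \<in> Ob C" "Y \<in> Ob C" and ab: "a \<noteq> b"
 shows "is_coproduct C {a, b} (\<lambda>i. if i = a then X else Y) P (\<lambda>i. if i = a then iX else iY)"
proof -
 have P: "P \<in> Ob C" and A: "iX \<in> Arr C X P" "iY \<in> Arr C Y P" "pX \<in> Arr C P X" "pY \<in> Arr C P Y"
  and e: "Cmp C X P X pX iX = Ident C X" "Cmp C Y P Y pY iY = Ident C Y"
   "Cmp C Y P X pX iY = Nul C Y X" "Cmp C X P Y pY iX = Nul C X Y"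
   "Add C P P (Cmp C P X P iX pX) (Cmp C P Y P iY pY) = Ident C P"
  using b by (auto simp: is_biproduct_def)
 have "\<exists>!h. h \<in> Arr C P Z \<and> Cmp C X P Z h iX = f \<and> Cmp C Y P Z h iY = g"
  if Z: "Z \<in> Ob C" and fg: "f \<in> Arr C X Z" "g \<in> Arr C Y Z" for Z f g
 proof (rule ex1I)
  let ?h = "Add C P Z (Cmp C P X Z f pX) (Cmp C P Y Z g pY)"
  show "?h \<in> Arr C P Z \<and> Cmp C X P Z ?h iX = f \<and> Cmp C Y P Z ?h iY = g"
   using O P A Z fg
   by (simp add: hom_closed Cmp_closed Cmp_Add_left Cmp_assoc[symmetric] e Cmp_Ident_right Cmp_Nul_right
     Add_Nul Add_commute[of X Z f] Nul_closed)
  fix h assume h: "h \<in> Arr C P Z \<and> Cmp C X P Z h iX = f \<and> Cmp C Y P Z h iY = g"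
  then have "h = Cmp C P P Z h (Add C P P (Cmp C P X P iX pX) (Cmp C P Y P iY pY))"
   using P Z by (simp add: e Cmp_Ident_right)
  also have "\<dots> = Add C P Z (Cmp C P X Z (Cmp C X P Z h iX) pX) (Cmp C P Y Z (Cmp C Y P Z h iY) pY)"
   using O P A Z h by (simp add: Cmp_Add_right Cmp_closed Cmp_assoc)
  finally show "h = ?h" using h by simp
 qed
 then show ?thesis using P A ab unfolding is_coproduct_def by auto
qed

section \<open>Localizing subcategories as triangulated categories with coproducts\<close>

locale coproduct_triangulated = universe U + triangulated_category T
 for U :: "'u set" and T :: "('o, 'm, 'z) tri_cat_scheme" +
 assumes locally_small: "locally_small U T" and has_coproducts: "has_coproducts U T"
begin

abbreviation localizing :: "'o set \<Rightarrow> bool" where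
 "localizing A \<equiv> localizing_subcategory U T A"

lemma localizingI:
 assumes "A \<subseteq> Ob T" "\<And>N. is_zero T N \<Longrightarrow> N \<in> A"
  "\<And>X Y f. \<lbrakk>X \<in> A; Y \<in> Ob T; isomorphism T X Y f\<rbrakk> \<Longrightarrow> Y \<in> A"
  "\<And>X. X \<in> A \<Longrightarrow> S X \<in> A" "\<And>X. \<lbrakk>X \<in> Ob T; S X \<in> A\<rbrakk> \<Longrightarrow> X \<in> A"
  "\<And>X Y Z u v w. \<lbrakk>(X, Y, Z, u, v, w) \<in> Tri T; X \<in> A; Y \<in> A\<rbrakk> \<Longrightarrow> Z \<in> A"
  "\<And>(I :: 'u set) X P \<iota>. \<lbrakk>small U I; \<And>i. i \<in> I \<Longrightarrow> X i \<in> A; is_coproduct T I X P \<iota>\<rbrakk> \<Longrightarrow> P \<in> A"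
 shows "localizing A"
 unfolding localizing_subcategory_def triangulated_subcategory_def
 using assms by (intro conjI allI ballI impI iffI; metis)

lemma localizingD:
 assumes "localizing A"
 shows "A \<subseteq> Ob T" "\<And>N. is_zero T N \<Longrightarrow> N \<in> A"
  "\<And>X Y f. \<lbrakk>X \<in> A; Y \<in> Ob T; isomorphism T X Y f\<rbrakk> \<Longrightarrow> Y \<in> A"
  "\<And>X. X \<in> A \<Longrightarrow> S X \<in> A" "\<And>X. \<lbrakk>X \<in> Ob T; S X \<in> A\<rbrakk> \<Longrightarrow> X \<in> A"
  "\<And>X Y Z u v w. \<lbrakk>(X, Y, Z, u, v, w) \<in> Tri T; X \<in> A; Y \<in> A\<rbrakk> \<Longrightarrow> Z \<in> A"
  "\<And>(I :: 'u set) X P \<iota>. \<lbrakk>small U I; \<And>i. i \<in> I \<Longrightarrow> X i \<in> A; is_coproduct T I X P \<iota>\<rbrakk> \<Longrightarrow> P \<in> A"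
proof -
 have t: "triangulated_subcategory T A"
  and c: "\<And>(I :: 'u set) X P \<iota>. small U I \<longrightarrow> (\<forall>i\<in>I. X i \<in> A) \<longrightarrow> is_coproduct T I X P \<iota> \<longrightarrow> P \<in> A"
  using assms by (auto simp: localizing_subcategory_def)
 show A: "A \<subseteq> Ob T" using t by (simp add: triangulated_subcategory_def)
 show "\<And>N. is_zero T N \<Longrightarrow> N \<in> A" using t by (simp add: triangulated_subcategory_def)
 show "\<And>X Y f. \<lbrakk>X \<in> A; Y \<in> Ob T; isomorphism T X Y f\<rbrakk> \<Longrightarrow> Y \<in> A"
  using t unfolding triangulated_subcategory_def by blast
 show "\<And>X. X \<in> A \<Longrightarrow> S X \<in> A" "\<And>X. \<lbrakk>X \<in> Ob T; S X \<in> A\<rbrakk> \<Longrightarrow> X \<in> A"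
  using t A unfolding triangulated_subcategory_def by blast+
 show "\<And>X Y Z u v w. \<lbrakk>(X, Y, Z, u, v, w) \<in> Tri T; X \<in> A; Y \<in> A\<rbrakk> \<Longrightarrow> Z \<in> A"
  using t unfolding triangulated_subcategory_def by blast
 show "\<And>(I :: 'u set) X P \<iota>. \<lbrakk>small U I; \<And>i. i \<in> I \<Longrightarrow> X i \<in> A; is_coproduct T I X P \<iota>\<rbrakk> \<Longrightarrow> P \<in> A"
  using c by blast
qed

lemma localizing_Ob: "localizing (Ob T)"
 by (rule localizingI) (auto simp: is_zero_def S_closed is_coproduct_def dest: TriD)

lemma Loc_subset: "localizing A \<Longrightarrow> G \<subseteq> A \<Longrightarrow> Loc U T G \<subseteq> A"
 by (auto simp: Loc_def)

lemma Loc_contains: "G \<subseteq> Loc U T G"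
 by (auto simp: Loc_def)

lemma localizing_Loc: assumes "G \<subseteq> Ob T" shows "localizing (Loc U T G)"
proof (rule localizingI)
 show O: "Loc U T G \<subseteq> Ob T" using Loc_subset[OF localizing_Ob assms] .
 have mem: "X \<in> Loc U T G \<longleftrightarrow> (\<forall>A. localizing A \<longrightarrow> G \<subseteq> A \<longrightarrow> X \<in> A)" for X
  by (auto simp: Loc_def)
 show "N \<in> Loc U T G" if "is_zero T N" for N using that localizingD(2) by (auto simp: mem)
 show "Y \<in> Loc U T G" if "X \<in> Loc U T G" "Y \<in> Ob T" "isomorphism T X Y f" for X Y f
  using that localizingD(3) unfolding mem by blast
 show "S X \<in> Loc U T G" if "X \<in> Loc U T G" for X using that localizingD(4) unfolding mem by blast
 show "X \<in> Loc U T G" if "X \<in> Ob T" "S X \<in> Loc U T G" for X using that localizingD(5) unfolding mem by blast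
 show "Z \<in> Loc U T G" if "(X, Y, Z, u, v, w) \<in> Tri T" "X \<in> Loc U T G" "Y \<in> Loc U T G" for X Y Z u v w
  using that localizingD(6) unfolding mem by blast
 show "P \<in> Loc U T G" if "small U I" "\<And>i. i \<in> I \<Longrightarrow> X i \<in> Loc U T G" "is_coproduct T I X P \<iota>"
  for I :: "'u set" and X P \<iota>
  using that localizingD(7)[of _ I X P \<iota>] unfolding mem by blast
qed

lemma small_finite: "finite (J :: 'a set) \<Longrightarrow> small U J"
 by (simp add: small_def lt_finite)

text \<open>A coproduct formed in the subcategory is tested only against objects of
  \<open>A\<close>. It is compared with a coproduct \<open>P'\<close> of the same objects in
  \<open>T\<close>, which lies in \<open>A\<close> since \<open>A\<close> is localizing, and
  inherits the full universal property from there.\<close>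

lemma full_subcategory_coproducts:
 assumes A: "localizing A" and I: "small U (I :: 'u set)" and X: "\<And>i. i \<in> I \<Longrightarrow> X i \<in> A"
 shows "is_coproduct T I X P \<iota> \<longleftrightarrow> is_coproduct (full_subcategory T A) I X P \<iota>"
proof
 assume P: "is_coproduct T I X P \<iota>"
 then have "P \<in> A" using localizingD(7)[OF A I, of X] X by blast
 with P show "is_coproduct (full_subcategory T A) I X P \<iota>"
  using localizingD(1)[OF A] unfolding is_coproduct_def by (simp add: full_subcategory_def subset_iff)
next
 assume P: "is_coproduct (full_subcategory T A) I X P \<iota>"
 have XO: "\<And>i. i \<in> I \<Longrightarrow> X i \<in> Ob T" using X localizingD(1)[OF A] by blast
 then obtain P' \<iota>' where P': "is_coproduct T I X P' \<iota>'" using has_coproducts I unfolding has_coproducts_def by meson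
 then have P'A: "P' \<in> A" using localizingD(7)[OF A I, of X] X by blast
 have PA: "P \<in> A" and \<iota>: "\<And>i. i \<in> I \<Longrightarrow> \<iota> i \<in> Arr T (X i) P" using P by (auto simp: is_coproduct_def full_subcategory_def)
 have \<iota>': "\<And>i. i \<in> I \<Longrightarrow> \<iota>' i \<in> Arr T (X i) P'" using P' by (auto simp: is_coproduct_def)
 have O: "P \<in> Ob T" "P' \<in> Ob T" using PA P'A localizingD(1)[OF A] by auto
 have univ: "\<exists>!h. h \<in> Arr T P Z \<and> (\<forall>i\<in>I. Cmp T (X i) P Z h (\<iota> i) = f i)"
  if "Z \<in> A" "\<forall>i\<in>I. f i \<in> Arr T (X i) Z" for Z f
  using P that by (auto simp: is_coproduct_def full_subcategory_def)
 obtain h where h: "h \<in> Arr T P P'" "\<And>i. i \<in> I \<Longrightarrow> Cmp T (X i) P P' h (\<iota> i) = \<iota>' i"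
  using univ[OF P'A] \<iota>' by meson
 obtain k where k: "k \<in> Arr T P' P" "\<And>i. i \<in> I \<Longrightarrow> Cmp T (X i) P' P k (\<iota>' i) = \<iota> i"
  using coproduct_map[OF P' O(1) \<iota>] by blast
 have kh: "Cmp T P P' P k h = Ident T P"
 proof -
  have "Cmp T (X i) P P (Cmp T P P' P k h) (\<iota> i) = \<iota> i" "Cmp T (X i) P P (Ident T P) (\<iota> i) = \<iota> i" if "i \<in> I" for i
   using that O XO \<iota> h k by (simp_all add: Cmp_assoc[symmetric] Cmp_Ident_left)
  then show ?thesis using univ[OF PA, of \<iota>] \<iota> h k O by (metis Cmp_closed Ident_closed)
 qed
 have "\<exists>!m. m \<in> Arr T P Z \<and> (\<forall>i\<in>I. Cmp T (X i) P Z m (\<iota> i) = f i)"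
  if Z: "Z \<in> Ob T" and f: "\<forall>i\<in>I. f i \<in> Arr T (X i) Z" for Z f
 proof -
  obtain n where n: "n \<in> Arr T P' Z" "\<And>i. i \<in> I \<Longrightarrow> Cmp T (X i) P' Z n (\<iota>' i) = f i"
   using coproduct_map[OF P' Z, of f] f by blast
  show ?thesis
  proof (rule ex1I)
   show "Cmp T P P' Z n h \<in> Arr T P Z \<and> (\<forall>i\<in>I. Cmp T (X i) P Z (Cmp T P P' Z n h) (\<iota> i) = f i)"
    using n h O XO Z \<iota> by (simp add: Cmp_closed Cmp_assoc[symmetric])
   fix m assume m: "m \<in> Arr T P Z \<and> (\<forall>i\<in>I. Cmp T (X i) P Z m (\<iota> i) = f i)"
   have "Cmp T P' P Z m k = n"
    by (rule coproduct_eq[OF P' XO Z])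
     (use m n k O XO Z \<iota>' in \<open>simp_all add: Cmp_closed Cmp_assoc[symmetric]\<close>)
   then show "m = Cmp T P P' Z n h"
    using m h k kh O Z by (metis Cmp_assoc Cmp_Ident_right)
  qed
 qed
 then show "is_coproduct T I X P \<iota>" using O \<iota> by (simp add: is_coproduct_def)
qed

lemma full_subcategory_simps [simp]:
 "Ob (full_subcategory T A) = A" "Arr (full_subcategory T A) = Arr T" "Ident (full_subcategory T A) = Ident T"
 "Cmp (full_subcategory T A) = Cmp T" "Add (full_subcategory T A) = Add T" "Nul (full_subcategory T A) = Nul T"
 "Shift (full_subcategory T A) = Shift T" "hom_group (full_subcategory T A) = hom_group T"
 "isomorphism (full_subcategory T A) = isomorphism T"
 unfolding hom_group_def[abs_def] isomorphism_def[abs_def] full_subcategory_def by simp_all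

lemma full_subcategory_Tri:
 "(X, Y, Z, u, v, w) \<in> Tri (full_subcategory T A) \<longleftrightarrow> (X, Y, Z, u, v, w) \<in> Tri T \<and> X \<in> A \<and> Y \<in> A \<and> Z \<in> A"
 by (simp add: full_subcategory_def)

lemma full_subcategory_triangulated:
 assumes A: "localizing A" shows "triangulated_category (full_subcategory T A)"
proof -
 let ?F = "full_subcategory T A"
 note L = localizingD[OF A]
 have sub: "\<And>X. X \<in> A \<Longrightarrow> X \<in> Ob T" using L(1) by blast
 have cat: "category ?F"
  by (rule category.intro) (use sub in \<open>auto simp: closed Cmp_Ident_left Cmp_Ident_right Cmp_assoc\<close>)
 have pre: "preadditive_category ?F"
  by (intro preadditive_category.intro preadditive_category_axioms.intro cat)
   (use sub in \<open>auto simp: hom_group Cmp_Add_left Cmp_Add_right\<close>)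
 interpret F: preadditive_category ?F by (rule pre)
 \<comment> \<open>Vanishing of an object is the equation \<open>Ident = Nul\<close> and does not
   depend on the ambient class of objects.\<close>
 have zero: "is_zero ?F N \<longleftrightarrow> is_zero T N \<and> N \<in> A" for N
 proof (cases "N \<in> A")
  case True
  then show ?thesis using F.is_zero_iff[of N] is_zero_iff[OF sub[OF True]] by simp
 next
  case False
  then show ?thesis unfolding is_zero_def full_subcategory_simps by blast
 qed
 have add: "additive_category ?F"
 proof (intro additive_category.intro additive_category_axioms.intro pre)
  show "\<exists>X. is_zero ?F X" using zero_object zero L(2) by blast
  fix X Y assume "X \<in> Ob ?F" "Y \<in> Ob ?F"
  then have XY: "X \<in> A" "Y \<in> A" by simp_all
  then obtain P iX iY pX pY where b: "is_biproduct T X Y P iX iY pX pY" using biproducts sub by blast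
  obtain a b :: 'u where ab: "a \<noteq> b" using two_elements by blast
  have "P \<in> A"
   by (rule L(7)[OF _ _ biproduct_coproduct[OF b sub[OF XY(1)] sub[OF XY(2)] ab]])
    (use XY in \<open>auto intro: small_finite\<close>)
  with b have "is_biproduct ?F X Y P iX iY pX pY" by (simp add: is_biproduct_def)
  then show "\<exists>P iX iY pX pY. is_biproduct ?F X Y P iX iY pX pY" by blast
 qed
 have func: "is_functor ?F ?F (Shift T)"
  using shift_functor sub L(4) unfolding is_functor_def full_subcategory_simps by blast
 have equiv: "is_equivalence ?F ?F (Shift T)"
  unfolding is_equivalence_def full_subcategory_simps
 proof (intro conjI ballI func)
  show "bij_betw (fmor (Shift T) X Y) (Arr T X Y) (Arr T (S X) (S Y))" if "X \<in> A" "Y \<in> A" for X Y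
   using shift_equivalence sub that unfolding is_equivalence_def by blast
  fix Z assume Z: "Z \<in> A"
  then obtain X f where X: "X \<in> Ob T" "isomorphism T (S X) Z f" using S_ess_surj sub by blast
  then obtain g where "isomorphism T Z (S X) g" using isomorphism_inverse by metis
  then have "X \<in> A" using L(3)[OF Z] L(5) X S_closed by blast
  with X show "\<exists>X\<in>A. \<exists>f. isomorphism T (S X) Z f" by blast
 qed
 have tri: "is_triangle ?F (Shift T) (X, Y, Z, u, v, w) \<longleftrightarrow>
   is_triangle T (Shift T) (X, Y, Z, u, v, w) \<and> X \<in> A \<and> Y \<in> A \<and> Z \<in> A" for X Y Z u v w
  using sub by auto
 have tmap: "triangle_map ?F (Shift T) (X, Y, Z, u, v, w) (X', Y', Z', u', v', w') (a, b, c) \<longleftrightarrow>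
   triangle_map T (Shift T) (X, Y, Z, u, v, w) (X', Y', Z', u', v', w') (a, b, c)"
  for X Y Z u v w X' Y' Z' u' v' w' a b c by simp
 show ?thesis
 proof (intro triangulated_category.intro triangulated_category_axioms.intro add; (unfold full_subcategory_simps)?)
  show "is_additive_functor ?F ?F (Shift T)"
   using shift_additive func sub by (simp add: is_additive_functor_def)
  show "is_equivalence ?F ?F (Shift T)" by (rule equiv)
  show "is_triangle ?F (Shift T) t" if "t \<in> Tri ?F" for t
   using that Tri_triangles tri by (cases t) (simp add: full_subcategory_Tri del: is_triangle.simps)
  show "t' \<in> Tri ?F" if "t \<in> Tri ?F" "is_triangle ?F (Shift T) t'" "triangle_iso ?F (Shift T) t t'" for t t'
  proof -
   obtain X Y Z u v w where t: "t = (X, Y, Z, u, v, w)" by (cases t)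
   obtain X' Y' Z' u' v' w' where t': "t' = (X', Y', Z', u', v', w')" by (cases t')
   have "triangle_iso T (Shift T) t t'" using that(3) unfolding t t' by simp
   then show ?thesis using that Tri_iso_closed tri unfolding t t' full_subcategory_Tri by blast
  qed
  show "(X, X, N, Ident T X, Nul T X N, Nul T N (S X)) \<in> Tri ?F" if "X \<in> A" "is_zero ?F N" for X N
   using that zero Tri_Ident sub by (simp add: full_subcategory_Tri)
  show "\<exists>Z v w. (X, Y, Z, u, v, w) \<in> Tri ?F" if "X \<in> A" "Y \<in> A" "u \<in> Arr T X Y" for X Y u
   using that Tri_complete sub L(6) unfolding full_subcategory_Tri by metis
  show "(X, Y, Z, u, v, w) \<in> Tri ?F \<longleftrightarrow> (Y, Z, S X, v, w, Neg T (S X) (S Y) (SM X Y u)) \<in> Tri ?F"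
   if "is_triangle ?F (Shift T) (X, Y, Z, u, v, w)" for X Y Z u v w
   using that Tri_rotate L(4) unfolding full_subcategory_Tri tri by blast
  show "\<exists>c. triangle_map ?F (Shift T) (X, Y, Z, u, v, w) (X', Y', Z', u', v', w') (a, b, c)"
   if "(X, Y, Z, u, v, w) \<in> Tri ?F" "(X', Y', Z', u', v', w') \<in> Tri ?F" "a \<in> Arr T X X'" "b \<in> Arr T Y Y'"
    "Cmp T X Y Y' b u = Cmp T X X' Y' u' a" for X Y Z u v w X' Y' Z' u' v' w' a b
   using that Tri_fill unfolding full_subcategory_Tri tmap by blast
  show "\<exists>f g. (Z', Y', X', f, g, Cmp T X' (S Y) (S Z') (SM Y Z' i) j') \<in> Tri ?F \<and>
     Cmp T Y Z' Y' f i = Cmp T Y Z Y' k v \<and> Cmp T Z' Y' (S X) k' f = i' \<and>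
     Cmp T Z Y' X' g k = j \<and> Cmp T Y' X' (S Y) j' g = Cmp T Y' (S X) (S Y) (SM X Y u) k'"
   if "(X, Y, Z', u, i, i') \<in> Tri ?F" "(Y, Z, X', v, j, j') \<in> Tri ?F" "(X, Z, Y', Cmp T X Y Z v u, k, k') \<in> Tri ?F"
   for X Y Z X' Y' Z' u v i j k i' j' k'
   using that octahedral[of X Y Z' u i i' Z X' v j j' Y' k k'] unfolding full_subcategory_Tri by blast
 qed
qed

lemma full_subcategory_with_coproducts:
 assumes A: "localizing A" shows "triangulated_with_coproducts U (full_subcategory T A)"
 unfolding triangulated_with_coproducts_def
proof (intro conjI)
 show "locally_small U (full_subcategory T A)"
  using locally_small localizingD(1)[OF A] by (auto simp: locally_small_def)
 show "has_coproducts U (full_subcategory T A)"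
  unfolding has_coproducts_def
 proof (intro allI impI)
  fix I :: "'u set" and X assume I: "small U I" and "\<forall>i\<in>I. X i \<in> Ob (full_subcategory T A)"
  then have X: "\<And>i. i \<in> I \<Longrightarrow> X i \<in> A" by simp
  then obtain P \<iota> where "is_coproduct T I X P \<iota>"
   using has_coproducts I localizingD(1)[OF A] unfolding has_coproducts_def by (meson subsetD)
  then show "\<exists>P \<iota>. is_coproduct (full_subcategory T A) I X P \<iota>"
   using full_subcategory_coproducts[OF A I, of X] X by blast
 qed
qed (rule full_subcategory_triangulated[OF A])

end

section \<open>Well generation from small objects\<close>

text \<open>What the argument requires of the small complexes, stated for any triangulated category
  with coproducts. \<open>Sm\<close> is a class; \<open>Sm_representatives\<close> provides a small
  set of representatives up to isomorphism. \<open>Sm_factor\<close> places the middle objects in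
  \<open>Sm\<close>, with no control over any localizing subcategory; gaining that control is the
  task of what follows.\<close>

locale small_objects = coproduct_triangulated U T + \<kappa>: regular_cardinal \<kappa>
 for U :: "'u set" and T :: "('o, 'm, 'z) tri_cat_scheme" and \<kappa> :: "'u rel" +
 fixes Sm :: "'o set"
 assumes \<kappa>_small: "\<kappa> <o |U|"
  and Sm_Ob: "Sm \<subseteq> Ob T"
  and Sm_zero: "\<exists>N\<in>Sm. is_zero T N"
  and Sm_shift: "X \<in> Sm \<Longrightarrow> fob (Shift T) X \<in> Sm"
  and Sm_unshift: "X \<in> Sm \<Longrightarrow> \<exists>Y\<in>Sm. \<exists>f. isomorphism T (fob (Shift T) Y) X f"
  and Sm_cone: "\<lbrakk>X \<in> Sm; Y \<in> Sm; u \<in> Arr T X Y\<rbrakk> \<Longrightarrow> \<exists>Z\<in>Sm. \<exists>v w. (X, Y, Z, u, v, w) \<in> Tri T"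
  and Sm_coproduct: "\<lbrakk>|J :: 'u set| <o \<kappa>; \<And>i. i \<in> J \<Longrightarrow> V i \<in> Sm\<rbrakk> \<Longrightarrow> \<exists>P\<in>Sm. \<exists>\<iota>. is_coproduct T J V P \<iota>"
  and Sm_small: "Y \<in> Sm \<Longrightarrow> \<kappa>_small_object U \<kappa> T Y"
  and Sm_factor: "\<lbrakk>Y \<in> Sm; small U (I :: 'u set); \<And>i. i \<in> I \<Longrightarrow> V i \<in> Ob T; is_coproduct T I V P \<iota>; f \<in> Arr T Y P\<rbrakk>
   \<Longrightarrow> \<exists>Y' f' Q \<iota>' g h. (\<forall>i\<in>I. Y' i \<in> Sm \<and> f' i \<in> Arr T (Y' i) (V i)) \<and> is_coproduct T I Y' Q \<iota>' \<and>
    g \<in> Arr T Y Q \<and> h \<in> Arr T Q P \<and>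
    (\<forall>i\<in>I. Cmp T (Y' i) Q P h (\<iota>' i) = Cmp T (Y' i) (V i) P (\<iota> i) (f' i)) \<and> f = Cmp T Y Q P h g"
  and Sm_representatives: "\<exists>R. small U R \<and> R \<subseteq> Sm \<and> (\<forall>X\<in>Sm. \<exists>Y\<in>R. \<exists>f. isomorphism T X Y f)"
begin

lemma lt_\<kappa>_small: "|J| <o \<kappa> \<Longrightarrow> small U J"
 unfolding small_def using \<kappa>_small ordLess_transitive by blast

context
 fixes G :: "'o set" assumes G: "G \<subseteq> Sm"
begin

abbreviation "L \<equiv> Loc U T G"

lemma L: "localizing L"
 using localizing_Loc G Sm_Ob by blast

lemmas L_closed = localizingD[OF L]

lemma L_Ob: "X \<in> L \<Longrightarrow> X \<in> Ob T" and SmO: "X \<in> Sm \<Longrightarrow> X \<in> Ob T"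
 using L_closed(1) Sm_Ob by blast+

section \<open>Maps from small objects into the localizing subcategory\<close>

definition factors :: "'o \<Rightarrow> 'o \<Rightarrow> 'm \<Rightarrow> bool" where
 "factors C X f \<longleftrightarrow> (\<exists>Y\<in>Sm \<inter> L. \<exists>g\<in>Arr T C Y. \<exists>h\<in>Arr T Y X. f = Cmp T C Y X h g)"

lemma factorsI: "\<lbrakk>Y \<in> Sm; Y \<in> L; g \<in> Arr T C Y; h \<in> Arr T Y X; f = Cmp T C Y X h g\<rbrakk> \<Longrightarrow> factors C X f"
 by (auto simp: factors_def)

lemma factors_post:
 assumes "factors C X f" "C \<in> Ob T" "X \<in> Ob T" "Z \<in> Ob T" "k \<in> Arr T X Z" shows "factors C Z (Cmp T C X Z k f)"
proof -
 obtain Y g h where Y: "Y \<in> Sm" "Y \<in> L" "g \<in> Arr T C Y" "h \<in> Arr T Y X" "f = Cmp T C Y X h g"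
  using assms by (auto simp: factors_def)
 show ?thesis by (rule factorsI[OF Y(1,2,3), of "Cmp T Y X Z k h"]) (use Y assms SmO in \<open>simp_all add: closed Cmp_assoc\<close>)
qed

lemma factors_pre:
 assumes "factors C X f" "C \<in> Ob T" "X \<in> Ob T" "B \<in> Ob T" "k \<in> Arr T B C" shows "factors B X (Cmp T B C X f k)"
proof -
 obtain Y g h where Y: "Y \<in> Sm" "Y \<in> L" "g \<in> Arr T C Y" "h \<in> Arr T Y X" "f = Cmp T C Y X h g"
  using assms by (auto simp: factors_def)
 show ?thesis by (rule factorsI[OF Y(1,2) _ Y(4), of "Cmp T B C Y g k"]) (use Y assms SmO in \<open>simp_all add: closed Cmp_assoc\<close>)
qed

text \<open>The sum passes through the coproduct of the two middle objects. It allows a map to be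
  corrected by an error term that also factors, as happens for cones.\<close>

lemma factors_add:
 assumes f: "factors C X f" and f': "factors C X f'" and O: "C \<in> Ob T" "X \<in> Ob T"
 shows "factors C X (Add T C X f f')"
proof -
 obtain Y g h where Y: "Y \<in> Sm" "Y \<in> L" "g \<in> Arr T C Y" "h \<in> Arr T Y X" "f = Cmp T C Y X h g"
  using f by (auto simp: factors_def)
 obtain Y' g' h' where Y': "Y' \<in> Sm" "Y' \<in> L" "g' \<in> Arr T C Y'" "h' \<in> Arr T Y' X" "f' = Cmp T C Y' X h' g'"
  using f' by (auto simp: factors_def)
 obtain a b :: 'u where ab: "a \<noteq> b" using two_elements by blast
 let ?X = "\<lambda>i. if i = a then Y else Y'"
 have "\<exists>P\<in>Sm. \<exists>\<iota>. is_coproduct T {a, b} ?X P \<iota>"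
  by (rule Sm_coproduct) (use Y Y' in \<open>auto intro: \<kappa>.lt_finite\<close>)
 then obtain P \<iota> where P: "P \<in> Sm" "is_coproduct T {a, b} ?X P \<iota>" by blast
 have PL: "P \<in> L" by (rule L_closed(7)[OF _ _ P(2)]) (use Y Y' in \<open>auto intro: small_finite\<close>)
 have PO: "P \<in> Ob T" "Y \<in> Ob T" "Y' \<in> Ob T" using SmO P Y Y' by auto
 have \<iota>: "\<iota> a \<in> Arr T Y P" "\<iota> b \<in> Arr T Y' P" using P(2) ab by (auto simp: is_coproduct_def)
 obtain k where k: "k \<in> Arr T P X" "\<And>i. i \<in> {a, b} \<Longrightarrow> Cmp T (?X i) P X k (\<iota> i) = (if i = a then h else h')"
  using coproduct_map[OF P(2) O(2), of "\<lambda>i. if i = a then h else h'"] Y Y' by (smt (verit))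
 have k': "Cmp T Y P X k (\<iota> a) = h" "Cmp T Y' P X k (\<iota> b) = h'" using k(2)[of a] k(2)[of b] ab by auto
 show ?thesis
  by (rule factorsI[OF P(1) PL _ k(1), of "Add T C P (Cmp T C Y P (\<iota> a) g) (Cmp T C Y' P (\<iota> b) g')"])
   (use O PO \<iota> k(1) Y Y' in \<open>simp_all add: closed Cmp_Add_right Cmp_assoc k'\<close>)
qed

definition dense :: "'o set" where
 "dense = {X \<in> L. \<forall>C\<in>Sm. \<forall>f\<in>Arr T C X. factors C X f}"

lemma dense_factors: "\<lbrakk>X \<in> dense; C \<in> Sm; f \<in> Arr T C X\<rbrakk> \<Longrightarrow> factors C X f"
 and dense_L: "X \<in> dense \<Longrightarrow> X \<in> L"
 by (auto simp: dense_def)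

lemma Sm_unshift_inverse:
 assumes "Y \<in> Sm" obtains Y0 \<theta> \<theta>' where "Y0 \<in> Sm" "\<theta> \<in> Arr T (S Y0) Y" "\<theta>' \<in> Arr T Y (S Y0)"
  "Cmp T Y (S Y0) Y \<theta> \<theta>' = Ident T Y" "Cmp T (S Y0) Y (S Y0) \<theta>' \<theta> = Ident T (S Y0)" "Y \<in> L \<Longrightarrow> Y0 \<in> L"
proof -
 obtain Y0 \<theta> where Y0: "Y0 \<in> Sm" "isomorphism T (S Y0) Y \<theta>" using Sm_unshift[OF assms] by blast
 then obtain \<theta>' where *: "isomorphism T Y (S Y0) \<theta>'" "\<theta>' \<in> Arr T Y (S Y0)"
  "Cmp T Y (S Y0) Y \<theta> \<theta>' = Ident T Y" "Cmp T (S Y0) Y (S Y0) \<theta>' \<theta> = Ident T (S Y0)"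
  using isomorphism_inverse by metis
 have "Y0 \<in> L" if "Y \<in> L" using L_closed(3)[OF that _ *(1)] L_closed(5) SmO Y0(1) S_closed by blast
 with that Y0 * show thesis by (auto simp: isomorphism_def)
qed

lemma dense_shift: assumes X: "X \<in> dense" shows "S X \<in> dense"
proof -
 have "factors C (S X) f" if C: "C \<in> Sm" and f: "f \<in> Arr T C (S X)" for C f
 proof -
  obtain C0 \<theta> \<theta>' where C0: "C0 \<in> Sm" "\<theta> \<in> Arr T (S C0) C" "\<theta>' \<in> Arr T C (S C0)" "Cmp T C (S C0) C \<theta> \<theta>' = Ident T C"
   using Sm_unshift_inverse[OF C] by metis
  have O: "X \<in> Ob T" "S X \<in> Ob T" "C \<in> Ob T" "C0 \<in> Ob T" "S C0 \<in> Ob T" using X C C0 SmO L_Ob dense_L S_closed by auto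
  obtain f0 where f0: "f0 \<in> Arr T C0 X" "Cmp T (S C0) C (S X) f \<theta> = SM C0 X f0"
   using SM_surj O C0 f Cmp_closed by metis
  obtain Y g h where Y: "Y \<in> Sm" "Y \<in> L" "g \<in> Arr T C0 Y" "h \<in> Arr T Y X" "f0 = Cmp T C0 Y X h g"
   using dense_factors[OF X C0(1) f0(1)] by (auto simp: factors_def)
  have "factors (S C0) (S X) (SM C0 X f0)"
   by (rule factorsI[OF Sm_shift[OF Y(1)] L_closed(4)[OF Y(2)], of "SM C0 Y g" _ "SM Y X h"])
    (use O Y SmO in \<open>simp_all add: SM_closed SM_Cmp\<close>)
  then have "factors C (S X) (Cmp T C (S C0) (S X) (SM C0 X f0) \<theta>')" by (rule factors_pre) (use O C0 in auto)
  then show ?thesis using O C0 f by (simp add: f0(2)[symmetric] Cmp_assoc[symmetric] Cmp_Ident_right)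
 qed
 then show ?thesis using L_closed(4) dense_L[OF X] by (auto simp: dense_def)
qed

lemma dense_unshift: assumes X: "X \<in> Ob T" and SX: "S X \<in> dense" shows "X \<in> dense"
proof -
 have "factors C X f" if C: "C \<in> Sm" and f: "f \<in> Arr T C X" for C f
 proof -
  have CO: "C \<in> Ob T" "S C \<in> Ob T" "S X \<in> Ob T" using SmO C X S_closed by auto
  obtain Y g h where Y: "Y \<in> Sm" "Y \<in> L" "g \<in> Arr T (S C) Y" "h \<in> Arr T Y (S X)" "SM C X f = Cmp T (S C) Y (S X) h g"
   using dense_factors[OF SX Sm_shift[OF C] SM_closed[OF CO(1) X f]] by (auto simp: factors_def)
  obtain Y0 \<theta> \<theta>' where Y0: "Y0 \<in> Sm" "\<theta> \<in> Arr T (S Y0) Y" "\<theta>' \<in> Arr T Y (S Y0)" "Cmp T Y (S Y0) Y \<theta> \<theta>' = Ident T Y" "Y0 \<in> L"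
   using Sm_unshift_inverse[OF Y(1)] Y(2) by metis
  have O: "Y \<in> Ob T" "Y0 \<in> Ob T" "S Y0 \<in> Ob T" using SmO Y Y0 S_closed by auto
  obtain g0 where g0: "g0 \<in> Arr T C Y0" "Cmp T (S C) Y (S Y0) \<theta>' g = SM C Y0 g0"
   using SM_surj[OF CO(1) O(2)] O CO Y0 Y by (metis Cmp_closed)
  obtain h0 where h0: "h0 \<in> Arr T Y0 X" "Cmp T (S Y0) Y (S X) h \<theta> = SM Y0 X h0"
   using SM_surj[OF O(2) X] O CO Y0 Y by (metis Cmp_closed)
  have "SM C X (Cmp T C Y0 X h0 g0) = Cmp T (S C) (S Y0) (S X) (Cmp T (S Y0) Y (S X) h \<theta>) (Cmp T (S C) Y (S Y0) \<theta>' g)"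
   using O CO X h0 g0 by (simp add: SM_Cmp)
  also have "\<dots> = Cmp T (S C) Y (S X) h (Cmp T (S C) Y Y (Cmp T Y (S Y0) Y \<theta> \<theta>') g)"
   using O CO X Y Y0(2,3) by (simp add: Cmp_assoc Cmp_closed)
  also have "\<dots> = SM C X f" using O CO X Y by (simp add: Y0(4) Cmp_Ident_left)
  finally have "f = Cmp T C Y0 X h0 g0"
   using SM_inject[of C X f "Cmp T C Y0 X h0 g0"] O CO X f h0 g0 by (simp add: Cmp_closed)
  then show ?thesis using factorsI[OF Y0(1,5) g0(1) h0(1)] by blast
 qed
 moreover have "X \<in> L" using L_closed(5)[OF X dense_L[OF SX]] .
 ultimately show ?thesis by (auto simp: dense_def)
qed

text \<open>
 A map from a shifted small object \<open>S C\<close> to the cone \<open>X3\<close> is, up to a map factoring through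
 \<open>S Y\<close>, a composite \<open>S C \<rightarrow> Y3 \<rightarrow> X3\<close>: the first factorisation is of
 \<open>S C \<rightarrow> X3 \<rightarrow> S X1\<close> through \<open>S Y\<close>, the second of the induced map from the fibre \<open>W\<close> to \<open>X2\<close> through \<open>Y2\<close>,
 and \<open>Y3\<close> is the cone of \<open>Y \<rightarrow> W \<rightarrow> Y2\<close>.
\<close>

lemma dense_cone_shifted:
 assumes t: "(X1, X2, X3, u, v, w) \<in> Tri T" and X1: "X1 \<in> dense" and X2: "X2 \<in> dense"
  and C: "C \<in> Sm" and f: "f \<in> Arr T (S C) X3"
 shows "factors (S C) X3 f"
proof -
 note T = TriD[OF t]
 have CO: "C \<in> Ob T" "S C \<in> Ob T" "S X1 \<in> Ob T" "S X2 \<in> Ob T" using SmO[OF C] S_closed T by auto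
 have "factors (S C) (S X1) (Cmp T (S C) X3 (S X1) w f)"
  using dense_factors[OF dense_shift[OF X1] Sm_shift[OF C]] Cmp_closed T CO f by blast
 then obtain Y1 g h where Y1: "Y1 \<in> Sm" "Y1 \<in> L" "g \<in> Arr T (S C) Y1" "h \<in> Arr T Y1 (S X1)"
  "Cmp T (S C) X3 (S X1) w f = Cmp T (S C) Y1 (S X1) h g" by (auto simp: factors_def)
 obtain Y \<theta> \<theta>' where Y: "Y \<in> Sm" "\<theta> \<in> Arr T (S Y) Y1" "\<theta>' \<in> Arr T Y1 (S Y)" "Cmp T Y1 (S Y) Y1 \<theta> \<theta>' = Ident T Y1" "Y \<in> L"
  using Sm_unshift_inverse[OF Y1(1)] Y1(2) by metis
 have O: "Y1 \<in> Ob T" "Y \<in> Ob T" "S Y \<in> Ob T" using SmO Y1 Y S_closed by auto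
 define g' where "g' = Cmp T (S C) Y1 (S Y) \<theta>' g"
 have g': "g' \<in> Arr T (S C) (S Y)" using O CO Y1 Y by (simp add: g'_def closed)
 obtain y where y: "y \<in> Arr T Y X1" "Cmp T (S Y) Y1 (S X1) h \<theta> = SM Y X1 y"
  using SM_surj[OF O(2) T(1)] O CO Y1 Y by (metis Cmp_closed)
 have SyA: "SM Y X1 y \<in> Arr T (S Y) (S X1)" using y O T by (simp add: closed)
 have "Cmp T (S C) (S Y) (S X1) (SM Y X1 y) g' = Cmp T (S C) Y1 (S X1) h (Cmp T (S C) Y1 Y1 (Cmp T Y1 (S Y) Y1 \<theta> \<theta>') g)"
  unfolding g'_def y(2)[symmetric] using O CO Y1(3,4) Y(2,3) by (simp add: Cmp_assoc Cmp_closed)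
 then have wf: "Cmp T (S C) X3 (S X1) w f = Cmp T (S C) (S Y) (S X1) (SM Y X1 y) g'"
  using O CO Y1 by (simp add: Y(4) Cmp_Ident_left)
 obtain s where s: "s \<in> Arr T C Y" "g' = SM C Y s" using SM_surj[OF CO(1) O(2) g'] by blast
 \<comment> \<open>The sign compensates the one in the rotation: the third arrow of the rotated
   triangle becomes \<open>g'\<close> itself.\<close>
 have s': "Neg T C Y s \<in> Arr T C Y" using s CO O by (simp add: closed)
 obtain W m n where W: "W \<in> Sm" "(C, Y, W, Neg T C Y s, m, n) \<in> Tri T" using Sm_cone[OF C Y(1) s'] by blast
 have "SM C Y (Neg T C Y s) = Neg T (S C) (S Y) g'"
 proof (rule Neg_unique[OF CO(2) O(3) g'])
  interpret G: comm_group "hom_group T C Y" using CO O by (simp add: hom_group)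
  have "SM C Y \<in> hom (hom_group T C Y) (hom_group T (S C) (S Y))"
   using shift_additive CO O by (simp add: is_additive_functor_def)
  from hom_mult[OF this, of "Neg T C Y s" s]
  show "Add T (S C) (S Y) (SM C Y (Neg T C Y s)) g' = Nul T (S C) (S Y)"
   using s s' CO O Add_Neg[OF CO(1) O(2) s(1)] SM_Nul by (simp add: hom_group_def)
  show "SM C Y (Neg T C Y s) \<in> Arr T (S C) (S Y)" using s' CO O by (simp add: closed)
 qed
 then have tW: "(Y, W, S C, m, n, g') \<in> Tri T"
  using Tri_rotate_forward[OF W(2)] g' CO O by (simp add: Neg_Neg)
 note TW = TriD[OF tW]
 have SO: "S W \<in> Ob T" using TW S_closed by auto
 \<comment> \<open>Filling between the twice rotated triangles, with \<open>f\<close> and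
   \<open>S y\<close> as the first two components, gives an arrow \<open>S W -> S X2\<close>; as
   \<open>S\<close> is full, it comes from an arrow \<open>\<beta> : W -> X2\<close>.\<close>
 have "\<exists>c. triangle_map T (Shift T)
  (S C, S Y, S W, g', Neg T (S Y) (S W) (SM Y W m), Neg T (S W) (S (S C)) (SM W (S C) n))
  (X3, S X1, S X2, w, Neg T (S X1) (S X2) (SM X1 X2 u), Neg T (S X2) (S X3) (SM X2 X3 v)) (f, SM Y X1 y, c)"
  by (rule Tri_fill[OF Tri_rotate_forward[OF Tri_rotate_forward[OF tW]] Tri_rotate_forward[OF Tri_rotate_forward[OF t]] f SyA])
   (simp add: wf)
 then obtain c where c: "c \<in> Arr T (S W) (S X2)"
  "Cmp T (S Y) (S W) (S X2) c (Neg T (S Y) (S W) (SM Y W m)) = Cmp T (S Y) (S X1) (S X2) (Neg T (S X1) (S X2) (SM X1 X2 u)) (SM Y X1 y)"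
  "Cmp T (S W) (S (S C)) (S X3) (SM (S C) X3 f) (Neg T (S W) (S (S C)) (SM W (S C) n)) =
   Cmp T (S W) (S X2) (S X3) (Neg T (S X2) (S X3) (SM X2 X3 v)) c" by auto
 obtain \<beta> where \<beta>: "\<beta> \<in> Arr T W X2" "c = SM W X2 \<beta>" using SM_surj[OF TW(2) T(2) c(1)] by blast
 have "Neg T (S Y) (S X2) (SM Y X2 (Cmp T Y W X2 \<beta> m)) = Neg T (S Y) (S X2) (SM Y X2 (Cmp T Y X1 X2 u y))"
  using c(2) \<beta> O T TW y by (simp add: Cmp_Neg_right Cmp_Neg_left closed SM_Cmp)
 then have \<beta>m: "Cmp T Y W X2 \<beta> m = Cmp T Y X1 X2 u y"
  using Neg_inject[of "S Y" "S X2" "SM Y X2 (Cmp T Y W X2 \<beta> m)" "SM Y X2 (Cmp T Y X1 X2 u y)"]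
   SM_inject[of Y X2 "Cmp T Y W X2 \<beta> m" "Cmp T Y X1 X2 u y"] \<beta> O T TW y by (simp add: closed)
 have "Neg T (S W) (S X3) (SM W X3 (Cmp T W (S C) X3 f n)) = Neg T (S W) (S X3) (SM W X3 (Cmp T W X2 X3 v \<beta>))"
  using c(3) \<beta> CO T TW f by (simp add: Cmp_Neg_right Cmp_Neg_left closed SM_Cmp)
 then have fn: "Cmp T W (S C) X3 f n = Cmp T W X2 X3 v \<beta>"
  using Neg_inject[of "S W" "S X3" "SM W X3 (Cmp T W (S C) X3 f n)" "SM W X3 (Cmp T W X2 X3 v \<beta>)"]
   SM_inject[of W X3 "Cmp T W (S C) X3 f n" "Cmp T W X2 X3 v \<beta>"] \<beta> CO T TW f by (simp add: closed)
 obtain Y2 g2 h2 where Y2: "Y2 \<in> Sm" "Y2 \<in> L" "g2 \<in> Arr T W Y2" "h2 \<in> Arr T Y2 X2" "\<beta> = Cmp T W Y2 X2 h2 g2"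
  using dense_factors[OF X2 W(1) \<beta>(1)] by (auto simp: factors_def)
 have O2: "Y2 \<in> Ob T" using SmO Y2 by auto
 have gm: "Cmp T Y W Y2 g2 m \<in> Arr T Y Y2" using Y2 TW O2 by (simp add: closed)
 obtain Y3 v3 w3 where Y3: "Y3 \<in> Sm" "(Y, Y2, Y3, Cmp T Y W Y2 g2 m, v3, w3) \<in> Tri T"
  using Sm_cone[OF Y(1) Y2(1) gm] by blast
 note T3 = TriD[OF Y3(2)]
 have Y3L: "Y3 \<in> L" using L_closed(6)[OF Y3(2) Y(5) Y2(2)] .
 have "\<exists>c. triangle_map T (Shift T) (Y, W, S C, m, n, g') (Y, Y2, Y3, Cmp T Y W Y2 g2 m, v3, w3) (Ident T Y, g2, c)"
  by (rule Tri_fill[OF tW Y3(2)]) (use TW T3 Y2 gm in \<open>simp_all add: closed Cmp_Ident_right\<close>)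
 then obtain c1 where c1: "c1 \<in> Arr T (S C) Y3" "Cmp T W (S C) Y3 c1 n = Cmp T W Y2 Y3 v3 g2"
  "Cmp T (S C) Y3 (S Y) w3 c1 = g'"
  using TW g' CO O by (auto simp: SM_Ident Cmp_Ident_left)
 have "\<exists>c. triangle_map T (Shift T) (Y, Y2, Y3, Cmp T Y W Y2 g2 m, v3, w3) (X1, X2, X3, u, v, w) (y, h2, c)"
  by (rule Tri_fill[OF Y3(2) t y(1) Y2(4)]) (use TW T3 T Y2(3-5) \<beta>m in \<open>simp add: Cmp_assoc\<close>)
 then obtain c2 where c2: "c2 \<in> Arr T Y3 X3" "Cmp T Y2 Y3 X3 c2 v3 = Cmp T Y2 X2 X3 v h2" by auto
 define d where "d = Cmp T (S C) Y3 X3 c2 c1"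
 have d: "d \<in> Arr T (S C) X3" using c1 c2 CO T T3 by (simp add: d_def closed)
 \<comment> \<open>\<open>d\<close> need not equal \<open>f\<close>, but the two agree after
   composition with \<open>n\<close>. The difference therefore factors through \<open>g'\<close>,
   that is, through \<open>S Y\<close>, which is small and lies in \<open>L\<close>.\<close>
 define \<delta> where "\<delta> = Add T (S C) X3 f (Neg T (S C) X3 d)"
 have \<delta>: "\<delta> \<in> Arr T (S C) X3" using d f CO T by (simp add: \<delta>_def closed)
 have "Cmp T W (S C) X3 d n = Cmp T W Y2 X3 (Cmp T Y2 Y3 X3 c2 v3) g2"
  unfolding d_def using c1 c2(1) CO T T3 TW Y2 by (simp add: Cmp_assoc[symmetric])
 also have "\<dots> = Cmp T W (S C) X3 f n"
  unfolding c2(2) fn using T T3 TW Y2 by (simp add: Cmp_assoc)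
 finally have "Cmp T W (S C) X3 \<delta> n = Nul T W X3"
  using f d CO T TW Add_Neg[of W X3 "Cmp T W (S C) X3 f n"]
  by (simp add: \<delta>_def Cmp_Add_left Cmp_Neg_left closed Add_commute[of W X3 "Cmp T W (S C) X3 f n"])
 then obtain z where z: "z \<in> Arr T (S Y) X3" "Cmp T (S C) (S Y) X3 z g' = \<delta>"
  using weak_cokernel[OF Tri_rotate_forward[OF tW] T(3) \<delta>] by blast
 have "factors (S C) X3 d" unfolding d_def by (rule factorsI[OF Y3(1) Y3L c1(1) c2(1) refl])
 moreover have "factors (S C) X3 \<delta>"
  by (rule factorsI[OF Sm_shift[OF Y(1)] L_closed(4)[OF Y(5)] g' z(1)]) (simp add: z)
 ultimately have "factors (S C) X3 (Add T (S C) X3 \<delta> d)" using factors_add CO T by blast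
 moreover have "Add T (S C) X3 \<delta> d = Add T (S C) X3 f (Add T (S C) X3 (Neg T (S C) X3 d) d)"
  unfolding \<delta>_def by (rule Add_assoc) (use f d CO T in \<open>simp_all add: closed\<close>)
 then have "Add T (S C) X3 \<delta> d = f"
  using f d CO T by (simp add: Add_Neg Add_commute[of "S C" X3 f] closed Add_Nul)
 ultimately show ?thesis by simp
qed

lemma dense_cone:
 assumes t: "(X1, X2, X3, u, v, w) \<in> Tri T" and X1: "X1 \<in> dense" and X2: "X2 \<in> dense"
 shows "X3 \<in> dense"
proof -
 have "factors C X3 f" if C: "C \<in> Sm" and f: "f \<in> Arr T C X3" for C f
 proof -
  obtain C0 \<theta> \<theta>' where C0: "C0 \<in> Sm" "\<theta> \<in> Arr T (S C0) C" "\<theta>' \<in> Arr T C (S C0)" "Cmp T C (S C0) C \<theta> \<theta>' = Ident T C"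
   using Sm_unshift_inverse[OF C] by metis
  have O: "C \<in> Ob T" "S C0 \<in> Ob T" "X3 \<in> Ob T" using C C0 SmO S_closed TriD[OF t] by auto
  have "factors (S C0) X3 (Cmp T (S C0) C X3 f \<theta>)"
   by (rule dense_cone_shifted[OF t X1 X2 C0(1)]) (use O C0 f in \<open>simp add: closed\<close>)
  then have "factors C X3 (Cmp T C (S C0) X3 (Cmp T (S C0) C X3 f \<theta>) \<theta>')"
   by (rule factors_pre) (use O C0 in auto)
  then show ?thesis using O C0 f by (simp add: Cmp_assoc[symmetric] Cmp_Ident_right)
 qed
 moreover have "X3 \<in> L" using L_closed(6)[OF t] X1 X2 dense_L by blast
 ultimately show ?thesis by (auto simp: dense_def)
qed

text \<open>Smallness restricts \<open>f\<close> to fewer than \<kappa> summands,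
  \<open>Sm_factor\<close> replaces these by objects of \<open>Sm\<close>, and density of the
  summands replaces those by objects of \<open>Sm\<close> in \<open>L\<close>. The bound on the
  number of summands is what leaves the coproduct \<open>V\<close> in \<open>Sm\<close>.\<close>

lemma dense_coproduct:
 assumes I: "small U (I :: 'u set)" and X: "\<And>i. i \<in> I \<Longrightarrow> X i \<in> dense" and P: "is_coproduct T I X P \<iota>"
 shows "P \<in> dense"
proof -
 have PL: "P \<in> L" using L_closed(7)[OF I _ P] X dense_L by blast
 have XO: "\<And>i. i \<in> I \<Longrightarrow> X i \<in> Ob T" using X dense_L L_Ob by blast
 have "factors C P f" if C: "C \<in> Sm" and f: "f \<in> Arr T C P" for C f
 proof -
  obtain J Q \<iota>1 g h where J: "J \<subseteq> I" "|J| <o \<kappa>" "is_coproduct T J X Q \<iota>1" "g \<in> Arr T C Q" "h \<in> Arr T Q P"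
   "f = Cmp T C Q P h g"
   using Sm_small[OF C, unfolded \<kappa>_small_object_def, rule_format, OF I _ P f] XO by blast
  have "\<exists>Y' f' R \<iota>' g1 h1. (\<forall>i\<in>J. Y' i \<in> Sm \<and> f' i \<in> Arr T (Y' i) (X i)) \<and> is_coproduct T J Y' R \<iota>' \<and>
    g1 \<in> Arr T C R \<and> h1 \<in> Arr T R Q \<and>
    (\<forall>i\<in>J. Cmp T (Y' i) R Q h1 (\<iota>' i) = Cmp T (Y' i) (X i) Q (\<iota>1 i) (f' i)) \<and> g = Cmp T C R Q h1 g1"
   by (rule Sm_factor[OF C lt_\<kappa>_small[OF J(2)] _ J(3,4)]) (use XO J in blast)
  then obtain C' f' R \<iota>2 g1 h1 where C': "\<And>i. i \<in> J \<Longrightarrow> C' i \<in> Sm" "\<And>i. i \<in> J \<Longrightarrow> f' i \<in> Arr T (C' i) (X i)"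
   and R: "is_coproduct T J C' R \<iota>2" "g1 \<in> Arr T C R" "h1 \<in> Arr T R Q"
    "\<And>i. i \<in> J \<Longrightarrow> Cmp T (C' i) R Q h1 (\<iota>2 i) = Cmp T (C' i) (X i) Q (\<iota>1 i) (f' i)" "g = Cmp T C R Q h1 g1"
   by blast
  have "\<forall>i\<in>J. \<exists>Y a b. Y \<in> Sm \<and> Y \<in> L \<and> a \<in> Arr T (C' i) Y \<and> b \<in> Arr T Y (X i) \<and> f' i = Cmp T (C' i) Y (X i) b a"
   using dense_factors[OF X C'] J(1) unfolding factors_def by blast
  then obtain Y a b where Y: "\<And>i. i \<in> J \<Longrightarrow> Y i \<in> Sm" "\<And>i. i \<in> J \<Longrightarrow> Y i \<in> L"
   "\<And>i. i \<in> J \<Longrightarrow> a i \<in> Arr T (C' i) (Y i)" "\<And>i. i \<in> J \<Longrightarrow> b i \<in> Arr T (Y i) (X i)"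
   "\<And>i. i \<in> J \<Longrightarrow> f' i = Cmp T (C' i) (Y i) (X i) (b i) (a i)" by metis
  obtain V \<iota>3 where V: "V \<in> Sm" "is_coproduct T J Y V \<iota>3" using Sm_coproduct[OF J(2), of Y] Y(1) by blast
  have VL: "V \<in> L" using L_closed(7)[OF lt_\<kappa>_small[OF J(2)] Y(2) V(2)] .
  have O: "C \<in> Ob T" "P \<in> Ob T" "Q \<in> Ob T" "R \<in> Ob T" "V \<in> Ob T"
   using C SmO PL L_Ob VL J(3) R(1) by (auto simp: is_coproduct_def)
  have Oi: "C' i \<in> Ob T" "Y i \<in> Ob T" "X i \<in> Ob T" if "i \<in> J" for i using that C'(1) Y(1) SmO XO J(1) by auto
  have \<iota>: "\<iota>1 i \<in> Arr T (X i) Q" "\<iota>2 i \<in> Arr T (C' i) R" "\<iota>3 i \<in> Arr T (Y i) V" if "i \<in> J" for i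
   using that J(3) R(1) V(2) by (auto simp: is_coproduct_def)
  obtain \<alpha> where \<alpha>: "\<alpha> \<in> Arr T R V" "\<And>i. i \<in> J \<Longrightarrow> Cmp T (C' i) R V \<alpha> (\<iota>2 i) = Cmp T (C' i) (Y i) V (\<iota>3 i) (a i)"
   using coproduct_map[OF R(1) O(5), of "\<lambda>i. Cmp T (C' i) (Y i) V (\<iota>3 i) (a i)"] Oi \<iota> Y(3) O(5) Cmp_closed by blast
  obtain \<beta> where \<beta>: "\<beta> \<in> Arr T V Q" "\<And>i. i \<in> J \<Longrightarrow> Cmp T (Y i) V Q \<beta> (\<iota>3 i) = Cmp T (Y i) (X i) Q (\<iota>1 i) (b i)"
   using coproduct_map[OF V(2) O(3), of "\<lambda>i. Cmp T (Y i) (X i) Q (\<iota>1 i) (b i)"] Oi \<iota> Y(4) O(3) Cmp_closed by blast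
  have "h1 = Cmp T R V Q \<beta> \<alpha>"
  proof (rule coproduct_eq[OF R(1) Oi(1) O(3) R(3)])
   show "Cmp T R V Q \<beta> \<alpha> \<in> Arr T R Q" using O \<alpha> \<beta> by (simp add: closed)
   fix i assume i: "i \<in> J"
   have "Cmp T (C' i) R Q (Cmp T R V Q \<beta> \<alpha>) (\<iota>2 i) = Cmp T (C' i) (Y i) Q (Cmp T (Y i) V Q \<beta> (\<iota>3 i)) (a i)"
    using i O Oi \<iota> Y(3) \<alpha> \<beta>(1) by (simp add: Cmp_assoc[symmetric])
   also have "\<dots> = Cmp T (C' i) (X i) Q (\<iota>1 i) (f' i)"
    using i O Oi \<iota> Y(3,4) by (simp add: \<beta>(2) Y(5) Cmp_assoc)
   finally show "Cmp T (C' i) R Q h1 (\<iota>2 i) = Cmp T (C' i) R Q (Cmp T R V Q \<beta> \<alpha>) (\<iota>2 i)" using R(4) i by simp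
  qed
  then show ?thesis
   by (intro factorsI[OF V(1) VL, of "Cmp T C R V \<alpha> g1" _ "Cmp T V Q P h \<beta>"])
    (use O \<alpha> \<beta> R J in \<open>simp_all add: closed Cmp_assoc\<close>)
 qed
 with PL show ?thesis by (auto simp: dense_def)
qed

lemma L_dense: "L \<subseteq> dense"
proof (rule Loc_subset[OF localizingI])
 show "dense \<subseteq> Ob T" using dense_L L_Ob by blast
 show "N \<in> dense" if N: "is_zero T N" for N
 proof -
  obtain N0 where N0: "N0 \<in> Sm" "is_zero T N0" using Sm_zero by blast
  have O: "N \<in> Ob T" "N0 \<in> Ob T" using N N0 by (auto simp: is_zero_def)
  have "factors C N f" if C: "C \<in> Sm" and f: "f \<in> Arr T C N" for C f
   by (rule factorsI[OF N0(1) L_closed(2)[OF N0(2)], of "Nul T C N0" _ "Nul T N0 N"])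
    (use O SmO[OF C] is_zero_hom(1)[OF N SmO[OF C] f] in \<open>simp_all add: closed Cmp_Nul_left\<close>)
  then show ?thesis using L_closed(2)[OF N] by (auto simp: dense_def)
 qed
 show "Y \<in> dense" if X: "X \<in> dense" and Y: "Y \<in> Ob T" and i: "isomorphism T X Y k" for X Y k
 proof -
  obtain k' where k: "k \<in> Arr T X Y" "k' \<in> Arr T Y X" "Cmp T Y X Y k k' = Ident T Y"
   using i by (auto simp: isomorphism_def)
  have XO: "X \<in> Ob T" using X dense_L L_Ob by blast
  have "factors C Y f" if C: "C \<in> Sm" and f: "f \<in> Arr T C Y" for C f
  proof -
   have "factors C X (Cmp T C Y X k' f)"
    by (rule dense_factors[OF X C]) (use SmO[OF C] XO Y k f in \<open>simp add: closed\<close>)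
   then have "factors C Y (Cmp T C X Y k (Cmp T C Y X k' f))"
    by (rule factors_post) (use SmO[OF C] XO Y k in auto)
   then show ?thesis using SmO[OF C] XO Y k f by (simp add: Cmp_assoc Cmp_Ident_left)
  qed
  then show ?thesis using L_closed(3)[OF dense_L[OF X] Y i] by (auto simp: dense_def)
 qed
 show "G \<subseteq> dense"
 proof
  fix X assume "X \<in> G"
  then have X: "X \<in> Sm" "X \<in> L" using G Loc_contains by auto
  have "factors C X f" if "C \<in> Sm" "f \<in> Arr T C X" for C f
   by (rule factorsI[OF X that(2), of "Ident T X"]) (use SmO X that in \<open>simp_all add: closed Cmp_Ident_left\<close>)
  with X show "X \<in> dense" by (auto simp: dense_def)
 qed
qed (fact dense_shift dense_unshift dense_cone dense_coproduct)+

lemma L_factors: "\<lbrakk>X \<in> L; C \<in> Sm; f \<in> Arr T C X\<rbrakk> \<Longrightarrow> factors C X f"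
 using L_dense dense_factors by blast

section \<open>Generation of the localizing subcategory by its small objects\<close>

definition right_orthogonal :: "'o set" where
 "right_orthogonal = {X \<in> Ob T. \<forall>Y\<in>Sm \<inter> L. \<forall>f\<in>Arr T Y X. f = Nul T Y X}"

text \<open>Both orthogonals are formed in all of \<open>T\<close>. An object of \<open>L\<close>
  that receives only zero maps from \<open>Sm \<inter> L\<close> lies in
  \<open>right_orthogonal\<close>; once it is known to lie here as well, its identity is
  zero.\<close>

definition double_orthogonal :: "'o set" where
 "double_orthogonal = {Z \<in> Ob T. \<forall>X\<in>right_orthogonal. \<forall>f\<in>Arr T Z X. f = Nul T Z X}"

lemma right_orthogonalD: "\<lbrakk>X \<in> right_orthogonal; Y \<in> Sm; Y \<in> L; f \<in> Arr T Y X\<rbrakk> \<Longrightarrow> f = Nul T Y X"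
 and right_orthogonal_Ob: "X \<in> right_orthogonal \<Longrightarrow> X \<in> Ob T"
 by (auto simp: right_orthogonal_def)

lemma double_orthogonalD: "\<lbrakk>Z \<in> double_orthogonal; X \<in> right_orthogonal; f \<in> Arr T Z X\<rbrakk> \<Longrightarrow> f = Nul T Z X"
 by (auto simp: double_orthogonal_def)

text \<open>Together with \<open>right_orthogonal_unshift\<close> this makes the test class stable
  under the shift in both directions, which closes \<open>double_orthogonal\<close> under shifting
  and unshifting.\<close>

lemma right_orthogonal_shift: assumes X: "X \<in> right_orthogonal" shows "S X \<in> right_orthogonal"
proof -
 have "f = Nul T Y (S X)" if Y: "Y \<in> Sm" "Y \<in> L" and f: "f \<in> Arr T Y (S X)" for Y f
 proof -
  obtain Y0 \<theta> \<theta>' where Y0: "Y0 \<in> Sm" "\<theta> \<in> Arr T (S Y0) Y" "\<theta>' \<in> Arr T Y (S Y0)" "Cmp T Y (S Y0) Y \<theta> \<theta>' = Ident T Y" "Y0 \<in> L"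
   using Sm_unshift_inverse[OF Y(1)] Y(2) by metis
  have O: "Y \<in> Ob T" "Y0 \<in> Ob T" "S Y0 \<in> Ob T" "X \<in> Ob T" "S X \<in> Ob T"
   using SmO Y Y0 S_closed right_orthogonal_Ob X by auto
  obtain g where g: "g \<in> Arr T Y0 X" "Cmp T (S Y0) Y (S X) f \<theta> = SM Y0 X g"
   using SM_surj[OF O(2,4)] O Y0 f by (metis Cmp_closed)
  have "Cmp T (S Y0) Y (S X) f \<theta> = Nul T (S Y0) (S X)"
   using right_orthogonalD[OF X Y0(1,5) g(1)] g(2) O SM_Nul by simp
  then have "Cmp T Y Y (S X) f (Cmp T Y (S Y0) Y \<theta> \<theta>') = Nul T Y (S X)"
   using O f Y0(2,3) by (simp add: Cmp_assoc Cmp_Nul_left)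
  then show ?thesis using O f by (simp add: Y0(4) Cmp_Ident_right)
 qed
 then show ?thesis using X S_closed by (auto simp: right_orthogonal_def)
qed

lemma right_orthogonal_unshift:
 assumes X: "X \<in> right_orthogonal" and V: "V \<in> Ob T" and k: "isomorphism T (S V) X k"
 shows "V \<in> right_orthogonal"
proof -
 have XO: "X \<in> Ob T" "S V \<in> Ob T" using right_orthogonal_Ob[OF X] S_closed V by auto
 obtain k' where k: "k \<in> Arr T (S V) X" "k' \<in> Arr T X (S V)" "Cmp T (S V) X (S V) k' k = Ident T (S V)"
  using k by (auto simp: isomorphism_def)
 have "f = Nul T Y V" if Y: "Y \<in> Sm" "Y \<in> L" and f: "f \<in> Arr T Y V" for Y f
 proof -
  have O: "Y \<in> Ob T" "S Y \<in> Ob T" using SmO Y S_closed by auto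
  have Sf: "SM Y V f \<in> Arr T (S Y) (S V)" using f O V by (simp add: closed)
  have "Cmp T (S Y) (S V) X k (SM Y V f) = Nul T (S Y) X"
   by (rule right_orthogonalD[OF X Sm_shift[OF Y(1)] L_closed(4)[OF Y(2)]]) (use O XO k Sf in \<open>simp add: closed\<close>)
  then have "Cmp T (S Y) (S V) (S V) (Cmp T (S V) X (S V) k' k) (SM Y V f) = Nul T (S Y) (S V)"
   using O XO k(1,2) Sf by (simp add: Cmp_assoc[symmetric] Cmp_Nul_right)
  then have "SM Y V f = SM Y V (Nul T Y V)" using O XO V Sf by (simp add: k(3) Cmp_Ident_left SM_Nul)
  then show ?thesis using SM_inject O V f Nul_closed by blast
 qed
 then show ?thesis using V by (auto simp: right_orthogonal_def)
qed

lemma double_orthogonal_shift: assumes Z: "Z \<in> double_orthogonal" shows "S Z \<in> double_orthogonal"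
proof -
 have ZO: "Z \<in> Ob T" "S Z \<in> Ob T" using Z S_closed by (auto simp: double_orthogonal_def)
 have "f = Nul T (S Z) X" if X: "X \<in> right_orthogonal" and f: "f \<in> Arr T (S Z) X" for X f
 proof -
  have XO: "X \<in> Ob T" using right_orthogonal_Ob[OF X] .
  obtain V k where V: "V \<in> Ob T" "isomorphism T (S V) X k" using S_ess_surj[OF XO] by blast
  then obtain k' where k: "k \<in> Arr T (S V) X" "k' \<in> Arr T X (S V)" "Cmp T X (S V) X k k' = Ident T X"
   by (auto simp: isomorphism_def)
  obtain g where g: "g \<in> Arr T Z V" "Cmp T (S Z) X (S V) k' f = SM Z V g"
   using SM_surj[OF ZO(1) V(1)] k f ZO XO V S_closed by (metis Cmp_closed)
  have "Cmp T (S Z) X (S V) k' f = Nul T (S Z) (S V)"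
   using double_orthogonalD[OF Z right_orthogonal_unshift[OF X V] g(1)] g(2) SM_Nul ZO V by simp
  then have "Cmp T (S Z) X X (Cmp T X (S V) X k k') f = Nul T (S Z) X"
   using k(1,2) f ZO XO V S_closed by (simp add: Cmp_assoc[symmetric] Cmp_Nul_right)
  then show ?thesis using f ZO XO by (simp add: k(3) Cmp_Ident_left)
 qed
 then show ?thesis using ZO by (auto simp: double_orthogonal_def)
qed

lemma double_orthogonal_cone:
 assumes t: "(X, Y, Z, u, v, w) \<in> Tri T" and X: "X \<in> double_orthogonal" and Y: "Y \<in> double_orthogonal"
 shows "Z \<in> double_orthogonal"
proof -
 note T = TriD[OF t]
 have "f = Nul T Z V" if V: "V \<in> right_orthogonal" and f: "f \<in> Arr T Z V" for V f
 proof -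
  have VO: "V \<in> Ob T" using right_orthogonal_Ob[OF V] .
  have "Cmp T Y Z V f v = Nul T Y V"
   by (rule double_orthogonalD[OF Y V]) (use T VO f in \<open>simp add: closed\<close>)
  then obtain z where z: "z \<in> Arr T (S X) V" "Cmp T Z (S X) V z w = f"
   using weak_cokernel[OF Tri_rotate_forward[OF t] VO f] by blast
  have "z = Nul T (S X) V" using double_orthogonalD[OF double_orthogonal_shift[OF X] V z(1)] .
  then show ?thesis using z T VO S_closed by (simp add: Cmp_Nul_left)
 qed
 then show ?thesis using T by (auto simp: double_orthogonal_def)
qed

text \<open>By minimality of \<open>Loc\<close>: having no nonzero map to
  \<open>right_orthogonal\<close> is stable under cones (by weak cokernels) and under coproducts (by
  uniqueness of maps out of them), and \<open>G\<close> has this property because its objects lie in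
  \<open>Sm\<close> and in \<open>L\<close>.\<close>

lemma L_double_orthogonal: "L \<subseteq> double_orthogonal"
proof (rule Loc_subset[OF localizingI])
 show "double_orthogonal \<subseteq> Ob T" by (auto simp: double_orthogonal_def)
 show "N \<in> double_orthogonal" if "is_zero T N" for N
  using that is_zero_hom(2)[OF that] by (auto simp: double_orthogonal_def right_orthogonal_def is_zero_def)
 show "Y \<in> double_orthogonal" if Z: "X \<in> double_orthogonal" and Y: "Y \<in> Ob T" and i: "isomorphism T X Y k" for X Y k
 proof -
  obtain k' where k: "k \<in> Arr T X Y" "k' \<in> Arr T Y X" "Cmp T Y X Y k k' = Ident T Y"
   using i by (auto simp: isomorphism_def)
  have XO: "X \<in> Ob T" using Z by (simp add: double_orthogonal_def)
  have "f = Nul T Y V" if V: "V \<in> right_orthogonal" and f: "f \<in> Arr T Y V" for V f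
  proof -
   have VO: "V \<in> Ob T" using right_orthogonal_Ob[OF V] .
   have "Cmp T X Y V f k = Nul T X V"
    by (rule double_orthogonalD[OF Z V]) (use XO Y VO k f in \<open>simp add: closed\<close>)
   then have "Cmp T Y Y V f (Cmp T Y X Y k k') = Nul T Y V"
    using XO Y VO k(1,2) f by (simp add: Cmp_assoc Cmp_Nul_left)
   then show ?thesis using Y VO f by (simp add: k(3) Cmp_Ident_right)
  qed
  then show ?thesis using Y by (auto simp: double_orthogonal_def)
 qed
 show "X \<in> double_orthogonal" if X: "X \<in> Ob T" and SX: "S X \<in> double_orthogonal" for X
 proof -
  have "f = Nul T X V" if V: "V \<in> right_orthogonal" and f: "f \<in> Arr T X V" for V f
  proof -
   have VO: "V \<in> Ob T" using right_orthogonal_Ob[OF V] .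
   have "SM X V f = SM X V (Nul T X V)"
    using double_orthogonalD[OF SX right_orthogonal_shift[OF V] SM_closed[OF X VO f]] X VO by (simp add: SM_Nul)
   then show ?thesis using SM_inject X VO f Nul_closed by blast
  qed
  then show ?thesis using X by (auto simp: double_orthogonal_def)
 qed
 show "P \<in> double_orthogonal"
  if "small U I" and X: "\<And>i. i \<in> I \<Longrightarrow> X i \<in> double_orthogonal" and P: "is_coproduct T I X P \<iota>"
  for I :: "'u set" and X P \<iota>
 proof -
  have O: "P \<in> Ob T" "\<And>i. i \<in> I \<Longrightarrow> X i \<in> Ob T" "\<And>i. i \<in> I \<Longrightarrow> \<iota> i \<in> Arr T (X i) P"
   using P X by (auto simp: is_coproduct_def double_orthogonal_def)
  have "f = Nul T P V" if V: "V \<in> right_orthogonal" and f: "f \<in> Arr T P V" for V f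
  proof -
   have VO: "V \<in> Ob T" using right_orthogonal_Ob[OF V] .
   have "Cmp T (X i) P V f (\<iota> i) = Nul T (X i) V" if "i \<in> I" for i
    by (rule double_orthogonalD[OF X[OF that] V]) (use that O VO f in \<open>simp add: closed\<close>)
   then show ?thesis
    by (intro coproduct_eq[OF P O(2) VO f]) (use O VO in \<open>simp_all add: closed Cmp_Nul_left\<close>)
  qed
  then show ?thesis using O by (auto simp: double_orthogonal_def)
 qed
 show "G \<subseteq> double_orthogonal"
  using G Loc_contains Sm_Ob right_orthogonalD by (fastforce simp: double_orthogonal_def)
qed (fact double_orthogonal_shift double_orthogonal_cone)+

lemma L_generated:
 assumes "X \<in> L" "\<And>Y f. \<lbrakk>Y \<in> Sm; Y \<in> L; f \<in> Arr T Y X\<rbrakk> \<Longrightarrow> f = Nul T Y X"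
 shows "is_zero T X"
proof -
 have "X \<in> right_orthogonal" "X \<in> double_orthogonal" "X \<in> Ob T"
  using assms L_Ob L_double_orthogonal by (auto simp: right_orthogonal_def)
 then show ?thesis using double_orthogonalD is_zero_iff Ident_closed by blast
qed

text \<open>The generating set is \<open>R \<inter> L\<close> for a small set \<open>R\<close> of
  representatives of \<open>Sm\<close>; passing from \<open>Sm \<inter> L\<close> to it only inserts
  isomorphisms.\<close>

theorem Loc_\<kappa>_well_generated: "\<kappa>_well_generated U \<kappa> (full_subcategory T L)"
proof -
 let ?F = "full_subcategory T L"
 obtain R where R: "small U R" "R \<subseteq> Sm" "\<And>X. X \<in> Sm \<Longrightarrow> \<exists>Y\<in>R. \<exists>f. isomorphism T X Y f"
  using Sm_representatives by blast
 have R_iso: "\<exists>Z k k'. Z \<in> R \<inter> L \<and> k \<in> Arr T Y Z \<and> k' \<in> Arr T Z Y \<and> Cmp T Y Z Y k' k = Ident T Y"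
  if Y: "Y \<in> Sm" "Y \<in> L" for Y
 proof -
  obtain Z k where Z: "Z \<in> R" "isomorphism T Y Z k" using R(3)[OF Y(1)] by blast
  then have "Z \<in> L" using L_closed(3)[OF Y(2)] R(2) SmO by blast
  with Z show ?thesis by (auto simp: isomorphism_def)
 qed
 have small: "small U (R \<inter> L)" using R(1) lt_subset[of "R \<inter> L" R] by (auto simp: small_def)
 have gen: "is_zero ?F X" if X: "X \<in> L" and Y: "\<forall>Y\<in>R \<inter> L. Arr T Y X = {Nul T Y X}" for X
 proof -
  have "f = Nul T Y X" if "Y \<in> Sm" "Y \<in> L" "f \<in> Arr T Y X" for Y f
  proof -
   obtain Z k k' where Z: "Z \<in> R \<inter> L" "k \<in> Arr T Y Z" "k' \<in> Arr T Z Y" "Cmp T Y Z Y k' k = Ident T Y"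
    using R_iso[OF \<open>Y \<in> Sm\<close> \<open>Y \<in> L\<close>] by blast
   have O: "Y \<in> Ob T" "Z \<in> Ob T" "X \<in> Ob T" using that Z L_Ob X by auto
   have "Cmp T Z Y X f k' \<in> Arr T Z X" using O Z that by (simp add: closed)
   then have "Cmp T Z Y X f k' = Nul T Z X" using Y Z by blast
   then have "Cmp T Y Y X f (Cmp T Y Z Y k' k) = Nul T Y X"
    using O Z(2,3) that by (simp add: Cmp_assoc Cmp_Nul_left)
   then show ?thesis using O that by (simp add: Z(4) Cmp_Ident_right)
  qed
  then have "is_zero T X" using L_generated[OF X] by blast
  then show ?thesis using X L_Ob by (auto simp: is_zero_def)
 qed
 have sm: "\<kappa>_small_object U \<kappa> ?F Y" if Y: "Y \<in> R \<inter> L" for Y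
  unfolding \<kappa>_small_object_def full_subcategory_simps
 proof (intro allI impI)
  fix I :: "'u set" and X P \<iota> f
  assume I: "small U I" and X: "\<forall>i\<in>I. X i \<in> L" and P: "is_coproduct ?F I X P \<iota>" and f: "f \<in> Arr T Y P"
  have P': "is_coproduct T I X P \<iota>" using full_subcategory_coproducts[OF L I, of X] X P by blast
  have XO: "\<And>i. i \<in> I \<Longrightarrow> X i \<in> Ob T" using X L_Ob by blast
  have Ysm: "\<kappa>_small_object U \<kappa> T Y" using Sm_small Y R(2) by blast
  obtain J Q \<iota>' g h where J: "J \<subseteq> I" "|J| <o \<kappa>" "is_coproduct T J X Q \<iota>'" "g \<in> Arr T Y Q" "h \<in> Arr T Q P"
   "\<forall>i\<in>J. Cmp T (X i) Q P h (\<iota>' i) = \<iota> i" "f = Cmp T Y Q P h g"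
   using Ysm[unfolded \<kappa>_small_object_def, rule_format, OF I _ P' f] XO by blast
  then have "is_coproduct ?F J X Q \<iota>'"
   using full_subcategory_coproducts[OF L lt_\<kappa>_small[OF J(2)], of X] X J(1) by blast
  with J show "\<exists>J Q \<iota>' g h. J \<subseteq> I \<and> |J| <o \<kappa> \<and> is_coproduct ?F J X Q \<iota>' \<and> g \<in> Arr T Y Q \<and> h \<in> Arr T Q P \<and>
   (\<forall>i\<in>J. Cmp T (X i) Q P h (\<iota>' i) = \<iota> i) \<and> f = Cmp T Y Q P h g" by blast
 qed
 have fac: "\<exists>Y' f' Q \<iota>' g h. (\<forall>i\<in>I. Y' i \<in> R \<inter> L \<and> f' i \<in> Arr T (Y' i) (X i)) \<and> is_coproduct ?F I Y' Q \<iota>' \<and>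
   g \<in> Arr T Y Q \<and> h \<in> Arr T Q P \<and>
   (\<forall>i\<in>I. Cmp T (Y' i) Q P h (\<iota>' i) = Cmp T (Y' i) (X i) P (\<iota> i) (f' i)) \<and> f = Cmp T Y Q P h g"
  if Y: "Y \<in> R \<inter> L" and I: "small U I" and X: "\<forall>i\<in>I. X i \<in> L" and P: "is_coproduct ?F I X P \<iota>" and f: "f \<in> Arr T Y P"
  for Y and I :: "'u set" and X P \<iota> f
 proof -
  have P': "is_coproduct T I X P \<iota>" using full_subcategory_coproducts[OF L I, of X] X P by blast
  have XO: "\<And>i. i \<in> I \<Longrightarrow> X i \<in> Ob T" using X L_Ob by blast
  have YO: "Y \<in> Ob T" using Y L_Ob by blast
  obtain C c Q \<iota>1 g h where C: "\<And>i. i \<in> I \<Longrightarrow> C i \<in> Sm" "\<And>i. i \<in> I \<Longrightarrow> c i \<in> Arr T (C i) (X i)"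
   and Q: "is_coproduct T I C Q \<iota>1" "g \<in> Arr T Y Q" "h \<in> Arr T Q P"
    "\<And>i. i \<in> I \<Longrightarrow> Cmp T (C i) Q P h (\<iota>1 i) = Cmp T (C i) (X i) P (\<iota> i) (c i)" "f = Cmp T Y Q P h g"
   using Sm_factor[OF _ I XO P' f] Y R(2) by blast
  \<comment> \<open>The objects \<open>C i\<close> from \<open>Sm_factor\<close> may lie outside
    \<open>L\<close>. Since \<open>X i\<close> is in \<open>L\<close>, each \<open>c i\<close>
    factors once more through an object of \<open>Sm \<inter> L\<close>, which is then exchanged for
    its representative.\<close>
  have "\<forall>i\<in>I. \<exists>Z a b. Z \<in> R \<inter> L \<and> a \<in> Arr T (C i) Z \<and> b \<in> Arr T Z (X i) \<and> c i = Cmp T (C i) Z (X i) b a"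
  proof
   fix i assume i: "i \<in> I"
   have "factors (C i) (X i) (c i)" using L_factors X C i by blast
   then obtain Z a b where Z: "Z \<in> Sm" "Z \<in> L" "a \<in> Arr T (C i) Z" "b \<in> Arr T Z (X i)" "c i = Cmp T (C i) Z (X i) b a"
    by (auto simp: factors_def)
   obtain V k k' where V: "V \<in> R \<inter> L" "k \<in> Arr T Z V" "k' \<in> Arr T V Z" "Cmp T Z V Z k' k = Ident T Z"
    using R_iso[OF Z(1,2)] by blast
   have O: "C i \<in> Ob T" "Z \<in> Ob T" "V \<in> Ob T" "X i \<in> Ob T" using i XO C SmO Z V L_Ob by auto
   have "Cmp T (C i) V (X i) (Cmp T V Z (X i) b k') (Cmp T (C i) Z V k a) =
     Cmp T (C i) Z (X i) b (Cmp T (C i) Z Z (Cmp T Z V Z k' k) a)"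
    using O Z(3,4) V(2,3) by (simp add: Cmp_assoc closed)
   then have "c i = Cmp T (C i) V (X i) (Cmp T V Z (X i) b k') (Cmp T (C i) Z V k a)"
    using O Z V(4) by (simp add: Cmp_Ident_left)
   then show "\<exists>Z a b. Z \<in> R \<inter> L \<and> a \<in> Arr T (C i) Z \<and> b \<in> Arr T Z (X i) \<and> c i = Cmp T (C i) Z (X i) b a"
    using O Z V Cmp_closed by blast
  qed
  then obtain Z a b where Z: "\<And>i. i \<in> I \<Longrightarrow> Z i \<in> R \<inter> L" "\<And>i. i \<in> I \<Longrightarrow> a i \<in> Arr T (C i) (Z i)"
   "\<And>i. i \<in> I \<Longrightarrow> b i \<in> Arr T (Z i) (X i)" "\<And>i. i \<in> I \<Longrightarrow> c i = Cmp T (C i) (Z i) (X i) (b i) (a i)" by metis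
  have ZO: "\<And>i. i \<in> I \<Longrightarrow> Z i \<in> Ob T" using Z(1) L_Ob by blast
  obtain V \<iota>2 where V: "is_coproduct T I Z V \<iota>2" using has_coproducts I ZO unfolding has_coproducts_def by meson
  have O: "P \<in> Ob T" "Q \<in> Ob T" "V \<in> Ob T" using P' Q(1) V by (auto simp: is_coproduct_def)
  have Oi: "C i \<in> Ob T" "Z i \<in> Ob T" "X i \<in> Ob T" if "i \<in> I" for i using that C(1) ZO SmO XO by auto
  have \<iota>: "\<iota> i \<in> Arr T (X i) P" "\<iota>1 i \<in> Arr T (C i) Q" "\<iota>2 i \<in> Arr T (Z i) V" if "i \<in> I" for i
   using that P' Q(1) V by (auto simp: is_coproduct_def)
  obtain \<alpha> where \<alpha>: "\<alpha> \<in> Arr T Q V" "\<And>i. i \<in> I \<Longrightarrow> Cmp T (C i) Q V \<alpha> (\<iota>1 i) = Cmp T (C i) (Z i) V (\<iota>2 i) (a i)"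
   using coproduct_map[OF Q(1) O(3), of "\<lambda>i. Cmp T (C i) (Z i) V (\<iota>2 i) (a i)"] Oi \<iota> Z(2) O(3) Cmp_closed by blast
  obtain \<beta> where \<beta>: "\<beta> \<in> Arr T V P" "\<And>i. i \<in> I \<Longrightarrow> Cmp T (Z i) V P \<beta> (\<iota>2 i) = Cmp T (Z i) (X i) P (\<iota> i) (b i)"
   using coproduct_map[OF V O(1), of "\<lambda>i. Cmp T (Z i) (X i) P (\<iota> i) (b i)"] Oi \<iota> Z(3) O(1) Cmp_closed by blast
  have "h = Cmp T Q V P \<beta> \<alpha>"
  proof (rule coproduct_eq[OF Q(1) Oi(1) O(1) Q(3)])
   show "Cmp T Q V P \<beta> \<alpha> \<in> Arr T Q P" using O \<alpha> \<beta> by (simp add: closed)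
   fix i assume i: "i \<in> I"
   have "Cmp T (C i) Q P (Cmp T Q V P \<beta> \<alpha>) (\<iota>1 i) = Cmp T (C i) (Z i) P (Cmp T (Z i) V P \<beta> (\<iota>2 i)) (a i)"
    using i O Oi \<iota> Z(2) \<alpha> \<beta>(1) by (simp add: Cmp_assoc[symmetric])
   also have "\<dots> = Cmp T (C i) (X i) P (\<iota> i) (c i)"
    using i O Oi \<iota> Z(2,3) by (simp add: \<beta>(2) Z(4) Cmp_assoc)
   finally show "Cmp T (C i) Q P h (\<iota>1 i) = Cmp T (C i) Q P (Cmp T Q V P \<beta> \<alpha>) (\<iota>1 i)" using Q(4) i by simp
  qed
  then have "f = Cmp T Y V P \<beta> (Cmp T Y Q V \<alpha> g)" using O YO \<alpha>(1) \<beta>(1) Q(2,5) by (simp add: Cmp_assoc)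
  moreover have "Cmp T Y Q V \<alpha> g \<in> Arr T Y V" using O YO \<alpha>(1) Q(2) by (simp add: closed)
  moreover have "is_coproduct ?F I Z V \<iota>2" using full_subcategory_coproducts[OF L I, of Z] Z(1) V by blast
  ultimately show ?thesis using Z \<beta> by blast
 qed
 show ?thesis
  unfolding \<kappa>_well_generated_def full_subcategory_simps
 proof (intro conjI full_subcategory_with_coproducts[OF L] exI[of _ "R \<inter> L"])
  show "R \<inter> L \<subseteq> L" by blast
  show "small U (R \<inter> L)" by (rule small)
  show "\<forall>X\<in>L. (\<forall>Y\<in>R \<inter> L. Arr T Y X = {Nul T Y X}) \<longrightarrow> is_zero ?F X" using gen by blast
  show "\<forall>Y\<in>R \<inter> L. \<kappa>_small_object U \<kappa> ?F Y" using sm by blast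
 qed (intro ballI allI impI, rule fac)
qed

end

end

section \<open>Filtered colimits of abelian groups\<close>

locale small_filtered_category = universe U + J: category J
 for U :: "'u set" and J :: "('u, 'u) cat" +
 assumes small_J: "small_category U J" and filtered_J: "filtered J"
begin

lemma filtered_span:
 assumes "j \<in> Ob J" "k \<in> Ob J" "l \<in> Ob J" "\<alpha> \<in> Arr J j k" "\<beta> \<in> Arr J j l"
 obtains m \<gamma> \<delta> where "m \<in> Ob J" "\<gamma> \<in> Arr J k m" "\<delta> \<in> Arr J l m" "Cmp J j k m \<gamma> \<alpha> = Cmp J j l m \<delta> \<beta>"
proof -
 obtain p \<gamma> \<delta> where p: "p \<in> Ob J" "\<gamma> \<in> Arr J k p" "\<delta> \<in> Arr J l p"
  using filtered_J assms unfolding filtered_def by blast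
 then obtain m \<epsilon> where m: "m \<in> Ob J" "\<epsilon> \<in> Arr J p m"
  "Cmp J j p m \<epsilon> (Cmp J j k p \<gamma> \<alpha>) = Cmp J j p m \<epsilon> (Cmp J j l p \<delta> \<beta>)"
  using filtered_J assms J.Cmp_closed unfolding filtered_def by metis
 show thesis
  by (rule that[of m "Cmp J k p m \<epsilon> \<gamma>" "Cmp J l p m \<epsilon> \<delta>"])
   (use m p assms in \<open>simp_all add: J.Cmp_closed J.Cmp_assoc[symmetric]\<close>)
qed

lemma filtered_coequalize:
 assumes "j \<in> Ob J" "k \<in> Ob J" "\<alpha> \<in> Arr J j k" "\<beta> \<in> Arr J j k"
 obtains m \<gamma> where "m \<in> Ob J" "\<gamma> \<in> Arr J k m" "Cmp J j k m \<gamma> \<alpha> = Cmp J j k m \<gamma> \<beta>"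
 using filtered_J assms unfolding filtered_def by metis

end

text \<open>The colimit is constructed from germs, because its elements have to be encoded in
  \<open>'u\<close> for the group to be an object of \<open>Ab U\<close>. It serves as the target of
  a cocone that separates elements with distinct germs.\<close>

locale filtered_groups = small_filtered_category U J
 for U :: "'u set" and J :: "('u, 'u) cat" +
 fixes H :: "'u \<Rightarrow> 'u monoid" and \<phi> :: "'u \<Rightarrow> 'u \<Rightarrow> 'u \<Rightarrow> 'u \<Rightarrow> 'u"
 assumes group_H: "j \<in> Ob J \<Longrightarrow> comm_group (H j)"
  and small_H: "j \<in> Ob J \<Longrightarrow> small U (carrier (H j))"
  and \<phi>_hom: "\<lbrakk>j \<in> Ob J; k \<in> Ob J; \<alpha> \<in> Arr J j k\<rbrakk> \<Longrightarrow> \<phi> j k \<alpha> \<in> hom (H j) (H k)"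
  and \<phi>_Ident: "\<lbrakk>j \<in> Ob J; x \<in> carrier (H j)\<rbrakk> \<Longrightarrow> \<phi> j j (Ident J j) x = x"
  and \<phi>_Cmp: "\<lbrakk>j \<in> Ob J; k \<in> Ob J; l \<in> Ob J; \<alpha> \<in> Arr J j k; \<beta> \<in> Arr J k l; x \<in> carrier (H j)\<rbrakk>
   \<Longrightarrow> \<phi> j l (Cmp J j k l \<beta> \<alpha>) x = \<phi> k l \<beta> (\<phi> j k \<alpha> x)"
begin

definition pts :: "('u \<times> 'u) set" where "pts = (SIGMA j : Ob J. carrier (H j))"

definition germ_rel :: "'u \<times> 'u \<Rightarrow> 'u \<times> 'u \<Rightarrow> bool" where
 "germ_rel p q \<longleftrightarrow> (\<exists>l\<in>Ob J. \<exists>\<alpha>\<in>Arr J (fst p) l. \<exists>\<beta>\<in>Arr J (fst q) l.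
   \<phi> (fst p) l \<alpha> (snd p) = \<phi> (fst q) l \<beta> (snd q))"

lemma \<phi>_closed: "\<lbrakk>j \<in> Ob J; k \<in> Ob J; \<alpha> \<in> Arr J j k; x \<in> carrier (H j)\<rbrakk> \<Longrightarrow> \<phi> j k \<alpha> x \<in> carrier (H k)"
 using \<phi>_hom hom_in_carrier by metis

lemma germ_rel_refl: "p \<in> pts \<Longrightarrow> germ_rel p p"
 unfolding germ_rel_def pts_def using J.Ident_closed by fastforce

lemma germ_rel_sym: "germ_rel p q \<Longrightarrow> germ_rel q p"
 unfolding germ_rel_def by metis

lemma germ_rel_trans:
 assumes "germ_rel p q" "germ_rel q r" "p \<in> pts" "q \<in> pts" "r \<in> pts" shows "germ_rel p r"
proof -
 obtain l \<alpha> \<beta> where l: "l \<in> Ob J" "\<alpha> \<in> Arr J (fst p) l" "\<beta> \<in> Arr J (fst q) l"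
  "\<phi> (fst p) l \<alpha> (snd p) = \<phi> (fst q) l \<beta> (snd q)" using assms(1) by (auto simp: germ_rel_def)
 obtain n \<gamma> \<delta> where n: "n \<in> Ob J" "\<gamma> \<in> Arr J (fst q) n" "\<delta> \<in> Arr J (fst r) n"
  "\<phi> (fst q) n \<gamma> (snd q) = \<phi> (fst r) n \<delta> (snd r)" using assms(2) by (auto simp: germ_rel_def)
 have O: "fst p \<in> Ob J" "fst q \<in> Ob J" "fst r \<in> Ob J" "snd p \<in> carrier (H (fst p))"
  "snd q \<in> carrier (H (fst q))" "snd r \<in> carrier (H (fst r))" using assms by (auto simp: pts_def)
 obtain m \<epsilon> \<zeta> where m: "m \<in> Ob J" "\<epsilon> \<in> Arr J l m" "\<zeta> \<in> Arr J n m"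
  "Cmp J (fst q) l m \<epsilon> \<beta> = Cmp J (fst q) n m \<zeta> \<gamma>"
  using filtered_span[OF O(2) l(1) n(1) l(3) n(2)] by metis
 have "\<phi> (fst p) m (Cmp J (fst p) l m \<epsilon> \<alpha>) (snd p) = \<phi> (fst q) m (Cmp J (fst q) l m \<epsilon> \<beta>) (snd q)"
  using O l m(1,2) by (simp add: \<phi>_Cmp)
 also have "\<dots> = \<phi> (fst r) m (Cmp J (fst r) n m \<zeta> \<delta>) (snd r)"
  unfolding m(4) using O n m(1-3) by (simp add: \<phi>_Cmp)
 finally show ?thesis unfolding germ_rel_def using O l n m J.Cmp_closed by blast
qed

definition germ :: "'u \<Rightarrow> 'u \<Rightarrow> ('u \<times> 'u) set" where "germ j x = {p \<in> pts. germ_rel p (j, x)}"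

lemma germ_eq_iff:
 assumes "(j, x) \<in> pts" "(k, y) \<in> pts" shows "germ j x = germ k y \<longleftrightarrow> germ_rel (j, x) (k, y)"
proof
 show "germ j x = germ k y \<Longrightarrow> germ_rel (j, x) (k, y)"
  using germ_rel_refl[OF assms(1)] assms by (auto simp: germ_def)
 show "germ_rel (j, x) (k, y) \<Longrightarrow> germ j x = germ k y"
 proof -
  assume r: "germ_rel (j, x) (k, y)"
  have "germ_rel p (j, x) \<longleftrightarrow> germ_rel p (k, y)" if "p \<in> pts" for p
   using germ_rel_trans[OF _ r that assms] germ_rel_trans[OF _ germ_rel_sym[OF r] that assms(2,1)] by blast
  then show "germ j x = germ k y" by (auto simp: germ_def)
 qed
qed

lemma small_germs: "small U ((\<lambda>(j, x). germ j x) ` pts)"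
 unfolding small_def pts_def
 by (intro lt_image lt_Sigma) (use small_J small_H in \<open>auto simp: small_category_def small_def\<close>)

definition enc :: "('u \<times> 'u) set \<Rightarrow> 'u" where "enc = (SOME f. inj_on f ((\<lambda>(j, x). germ j x) ` pts))"

definition gm :: "'u \<Rightarrow> 'u \<Rightarrow> 'u" where "gm j x = enc (germ j x)"

lemma gm_eq_iff: assumes "(j, x) \<in> pts" "(k, y) \<in> pts" shows "gm j x = gm k y \<longleftrightarrow> germ_rel (j, x) (k, y)"
proof -
 obtain f :: "('u \<times> 'u) set \<Rightarrow> 'u" where "inj_on f ((\<lambda>(j, x). germ j x) ` pts)" by (rule small_ex_inj[OF small_germs])
 then have "inj_on enc ((\<lambda>(j, x). germ j x) ` pts)" unfolding enc_def by (rule someI[where P = "\<lambda>f. inj_on f ((\<lambda>(j, x). germ j x) ` pts)"])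
 then have "enc (germ j x) = enc (germ k y) \<longleftrightarrow> germ j x = germ k y"
  by (rule inj_on_eq_iff) (use assms in force)+
 then show ?thesis using germ_eq_iff[OF assms] by (simp add: gm_def)
qed

lemma gm_\<phi>:
 assumes "j \<in> Ob J" "k \<in> Ob J" "\<alpha> \<in> Arr J j k" "x \<in> carrier (H j)" shows "gm k (\<phi> j k \<alpha> x) = gm j x"
proof -
 have p: "(j, x) \<in> pts" "(k, \<phi> j k \<alpha> x) \<in> pts" using assms \<phi>_closed by (auto simp: pts_def)
 have "germ_rel (k, \<phi> j k \<alpha> x) (j, x)"
  unfolding germ_rel_def fst_conv snd_conv
  by (intro bexI[of _ k] bexI[of _ "Ident J k"] bexI[of _ \<alpha>])
   (use assms \<phi>_closed \<phi>_Ident J.Ident_closed in simp_all)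
 then show ?thesis using gm_eq_iff p by blast
qed

lemma common_index:
 assumes "p \<in> pts" "q \<in> pts" obtains m x y where "m \<in> Ob J" "x \<in> carrier (H m)" "y \<in> carrier (H m)"
  "gm (fst p) (snd p) = gm m x" "gm (fst q) (snd q) = gm m y"
proof -
 have O: "fst p \<in> Ob J" "fst q \<in> Ob J" "snd p \<in> carrier (H (fst p))" "snd q \<in> carrier (H (fst q))"
  using assms by (auto simp: pts_def)
 obtain m \<alpha> \<beta> where m: "m \<in> Ob J" "\<alpha> \<in> Arr J (fst p) m" "\<beta> \<in> Arr J (fst q) m"
  using filtered_J O unfolding filtered_def by blast
 show thesis by (rule that[OF m(1) _ _ gm_\<phi>[symmetric] gm_\<phi>[symmetric]]) (use O m \<phi>_closed in auto)
qed

text \<open>The two equalities are witnessed at different indices and along different arrows.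
  \<open>filtered_span\<close> makes the arrows out of \<open>m\<close> agree,
  \<open>filtered_coequalize\<close> those out of \<open>n\<close>; at the index \<open>r\<close>
  both equalities hold along the same pair \<open>?a\<close>, \<open>?b\<close>, whose transition
  maps are homomorphisms.\<close>

lemma gm_add_cong:
 assumes "m \<in> Ob J" "x \<in> carrier (H m)" "y \<in> carrier (H m)" "n \<in> Ob J" "x' \<in> carrier (H n)" "y' \<in> carrier (H n)"
  and eq: "gm m x = gm n x'" "gm m y = gm n y'"
 shows "gm m (x \<otimes>\<^bsub>H m\<^esub> y) = gm n (x' \<otimes>\<^bsub>H n\<^esub> y')"
proof -
 have p: "(m, x) \<in> pts" "(m, y) \<in> pts" "(n, x') \<in> pts" "(n, y') \<in> pts" using assms by (auto simp: pts_def)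
 obtain l1 \<alpha>1 \<beta>1 where 1: "l1 \<in> Ob J" "\<alpha>1 \<in> Arr J m l1" "\<beta>1 \<in> Arr J n l1" "\<phi> m l1 \<alpha>1 x = \<phi> n l1 \<beta>1 x'"
  using eq(1) gm_eq_iff p by (auto simp: germ_rel_def)
 obtain l2 \<alpha>2 \<beta>2 where 2: "l2 \<in> Ob J" "\<alpha>2 \<in> Arr J m l2" "\<beta>2 \<in> Arr J n l2" "\<phi> m l2 \<alpha>2 y = \<phi> n l2 \<beta>2 y'"
  using eq(2) gm_eq_iff p by (auto simp: germ_rel_def)
 obtain q \<gamma>1 \<gamma>2 where q: "q \<in> Ob J" "\<gamma>1 \<in> Arr J l1 q" "\<gamma>2 \<in> Arr J l2 q" "Cmp J m l1 q \<gamma>1 \<alpha>1 = Cmp J m l2 q \<gamma>2 \<alpha>2"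
  using filtered_span[OF assms(1) 1(1) 2(1) 1(2) 2(2)] by metis
 obtain r \<delta> where r: "r \<in> Ob J" "\<delta> \<in> Arr J q r"
  "Cmp J n q r \<delta> (Cmp J n l1 q \<gamma>1 \<beta>1) = Cmp J n q r \<delta> (Cmp J n l2 q \<gamma>2 \<beta>2)"
  using filtered_coequalize[OF assms(4) q(1), of "Cmp J n l1 q \<gamma>1 \<beta>1" "Cmp J n l2 q \<gamma>2 \<beta>2"]
   J.Cmp_closed assms 1 2 q by metis
 let ?a = "Cmp J m q r \<delta> (Cmp J m l1 q \<gamma>1 \<alpha>1)"
 let ?b = "Cmp J n q r \<delta> (Cmp J n l1 q \<gamma>1 \<beta>1)"
 have ab: "?a \<in> Arr J m r" "?b \<in> Arr J n r" using assms(1,4) 1 q(1-3) r(1,2) by (simp_all add: J.Cmp_closed)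
 have x: "\<phi> m r ?a x = \<phi> n r ?b x'"
  using assms 1 q(1-3) r(1,2) by (simp add: \<phi>_Cmp \<phi>_closed J.Cmp_closed)
 have "\<phi> m r ?a y = \<phi> q r \<delta> (\<phi> l2 q \<gamma>2 (\<phi> m l2 \<alpha>2 y))"
  unfolding q(4) using assms 2 q(1-3) r(1,2) by (simp add: \<phi>_Cmp \<phi>_closed J.Cmp_closed)
 also have "\<dots> = \<phi> n r (Cmp J n q r \<delta> (Cmp J n l2 q \<gamma>2 \<beta>2)) y'"
  using assms 2 q(1-3) r(1,2) by (simp add: \<phi>_Cmp \<phi>_closed J.Cmp_closed)
 finally have y: "\<phi> m r ?a y = \<phi> n r ?b y'" using r(3) by simp
 have cl: "x \<otimes>\<^bsub>H m\<^esub> y \<in> carrier (H m)" "x' \<otimes>\<^bsub>H n\<^esub> y' \<in> carrier (H n)"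
  using comm_group.axioms(2)[OF group_H] assms group.subgroup_self subgroup.m_closed by metis+
 have "\<phi> m r ?a (x \<otimes>\<^bsub>H m\<^esub> y) = \<phi> n r ?b (x' \<otimes>\<^bsub>H n\<^esub> y')"
  using hom_mult[OF \<phi>_hom[OF assms(1) r(1) ab(1)]] hom_mult[OF \<phi>_hom[OF assms(4) r(1) ab(2)]] assms x y by simp
 then have "germ_rel (m, x \<otimes>\<^bsub>H m\<^esub> y) (n, x' \<otimes>\<^bsub>H n\<^esub> y')"
  unfolding germ_rel_def using ab r(1) by auto
 then show ?thesis using gm_eq_iff cl assms by (simp add: pts_def)
qed

text \<open>Two germs are added at any common index; such an index exists by
  \<open>common_index\<close>, and the choice is immaterial by \<open>gm_add_cong\<close>.\<close>

definition limit_group :: "'u monoid" where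
 "limit_group = \<lparr>carrier = (\<lambda>(j, x). gm j x) ` pts,
   mult = \<lambda>u v. SOME w. \<exists>m x y. m \<in> Ob J \<and> x \<in> carrier (H m) \<and> y \<in> carrier (H m) \<and>
    u = gm m x \<and> v = gm m y \<and> w = gm m (x \<otimes>\<^bsub>H m\<^esub> y),
   one = SOME w. \<exists>m\<in>Ob J. w = gm m \<one>\<^bsub>H m\<^esub>\<rparr>"

lemma limit_mult:
 assumes "m \<in> Ob J" "x \<in> carrier (H m)" "y \<in> carrier (H m)"
 shows "gm m x \<otimes>\<^bsub>limit_group\<^esub> gm m y = gm m (x \<otimes>\<^bsub>H m\<^esub> y)"
 unfolding limit_group_def monoid.select_convs
proof (rule some_equality)
 show "w = gm m (x \<otimes>\<^bsub>H m\<^esub> y)" if "\<exists>n x' y'. n \<in> Ob J \<and> x' \<in> carrier (H n) \<and> y' \<in> carrier (H n) \<and>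
   gm m x = gm n x' \<and> gm m y = gm n y' \<and> w = gm n (x' \<otimes>\<^bsub>H n\<^esub> y')" for w
  using that gm_add_cong[OF assms] by metis
qed (use assms in blast)

lemma limit_one: assumes "m \<in> Ob J" shows "\<one>\<^bsub>limit_group\<^esub> = gm m \<one>\<^bsub>H m\<^esub>"
proof -
 have "gm m \<one>\<^bsub>H m\<^esub> = gm n \<one>\<^bsub>H n\<^esub>" if mn: "m \<in> Ob J" "n \<in> Ob J" for m n
 proof -
  have g: "group (H j)" if "j \<in> Ob J" for j using group_H[OF that] comm_group.axioms(2) by blast
  obtain l \<alpha> \<beta> where l: "l \<in> Ob J" "\<alpha> \<in> Arr J m l" "\<beta> \<in> Arr J n l"
   using filtered_J mn unfolding filtered_def by blast
  then have "\<phi> m l \<alpha> \<one>\<^bsub>H m\<^esub> = \<one>\<^bsub>H l\<^esub>" "\<phi> n l \<beta> \<one>\<^bsub>H n\<^esub> = \<one>\<^bsub>H l\<^esub>"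
   using hom_one[OF \<phi>_hom] mn g by blast+
  moreover have "\<one>\<^bsub>H m\<^esub> \<in> carrier (H m)" "\<one>\<^bsub>H n\<^esub> \<in> carrier (H n)"
   using g mn group.is_monoid monoid.one_closed by blast+
  ultimately show ?thesis
   using gm_\<phi>[OF mn(1) l(1,2), of "\<one>\<^bsub>H m\<^esub>"] gm_\<phi>[OF mn(2) l(1,3), of "\<one>\<^bsub>H n\<^esub>"] by simp
 qed
 then have "w = gm m \<one>\<^bsub>H m\<^esub>" if "\<exists>n\<in>Ob J. w = gm n \<one>\<^bsub>H n\<^esub>" for w using that assms by blast
 with assms show ?thesis unfolding limit_group_def monoid.select_convs by (intro some_equality) blast+
qed

lemma limit_group_comm_group: "comm_group limit_group"
proof -
 have car: "carrier limit_group = (\<lambda>(j, x). gm j x) ` pts" by (simp add: limit_group_def)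
 have g: "comm_group (H j)" "group (H j)" "monoid (H j)" if "j \<in> Ob J" for j
  using group_H[OF that] comm_group.axioms(2) group.is_monoid by blast+
 have gm_car: "gm m x \<in> carrier limit_group" if "m \<in> Ob J" "x \<in> carrier (H m)" for m x
  unfolding car using that by (force simp: pts_def)
 have two: "\<exists>m x y. m \<in> Ob J \<and> x \<in> carrier (H m) \<and> y \<in> carrier (H m) \<and> u = gm m x \<and> v = gm m y"
  if uv: "u \<in> carrier limit_group" "v \<in> carrier limit_group" for u v
 proof -
  obtain p q where "p \<in> pts" "q \<in> pts" "u = gm (fst p) (snd p)" "v = gm (fst q) (snd q)"
   using uv unfolding car by force
  then show ?thesis using common_index by metis
 qed
 show ?thesis
 proof (rule comm_groupI)
  show "\<one>\<^bsub>limit_group\<^esub> \<in> carrier limit_group"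
   using filtered_J limit_one gm_car g(3) monoid.one_closed unfolding filtered_def by (metis all_not_in_conv)
  fix u v assume uv: "u \<in> carrier limit_group" "v \<in> carrier limit_group"
  obtain m x y where m: "m \<in> Ob J" "x \<in> carrier (H m)" "y \<in> carrier (H m)" "u = gm m x" "v = gm m y"
   using two[OF uv] by blast
  interpret comm_group "H m" using g m by blast
  show "u \<otimes>\<^bsub>limit_group\<^esub> v \<in> carrier limit_group" using m by (simp add: limit_mult gm_car)
  show "u \<otimes>\<^bsub>limit_group\<^esub> v = v \<otimes>\<^bsub>limit_group\<^esub> u" using m by (simp add: limit_mult m_comm)
  show "\<one>\<^bsub>limit_group\<^esub> \<otimes>\<^bsub>limit_group\<^esub> u = u" using m by (simp add: limit_mult limit_one)
  have "gm m (inv\<^bsub>H m\<^esub> x) \<otimes>\<^bsub>limit_group\<^esub> u = \<one>\<^bsub>limit_group\<^esub>"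
   using m limit_mult[OF m(1), of "inv\<^bsub>H m\<^esub> x" x] by (simp add: limit_one)
  then show "\<exists>y\<in>carrier limit_group. y \<otimes>\<^bsub>limit_group\<^esub> u = \<one>\<^bsub>limit_group\<^esub>"
   using gm_car m by blast
  fix w assume w: "w \<in> carrier limit_group"
  obtain n z where n: "n \<in> Ob J" "z \<in> carrier (H n)" "w = gm n z" using w unfolding car by (auto simp: pts_def)
  obtain l \<alpha> \<beta> where l: "l \<in> Ob J" "\<alpha> \<in> Arr J m l" "\<beta> \<in> Arr J n l"
   using filtered_J m n unfolding filtered_def by blast
  have e: "u = gm l (\<phi> m l \<alpha> x)" "v = gm l (\<phi> m l \<alpha> y)" "w = gm l (\<phi> n l \<beta> z)"
   using m n l by (simp_all add: gm_\<phi>)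
  have c: "\<phi> m l \<alpha> x \<in> carrier (H l)" "\<phi> m l \<alpha> y \<in> carrier (H l)" "\<phi> n l \<beta> z \<in> carrier (H l)"
   using \<phi>_closed m n l by metis+
  interpret l: comm_group "H l" using g l by blast
  show "u \<otimes>\<^bsub>limit_group\<^esub> v \<otimes>\<^bsub>limit_group\<^esub> w = u \<otimes>\<^bsub>limit_group\<^esub> (v \<otimes>\<^bsub>limit_group\<^esub> w)"
   unfolding e using l(1) c by (simp add: limit_mult l.m_assoc)
 qed
qed

lemma limit_group_Ab: "limit_group \<in> Ob (Ab U)"
proof -
 have "|(\<lambda>(j, x). gm j x) ` pts| <o |U|"
  using lt_image[OF small_germs[unfolded small_def], of enc] by (simp add: image_image gm_def case_prod_beta')
 then show ?thesis using limit_group_comm_group by (simp add: Ab_def small_def limit_group_def)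
qed

lemma gm_hom: assumes "j \<in> Ob J" shows "(\<lambda>x\<in>carrier (H j). gm j x) \<in> hom (H j) limit_group"
proof (rule homI)
 have m: "monoid (H j)" using group_H[OF assms] comm_group.axioms(2) group.is_monoid by blast
 fix x y assume x: "x \<in> carrier (H j)"
 then show "(\<lambda>x\<in>carrier (H j). gm j x) x \<in> carrier limit_group"
  using assms by (force simp: limit_group_def pts_def)
 assume "y \<in> carrier (H j)"
 then show "(\<lambda>x\<in>carrier (H j). gm j x) (x \<otimes>\<^bsub>H j\<^esub> y) =
   (\<lambda>x\<in>carrier (H j). gm j x) x \<otimes>\<^bsub>limit_group\<^esub> (\<lambda>x\<in>carrier (H j). gm j x) y"
  using x assms limit_mult monoid.m_closed[OF m] by simp
qed

end

section \<open>Elements of objects of a finitely accessible category\<close>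

lemma is_colimit_map:
 assumes "is_colimit J C F L c" "is_cocone J C F M d"
 obtains h where "h \<in> Arr C L M" "\<And>j. j \<in> Ob J \<Longrightarrow> Cmp C (fob F j) L M h (c j) = d j"
proof -
 have "\<exists>!h. h \<in> Arr C L M \<and> (\<forall>j\<in>Ob J. Cmp C (fob F j) L M h (c j) = d j)"
  using assms(1)[unfolded is_colimit_def, THEN conjunct2, rule_format, OF assms(2)] .
 then obtain h where "h \<in> Arr C L M \<and> (\<forall>j\<in>Ob J. Cmp C (fob F j) L M h (c j) = d j)" by (rule ex1E)
 then show thesis by (intro that[of h]) simp_all
qed

locale finitely_accessible_category = universe U + additive_category B
 for U :: "'u set" and B :: "('o, 'u) preadd_cat" +
 fixes A :: "'o set"
 assumes locally_small_B: "locally_small U B"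
  and filtered_colimits: "has_filtered_colimits U B"
  and small_A: "small U A"
  and A_presentable: "a \<in> A \<Longrightarrow> finitely_presentable U B a"
  and A_colimits: "X \<in> Ob B \<Longrightarrow> \<exists>J F c. filtered_diagram U J B F \<and> (\<forall>j\<in>Ob J. fob F j \<in> A) \<and> is_colimit J B F X c"
begin

lemmas closed = Cmp_closed Ident_closed Nul_closed Neg_closed hom_closed

lemma A_Ob: "a \<in> A \<Longrightarrow> a \<in> Ob B"
 using A_presentable by (simp add: finitely_presentable_def)

lemma small_hom: "X \<in> Ob B \<Longrightarrow> Y \<in> Ob B \<Longrightarrow> small U (Arr B X Y)"
 using locally_small_B by (simp add: locally_small_def)

lemma hom_group_simps [simp]:
 "carrier (hom_group B X Y) = Arr B X Y" "mult (hom_group B X Y) = Add B X Y" "one (hom_group B X Y) = Nul B X Y"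
 by (simp_all add: hom_group_def)

lemma diagramD:
 assumes "filtered_diagram U J B F"
 shows "small_filtered_category U J" "is_functor J B F" "\<And>j. j \<in> Ob J \<Longrightarrow> fob F j \<in> Ob B"
  "\<And>j k \<alpha>. \<lbrakk>j \<in> Ob J; k \<in> Ob J; \<alpha> \<in> Arr J j k\<rbrakk> \<Longrightarrow> fmor F j k \<alpha> \<in> Arr B (fob F j) (fob F k)"
  "\<And>j. j \<in> Ob J \<Longrightarrow> fmor F j j (Ident J j) = Ident B (fob F j)"
  "\<And>j k l \<alpha> \<beta>. \<lbrakk>j \<in> Ob J; k \<in> Ob J; l \<in> Ob J; \<alpha> \<in> Arr J j k; \<beta> \<in> Arr J k l\<rbrakk> \<Longrightarrow>
   fmor F j l (Cmp J j k l \<beta> \<alpha>) = Cmp B (fob F j) (fob F k) (fob F l) (fmor F k l \<beta>) (fmor F j k \<alpha>)"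
proof -
 show "small_filtered_category U J"
  using assms by (intro small_filtered_category.intro small_filtered_category_axioms.intro universe_axioms)
   (auto simp: filtered_diagram_def small_category_def)
 show "is_functor J B F" using assms by (simp add: filtered_diagram_def)
 then show "\<And>j. j \<in> Ob J \<Longrightarrow> fob F j \<in> Ob B"
  "\<And>j k \<alpha>. \<lbrakk>j \<in> Ob J; k \<in> Ob J; \<alpha> \<in> Arr J j k\<rbrakk> \<Longrightarrow> fmor F j k \<alpha> \<in> Arr B (fob F j) (fob F k)"
  "\<And>j. j \<in> Ob J \<Longrightarrow> fmor F j j (Ident J j) = Ident B (fob F j)"
  "\<And>j k l \<alpha> \<beta>. \<lbrakk>j \<in> Ob J; k \<in> Ob J; l \<in> Ob J; \<alpha> \<in> Arr J j k; \<beta> \<in> Arr J k l\<rbrakk> \<Longrightarrow>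
   fmor F j l (Cmp J j k l \<beta> \<alpha>) = Cmp B (fob F j) (fob F k) (fob F l) (fmor F k l \<beta>) (fmor F j k \<alpha>)"
  unfolding is_functor_def by blast+
qed

lemma colimitD:
 assumes "is_colimit J B F L c"
 shows "L \<in> Ob B" "\<And>j. j \<in> Ob J \<Longrightarrow> c j \<in> Arr B (fob F j) L"
  "\<And>i j \<alpha>. \<lbrakk>i \<in> Ob J; j \<in> Ob J; \<alpha> \<in> Arr J i j\<rbrakk> \<Longrightarrow> Cmp B (fob F i) (fob F j) L (c j) (fmor F i j \<alpha>) = c i"
 using assms by (auto simp: is_colimit_def is_cocone_def)

context
 fixes J F L c a
 assumes diagram: "filtered_diagram U J B F" and colim: "is_colimit J B F L c" and a: "a \<in> A"
begin

interpretation small_filtered_category U J by (rule diagramD[OF diagram])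

lemmas F = diagramD(3-6)[OF diagram]
lemmas c = colimitD[OF colim]

lemma hom_colimit:
 "is_colimit J (Ab U) (func_comp (hom_functor B a) F) (hom_group B a L)
   (\<lambda>j. \<lambda>x\<in>Arr B a (fob F j). Cmp B a (fob F j) L (c j) x)"
 using A_presentable[OF a] diagram colim
 unfolding finitely_presentable_def preserves_filtered_colimits_def by (fastforce simp: hom_functor_def)

text \<open>The elements that factor through some stage form a subgroup \<open>I\<close>, which
  receives the colimit cocone. The induced homomorphism into \<open>I\<close>, followed by the
  inclusion, is compatible with the cocone and thus equals the identity, so \<open>I\<close> is
  everything.\<close>

lemma colimit_factor:
 assumes x: "x \<in> Arr B a L" shows "\<exists>j\<in>Ob J. \<exists>y\<in>Arr B a (fob F j). x = Cmp B a (fob F j) L (c j) y"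
proof -
 define I where "I = {x. \<exists>j\<in>Ob J. \<exists>y\<in>Arr B a (fob F j). x = Cmp B a (fob F j) L (c j) y}"
 note aO = A_Ob[OF a]
 interpret LG: comm_group "hom_group B a L" using aO c by (simp add: hom_group)
 have sub: "subgroup I (hom_group B a L)"
 proof (rule subgroup.intro)
  show "I \<subseteq> carrier (hom_group B a L)" using aO F c by (auto simp: I_def closed)
  obtain j0 where j0: "j0 \<in> Ob J" using filtered_J by (auto simp: filtered_def)
  have "Nul B a L = Cmp B a (fob F j0) L (c j0) (Nul B a (fob F j0))" "Nul B a (fob F j0) \<in> Arr B a (fob F j0)"
   using aO F(1) c j0 by (simp_all add: Cmp_Nul_right closed)
  with j0 show "\<one>\<^bsub>hom_group B a L\<^esub> \<in> I" unfolding I_def by auto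
  show "inv\<^bsub>hom_group B a L\<^esub> x \<in> I" if "x \<in> I" for x
  proof -
   obtain j y where j: "j \<in> Ob J" "y \<in> Arr B a (fob F j)" "x = Cmp B a (fob F j) L (c j) y"
    using \<open>x \<in> I\<close> by (auto simp: I_def)
   then have "Neg B a L x = Cmp B a (fob F j) L (c j) (Neg B a (fob F j) y)"
    using aO F c by (simp add: Cmp_Neg_right)
   then show ?thesis unfolding I_def using j aO F Neg_closed by blast
  qed
  show "x \<otimes>\<^bsub>hom_group B a L\<^esub> x' \<in> I" if "x \<in> I" "x' \<in> I" for x x'
  proof -
   obtain j y where j: "j \<in> Ob J" "y \<in> Arr B a (fob F j)" "x = Cmp B a (fob F j) L (c j) y"
    using \<open>x \<in> I\<close> by (auto simp: I_def)
   obtain k z where k: "k \<in> Ob J" "z \<in> Arr B a (fob F k)" "x' = Cmp B a (fob F k) L (c k) z"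
    using \<open>x' \<in> I\<close> by (auto simp: I_def)
   obtain m \<alpha> \<beta> where m: "m \<in> Ob J" "\<alpha> \<in> Arr J j m" "\<beta> \<in> Arr J k m"
    using filtered_J j(1) k(1) unfolding filtered_def by blast
   let ?y = "Cmp B a (fob F j) (fob F m) (fmor F j m \<alpha>) y" and ?z = "Cmp B a (fob F k) (fob F m) (fmor F k m \<beta>) z"
   have "x = Cmp B a (fob F m) L (c m) ?y" "x' = Cmp B a (fob F m) L (c m) ?z"
    using aO F c j k m by (simp_all add: Cmp_assoc)
   moreover have yz: "?y \<in> Arr B a (fob F m)" "?z \<in> Arr B a (fob F m)"
    using aO F j k m by (simp_all add: closed)
   ultimately have "Add B a L x x' = Cmp B a (fob F m) L (c m) (Add B a (fob F m) ?y ?z)"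
    using aO F c m by (simp add: Cmp_Add_right)
   then show ?thesis unfolding I_def using m(1) yz aO F hom_closed[of a "fob F m" ?y ?z] by auto
  qed
 qed
 let ?G = "(hom_group B a L)\<lparr>carrier := I\<rparr>"
 have IL: "I \<subseteq> Arr B a L" using subgroup.subset[OF sub] by simp
 have G: "comm_group ?G"
  by (rule group.group_comm_groupI[OF LG.subgroup_imp_group[OF sub]])
   (use IL aO c(1) in \<open>auto intro: Add_commute\<close>)
 have "small U I" using small_hom[OF aO c(1)] IL lt_subset by (simp add: small_def)
 then have GO: "?G \<in> Ob (Ab U)" using G by (simp add: Ab_def)
 let ?c = "\<lambda>j. \<lambda>x\<in>Arr B a (fob F j). Cmp B a (fob F j) L (c j) x"
 have coL: "is_cocone J (Ab U) (func_comp (hom_functor B a) F) (hom_group B a L) ?c"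
  using hom_colimit by (simp add: is_colimit_def)
 have c_hom: "?c j \<in> hom (hom_group B a (fob F j)) (hom_group B a L)" if "j \<in> Ob J" for j
  using coL that by (simp add: is_cocone_def Ab_def func_comp_def hom_functor_def)
 have "?c j \<in> hom (hom_group B a (fob F j)) ?G" if "j \<in> Ob J" for j
  using c_hom[OF that] that unfolding hom_def by (auto simp: I_def)
 then have coG: "is_cocone J (Ab U) (func_comp (hom_functor B a) F) ?G ?c"
  using coL GO unfolding is_cocone_def by (simp add: Ab_def func_comp_def hom_functor_def)
 obtain h where h: "h \<in> Arr (Ab U) (hom_group B a L) ?G"
  "\<And>j. j \<in> Ob J \<Longrightarrow> Cmp (Ab U) (fob (func_comp (hom_functor B a) F) j) (hom_group B a L) ?G h (?c j) = ?c j"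
  using is_colimit_map[OF hom_colimit coG] by blast
 have h': "h \<in> hom (hom_group B a L) (hom_group B a L) \<inter> extensional (Arr B a L)"
  using h(1) IL by (auto simp: Ab_def hom_def)
 let ?Q = "\<lambda>h. h \<in> Arr (Ab U) (hom_group B a L) (hom_group B a L) \<and>
   (\<forall>j\<in>Ob J. Cmp (Ab U) (fob (func_comp (hom_functor B a) F) j) (hom_group B a L) (hom_group B a L) h (?c j) = ?c j)"
 have "\<exists>!h. ?Q h" using hom_colimit[unfolded is_colimit_def, THEN conjunct2, rule_format, OF coL] .
 moreover have "?Q h" using h h' by (simp add: Ab_def)
 moreover have "?Q (\<lambda>x\<in>Arr B a L. x)"
  using aO F c by (auto simp: Ab_def func_comp_def hom_functor_def hom_def compose_def fun_eq_iff closed)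
 ultimately have "h = (\<lambda>x\<in>Arr B a L. x)" by (rule Ex1_eq[where P = ?Q])
 then have "h x = x" using x by simp
 moreover have "h x \<in> I" using h(1) x by (auto simp: Ab_def hom_def)
 ultimately show ?thesis by (simp add: I_def)
qed

text \<open>The colimit property of \<open>B(a, L)\<close>, applied to the group of germs, shows
  that elements of a stage with equal images in \<open>B(a, L)\<close> have equal germs. The two
  arrows witnessing this may differ and are coequalized afterwards.\<close>

lemma colimit_eq:
 assumes j: "j \<in> Ob J" and xy: "x \<in> Arr B a (fob F j)" "y \<in> Arr B a (fob F j)"
  and eq: "Cmp B a (fob F j) L (c j) x = Cmp B a (fob F j) L (c j) y"
 shows "\<exists>k\<in>Ob J. \<exists>\<alpha>\<in>Arr J j k. Cmp B a (fob F j) (fob F k) (fmor F j k \<alpha>) x = Cmp B a (fob F j) (fob F k) (fmor F j k \<alpha>) y"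
proof -
 note aO = A_Ob[OF a]
 let ?H = "\<lambda>j. hom_group B a (fob F j)" and ?\<phi> = "\<lambda>j k \<alpha>. Cmp B a (fob F j) (fob F k) (fmor F j k \<alpha>)"
 interpret D: filtered_groups U J ?H ?\<phi>
  by (intro filtered_groups.intro filtered_groups_axioms.intro small_filtered_category_axioms)
   (use aO F in \<open>auto simp: hom_group small_hom hom_def closed Cmp_Add_right Cmp_Ident_left Cmp_assoc\<close>)
 let ?c = "\<lambda>j. \<lambda>x\<in>Arr B a (fob F j). Cmp B a (fob F j) L (c j) x"
 let ?d = "\<lambda>j. \<lambda>x\<in>Arr B a (fob F j). D.gm j x"
 have "compose (Arr B a (fob F i)) (?d k) (\<lambda>x\<in>Arr B a (fob F i). ?\<phi> i k \<alpha> x) = ?d i"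
  if "i \<in> Ob J" "k \<in> Ob J" "\<alpha> \<in> Arr J i k" for i k \<alpha>
  using D.gm_\<phi>[OF that] aO F that by (auto simp: compose_def fun_eq_iff closed)
 then have co: "is_cocone J (Ab U) (func_comp (hom_functor B a) F) D.limit_group ?d"
  unfolding is_cocone_def using D.limit_group_Ab D.gm_hom
  by (simp add: Ab_def func_comp_def hom_functor_def)
 obtain h where "h \<in> Arr (Ab U) (hom_group B a L) D.limit_group" and h: "\<And>j. j \<in> Ob J \<Longrightarrow>
   Cmp (Ab U) (fob (func_comp (hom_functor B a) F) j) (hom_group B a L) D.limit_group h (?c j) = ?d j"
  using is_colimit_map[OF hom_colimit co] by blast
 have "D.gm j z = h (Cmp B a (fob F j) L (c j) z)" if "z \<in> Arr B a (fob F j)" for z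
  using fun_cong[OF h[OF j], of z] that by (simp add: Ab_def func_comp_def hom_functor_def compose_def)
 then have "D.gm j x = D.gm j y" using xy eq by simp
 then have "D.germ_rel (j, x) (j, y)" using D.gm_eq_iff j xy by (simp add: D.pts_def)
 then obtain l \<alpha> \<beta> where l: "l \<in> Ob J" "\<alpha> \<in> Arr J j l" "\<beta> \<in> Arr J j l" "?\<phi> j l \<alpha> x = ?\<phi> j l \<beta> y"
  by (auto simp: D.germ_rel_def)
 obtain m \<gamma> where m: "m \<in> Ob J" "\<gamma> \<in> Arr J l m" "Cmp J j l m \<gamma> \<alpha> = Cmp J j l m \<gamma> \<beta>"
  using filtered_coequalize[OF j l(1-3)] by metis
 have "?\<phi> j m (Cmp J j l m \<gamma> \<alpha>) x = ?\<phi> l m \<gamma> (?\<phi> j l \<alpha> x)" "?\<phi> j m (Cmp J j l m \<gamma> \<beta>) y = ?\<phi> l m \<gamma> (?\<phi> j l \<beta> y)"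
  using aO F j l(1-3) m(1,2) xy by (simp_all add: Cmp_assoc)
 then have "?\<phi> j m (Cmp J j l m \<gamma> \<alpha>) x = ?\<phi> j m (Cmp J j l m \<gamma> \<alpha>) y" using l(4) m(3) by metis
 then show ?thesis using j l m J.Cmp_closed by blast
qed

end

text \<open>\<open>X\<close> is a colimit of objects from \<open>A\<close>, and the colimit
  injections are among the test arrows.\<close>

lemma joint_epi:
 assumes O: "X \<in> Ob B" "Y \<in> Ob B" and fg: "f \<in> Arr B X Y" "g \<in> Arr B X Y"
  and eq: "\<And>a x. \<lbrakk>a \<in> A; x \<in> Arr B a X\<rbrakk> \<Longrightarrow> Cmp B a X Y f x = Cmp B a X Y g x"
 shows "f = g"
proof -
 obtain J F c where d: "filtered_diagram U J B F" and FA: "\<forall>j\<in>Ob J. fob F j \<in> A" and col: "is_colimit J B F X c"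
  using A_colimits[OF O(1)] by blast
 note F = diagramD(3-6)[OF d] and c = colimitD[OF col]
 let ?e = "\<lambda>j. Cmp B (fob F j) X Y g (c j)"
 have "is_cocone J B F Y ?e" unfolding is_cocone_def
  using O fg F c by (auto simp: closed Cmp_assoc[symmetric])
 then have "\<exists>!h. h \<in> Arr B X Y \<and> (\<forall>j\<in>Ob J. Cmp B (fob F j) X Y h (c j) = ?e j)"
  using col[unfolded is_colimit_def, THEN conjunct2, rule_format] by blast
 moreover have "f \<in> Arr B X Y \<and> (\<forall>j\<in>Ob J. Cmp B (fob F j) X Y f (c j) = ?e j)" using fg eq FA c by auto
 moreover have "g \<in> Arr B X Y \<and> (\<forall>j\<in>Ob J. Cmp B (fob F j) X Y g (c j) = ?e j)" using fg by simp
 ultimately show ?thesis by (rule Ex1_eq)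
qed

text \<open>Fullness of the restriction of \<open>B(-, X)\<close> to \<open>A\<close>, with
  \<open>joint_epi\<close> as faithfulness. The values of \<open>\<phi>\<close> on the colimit
  injections form a cocone, and every element factors through one of these injections.\<close>

lemma natural_family:
 assumes O: "X \<in> Ob B" "Y \<in> Ob B"
  and \<phi>: "\<And>a x. \<lbrakk>a \<in> A; x \<in> Arr B a X\<rbrakk> \<Longrightarrow> \<phi> a x \<in> Arr B a Y"
  and nat: "\<And>a b x u. \<lbrakk>a \<in> A; b \<in> A; x \<in> Arr B a X; u \<in> Arr B b a\<rbrakk> \<Longrightarrow> \<phi> b (Cmp B b a X x u) = Cmp B b a Y (\<phi> a x) u"
 obtains f where "f \<in> Arr B X Y" "\<And>a x. \<lbrakk>a \<in> A; x \<in> Arr B a X\<rbrakk> \<Longrightarrow> Cmp B a X Y f x = \<phi> a x"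
proof -
 obtain J F c where d: "filtered_diagram U J B F" and FA: "\<forall>j\<in>Ob J. fob F j \<in> A" and col: "is_colimit J B F X c"
  using A_colimits[OF O(1)] by blast
 note F = diagramD(3-6)[OF d] and c = colimitD[OF col]
 let ?e = "\<lambda>j. \<phi> (fob F j) (c j)"
 have "is_cocone J B F Y ?e" unfolding is_cocone_def
  using O F c FA \<phi> by (simp add: nat[symmetric])
 then obtain f where f: "f \<in> Arr B X Y" "\<And>j. j \<in> Ob J \<Longrightarrow> Cmp B (fob F j) X Y f (c j) = ?e j"
  using is_colimit_map[OF col] by blast
 have "Cmp B a X Y f x = \<phi> a x" if a: "a \<in> A" "x \<in> Arr B a X" for a x
 proof -
  obtain j y where j: "j \<in> Ob J" "y \<in> Arr B a (fob F j)" "x = Cmp B a (fob F j) X (c j) y"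
   using colimit_factor[OF d col a] by blast
  have "Cmp B a X Y f x = Cmp B a (fob F j) Y (Cmp B (fob F j) X Y f (c j)) y"
   using O j f(1) c F A_Ob[OF a(1)] by (simp add: Cmp_assoc)
  also have "\<dots> = \<phi> a x" using j a c FA by (simp add: f(2) nat)
  finally show ?thesis .
 qed
 with f that show thesis by blast
qed

text \<open>Elements are lifted to a stage of a colimit presentation with stages in
  \<open>A\<close>. Together with \<open>elements_coequalize\<close> this says that the category of
  elements of \<open>X\<close> over \<open>A\<close> is filtered.\<close>

lemma elements_directed:
 assumes X: "X \<in> Ob B" and a: "a \<in> A" "x \<in> Arr B a X" and b: "b \<in> A" "y \<in> Arr B b X"
 shows "\<exists>c\<in>A. \<exists>z\<in>Arr B c X. \<exists>u\<in>Arr B a c. \<exists>v\<in>Arr B b c. Cmp B a c X z u = x \<and> Cmp B b c X z v = y"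
proof -
 obtain J F c where d: "filtered_diagram U J B F" and FA: "\<forall>j\<in>Ob J. fob F j \<in> A" and col: "is_colimit J B F X c"
  using A_colimits[OF X] by blast
 note F = diagramD(3-6)[OF d] and c = colimitD[OF col]
 interpret small_filtered_category U J by (rule diagramD[OF d])
 obtain j x' where j: "j \<in> Ob J" "x' \<in> Arr B a (fob F j)" "x = Cmp B a (fob F j) X (c j) x'"
  using colimit_factor[OF d col a] by blast
 obtain k y' where k: "k \<in> Ob J" "y' \<in> Arr B b (fob F k)" "y = Cmp B b (fob F k) X (c k) y'"
  using colimit_factor[OF d col b] by blast
 obtain m \<alpha> \<beta> where m: "m \<in> Ob J" "\<alpha> \<in> Arr J j m" "\<beta> \<in> Arr J k m"
  using filtered_J j(1) k(1) unfolding filtered_def by blast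
 show ?thesis
  by (rule bexI[of _ "fob F m"], rule bexI[of _ "c m"], rule bexI[of _ "Cmp B a (fob F j) (fob F m) (fmor F j m \<alpha>) x'"],
    rule bexI[of _ "Cmp B b (fob F k) (fob F m) (fmor F k m \<beta>) y'"])
   (use X F c FA j k m A_Ob[OF a(1)] A_Ob[OF b(1)] in \<open>simp_all add: closed Cmp_assoc\<close>)
qed

lemma elements_coequalize:
 assumes X: "X \<in> Ob B" and ab: "a \<in> A" "b \<in> A" and z: "z \<in> Arr B b X" and uv: "u \<in> Arr B a b" "v \<in> Arr B a b"
  and eq: "Cmp B a b X z u = Cmp B a b X z v"
 shows "\<exists>c\<in>A. \<exists>z'\<in>Arr B c X. \<exists>w\<in>Arr B b c. Cmp B b c X z' w = z \<and> Cmp B a b c w u = Cmp B a b c w v"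
proof -
 obtain J F c where d: "filtered_diagram U J B F" and FA: "\<forall>j\<in>Ob J. fob F j \<in> A" and col: "is_colimit J B F X c"
  using A_colimits[OF X] by blast
 note F = diagramD(3-6)[OF d] and c = colimitD[OF col]
 obtain j z0 where j: "j \<in> Ob J" "z0 \<in> Arr B b (fob F j)" "z = Cmp B b (fob F j) X (c j) z0"
  using colimit_factor[OF d col ab(2) z] by blast
 note O = A_Ob[OF ab(1)] A_Ob[OF ab(2)]
 have "Cmp B a (fob F j) X (c j) (Cmp B a b (fob F j) z0 u) = Cmp B a (fob F j) X (c j) (Cmp B a b (fob F j) z0 v)"
  using eq X F c j O uv by (simp add: Cmp_assoc)
 then obtain k \<alpha> where k: "k \<in> Ob J" "\<alpha> \<in> Arr J j k"
  "Cmp B a (fob F j) (fob F k) (fmor F j k \<alpha>) (Cmp B a b (fob F j) z0 u) =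
   Cmp B a (fob F j) (fob F k) (fmor F j k \<alpha>) (Cmp B a b (fob F j) z0 v)"
  using colimit_eq[OF d col ab(1) j(1)] O F j uv Cmp_closed by metis
 let ?w = "Cmp B b (fob F j) (fob F k) (fmor F j k \<alpha>) z0"
 have "Cmp B b (fob F k) X (c k) ?w = z" using X F c j k O by (simp add: Cmp_assoc)
 moreover have "Cmp B a b (fob F k) ?w u = Cmp B a b (fob F k) ?w v"
  using F j k O uv by (simp add: Cmp_assoc)
 moreover have "?w \<in> Arr B b (fob F k)" using F j k O by (simp add: closed)
 ultimately show ?thesis using FA k c by blast
qed

section \<open>Families of elements and the objects they span\<close>

definition elements :: "'o \<Rightarrow> ('o \<times> 'u) set" where
 "elements X = (SIGMA a : A. Arr B a X)"

text \<open>A subfunctor of \<open>B(-, X)\<close> on \<open>A\<close> whose own category of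
  elements is filtered. The witnesses of filteredness must belong to \<open>P\<close>, so that the
  colimit over \<open>P\<close> exists in \<open>B\<close>.\<close>

definition closed_family :: "'o \<Rightarrow> ('o \<times> 'u) set \<Rightarrow> bool" where
 "closed_family X P \<longleftrightarrow> P \<subseteq> elements X \<and> P \<noteq> {} \<and>
   (\<forall>a x b u. (a, x) \<in> P \<longrightarrow> b \<in> A \<longrightarrow> u \<in> Arr B b a \<longrightarrow> (b, Cmp B b a X x u) \<in> P) \<and>
   (\<forall>a x b y. (a, x) \<in> P \<longrightarrow> (b, y) \<in> P \<longrightarrow>
    (\<exists>c z u v. (c, z) \<in> P \<and> u \<in> Arr B a c \<and> v \<in> Arr B b c \<and> Cmp B a c X z u = x \<and> Cmp B b c X z v = y)) \<and>
   (\<forall>a b z u v. (b, z) \<in> P \<longrightarrow> a \<in> A \<longrightarrow> u \<in> Arr B a b \<longrightarrow> v \<in> Arr B a b \<longrightarrow>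
    Cmp B a b X z u = Cmp B a b X z v \<longrightarrow>
    (\<exists>c z' w. (c, z') \<in> P \<and> w \<in> Arr B b c \<and> Cmp B b c X z' w = z \<and> Cmp B a b c w u = Cmp B a b c w v))"

text \<open>Plays the role of a monomorphism and is formulated on elements, where it can be read off
  from a filtered colimit; left cancellation follows in \<open>embedding_cancel\<close>.\<close>

definition embedding :: "'o \<Rightarrow> 'o \<Rightarrow> 'u \<Rightarrow> bool" where
 "embedding Y X m \<longleftrightarrow> Y \<in> Ob B \<and> X \<in> Ob B \<and> m \<in> Arr B Y X \<and> (\<forall>a\<in>A. inj_on (Cmp B a Y X m) (Arr B a Y))"

lemma small_elements: "X \<in> Ob B \<Longrightarrow> small U (elements X)"
 unfolding elements_def small_def using small_A small_hom A_Ob by (intro lt_Sigma) (auto simp: small_def)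

text \<open>The colimit over the category of elements of a closed family is the subobject it spans.\<close>

lemma closed_family_embedding:
 assumes X: "X \<in> Ob B" and P: "closed_family X P"
 shows "\<exists>Y m. embedding Y X m \<and> (\<forall>a\<in>A. Cmp B a Y X m ` Arr B a Y = {x. (a, x) \<in> P})"
proof -
 have P_el: "\<And>a x. (a, x) \<in> P \<Longrightarrow> a \<in> A \<and> x \<in> Arr B a X \<and> a \<in> Ob B"
  and P_ne: "P \<noteq> {}"
  and P_pre: "\<And>a x b u. \<lbrakk>(a, x) \<in> P; b \<in> A; u \<in> Arr B b a\<rbrakk> \<Longrightarrow> (b, Cmp B b a X x u) \<in> P"
  and P_dir: "\<And>a x b y. \<lbrakk>(a, x) \<in> P; (b, y) \<in> P\<rbrakk> \<Longrightarrow>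
   \<exists>c z u v. (c, z) \<in> P \<and> u \<in> Arr B a c \<and> v \<in> Arr B b c \<and> Cmp B a c X z u = x \<and> Cmp B b c X z v = y"
  and P_coeq: "\<And>a b z u v. \<lbrakk>(b, z) \<in> P; a \<in> A; u \<in> Arr B a b; v \<in> Arr B a b; Cmp B a b X z u = Cmp B a b X z v\<rbrakk> \<Longrightarrow>
   \<exists>c z' w. (c, z') \<in> P \<and> w \<in> Arr B b c \<and> Cmp B b c X z' w = z \<and> Cmp B a b c w u = Cmp B a b c w v"
  using P unfolding closed_family_def elements_def by (auto dest: A_Ob)
 have smP: "small U P"
  using P lt_subset small_elements[OF X] unfolding closed_family_def small_def by blast
 then obtain enc :: "'o \<times> 'u \<Rightarrow> 'u" where enc: "inj_on enc P" by (rule small_ex_inj)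
 define ob where "ob s = fst (inv_into P enc s)" for s
 define el where "el s = snd (inv_into P enc s)" for s
 have oe: "ob (enc (a, x)) = a" "el (enc (a, x)) = x" if "(a, x) \<in> P" for a x
  using that enc by (simp_all add: ob_def el_def)
 \<comment> \<open>The category of elements of \<open>P\<close>, with objects encoded in
   \<open>'u\<close> because diagrams are indexed by categories over \<open>'u\<close>.\<close>
 define J :: "('u, 'u) cat" where
  "J = \<lparr>Ob = enc ` P, Arr = \<lambda>s t. {u \<in> Arr B (ob s) (ob t). Cmp B (ob s) (ob t) X (el t) u = el s},
    Ident = \<lambda>s. Ident B (ob s), Cmp = \<lambda>r s t. Cmp B (ob r) (ob s) (ob t)\<rparr>"
 define F :: "('u, 'u, 'o, 'u) func" where "F = \<lparr>fob = ob, fmor = \<lambda>s t u. u\<rparr>"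
 have in_P: "(ob s, el s) \<in> P" "ob s \<in> A" "ob s \<in> Ob B" "el s \<in> Arr B (ob s) X" if "s \<in> Ob J" for s
  using that oe P_el by (auto simp: J_def)
 have J_arr: "u \<in> Arr J s t \<longleftrightarrow> u \<in> Arr B (ob s) (ob t) \<and> Cmp B (ob s) (ob t) X (el t) u = el s" for s t u
  by (simp add: J_def)
 have J_enc: "enc (a, x) \<in> Ob J" if "(a, x) \<in> P" for a x using that by (simp add: J_def)
 have J_id: "Ident J s = Ident B (ob s)" and J_cmp: "Cmp J r s t = Cmp B (ob r) (ob s) (ob t)" for r s t
  by (simp_all add: J_def)
 have catJ: "category J"
  by (rule category.intro)
   (use in_P X in \<open>auto simp: J_arr J_id J_cmp closed Cmp_Ident_left Cmp_Ident_right Cmp_assoc\<close>)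
 have "small U (Ob J)" using lt_image smP by (simp add: J_def small_def)
 moreover have "small U (Arr J s t)" if "s \<in> Ob J" "t \<in> Ob J" for s t
  using lt_subset[OF _ small_hom[OF in_P(3)[OF that(1)] in_P(3)[OF that(2)], unfolded small_def]]
  by (simp add: J_def small_def)
 ultimately have smJ: "small_category U J" using catJ by (simp add: small_category_def locally_small_def)
 have "filtered J" unfolding filtered_def
 proof (intro conjI ballI)
  show "Ob J \<noteq> {}" using P_ne by (simp add: J_def)
  fix s t assume st: "s \<in> Ob J" "t \<in> Ob J"
  then obtain c z u v where c: "(c, z) \<in> P" "u \<in> Arr B (ob s) c" "v \<in> Arr B (ob t) c"
   "Cmp B (ob s) c X z u = el s" "Cmp B (ob t) c X z v = el t" using P_dir in_P(1) by blast
  then have "u \<in> Arr J s (enc (c, z))" "v \<in> Arr J t (enc (c, z))" by (simp_all add: J_arr oe)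
  then show "\<exists>k\<in>Ob J. Arr J s k \<noteq> {} \<and> Arr J t k \<noteq> {}" using J_enc[OF c(1)] by blast
  fix u v assume uv: "u \<in> Arr J s t" "v \<in> Arr J s t"
  then have "Cmp B (ob s) (ob t) X (el t) u = Cmp B (ob s) (ob t) X (el t) v" by (simp add: J_arr)
  then obtain c z w where c: "(c, z) \<in> P" "w \<in> Arr B (ob t) c" "Cmp B (ob t) c X z w = el t"
   "Cmp B (ob s) (ob t) c w u = Cmp B (ob s) (ob t) c w v"
   using P_coeq[OF in_P(1)[OF st(2)] in_P(2)[OF st(1)]] uv J_arr by blast
  then have "w \<in> Arr J t (enc (c, z))" "Cmp J s t (enc (c, z)) w u = Cmp J s t (enc (c, z)) w v"
   by (simp_all add: J_arr J_cmp oe)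
  then show "\<exists>k\<in>Ob J. \<exists>c\<in>Arr J t k. Cmp J s t k c u = Cmp J s t k c v" using J_enc[OF c(1)] by blast
 qed
 moreover have "is_functor J B F"
  unfolding is_functor_def using in_P by (auto simp: F_def J_arr J_id J_cmp)
 ultimately have d: "filtered_diagram U J B F" using smJ by (simp add: filtered_diagram_def)
 then obtain Y c where col: "is_colimit J B F Y c" using filtered_colimits unfolding has_filtered_colimits_def by blast
 have Fo: "fob F s = ob s" "fmor F s t u = u" for s t u by (simp_all add: F_def)
 note c = colimitD[OF col, unfolded Fo]
 have "is_cocone J B F X el" unfolding is_cocone_def Fo using X in_P J_arr by blast
 then obtain m where m: "m \<in> Arr B Y X" "\<And>s. s \<in> Ob J \<Longrightarrow> Cmp B (ob s) Y X m (c s) = el s"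
  using is_colimit_map[OF col] unfolding Fo by blast
 have fac: "\<exists>s\<in>Ob J. \<exists>u\<in>Arr B a (ob s). y = Cmp B a (ob s) Y (c s) u" if "a \<in> A" "y \<in> Arr B a Y" for a y
  using colimit_factor[OF d col that] by (simp add: Fo)
 have my: "Cmp B a Y X m (Cmp B a (ob s) Y (c s) u) = Cmp B a (ob s) X (el s) u"
  if "a \<in> A" "s \<in> Ob J" "u \<in> Arr B a (ob s)" for a s u
  using that A_Ob in_P[OF that(2)] X c(1,2) m by (simp add: Cmp_assoc)
 have "inj_on (Cmp B a Y X m) (Arr B a Y)" if a: "a \<in> A" for a
 proof (rule inj_onI)
  fix y y' assume y: "y \<in> Arr B a Y" "y' \<in> Arr B a Y" "Cmp B a Y X m y = Cmp B a Y X m y'"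
  obtain s u where s: "s \<in> Ob J" "u \<in> Arr B a (ob s)" "y = Cmp B a (ob s) Y (c s) u" using fac a y by blast
  obtain t v where t: "t \<in> Ob J" "v \<in> Arr B a (ob t)" "y' = Cmp B a (ob t) Y (c t) v" using fac a y by blast
  obtain b z k l where b: "(b, z) \<in> P" "k \<in> Arr B (ob s) b" "l \<in> Arr B (ob t) b"
   "Cmp B (ob s) b X z k = el s" "Cmp B (ob t) b X z l = el t" using P_dir in_P(1) s t by blast
  note O = A_Ob[OF a] in_P(3)[OF s(1)] in_P(3)[OF t(1)] P_el[OF b(1)] X c(1)
  let ?b = "enc (b, z)"
  have bJ: "?b \<in> Ob J" "ob ?b = b" "el ?b = z" using b(1) J_enc oe by simp_all
  have kl: "k \<in> Arr J s ?b" "l \<in> Arr J t ?b" using b bJ by (simp_all add: J_arr)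
  have ck: "Cmp B (ob s) b Y (c ?b) k = c s" "Cmp B (ob t) b Y (c ?b) l = c t"
   using c(3)[OF s(1) bJ(1) kl(1)] c(3)[OF t(1) bJ(1) kl(2)] bJ by simp_all
  have cb: "c ?b \<in> Arr B b Y" using c(2)[OF bJ(1)] bJ by simp
  have "Cmp B a b X z (Cmp B a (ob s) b k u) = Cmp B a b X z (Cmp B a (ob t) b l v)"
   using y(3) my[OF a s(1,2)] my[OF a t(1,2)] s t b O by (simp add: Cmp_assoc)
  \<comment> \<open>The two elements agree in \<open>X\<close>, whereas equality in \<open>Y\<close>
    has to be produced at a stage inside \<open>P\<close>; the coequalizing clause of
    \<open>closed_family\<close> supplies it.\<close>
  then obtain d z' w where d: "(d, z') \<in> P" "w \<in> Arr B b d" "Cmp B b d X z' w = z"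
   "Cmp B a b d w (Cmp B a (ob s) b k u) = Cmp B a b d w (Cmp B a (ob t) b l v)"
   using P_coeq[OF b(1) a] s t b O Cmp_closed by metis
  let ?d = "enc (d, z')"
  have dJ: "?d \<in> Ob J" "ob ?d = d" "el ?d = z'" using d(1) J_enc oe by simp_all
  have "w \<in> Arr J ?b ?d" using d bJ dJ by (simp add: J_arr)
  then have cw: "Cmp B b d Y (c ?d) w = c ?b" using c(3)[OF bJ(1) dJ(1)] bJ dJ by simp
  have cd: "c ?d \<in> Arr B d Y" using c(2)[OF dJ(1)] dJ by simp
  note O' = O P_el[OF d(1)]
  have "y = Cmp B a d Y (c ?d) (Cmp B a b d w (Cmp B a (ob s) b k u))"
   using s b d(2) cd cb O' by (simp add: Cmp_assoc closed cw ck)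
  also have "\<dots> = y'"
   unfolding d(4) using t b d(2) cd cb O' by (simp add: Cmp_assoc closed cw ck)
  finally show "y = y'" .
 qed
 moreover have "Cmp B a Y X m ` Arr B a Y = {x. (a, x) \<in> P}" if a: "a \<in> A" for a
 proof (intro equalityI subsetI)
  fix x assume "x \<in> Cmp B a Y X m ` Arr B a Y"
  then obtain y where "y \<in> Arr B a Y" "x = Cmp B a Y X m y" by blast
  then show "x \<in> {x. (a, x) \<in> P}" using fac[OF a] my[OF a] P_pre in_P(1) a by fastforce
 next
  fix x assume "x \<in> {x. (a, x) \<in> P}"
  then have x: "(a, x) \<in> P" by simp
  have "x = Cmp B a Y X m (c (enc (a, x)))" using m(2)[OF J_enc[OF x]] oe[OF x] by simp
  moreover have "c (enc (a, x)) \<in> Arr B a Y" using c(2)[OF J_enc[OF x]] oe[OF x] by simp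
  ultimately show "x \<in> Cmp B a Y X m ` Arr B a Y" by blast
 qed
 ultimately show ?thesis using X c(1) m(1) unfolding embedding_def by blast
qed

lemma embedding_cancel:
 assumes m: "embedding Y X m" and Z: "Z \<in> Ob B" and h: "h \<in> Arr B Z Y" "h' \<in> Arr B Z Y"
  and eq: "Cmp B Z Y X m h = Cmp B Z Y X m h'"
 shows "h = h'"
proof (rule joint_epi[OF Z _ h])
 show Y: "Y \<in> Ob B" using m by (simp add: embedding_def)
 fix a x assume a: "a \<in> A" "x \<in> Arr B a Z"
 have "Cmp B a Y X m (Cmp B a Z Y h x) = Cmp B a Y X m (Cmp B a Z Y h' x)"
  using m Z h a A_Ob eq by (simp add: embedding_def Cmp_assoc)
 then show "Cmp B a Z Y h x = Cmp B a Z Y h' x"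
  using m a h Z Y A_Ob Cmp_closed unfolding embedding_def inj_on_def by metis
qed

text \<open>The lifts of the elements are unique because \<open>m\<close> is injective on elements,
  hence natural, and \<open>natural_family\<close> assembles them to an arrow.\<close>

lemma embedding_factor:
 assumes m: "embedding Y X m" and Z: "Z \<in> Ob B" and g: "g \<in> Arr B Z X"
  and fac: "\<And>a x. \<lbrakk>a \<in> A; x \<in> Arr B a Z\<rbrakk> \<Longrightarrow> \<exists>y\<in>Arr B a Y. Cmp B a Z X g x = Cmp B a Y X m y"
 obtains h where "h \<in> Arr B Z Y" "g = Cmp B Z Y X m h"
proof -
 have O: "Y \<in> Ob B" "X \<in> Ob B" "m \<in> Arr B Y X" using m by (auto simp: embedding_def)
 have inj: "y = y'" if "a \<in> A" "y \<in> Arr B a Y" "y' \<in> Arr B a Y" "Cmp B a Y X m y = Cmp B a Y X m y'" for a y y'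
  using m that by (auto simp: embedding_def inj_on_def)
 obtain \<phi> where \<phi>: "\<And>a x. \<lbrakk>a \<in> A; x \<in> Arr B a Z\<rbrakk> \<Longrightarrow> \<phi> a x \<in> Arr B a Y \<and> Cmp B a Z X g x = Cmp B a Y X m (\<phi> a x)"
  using fac by metis
 have "\<phi> b (Cmp B b a Z x u) = Cmp B b a Y (\<phi> a x) u"
  if "a \<in> A" "b \<in> A" "x \<in> Arr B a Z" "u \<in> Arr B b a" for a b x u
 proof (rule inj[OF that(2)])
  note ab = A_Ob[OF that(1)] A_Ob[OF that(2)]
  have xu: "Cmp B b a Z x u \<in> Arr B b Z" using that ab Z by (simp add: closed)
  show "\<phi> b (Cmp B b a Z x u) \<in> Arr B b Y" "Cmp B b a Y (\<phi> a x) u \<in> Arr B b Y"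
   using \<phi> that xu ab O by (simp_all add: closed)
  have "Cmp B b Y X m (\<phi> b (Cmp B b a Z x u)) = Cmp B b a X (Cmp B a Z X g x) u"
   using \<phi>[OF that(2) xu] that ab Z O g by (simp add: Cmp_assoc)
  also have "\<dots> = Cmp B b Y X m (Cmp B b a Y (\<phi> a x) u)"
   using \<phi>[OF that(1,3)] that ab O by (simp add: Cmp_assoc)
  finally show "Cmp B b Y X m (\<phi> b (Cmp B b a Z x u)) = Cmp B b Y X m (Cmp B b a Y (\<phi> a x) u)" .
 qed
 then obtain h where h: "h \<in> Arr B Z Y" "\<And>a x. \<lbrakk>a \<in> A; x \<in> Arr B a Z\<rbrakk> \<Longrightarrow> Cmp B a Z Y h x = \<phi> a x"
  using natural_family[OF Z O(1), of \<phi>] \<phi> by blast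
 have "g = Cmp B Z Y X m h"
  by (rule joint_epi[OF Z O(2) g]) (use Z O h \<phi> A_Ob in \<open>simp_all add: closed Cmp_assoc[symmetric]\<close>)
 with h that show thesis by blast
qed

end

section \<open>Coproducts and their elements\<close>

context finitely_accessible_category
begin

definition projections :: "'i set \<Rightarrow> ('i \<Rightarrow> 'o) \<Rightarrow> 'o \<Rightarrow> ('i \<Rightarrow> 'u) \<Rightarrow> ('i \<Rightarrow> 'u) \<Rightarrow> bool" where
 "projections I X P \<iota> \<pi> \<longleftrightarrow> (\<forall>i\<in>I. \<pi> i \<in> Arr B P (X i)) \<and>
   (\<forall>i\<in>I. \<forall>j\<in>I. Cmp B (X j) P (X i) (\<pi> i) (\<iota> j) = (if i = j then Ident B (X i) else Nul B (X j) (X i)))"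

lemma projections_exist:
 assumes P: "is_coproduct B I X P \<iota>" and X: "\<And>i. i \<in> I \<Longrightarrow> X i \<in> Ob B"
 obtains \<pi> where "projections I X P \<iota> \<pi>"
proof -
 have "\<exists>p\<in>Arr B P (X i). \<forall>j\<in>I. Cmp B (X j) P (X i) p (\<iota> j) = (if i = j then Ident B (X i) else Nul B (X j) (X i))"
  if i: "i \<in> I" for i
 proof -
  obtain p where "p \<in> Arr B P (X i)" "\<And>j. j \<in> I \<Longrightarrow>
    Cmp B (X j) P (X i) p (\<iota> j) = (if i = j then Ident B (X i) else Nul B (X j) (X i))"
   using coproduct_map[OF P X[OF i], of "\<lambda>j. if i = j then Ident B (X i) else Nul B (X j) (X i)"] X i closed
   by (smt (verit))
  then show ?thesis by blast
 qed
 then have "\<forall>i\<in>I. \<exists>p. p \<in> Arr B P (X i) \<and>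
   (\<forall>j\<in>I. Cmp B (X j) P (X i) p (\<iota> j) = (if i = j then Ident B (X i) else Nul B (X j) (X i)))" by blast
 then obtain \<pi> where "\<forall>i\<in>I. \<pi> i \<in> Arr B P (X i) \<and>
   (\<forall>j\<in>I. Cmp B (X j) P (X i) (\<pi> i) (\<iota> j) = (if i = j then Ident B (X i) else Nul B (X j) (X i)))" by (rule bchoice[THEN exE])
 then show thesis using that[of \<pi>] by (auto simp: projections_def)
qed

text \<open>Induction with biproducts. That the projections jointly detect zero is carried along: it
  comes from the biproduct equations, and arbitrary coproducts later inherit it on elements.\<close>

lemma finite_coproduct_exists:
 assumes "finite F" "\<And>i. i \<in> F \<Longrightarrow> X i \<in> Ob B"
 shows "\<exists>P \<iota> \<pi>. is_coproduct B F X P \<iota> \<and> projections F X P \<iota> \<pi> \<and>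
  (\<forall>Z\<in>Ob B. \<forall>y\<in>Arr B Z P. (\<forall>i\<in>F. Cmp B Z P (X i) (\<pi> i) y = Nul B Z (X i)) \<longrightarrow> y = Nul B Z P)"
 using assms
proof (induction F rule: finite_induct)
 case empty
 obtain N where N: "is_zero B N" using zero_object by blast
 then have "is_coproduct B {} X N \<iota>" for \<iota> by (auto simp: is_coproduct_def is_zero_def)
 with N show ?case using is_zero_hom(1)[OF N] by (auto simp: projections_def)
next
 case (insert j F)
 then obtain P \<iota> \<pi> where P: "is_coproduct B F X P \<iota>" "projections F X P \<iota> \<pi>"
  and jm: "\<And>Z y. \<lbrakk>Z \<in> Ob B; y \<in> Arr B Z P; \<forall>i\<in>F. Cmp B Z P (X i) (\<pi> i) y = Nul B Z (X i)\<rbrakk> \<Longrightarrow> y = Nul B Z P"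
  by blast
 have O: "P \<in> Ob B" "X j \<in> Ob B" "\<And>i. i \<in> F \<Longrightarrow> X i \<in> Ob B" using P insert by (auto simp: is_coproduct_def)
 obtain Q iP iX pP pX where b: "is_biproduct B P (X j) Q iP iX pP pX" using biproducts O by blast
 have Q: "Q \<in> Ob B" "iP \<in> Arr B P Q" "iX \<in> Arr B (X j) Q" "pP \<in> Arr B Q P" "pX \<in> Arr B Q (X j)"
  and e: "Cmp B P Q P pP iP = Ident B P" "Cmp B (X j) Q (X j) pX iX = Ident B (X j)"
  "Cmp B (X j) Q P pP iX = Nul B (X j) P" "Cmp B P Q (X j) pX iP = Nul B P (X j)"
  "Add B Q Q (Cmp B Q P Q iP pP) (Cmp B Q (X j) Q iX pX) = Ident B Q"
  using b by (auto simp: is_biproduct_def)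
 have \<iota>: "\<iota> i \<in> Arr B (X i) P" "\<pi> i \<in> Arr B P (X i)" if "i \<in> F" for i
  using P that by (auto simp: is_coproduct_def projections_def)
 have \<pi>\<iota>: "Cmp B (X k) P (X i) (\<pi> i) (\<iota> k) = (if i = k then Ident B (X i) else Nul B (X k) (X i))" if "i \<in> F" "k \<in> F" for i k
  using P(2) that by (simp add: projections_def)
 let ?\<iota> = "\<lambda>i. if i = j then iX else Cmp B (X i) P Q iP (\<iota> i)"
 let ?\<pi> = "\<lambda>i. if i = j then pX else Cmp B Q P (X i) (\<pi> i) pP"
 have split: "y = Add B Z Q (Cmp B Z P Q iP (Cmp B Z Q P pP y)) (Cmp B Z (X j) Q iX (Cmp B Z Q (X j) pX y))"
  if "Z \<in> Ob B" "y \<in> Arr B Z Q" for Z y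
 proof -
  have "y = Cmp B Z Q Q (Add B Q Q (Cmp B Q P Q iP pP) (Cmp B Q (X j) Q iX pX)) y"
   using that Q by (simp add: e Cmp_Ident_left)
  then show ?thesis using that Q O by (simp add: Cmp_Add_left closed Cmp_assoc)
 qed
 have split': "h = Add B Q Z (Cmp B Q P Z (Cmp B P Q Z h iP) pP) (Cmp B Q (X j) Z (Cmp B (X j) Q Z h iX) pX)"
  if "Z \<in> Ob B" "h \<in> Arr B Q Z" for Z h
 proof -
  have "h = Cmp B Q Q Z h (Add B Q Q (Cmp B Q P Q iP pP) (Cmp B Q (X j) Q iX pX))"
   using that Q by (simp add: e Cmp_Ident_right)
  then show ?thesis using that Q O by (simp add: Cmp_Add_right closed Cmp_assoc)
 qed
 have "is_coproduct B (insert j F) X Q ?\<iota>"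
  unfolding is_coproduct_def
 proof (intro conjI ballI allI impI)
  show "?\<iota> i \<in> Arr B (X i) Q" if "i \<in> insert j F" for i using that Q O \<iota> by (auto simp: closed)
  fix Z f assume Z: "Z \<in> Ob B" and f: "\<forall>i\<in>insert j F. f i \<in> Arr B (X i) Z"
  obtain k where k: "k \<in> Arr B P Z" "\<And>i. i \<in> F \<Longrightarrow> Cmp B (X i) P Z k (\<iota> i) = f i"
   using coproduct_map[OF P(1) Z, of f] f by blast
  let ?h = "Add B Q Z (Cmp B Q P Z k pP) (Cmp B Q (X j) Z (f j) pX)"
  have fj: "f j \<in> Arr B (X j) Z" using f by blast
  have hX: "Cmp B (X j) Q Z ?h iX = f j" and hP: "Cmp B P Q Z ?h iP = k"
   using Z O Q k(1) fj by (simp_all add: closed Cmp_Add_left Cmp_assoc[symmetric] e Cmp_Ident_right Cmp_Nul_right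
     Add_Nul Add_commute[of P Z k])
  show "\<exists>!h. h \<in> Arr B Q Z \<and> (\<forall>i\<in>insert j F. Cmp B (X i) Q Z h (?\<iota> i) = f i)"
  proof (rule ex1I[of _ ?h])
   have "?h \<in> Arr B Q Z" using Z O Q k(1) fj by (simp add: closed)
   then show "?h \<in> Arr B Q Z \<and> (\<forall>i\<in>insert j F. Cmp B (X i) Q Z ?h (?\<iota> i) = f i)"
    using insert.hyps Z O Q \<iota> k hX hP by (auto simp: Cmp_assoc)
   fix h assume h: "h \<in> Arr B Q Z \<and> (\<forall>i\<in>insert j F. Cmp B (X i) Q Z h (?\<iota> i) = f i)"
   have "Cmp B P Q Z h iP = k"
   proof (rule coproduct_eq[OF P(1) O(3) Z _ k(1)])
    show "Cmp B P Q Z h iP \<in> Arr B P Z" using h Z O Q by (simp add: closed)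
    fix i assume i: "i \<in> F"
    then have "i \<noteq> j" using insert.hyps by auto
    then have "Cmp B (X i) Q Z h (Cmp B (X i) P Q iP (\<iota> i)) = f i" using h i by auto
    then show "Cmp B (X i) P Z (Cmp B P Q Z h iP) (\<iota> i) = Cmp B (X i) P Z k (\<iota> i)"
     using h i Z O Q \<iota> k by (simp add: Cmp_assoc)
   qed
   then show "h = ?h" using split'[OF Z, of h] h by auto
  qed
 qed (rule Q)
 moreover have "projections (insert j F) X Q ?\<iota> ?\<pi>"
  unfolding projections_def
 proof (intro conjI ballI)
  show "?\<pi> i \<in> Arr B Q (X i)" if "i \<in> insert j F" for i using that Q O \<iota> by (auto simp: closed)
  fix i k assume ik: "i \<in> insert j F" "k \<in> insert j F"
  consider "i = j" "k = j" | "i = j" "k \<noteq> j" "k \<in> F" | "i \<noteq> j" "i \<in> F" "k = j" | "i \<noteq> j" "k \<noteq> j" "i \<in> F" "k \<in> F" using ik by auto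
  then show "Cmp B (X k) Q (X i) (?\<pi> i) (?\<iota> k) = (if i = k then Ident B (X i) else Nul B (X k) (X i))"
  proof cases
   case 1
   then show ?thesis using e by simp
  next
   case 2
   then have "Cmp B (X k) Q (X j) pX (Cmp B (X k) P Q iP (\<iota> k)) = Nul B (X k) (X j)"
    using O Q \<iota> by (simp add: Cmp_assoc e Cmp_Nul_left)
   with 2 show ?thesis by simp
  next
   case 3
   then have "Cmp B (X j) Q (X i) (Cmp B Q P (X i) (\<pi> i) pP) iX = Nul B (X j) (X i)"
    using O Q \<iota> by (simp add: Cmp_assoc[symmetric] e Cmp_Nul_right)
   with 3 show ?thesis by auto
  next
   case 4
   have "Cmp B (X k) Q (X i) (Cmp B Q P (X i) (\<pi> i) pP) (Cmp B (X k) P Q iP (\<iota> k)) =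
     Cmp B (X k) P (X i) (\<pi> i) (Cmp B (X k) P P (Cmp B P Q P pP iP) (\<iota> k))"
    using 4 O Q \<iota> by (simp add: Cmp_assoc closed)
   then show ?thesis using 4 O \<iota> \<pi>\<iota> by (simp add: e Cmp_Ident_left)
  qed
 qed
 moreover have "y = Nul B Z Q" if Z: "Z \<in> Ob B" and y: "y \<in> Arr B Z Q"
  and 0: "\<forall>i\<in>insert j F. Cmp B Z Q (X i) (?\<pi> i) y = Nul B Z (X i)" for Z y
 proof -
  have "Cmp B Z Q P pP y = Nul B Z P"
  proof (rule jm[OF Z])
   show "Cmp B Z Q P pP y \<in> Arr B Z P" using Z y O Q by (simp add: closed)
   show "\<forall>i\<in>F. Cmp B Z P (X i) (\<pi> i) (Cmp B Z Q P pP y) = Nul B Z (X i)"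
   proof
    fix i assume i: "i \<in> F"
    then have "i \<noteq> j" using insert.hyps by auto
    then have "Cmp B Z Q (X i) (Cmp B Q P (X i) (\<pi> i) pP) y = Nul B Z (X i)" using 0 i by fastforce
    then show "Cmp B Z P (X i) (\<pi> i) (Cmp B Z Q P pP y) = Nul B Z (X i)"
     using i Z y O Q \<iota> by (simp add: Cmp_assoc)
   qed
  qed
  moreover have "Cmp B Z Q (X j) pX y = Nul B Z (X j)" using 0 by auto
  ultimately show ?thesis using split[OF Z y] Z O Q by (simp add: Cmp_Nul_right Add_Nul closed)
 qed
 ultimately show ?case by blast
qed

text \<open>The elements of such a coproduct behave like those of a direct sum of abelian groups;
  this is the property through which all counting of elements proceeds.\<close>

definition good_coproduct :: "'i set \<Rightarrow> ('i \<Rightarrow> 'o) \<Rightarrow> 'o \<Rightarrow> ('i \<Rightarrow> 'u) \<Rightarrow> ('i \<Rightarrow> 'u) \<Rightarrow> bool" where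
 "good_coproduct I X P \<iota> \<pi> \<longleftrightarrow> is_coproduct B I X P \<iota> \<and> projections I X P \<iota> \<pi> \<and>
   (\<forall>a\<in>A. \<forall>x\<in>Arr B a P. finite {i \<in> I. Cmp B a P (X i) (\<pi> i) x \<noteq> Nul B a (X i)} \<and>
    ((\<forall>i\<in>I. Cmp B a P (X i) (\<pi> i) x = Nul B a (X i)) \<longrightarrow> x = Nul B a P))"

text \<open>An arbitrary coproduct is the filtered colimit of the finite subcoproducts.\<close>

lemma good_coproduct_exists:
 assumes I: "small U (I :: 'u set)" and X: "\<And>i. i \<in> I \<Longrightarrow> X i \<in> Ob B"
 shows "\<exists>P \<iota> \<pi>. good_coproduct I X P \<iota> \<pi>"
proof -
 have "\<forall>K\<in>Fpow I. \<exists>t. is_coproduct B K X (fst t) (fst (snd t)) \<and> projections K X (fst t) (fst (snd t)) (snd (snd t)) \<and>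
  (\<forall>Z\<in>Ob B. \<forall>y\<in>Arr B Z (fst t). (\<forall>i\<in>K. Cmp B Z (fst t) (X i) (snd (snd t) i) y = Nul B Z (X i)) \<longrightarrow> y = Nul B Z (fst t))"
  using finite_coproduct_exists X unfolding Fpow_def by fastforce
 then obtain T where T: "\<And>K. K \<in> Fpow I \<Longrightarrow> is_coproduct B K X (fst (T K)) (fst (snd (T K))) \<and>
   projections K X (fst (T K)) (fst (snd (T K))) (snd (snd (T K))) \<and>
   (\<forall>Z\<in>Ob B. \<forall>y\<in>Arr B Z (fst (T K)). (\<forall>i\<in>K. Cmp B Z (fst (T K)) (X i) (snd (snd (T K)) i) y = Nul B Z (X i)) \<longrightarrow>
    y = Nul B Z (fst (T K)))" by metis
 define P where "P K = fst (T K)" for K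
 define \<iota> where "\<iota> K = fst (snd (T K))" for K
 define \<pi> where "\<pi> K = snd (snd (T K))" for K
 have P: "is_coproduct B K X (P K) (\<iota> K)" and \<pi>: "projections K X (P K) (\<iota> K) (\<pi> K)"
  and jm: "\<And>Z y. \<lbrakk>Z \<in> Ob B; y \<in> Arr B Z (P K); \<And>i. i \<in> K \<Longrightarrow> Cmp B Z (P K) (X i) (\<pi> K i) y = Nul B Z (X i)\<rbrakk> \<Longrightarrow>
   y = Nul B Z (P K)" if "K \<in> Fpow I" for K
  using T[OF that] by (auto simp: P_def \<iota>_def \<pi>_def)
 have XK: "X i \<in> Ob B" if "K \<in> Fpow I" "i \<in> K" for K i using X that by (auto simp: Fpow_def)
 have PO: "P K \<in> Ob B" if "K \<in> Fpow I" for K using P[OF that] by (simp add: is_coproduct_def)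
 have \<iota>A: "\<iota> K i \<in> Arr B (X i) (P K)" if "K \<in> Fpow I" "i \<in> K" for K i using P[OF that(1)] that by (simp add: is_coproduct_def)
 have "\<exists>t. t \<in> Arr B (P K) (P K') \<and> (\<forall>i\<in>K. Cmp B (X i) (P K) (P K') t (\<iota> K i) = \<iota> K' i)"
  if KK: "K \<in> Fpow I" "K' \<in> Fpow I" "K \<subseteq> K'" for K K'
 proof -
  obtain t where "t \<in> Arr B (P K) (P K')" "\<And>i. i \<in> K \<Longrightarrow> Cmp B (X i) (P K) (P K') t (\<iota> K i) = \<iota> K' i"
   by (rule coproduct_map[OF P[OF KK(1)] PO[OF KK(2)], of "\<iota> K'"]) (use \<iota>A KK in blast)+
  then show ?thesis by blast
 qed
 then obtain t where t: "\<And>K K'. \<lbrakk>K \<in> Fpow I; K' \<in> Fpow I; K \<subseteq> K'\<rbrakk> \<Longrightarrow> t K K' \<in> Arr B (P K) (P K')"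
  "\<And>K K' i. \<lbrakk>K \<in> Fpow I; K' \<in> Fpow I; K \<subseteq> K'; i \<in> K\<rbrakk> \<Longrightarrow> Cmp B (X i) (P K) (P K') (t K K') (\<iota> K i) = \<iota> K' i"
  by metis
 have smF: "small U (Fpow I)"
  using small_Pow[OF I] lt_subset Fpow_subset_Pow unfolding small_def by blast
 then obtain enc :: "'u set \<Rightarrow> 'u" where enc: "inj_on enc (Fpow I)" by (rule small_ex_inj)
 define dec where "dec = inv_into (Fpow I) enc"
 have de: "dec (enc K) = K" if "K \<in> Fpow I" for K using enc that by (simp add: dec_def)
 \<comment> \<open>The poset of finite subsets of \<open>I\<close>, encoded in \<open>'u\<close>;
   \<open>undefined\<close> is the single arrow of each nonempty hom-set.\<close>
 define J :: "('u, 'u) cat" where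
  "J = \<lparr>Ob = enc ` Fpow I, Arr = \<lambda>s t. if dec s \<subseteq> dec t then {undefined} else {}, Ident = \<lambda>s. undefined,
    Cmp = \<lambda>r s t g f. undefined\<rparr>"
 define D :: "('u, 'u, 'o, 'u) func" where "D = \<lparr>fob = \<lambda>s. P (dec s), fmor = \<lambda>r s u. t (dec r) (dec s)\<rparr>"
 have J_Ob: "dec s \<in> Fpow I" if "s \<in> Ob J" for s using that de by (auto simp: J_def)
 have J_enc: "enc K \<in> Ob J" if "K \<in> Fpow I" for K using that by (simp add: J_def)
 have J_arr: "u \<in> Arr J r s \<longleftrightarrow> dec r \<subseteq> dec s \<and> u = undefined" for r s u by (simp add: J_def)
 have catJ: "category J" by (rule category.intro) (auto simp: J_def split: if_splits)
 have "small U (Ob J)" using smF lt_image by (simp add: J_def small_def)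
 moreover have "small U (Arr J r s)" for r s by (simp add: J_def small_def lt_finite)
 ultimately have smJ: "small_category U J" using catJ by (simp add: small_category_def locally_small_def)
 have "filtered J" unfolding filtered_def
 proof (intro conjI ballI)
  show "Ob J \<noteq> {}" by (simp add: J_def Fpow_not_empty)
  fix r s assume rs: "r \<in> Ob J" "s \<in> Ob J"
  have K: "dec r \<union> dec s \<in> Fpow I" using J_Ob[OF rs(1)] J_Ob[OF rs(2)] by (simp add: Fpow_def)
  then show "\<exists>k\<in>Ob J. Arr J r k \<noteq> {} \<and> Arr J s k \<noteq> {}"
   by (intro bexI[OF _ J_enc[OF K]]) (simp add: J_def de)
  show "\<exists>k\<in>Ob J. \<exists>c\<in>Arr J s k. Cmp J r s k c u = Cmp J r s k c v" if "u \<in> Arr J r s" "v \<in> Arr J r s" for u v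
  proof -
   have "undefined \<in> Arr J s s" "u = v" using that by (simp_all add: J_arr)
   with rs show ?thesis by blast
  qed
 qed
 moreover have "is_functor J B D"
  unfolding is_functor_def
 proof (intro conjI ballI)
  fix r assume r: "r \<in> Ob J"
  note K = J_Ob[OF r]
  show "fob D r \<in> Ob B" using PO[OF K] by (simp add: D_def)
  have "t (dec r) (dec r) = Ident B (P (dec r))"
   by (rule coproduct_eq[OF P[OF K] XK[OF K] PO[OF K]])
    (use K t PO XK \<iota>A in \<open>simp_all add: closed Cmp_Ident_left\<close>)
  then show "fmor D r r (Ident J r) = Ident B (fob D r)" by (simp add: D_def)
  fix s assume s: "s \<in> Ob J"
  show "fmor D r s u \<in> Arr B (fob D r) (fob D s)" if "u \<in> Arr J r s" for u
   using t(1)[OF K J_Ob[OF s]] that by (simp add: D_def J_arr)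
  fix v u u' assume v: "v \<in> Ob J" and u: "u \<in> Arr J r s" "u' \<in> Arr J s v"
  note K' = J_Ob[OF s] J_Ob[OF v]
  have sub: "dec r \<subseteq> dec s" "dec s \<subseteq> dec v" "dec r \<subseteq> dec v" using u by (auto simp: J_arr)
  have "t (dec r) (dec v) = Cmp B (P (dec r)) (P (dec s)) (P (dec v)) (t (dec s) (dec v)) (t (dec r) (dec s))"
  proof (rule coproduct_eq[OF P[OF K] XK[OF K] PO[OF K'(2)]])
   fix i assume i: "i \<in> dec r"
   then have "i \<in> dec s" using sub by blast
   with i show "Cmp B (X i) (P (dec r)) (P (dec v)) (t (dec r) (dec v)) (\<iota> (dec r) i) =
    Cmp B (X i) (P (dec r)) (P (dec v)) (Cmp B (P (dec r)) (P (dec s)) (P (dec v)) (t (dec s) (dec v)) (t (dec r) (dec s))) (\<iota> (dec r) i)"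
    using K K' sub t PO XK[OF K i] \<iota>A by (simp add: Cmp_assoc[symmetric])
  qed (use K K' sub t PO in \<open>simp_all add: closed\<close>)
  then show "fmor D r v (Cmp J r s v u' u) = Cmp B (fob D r) (fob D s) (fob D v) (fmor D s v u') (fmor D r s u)"
   by (simp add: D_def)
 qed
 ultimately have d: "filtered_diagram U J B D" using smJ by (simp add: filtered_diagram_def)
 then obtain L c where col: "is_colimit J B D L c" using filtered_colimits unfolding has_filtered_colimits_def by blast
 have Do: "fob D s = P (dec s)" "fmor D r s u = t (dec r) (dec s)" for r s u by (simp_all add: D_def)
 note c0 = colimitD[OF col, unfolded Do]
 define k where "k K = c (enc K)" for K
 have k: "k K \<in> Arr B (P K) L" if "K \<in> Fpow I" for K
  using c0(2)[OF J_enc[OF that]] that by (simp add: k_def de)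
 have kt: "Cmp B (P K) (P K') L (k K') (t K K') = k K" if "K \<in> Fpow I" "K' \<in> Fpow I" "K \<subseteq> K'" for K K'
  using c0(3)[OF J_enc[OF that(1)] J_enc[OF that(2)]] that by (simp add: k_def de J_arr)
 have sg: "{i} \<in> Fpow I" if "i \<in> I" for i using that by (simp add: Fpow_def)
 define \<mu> where "\<mu> i = Cmp B (X i) (P {i}) L (k {i}) (\<iota> {i} i)" for i
 have \<mu>A: "\<mu> i \<in> Arr B (X i) L" if "i \<in> I" for i
  using that X k[OF sg[OF that]] \<iota>A[OF sg[OF that], of i] PO[OF sg[OF that]] c0(1) by (simp add: \<mu>_def closed)
 have \<mu>K: "Cmp B (X i) (P K) L (k K) (\<iota> K i) = \<mu> i" if "K \<in> Fpow I" "i \<in> K" for K i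
 proof -
  have i: "i \<in> I" "{i} \<subseteq> K" using that by (auto simp: Fpow_def)
  show ?thesis unfolding \<mu>_def kt[OF sg[OF i(1)] that(1) i(2), symmetric]
   using that i t(1)[OF sg[OF i(1)] that(1) i(2)] t(2)[OF sg[OF i(1)] that(1) i(2)] X[OF i(1)] PO sg[OF i(1)] k \<iota>A c0(1)
   by (simp add: Cmp_assoc[symmetric])
 qed
 have cop: "is_coproduct B I X L \<mu>"
  unfolding is_coproduct_def
 proof (intro conjI ballI allI impI)
  show "L \<in> Ob B" by (rule c0)
  show "\<mu> i \<in> Arr B (X i) L" if "i \<in> I" for i using \<mu>A[OF that] .
  fix Z f assume Z: "Z \<in> Ob B" and f: "\<forall>i\<in>I. f i \<in> Arr B (X i) Z"
  have "\<forall>K\<in>Fpow I. \<exists>g. g \<in> Arr B (P K) Z \<and> (\<forall>i\<in>K. Cmp B (X i) (P K) Z g (\<iota> K i) = f i)"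
  proof
   fix K assume K: "K \<in> Fpow I"
   obtain g where "g \<in> Arr B (P K) Z" "\<And>i. i \<in> K \<Longrightarrow> Cmp B (X i) (P K) Z g (\<iota> K i) = f i"
    by (rule coproduct_map[OF P[OF K] Z, of f]) (use f K in \<open>auto simp: Fpow_def\<close>)
   then show "\<exists>g. g \<in> Arr B (P K) Z \<and> (\<forall>i\<in>K. Cmp B (X i) (P K) Z g (\<iota> K i) = f i)" by blast
  qed
  then obtain g where g: "\<And>K. K \<in> Fpow I \<Longrightarrow> g K \<in> Arr B (P K) Z"
   "\<And>K i. \<lbrakk>K \<in> Fpow I; i \<in> K\<rbrakk> \<Longrightarrow> Cmp B (X i) (P K) Z (g K) (\<iota> K i) = f i" by metis
  have gt: "Cmp B (P K) (P K') Z (g K') (t K K') = g K" if K: "K \<in> Fpow I" "K' \<in> Fpow I" "K \<subseteq> K'" for K K'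
  proof (rule coproduct_eq[OF P[OF K(1)] XK[OF K(1)] Z])
   fix i assume i: "i \<in> K"
   then have "i \<in> K'" using K by blast
   with i show "Cmp B (X i) (P K) Z (Cmp B (P K) (P K') Z (g K') (t K K')) (\<iota> K i) = Cmp B (X i) (P K) Z (g K) (\<iota> K i)"
    using K t g Z PO XK[OF K(1) i] \<iota>A by (simp add: Cmp_assoc[symmetric])
  qed (use K t g Z PO in \<open>simp_all add: closed\<close>)
  have co: "is_cocone J B D Z (\<lambda>s. g (dec s))"
   unfolding is_cocone_def Do using Z g(1) gt J_Ob by (simp add: J_arr)
  obtain h where h: "h \<in> Arr B L Z" "\<And>s. s \<in> Ob J \<Longrightarrow> Cmp B (P (dec s)) L Z h (c s) = g (dec s)"
   using is_colimit_map[OF col co] unfolding Do by blast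
  have hk: "Cmp B (P K) L Z h (k K) = g K" if "K \<in> Fpow I" for K
   using h(2)[OF J_enc[OF that]] that by (simp add: k_def de)
  have h\<mu>: "Cmp B (X i) L Z h (\<mu> i) = f i" if i: "i \<in> I" for i
   unfolding \<mu>_def using i sg[OF i] h(1) k \<iota>A X PO Z c0(1) g by (simp add: Cmp_assoc hk)
  have uniq: "h' = h" if h': "h' \<in> Arr B L Z" "\<forall>i\<in>I. Cmp B (X i) L Z h' (\<mu> i) = f i" for h'
  proof -
   have "Cmp B (P (dec s)) L Z h' (c s) = g (dec s)" if s: "s \<in> Ob J" for s
   proof (rule coproduct_eq[OF P[OF J_Ob[OF s]] XK[OF J_Ob[OF s]] Z _ g(1)[OF J_Ob[OF s]]])
    have cs: "c s = k (dec s)" using s by (auto simp: k_def J_def de)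
    then show "Cmp B (P (dec s)) L Z h' (c s) \<in> Arr B (P (dec s)) Z"
     using h' k[OF J_Ob[OF s]] PO[OF J_Ob[OF s]] c0(1) Z by (simp add: closed)
    fix i assume i: "i \<in> dec s"
    then have "i \<in> I" using J_Ob[OF s] by (auto simp: Fpow_def)
    have "Cmp B (X i) (P (dec s)) Z (Cmp B (P (dec s)) L Z h' (c s)) (\<iota> (dec s) i) =
      Cmp B (X i) L Z h' (Cmp B (X i) (P (dec s)) L (k (dec s)) (\<iota> (dec s) i))"
     using h'(1) k[OF J_Ob[OF s]] PO[OF J_Ob[OF s]] XK[OF J_Ob[OF s] i] \<iota>A[OF J_Ob[OF s] i] c0(1) Z
     by (simp add: Cmp_assoc cs)
    then show "Cmp B (X i) (P (dec s)) Z (Cmp B (P (dec s)) L Z h' (c s)) (\<iota> (dec s) i) =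
      Cmp B (X i) (P (dec s)) Z (g (dec s)) (\<iota> (dec s) i)"
     using g(2)[OF J_Ob[OF s] i] h'(2) \<open>i \<in> I\<close> \<mu>K[OF J_Ob[OF s] i] by simp
   qed
   then have "h' \<in> Arr B L Z \<and> (\<forall>j\<in>Ob J. Cmp B (fob D j) L Z h' (c j) = g (dec j))"
    using h'(1) by (simp add: Do)
   moreover have "h \<in> Arr B L Z \<and> (\<forall>j\<in>Ob J. Cmp B (fob D j) L Z h (c j) = g (dec j))"
    using h by (simp add: Do)
   ultimately show ?thesis
    by (rule Ex1_eq[OF col[unfolded is_colimit_def, THEN conjunct2, rule_format, OF co]])
  qed
  show "\<exists>!h. h \<in> Arr B L Z \<and> (\<forall>i\<in>I. Cmp B (X i) L Z h (\<mu> i) = f i)"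
  proof (rule ex1I[of _ h])
   show "h \<in> Arr B L Z \<and> (\<forall>i\<in>I. Cmp B (X i) L Z h (\<mu> i) = f i)" using h(1) h\<mu> by blast
   show "h' = h" if "h' \<in> Arr B L Z \<and> (\<forall>i\<in>I. Cmp B (X i) L Z h' (\<mu> i) = f i)" for h'
    using that by (elim conjE) (rule uniq)
  qed
 qed
 obtain p where p: "projections I X L \<mu> p" using projections_exist[OF cop X] .
 have pA: "p i \<in> Arr B L (X i)" if "i \<in> I" for i using p that by (simp add: projections_def)
 have pk: "Cmp B (P K) L (X i) (p i) (k K) = (if i \<in> K then \<pi> K i else Nul B (P K) (X i))" (is "_ = ?r")
  if K: "K \<in> Fpow I" and i: "i \<in> I" for K i
 proof (rule coproduct_eq[OF P[OF K] XK[OF K] X[OF i]])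
  have \<pi>A: "i \<in> K \<Longrightarrow> \<pi> K i \<in> Arr B (P K) (X i)" using \<pi>[OF K] by (simp add: projections_def)
  then show "?r \<in> Arr B (P K) (X i)" using PO[OF K] X[OF i] by (simp add: closed)
  show "Cmp B (P K) L (X i) (p i) (k K) \<in> Arr B (P K) (X i)" using pA[OF i] k[OF K] PO[OF K] X[OF i] c0(1) by (simp add: closed)
  fix j assume j: "j \<in> K"
  then have jI: "j \<in> I" using K by (auto simp: Fpow_def)
  have "Cmp B (X j) (P K) (X i) (Cmp B (P K) L (X i) (p i) (k K)) (\<iota> K j) = Cmp B (X j) L (X i) (p i) (\<mu> j)"
   using pA[OF i] k[OF K] PO[OF K] X[OF i] X[OF jI] c0(1) \<iota>A[OF K j] \<mu>K[OF K j] by (simp add: Cmp_assoc[symmetric])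
  also have "\<dots> = (if i = j then Ident B (X i) else Nul B (X j) (X i))"
   using p i jI by (simp add: projections_def)
  also have "\<dots> = Cmp B (X j) (P K) (X i) ?r (\<iota> K j)"
   using \<pi>[OF K] j \<iota>A[OF K j] PO[OF K] X[OF i] X[OF jI] by (auto simp: projections_def Cmp_Nul_left)
  finally show "Cmp B (X j) (P K) (X i) (Cmp B (P K) L (X i) (p i) (k K)) (\<iota> K j) = Cmp B (X j) (P K) (X i) ?r (\<iota> K j)" .
 qed
 have "finite {i \<in> I. Cmp B a L (X i) (p i) x \<noteq> Nul B a (X i)} \<and>
   ((\<forall>i\<in>I. Cmp B a L (X i) (p i) x = Nul B a (X i)) \<longrightarrow> x = Nul B a L)" if a: "a \<in> A" and x: "x \<in> Arr B a L" for a x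
 proof -
  \<comment> \<open>An element comes from a finite stage \<open>P K\<close>; outside
    \<open>K\<close> its components are zero, and inside \<open>K\<close> they are those of
    \<open>y\<close>, which the projections of \<open>P K\<close> detect.\<close>
  obtain s y where s: "s \<in> Ob J" "y \<in> Arr B a (P (dec s))" "x = Cmp B a (P (dec s)) L (c s) y"
   using colimit_factor[OF d col a x] unfolding Do by blast
  define K where "K = dec s"
  have K: "K \<in> Fpow I" using J_Ob[OF s(1)] by (simp add: K_def)
  have cs: "c s = k K" using s(1) by (auto simp: k_def J_def de K_def)
  have y: "y \<in> Arr B a (P K)" "x = Cmp B a (P K) L (k K) y" using s(2,3) cs by (simp_all add: K_def)
  note O = A_Ob[OF a] PO[OF K] c0(1)
  have px: "Cmp B a L (X i) (p i) x = (if i \<in> K then Cmp B a (P K) (X i) (\<pi> K i) y else Nul B a (X i))" if i: "i \<in> I" for i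
  proof -
   have "Cmp B a L (X i) (p i) x = Cmp B a (P K) (X i) (Cmp B (P K) L (X i) (p i) (k K)) y"
    using O X[OF i] pA[OF i] k[OF K] y by (simp add: Cmp_assoc)
   then show ?thesis using pk[OF K i] O X[OF i] y by (simp add: Cmp_Nul_left)
  qed
  have "{i \<in> I. Cmp B a L (X i) (p i) x \<noteq> Nul B a (X i)} \<subseteq> K"
   using px by (auto split: if_splits)
  moreover have "finite K" using K by (simp add: Fpow_def)
  moreover have "x = Nul B a L" if 0: "\<forall>i\<in>I. Cmp B a L (X i) (p i) x = Nul B a (X i)"
  proof -
   have "Cmp B a (P K) (X i) (\<pi> K i) y = Nul B a (X i)" if i: "i \<in> K" for i
   proof -
    have "i \<in> I" using i K by (auto simp: Fpow_def)
    then show ?thesis using px[of i] i 0 by simp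
   qed
   then have "y = Nul B a (P K)" using jm[OF K O(1) y(1)] by blast
   then show ?thesis using y O k[OF K] by (simp add: Cmp_Nul_right)
  qed
  ultimately show ?thesis using finite_subset by blast
 qed
 then have "good_coproduct I X L \<mu> p" using cop p by (simp add: good_coproduct_def)
 then show ?thesis by blast
qed

lemma good_coproductD:
 assumes "good_coproduct I X P \<iota> \<pi>"
 shows "is_coproduct B I X P \<iota>" "P \<in> Ob B" "\<And>i. i \<in> I \<Longrightarrow> \<iota> i \<in> Arr B (X i) P" "\<And>i. i \<in> I \<Longrightarrow> \<pi> i \<in> Arr B P (X i)"
  "\<And>i j. \<lbrakk>i \<in> I; j \<in> I\<rbrakk> \<Longrightarrow> Cmp B (X j) P (X i) (\<pi> i) (\<iota> j) = (if i = j then Ident B (X i) else Nul B (X j) (X i))"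
  "\<And>a x. \<lbrakk>a \<in> A; x \<in> Arr B a P\<rbrakk> \<Longrightarrow> finite {i \<in> I. Cmp B a P (X i) (\<pi> i) x \<noteq> Nul B a (X i)}"
  "\<And>a x. \<lbrakk>a \<in> A; x \<in> Arr B a P; \<And>i. i \<in> I \<Longrightarrow> Cmp B a P (X i) (\<pi> i) x = Nul B a (X i)\<rbrakk> \<Longrightarrow> x = Nul B a P"
 using assms unfolding good_coproduct_def projections_def is_coproduct_def by blast+

lemma good_coproduct_element_eq:
 assumes P: "good_coproduct I X P \<iota> \<pi>" and X: "\<And>i. i \<in> I \<Longrightarrow> X i \<in> Ob B"
  and a: "a \<in> A" and xy: "x \<in> Arr B a P" "y \<in> Arr B a P"
  and eq: "\<And>i. i \<in> I \<Longrightarrow> Cmp B a P (X i) (\<pi> i) x = Cmp B a P (X i) (\<pi> i) y"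
 shows "x = y"
proof -
 note PD = good_coproductD[OF P] and aO = A_Ob[OF a]
 let ?z = "Add B a P x (Neg B a P y)"
 have z: "?z \<in> Arr B a P" using xy aO PD(2) by (simp add: closed)
 have "?z = Nul B a P"
 proof (rule PD(7)[OF a z])
  fix i assume i: "i \<in> I"
  have "Cmp B a P (X i) (\<pi> i) ?z = Add B a (X i) (Cmp B a P (X i) (\<pi> i) y) (Neg B a (X i) (Cmp B a P (X i) (\<pi> i) y))"
   using i xy aO PD(2,4) X by (simp add: Cmp_Add_right Cmp_Neg_right closed eq)
  also have "\<dots> = Nul B a (X i)"
   using i xy aO PD(2,4) X by (subst Add_commute) (simp_all add: closed Add_Neg)
  finally show "Cmp B a P (X i) (\<pi> i) ?z = Nul B a (X i)" .
 qed
 then have "x = Neg B a P (Neg B a P y)" using Neg_unique[of a P "Neg B a P y" x] xy aO PD(2) by (simp add: closed)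
 then show ?thesis using xy aO PD(2) by (simp add: Neg_Neg)
qed

lemma good_coproduct_element_exists:
 assumes P: "good_coproduct I X P \<iota> \<pi>" and X: "\<And>i. i \<in> I \<Longrightarrow> X i \<in> Ob B" and a: "a \<in> A"
  and K: "finite K" "K \<subseteq> I" and e: "\<And>i. i \<in> K \<Longrightarrow> e i \<in> Arr B a (X i)"
 shows "\<exists>y\<in>Arr B a P. \<forall>i\<in>I. Cmp B a P (X i) (\<pi> i) y = (if i \<in> K then e i else Nul B a (X i))"
 using K e
proof (induction K rule: finite_induct)
 case empty
 then show ?case
  using good_coproductD[OF P] A_Ob[OF a] X by (intro bexI[of _ "Nul B a P"]) (simp_all add: Cmp_Nul_right closed)
next
 case (insert j K)
 note PD = good_coproductD[OF P] and aO = A_Ob[OF a]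
 obtain y where y: "y \<in> Arr B a P" "\<And>i. i \<in> I \<Longrightarrow> Cmp B a P (X i) (\<pi> i) y = (if i \<in> K then e i else Nul B a (X i))"
  using insert by auto
 have j: "j \<in> I" "e j \<in> Arr B a (X j)" "j \<notin> K" using insert by auto
 let ?y = "Add B a P y (Cmp B a (X j) P (\<iota> j) (e j))"
 have y': "?y \<in> Arr B a P" using y(1) j PD(2,3) aO X by (simp add: closed)
 have "Cmp B a P (X i) (\<pi> i) ?y = (if i \<in> insert j K then e i else Nul B a (X i))" if i: "i \<in> I" for i
 proof -
  have "Cmp B a P (X i) (\<pi> i) (Cmp B a (X j) P (\<iota> j) (e j)) = (if i = j then e j else Nul B a (X i))"
   using i j PD(2-4) aO X by (simp add: Cmp_assoc PD(5) Cmp_Ident_left Cmp_Nul_left)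
  then have "Cmp B a P (X i) (\<pi> i) ?y = Add B a (X i) (if i \<in> K then e i else Nul B a (X i)) (if i = j then e j else Nul B a (X i))"
   using i j y PD(2-4) aO X by (simp add: Cmp_Add_right closed)
  then show ?thesis
   using insert.prems i j aO X[OF i] Add_commute[of a "X i" "e i" "Nul B a (X i)"] by (auto simp: Add_Nul closed)
 qed
 then show ?case using y' by blast
qed

text \<open>Composed with \<open>\<pi> i\<close>, the arrow \<open>h\<close> becomes
  \<open>m i\<close> after \<open>\<pi>' i\<close> for \<open>i\<close> in \<open>J\<close> and zero
  outside \<open>J\<close>. Injectivity on elements can then be checked in each component, and an
  element of \<open>P\<close> with liftable components is lifted from its finitely many nonzero
  ones.\<close>

lemma coproduct_embedding:
 assumes Q: "good_coproduct J C Q \<iota>' \<pi>'" and P: "good_coproduct I X P \<iota> \<pi>" and JI: "J \<subseteq> I"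
  and C: "\<And>i. i \<in> J \<Longrightarrow> C i \<in> Ob B" and X: "\<And>i. i \<in> I \<Longrightarrow> X i \<in> Ob B"
  and m: "\<And>i. i \<in> J \<Longrightarrow> embedding (C i) (X i) (m i)"
  and h: "h \<in> Arr B Q P" "\<And>i. i \<in> J \<Longrightarrow> Cmp B (C i) Q P h (\<iota>' i) = Cmp B (C i) (X i) P (\<iota> i) (m i)"
 shows "embedding Q P h"
  and "\<lbrakk>a \<in> A; x \<in> Arr B a P; \<And>i. i \<in> J \<Longrightarrow> \<exists>e\<in>Arr B a (C i). Cmp B a P (X i) (\<pi> i) x = Cmp B a (C i) (X i) (m i) e;
    \<And>i. i \<in> I - J \<Longrightarrow> Cmp B a P (X i) (\<pi> i) x = Nul B a (X i)\<rbrakk> \<Longrightarrow> \<exists>y\<in>Arr B a Q. x = Cmp B a Q P h y"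
proof -
 note QD = good_coproductD[OF Q] and PD = good_coproductD[OF P]
 have mA: "m i \<in> Arr B (C i) (X i)" if "i \<in> J" for i using m[OF that] by (simp add: embedding_def)
 have \<pi>h: "Cmp B Q P (X i) (\<pi> i) h = (if i \<in> J then Cmp B Q (C i) (X i) (m i) (\<pi>' i) else Nul B Q (X i))" (is "_ = ?r")
  if i: "i \<in> I" for i
 proof (rule coproduct_eq[OF QD(1) C X[OF i]])
  show "?r \<in> Arr B Q (X i)" using mA QD C X[OF i] by (auto simp: closed)
  show "Cmp B Q P (X i) (\<pi> i) h \<in> Arr B Q (X i)" using h(1) QD(2) PD(2,4) X i by (simp add: closed)
  fix j assume j: "j \<in> J"
  then have jI: "j \<in> I" using JI by blast
  have "Cmp B (C j) Q (X i) (Cmp B Q P (X i) (\<pi> i) h) (\<iota>' j) =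
    Cmp B (C j) (X j) (X i) (Cmp B (X j) P (X i) (\<pi> i) (\<iota> j)) (m j)"
   using h(1) h(2)[OF j] i j jI QD(2,3) PD(2-4) C X mA by (simp add: Cmp_assoc[symmetric])
  also have "\<dots> = (if i = j then m i else Nul B (C j) (X i))"
   using i j jI C X mA by (simp add: PD(5) Cmp_Ident_left Cmp_Nul_left)
  also have "\<dots> = Cmp B (C j) Q (X i) ?r (\<iota>' j)"
  proof (cases "i \<in> J")
   case True
   have "Cmp B (C j) Q (X i) (Cmp B Q (C i) (X i) (m i) (\<pi>' i)) (\<iota>' j) =
     Cmp B (C j) (C i) (X i) (m i) (if i = j then Ident B (C i) else Nul B (C j) (C i))"
    using True j i QD(2-4) C X mA by (simp add: Cmp_assoc[symmetric] QD(5))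
   then show ?thesis using True i j C X mA by (auto simp: Cmp_Ident_right Cmp_Nul_right)
  next
   case False
   then show ?thesis using i j QD(2,3) C X by (auto simp: Cmp_Nul_left)
  qed
  finally show "Cmp B (C j) Q (X i) (Cmp B Q P (X i) (\<pi> i) h) (\<iota>' j) = Cmp B (C j) Q (X i) ?r (\<iota>' j)" .
 qed
 have \<pi>hy: "Cmp B a P (X i) (\<pi> i) (Cmp B a Q P h y) =
   (if i \<in> J then Cmp B a (C i) (X i) (m i) (Cmp B a Q (C i) (\<pi>' i) y) else Nul B a (X i))"
  if "a \<in> A" "y \<in> Arr B a Q" "i \<in> I" for a y i
 proof -
  have "Cmp B a P (X i) (\<pi> i) (Cmp B a Q P h y) = Cmp B a Q (X i) (Cmp B Q P (X i) (\<pi> i) h) y"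
   using that A_Ob X QD(2) PD(2,4) h(1) by (simp add: Cmp_assoc)
  then show ?thesis using that A_Ob X C mA QD(2,4) \<pi>h by (auto simp: Cmp_assoc Cmp_Nul_left)
 qed
 have "inj_on (Cmp B a Q P h) (Arr B a Q)" if a: "a \<in> A" for a
 proof (rule inj_onI)
  fix y y' assume y: "y \<in> Arr B a Q" "y' \<in> Arr B a Q" "Cmp B a Q P h y = Cmp B a Q P h y'"
  show "y = y'"
  proof (rule good_coproduct_element_eq[OF Q C a y(1,2)])
   fix i assume i: "i \<in> J"
   then have iI: "i \<in> I" using JI by blast
   have "Cmp B a (C i) (X i) (m i) (Cmp B a Q (C i) (\<pi>' i) y) = Cmp B a (C i) (X i) (m i) (Cmp B a Q (C i) (\<pi>' i) y')"
    using \<pi>hy[OF a y(1) iI] \<pi>hy[OF a y(2) iI] y(3) i by simp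
   then show "Cmp B a Q (C i) (\<pi>' i) y = Cmp B a Q (C i) (\<pi>' i) y'"
    using m[OF i] a i y C QD(2,4) A_Ob Cmp_closed unfolding embedding_def inj_on_def by metis
  qed
 qed
 then show "embedding Q P h" using h(1) QD(2) PD(2) by (simp add: embedding_def)
 assume a: "a \<in> A" and x: "x \<in> Arr B a P"
  and xJ: "\<And>i. i \<in> J \<Longrightarrow> \<exists>e\<in>Arr B a (C i). Cmp B a P (X i) (\<pi> i) x = Cmp B a (C i) (X i) (m i) e"
  and xI: "\<And>i. i \<in> I - J \<Longrightarrow> Cmp B a P (X i) (\<pi> i) x = Nul B a (X i)"
 obtain e where e: "\<And>i. i \<in> J \<Longrightarrow> e i \<in> Arr B a (C i)" "\<And>i. i \<in> J \<Longrightarrow> Cmp B a P (X i) (\<pi> i) x = Cmp B a (C i) (X i) (m i) (e i)"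
  using xJ by metis
 \<comment> \<open>Only the nonzero components are lifted by \<open>e i\<close>; at the others the
   lift is taken to be zero, as an element of \<open>Q\<close> has finite support.\<close>
 define K where "K = {i \<in> J. Cmp B a P (X i) (\<pi> i) x \<noteq> Nul B a (X i)}"
 have "K \<subseteq> {i \<in> I. Cmp B a P (X i) (\<pi> i) x \<noteq> Nul B a (X i)}" using JI by (auto simp: K_def)
 then have K: "finite K" "K \<subseteq> J" using PD(6)[OF a x] finite_subset by (auto simp: K_def)
 obtain y where y: "y \<in> Arr B a Q" "\<And>i. i \<in> J \<Longrightarrow> Cmp B a Q (C i) (\<pi>' i) y = (if i \<in> K then e i else Nul B a (C i))"
  using good_coproduct_element_exists[OF Q C a K, of e] e(1) K(2) by blast
 have "x = Cmp B a Q P h y"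
 proof (rule good_coproduct_element_eq[OF P X a x])
  show "Cmp B a Q P h y \<in> Arr B a P" using a A_Ob QD(2) PD(2) h(1) y(1) by (simp add: closed)
  fix i assume i: "i \<in> I"
  show "Cmp B a P (X i) (\<pi> i) x = Cmp B a P (X i) (\<pi> i) (Cmp B a Q P h y)"
  proof (cases "i \<in> J")
   case True
   then show ?thesis
    using \<pi>hy[OF a y(1) i] y(2)[OF True] e(2)[OF True] a A_Ob C[OF True] X[OF i] mA[OF True]
    by (auto simp: K_def Cmp_Nul_right)
  next
   case False
   then show ?thesis using \<pi>hy[OF a y(1) i] xI i by simp
  qed
 qed
 with y show "\<exists>y\<in>Arr B a Q. x = Cmp B a Q P h y" by blast
qed

end

section \<open>The differential graded category of complexes\<close>

definition graded_hom :: "('o, 'm) preadd_cat \<Rightarrow> int \<Rightarrow> (int \<Rightarrow> 'o) \<Rightarrow> (int \<Rightarrow> 'o) \<Rightarrow> (int \<Rightarrow> ('o, 'm) vec) endo set" where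
 "graded_hom C k X Y = graded_op C k X Y ` graded_arrows C k X Y"

context graded_category
begin

lemma graded_homI: "f \<in> graded_arrows C k X Y \<Longrightarrow> graded_op C k X Y f \<in> graded_hom C k X Y"
 by (simp add: graded_hom_def)

lemma graded_hom_add:
 assumes O: "objs X" "objs Y" and "a \<in> graded_hom C k X Y" "b \<in> graded_hom C k X Y"
 shows "a + b \<in> graded_hom C k X Y"
proof -
 obtain f g where fg: "f \<in> graded_arrows C k X Y" "g \<in> graded_arrows C k X Y"
  and ab: "a = graded_op C k X Y f" "b = graded_op C k X Y g"
  using assms by (auto simp: graded_hom_def)
 show ?thesis unfolding ab graded_op_Add(2)[OF O fg, symmetric] by (rule graded_homI[OF graded_op_Add(1)[OF O fg]])
qed

lemma graded_hom_uminus: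
 assumes O: "objs X" "objs Y" and "a \<in> graded_hom C k X Y" shows "- a \<in> graded_hom C k X Y"
proof -
 obtain f where f: "f \<in> graded_arrows C k X Y" and a: "a = graded_op C k X Y f"
  using assms by (auto simp: graded_hom_def)
 show ?thesis unfolding a graded_op_Neg(2)[OF O f, symmetric] by (rule graded_homI[OF graded_op_Neg(1)[OF O f]])
qed

lemma graded_hom_zero: assumes O: "objs X" "objs Y" shows "0 \<in> graded_hom C k X Y"
 unfolding graded_op_Nul(2)[OF O, of k, symmetric] by (rule graded_homI[OF graded_op_Nul(1)[OF O]])

lemma graded_hom_mult:
 assumes "objs X" "objs Y" "objs Z" "a \<in> graded_hom C k X Y" "b \<in> graded_hom C l Y Z"
 shows "b * a \<in> graded_hom C (k + l) X Z"
proof -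
 obtain f g where fg: "f \<in> graded_arrows C k X Y" "g \<in> graded_arrows C l Y Z"
  and ab: "a = graded_op C k X Y f" "b = graded_op C l Y Z g"
  using assms by (auto simp: graded_hom_def)
 show ?thesis unfolding ab graded_op_Cmp(2)[OF assms(1-3) fg, symmetric]
  by (rule graded_homI[OF graded_op_Cmp(1)[OF assms(1-3) fg]])
qed

definition gid :: "(int \<Rightarrow> 'o) \<Rightarrow> (int \<Rightarrow> ('o, 'm) vec) endo" where
 "gid X = graded_op C 0 X X (\<lambda>n. Ident C (X n))"

lemma gid_arrows: "objs X \<Longrightarrow> (\<lambda>n. Ident C (X n)) \<in> graded_arrows C 0 X X"
 by (simp add: graded_arrows_def Ident_closed)

lemma gid_hom: "objs X \<Longrightarrow> gid X \<in> graded_hom C 0 X X"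
 unfolding gid_def by (rule graded_homI[OF gid_arrows])

lemma gid_left:
 assumes "objs X" "objs Y" "a \<in> graded_hom C k X Y" shows "gid Y * a = a"
proof -
 obtain f where f: "f \<in> graded_arrows C k X Y" "a = graded_op C k X Y f" using assms by (auto simp: graded_hom_def)
 have "gid Y * a = graded_op C k X Y (\<lambda>n. Cmp C (X n) (Y (n + k)) (Y (n + k)) (Ident C (Y (n + k))) (f n))"
  using graded_op_Cmp(2)[OF assms(1,2,2) f(1) gid_arrows[OF assms(2)]] by (simp add: gid_def f(2))
 also have "\<dots> = a" using f assms by (simp add: graded_arrows_def Cmp_Ident_left)
 finally show ?thesis .
qed

lemma gid_right:
 assumes "objs X" "objs Y" "a \<in> graded_hom C k X Y" shows "a * gid X = a"
proof -
 obtain f where f: "f \<in> graded_arrows C k X Y" "a = graded_op C k X Y f" using assms by (auto simp: graded_hom_def)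
 have "a * gid X = graded_op C k X Y (\<lambda>n. Cmp C (X n) (X n) (Y (n + k)) (f n) (Ident C (X n)))"
  using graded_op_Cmp(2)[OF assms(1,1,2) gid_arrows[OF assms(1)] f(1)] by (simp add: gid_def f(2))
 also have "\<dots> = a" using f assms by (simp add: graded_arrows_def Cmp_Ident_right)
 finally show ?thesis .
qed

end

notation cob ("_$_" [1000, 1000] 1000)

locale homotopy = graded_category B + additive_category B for B :: "('o, 'm) preadd_cat"
begin

abbreviation "\<C> \<equiv> complexes B"
abbreviation "\<H> \<equiv> homotopy_class B"

lemma complexesD:
 assumes "X \<in> \<C>" shows "objs (cob X)" "cdiff X \<in> graded_arrows B 1 (cob X) (cob X)"
  "Cmp B X$n X$(n + 1) X$(n + 2) (cdiff X (n + 1)) (cdiff X n) = Nul B X$n X$(n + 2)"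
 using assms by (auto simp: complexes_def graded_arrows_def)

text \<open>Empty unless both arguments are complexes, so that membership guarantees the objects, as
  \<open>dg_category\<close> demands.\<close>

definition Hom :: "int \<Rightarrow> ('o, 'm) cpx \<Rightarrow> ('o, 'm) cpx \<Rightarrow> (int \<Rightarrow> ('o, 'm) vec) endo set" where
 "Hom k X Y = (if X \<in> \<C> \<and> Y \<in> \<C> then graded_hom B k (cob X) (cob Y) else {})"

definition unit :: "('o, 'm) cpx \<Rightarrow> (int \<Rightarrow> ('o, 'm) vec) endo" where "unit X = gid (cob X)"

definition dif :: "('o, 'm) cpx \<Rightarrow> (int \<Rightarrow> ('o, 'm) vec) endo" where
 "dif X = graded_op B 1 (cob X) (cob X) (cdiff X)"

abbreviation op :: "('o, 'm) cpx \<Rightarrow> ('o, 'm) cpx \<Rightarrow> (int \<Rightarrow> 'm) \<Rightarrow> (int \<Rightarrow> ('o, 'm) vec) endo" where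
 "op X Y \<equiv> graded_op B 0 (cob X) (cob Y)"

lemma dif_dif: assumes X: "X \<in> \<C>" shows "dif X * dif X = 0"
proof -
 note c = complexesD[OF X]
 have "dif X * dif X = graded_op B 2 (cob X) (cob X) (\<lambda>n. Cmp B X$n X$(n + 1) X$(n + 2) (cdiff X (n + 1)) (cdiff X n))"
  using graded_op_Cmp(2)[OF c(1,1,1,2,2)] by (simp add: dif_def)
 then show ?thesis using graded_op_Nul(2)[OF c(1,1), of 2] by (simp add: c(3))
qed

sublocale dg: dg_category \<C> Hom unit dif
proof
 show "dif X * dif X = 0" if "X \<in> \<C>" for X using dif_dif[OF that] .
 show "dif X \<in> Hom 1 X X" if "X \<in> \<C>" for X
  using that graded_homI[OF complexesD(2)[OF that]] by (simp add: dif_def Hom_def)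
 show "g * f \<in> Hom (k + l) X Z" if "f \<in> Hom k X Y" "g \<in> Hom l Y Z" for f g k l X Y Z
  using that graded_hom_mult[OF complexesD(1) complexesD(1) complexesD(1), of X Y Z f k g l]
  by (simp add: Hom_def split: if_splits)
 show "unit Y * f = f" "f * unit X = f" if "f \<in> Hom k X Y" for f k X Y
  using that gid_left[OF complexesD(1) complexesD(1), of X Y f k] gid_right[OF complexesD(1) complexesD(1), of X Y f k]
  by (simp_all add: Hom_def unit_def split: if_splits)
qed (auto simp: Hom_def unit_def graded_hom_zero graded_hom_add graded_hom_uminus gid_hom complexesD(1) split: if_splits)

lemma op_Hom: "\<lbrakk>X \<in> \<C>; Y \<in> \<C>; f \<in> graded_arrows B k (cob X) (cob Y)\<rbrakk> \<Longrightarrow> graded_op B k (cob X) (cob Y) f \<in> Hom k X Y"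
 by (simp add: Hom_def graded_homI)

lemma Hom_op: assumes "a \<in> Hom k X Y" obtains f where "f \<in> graded_arrows B k (cob X) (cob Y)" "a = graded_op B k (cob X) (cob Y) f"
 using assms by (auto simp: Hom_def graded_hom_def split: if_splits)

lemma chain_maps_arrows: "f \<in> chain_maps B X Y \<Longrightarrow> f \<in> graded_arrows B 0 (cob X) (cob Y)"
 by (simp add: chain_maps_def graded_arrows_def)

text \<open>The ring representation is injective, so the degreewise equations of a chain map amount
  to a single ring identity. \<open>null_homotopic_iff\<close> treats homotopies in the same
  manner.\<close>

lemma chain_maps_iff:
 assumes X: "X \<in> \<C>" and Y: "Y \<in> \<C>"
 shows "f \<in> chain_maps B X Y \<longleftrightarrow> f \<in> graded_arrows B 0 (cob X) (cob Y) \<and> op X Y f \<in> dg.cyc X Y"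
proof -
 note c = complexesD[OF X] and c' = complexesD[OF Y]
 have "dif Y * op X Y f = op X Y f * dif X \<longleftrightarrow>
   (\<forall>n. Cmp B X$n X$(n + 1) Y$(n + 1) (f (n + 1)) (cdiff X n) =
    Cmp B X$n Y$n Y$(n + 1) (cdiff Y n) (f n))" if f: "f \<in> graded_arrows B 0 (cob X) (cob Y)"
  using graded_op_Cmp[OF c(1) c'(1) c'(1) f c'(2)] graded_op_Cmp[OF c(1) c(1) c'(1) c(2) f]
   graded_op_inject[OF c(1) c'(1), of "\<lambda>n. Cmp B X$n X$(n + 1) Y$(n + 1) (f (n + 1)) (cdiff X n)" 1
    "\<lambda>n. Cmp B X$n Y$n Y$(n + 1) (cdiff Y n) (f n)"]
  by (auto simp: dif_def fun_eq_iff)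
 then show ?thesis using op_Hom[OF X Y, of f 0] by (auto simp: chain_maps_def graded_arrows_def dg.cyc_def)
qed

lemma op_cyc: "\<lbrakk>X \<in> \<C>; Y \<in> \<C>; f \<in> chain_maps B X Y\<rbrakk> \<Longrightarrow> op X Y f \<in> dg.cyc X Y"
 by (simp add: chain_maps_iff)

lemma cyc_op:
 assumes "a \<in> dg.cyc X Y" obtains f where "f \<in> chain_maps B X Y" "a = op X Y f"
proof -
 have O: "X \<in> \<C>" "Y \<in> \<C>" using dg.cyc_Ob assms by blast+
 obtain f where "f \<in> graded_arrows B 0 (cob X) (cob Y)" "a = op X Y f" using Hom_op[OF dg.cyc_H[OF assms]] .
 then show thesis using that[of f] assms O by (simp add: chain_maps_iff)
qed

lemma op_inject: "\<lbrakk>X \<in> \<C>; Y \<in> \<C>; f \<in> chain_maps B X Y; g \<in> chain_maps B X Y; op X Y f = op X Y g\<rbrakk> \<Longrightarrow> f = g"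
 using graded_op_inject complexesD(1) chain_maps_arrows by blast

lemma op_Cmp:
 assumes O: "X \<in> \<C>" "Y \<in> \<C>" "Z \<in> \<C>" and f: "f \<in> graded_arrows B 0 (cob X) (cob Y)" "g \<in> graded_arrows B 0 (cob Y) (cob Z)"
 shows "op X Z (\<lambda>n. Cmp B X$n Y$n Z$n (g n) (f n)) = op Y Z g * op X Y f"
  "(\<lambda>n. Cmp B X$n Y$n Z$n (g n) (f n)) \<in> graded_arrows B 0 (cob X) (cob Z)"
 using graded_op_Cmp[OF complexesD(1)[OF O(1)] complexesD(1)[OF O(2)] complexesD(1)[OF O(3)] f] by simp_all

lemma op_Add:
 assumes O: "X \<in> \<C>" "Y \<in> \<C>" and f: "f \<in> graded_arrows B 0 (cob X) (cob Y)" "g \<in> graded_arrows B 0 (cob X) (cob Y)"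
 shows "op X Y (\<lambda>n. Add B X$n Y$n (f n) (g n)) = op X Y f + op X Y g"
  "(\<lambda>n. Add B X$n Y$n (f n) (g n)) \<in> graded_arrows B 0 (cob X) (cob Y)"
 using graded_op_Add[OF complexesD(1)[OF O(1)] complexesD(1)[OF O(2)] f] by simp_all

lemma op_Nul:
 assumes O: "X \<in> \<C>" "Y \<in> \<C>"
 shows "op X Y (\<lambda>n. Nul B X$n Y$n) = 0"
  "(\<lambda>n. Nul B X$n Y$n) \<in> graded_arrows B 0 (cob X) (cob Y)"
 using graded_op_Nul[OF complexesD(1)[OF O(1)] complexesD(1)[OF O(2)], of 0] by simp_all

lemma op_Neg:
 assumes O: "X \<in> \<C>" "Y \<in> \<C>" and f: "f \<in> graded_arrows B 0 (cob X) (cob Y)"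
 shows "op X Y (\<lambda>n. Neg B X$n Y$n (f n)) = - op X Y f"
  "(\<lambda>n. Neg B X$n Y$n (f n)) \<in> graded_arrows B 0 (cob X) (cob Y)"
 using graded_op_Neg[OF complexesD(1)[OF O(1)] complexesD(1)[OF O(2)] f] by simp_all

lemma null_homotopic_iff:
 assumes X: "X \<in> \<C>" and Y: "Y \<in> \<C>" and f: "f \<in> chain_maps B X Y"
 shows "f \<in> null_homotopic B X Y \<longleftrightarrow> dg.homotopic X Y (op X Y f) 0"
proof -
 note c = complexesD[OF X] and c' = complexesD[OF Y]
 have key: "op X Y f = dif Y * graded_op B (- 1) (cob X) (cob Y) s + graded_op B (- 1) (cob X) (cob Y) s * dif X \<longleftrightarrow>
   (\<forall>n. f n = Add B X$n Y$n
      (Cmp B X$n Y$(n - 1) Y$n (cdiff Y (n - 1)) (s n))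
      (Cmp B X$n X$(n + 1) Y$n (s (n + 1)) (cdiff X n)))"
  if s: "s \<in> graded_arrows B (- 1) (cob X) (cob Y)" for s
 proof -
  let ?a = "\<lambda>n. Cmp B X$n Y$(n - 1) Y$n (cdiff Y (n - 1)) (s n)"
  let ?b = "\<lambda>n. Cmp B X$n X$(n + 1) Y$n (s (n + 1)) (cdiff X n)"
  have a: "?a \<in> graded_arrows B 0 (cob X) (cob Y)" "op X Y ?a = dif Y * graded_op B (- 1) (cob X) (cob Y) s"
   using graded_op_Cmp[OF c(1) c'(1) c'(1) s c'(2)] by (simp_all add: dif_def)
  have b: "?b \<in> graded_arrows B 0 (cob X) (cob Y)" "op X Y ?b = graded_op B (- 1) (cob X) (cob Y) s * dif X"
   using graded_op_Cmp[OF c(1) c(1) c'(1) c(2) s] by (simp_all add: dif_def)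
  have "op X Y f = op X Y ?a + op X Y ?b \<longleftrightarrow> f = (\<lambda>n. Add B X$n Y$n (?a n) (?b n))"
   using op_Add[OF X Y a(1) b(1)] graded_op_inject[OF c(1) c'(1) chain_maps_arrows[OF f] op_Add(2)[OF X Y a(1) b(1)]] by auto
  then show ?thesis by (simp add: a b fun_eq_iff)
 qed
 have s_iff: "s \<in> graded_arrows B (- 1) (cob X) (cob Y) \<longleftrightarrow> (\<forall>n. s n \<in> Arr B X$n Y$(n - 1))" for s
  by (simp add: graded_arrows_def)
 show ?thesis
 proof
  assume "f \<in> null_homotopic B X Y"
  then obtain s where "s \<in> graded_arrows B (- 1) (cob X) (cob Y)"
   "op X Y f = dif Y * graded_op B (- 1) (cob X) (cob Y) s + graded_op B (- 1) (cob X) (cob Y) s * dif X"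
   unfolding null_homotopic_def using s_iff key by blast
  then show "dg.homotopic X Y (op X Y f) 0" using op_Hom[OF X Y] by (auto simp: dg.homotopic_def)
 next
  assume "dg.homotopic X Y (op X Y f) 0"
  then obtain a where a: "a \<in> Hom (- 1) X Y" "op X Y f = dif Y * a + a * dif X" by (auto simp: dg.homotopic_def)
  obtain s where s: "s \<in> graded_arrows B (- 1) (cob X) (cob Y)" "a = graded_op B (- 1) (cob X) (cob Y) s"
   using Hom_op[OF a(1)] .
  then show "f \<in> null_homotopic B X Y" unfolding null_homotopic_def using f key[OF s(1)] a(2) s_iff by blast
 qed
qed

section \<open>The quotient by null-homotopic maps\<close>

lemma homotopic_diff: "dg.homotopic X Y (a - b) 0 \<longleftrightarrow> dg.homotopic X Y a b"
 by (simp add: dg.homotopic_def)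

lemma C_group: assumes X: "X \<in> \<C>" and Y: "Y \<in> \<C>" shows "comm_group (hom_group (C_cat B) X Y)"
proof -
 have O: "X$n \<in> Ob B" "Y$n \<in> Ob B" for n using complexesD(1) X Y by auto
 have A: "f n \<in> Arr B X$n Y$n" if "f \<in> chain_maps B X Y" for f n using that by (simp add: chain_maps_def)
 show ?thesis
 proof (rule comm_groupI; simp add: hom_group_def C_cat_def)
  show "(\<lambda>n. Add B X$n Y$n (f n) (g n)) \<in> chain_maps B X Y"
   if "f \<in> chain_maps B X Y" "g \<in> chain_maps B X Y" for f g
   using that op_Add[OF X Y chain_maps_arrows chain_maps_arrows] dg.cyc_add by (simp add: chain_maps_iff[OF X Y])
  show "(\<lambda>n. Nul B X$n Y$n) \<in> chain_maps B X Y"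
   using op_Nul[OF X Y] dg.cyc_zero[OF X Y] by (simp add: chain_maps_iff[OF X Y])
  show "(\<lambda>n. Add B X$n Y$n (Add B X$n Y$n (f n) (g n)) (h n)) =
    (\<lambda>n. Add B X$n Y$n (f n) (Add B X$n Y$n (g n) (h n)))"
   if "f \<in> chain_maps B X Y" "g \<in> chain_maps B X Y" "h \<in> chain_maps B X Y" for f g h
   using that O A by (simp add: Add_assoc)
  show "(\<lambda>n. Add B X$n Y$n (f n) (g n)) = (\<lambda>n. Add B X$n Y$n (g n) (f n))"
   if "f \<in> chain_maps B X Y" "g \<in> chain_maps B X Y" for f g
  proof
   fix n show "Add B X$n Y$n (f n) (g n) = Add B X$n Y$n (g n) (f n)"
    using Add_commute[OF O A A] that by blast
  qed
  show "(\<lambda>n. Add B X$n Y$n (Nul B X$n Y$n) (f n)) = f" if "f \<in> chain_maps B X Y" for f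
   using that O A by (simp add: Add_Nul)
  show "\<exists>g\<in>chain_maps B X Y. (\<lambda>n. Add B X$n Y$n (g n) (f n)) = (\<lambda>n. Nul B X$n Y$n)"
   if f: "f \<in> chain_maps B X Y" for f
  proof (intro bexI[of _ "\<lambda>n. Neg B X$n Y$n (f n)"])
   show "(\<lambda>n. Neg B X$n Y$n (f n)) \<in> chain_maps B X Y"
    using f op_Neg[OF X Y chain_maps_arrows[OF f]] dg.cyc_uminus by (simp add: chain_maps_iff[OF X Y])
  qed (use O A f in \<open>simp add: Add_Neg\<close>)
 qed
qed

lemma C_simps:
 "carrier (hom_group (C_cat B) X Y) = chain_maps B X Y"
 "mult (hom_group (C_cat B) X Y) f g = (\<lambda>n. Add B X$n Y$n (f n) (g n))"
 "one (hom_group (C_cat B) X Y) = (\<lambda>n. Nul B X$n Y$n)"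
 by (simp_all add: hom_group_def C_cat_def)

lemma C_inv:
 assumes X: "X \<in> \<C>" and Y: "Y \<in> \<C>" and f: "f \<in> chain_maps B X Y"
 shows "op X Y (inv\<^bsub>hom_group (C_cat B) X Y\<^esub> f) = - op X Y f"
proof -
 interpret G: comm_group "hom_group (C_cat B) X Y" by (rule C_group[OF X Y])
 let ?g = "inv\<^bsub>hom_group (C_cat B) X Y\<^esub> f"
 have g: "?g \<in> chain_maps B X Y" using G.inv_closed f by (simp add: C_simps)
 have "(\<lambda>n. Add B X$n Y$n (?g n) (f n)) = (\<lambda>n. Nul B X$n Y$n)"
  using G.l_inv f by (simp add: C_simps)
 then have "op X Y ?g + op X Y f = 0"
  using op_Add(1)[OF X Y chain_maps_arrows[OF g] chain_maps_arrows[OF f]] op_Nul(1)[OF X Y] by simp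
 then show ?thesis by (simp add: eq_neg_iff_add_eq_0)
qed

lemma homotopic_add: "\<lbrakk>dg.homotopic X Y a 0; dg.homotopic X Y b 0\<rbrakk> \<Longrightarrow> dg.homotopic X Y (a + b) 0"
proof -
 assume "dg.homotopic X Y a 0" "dg.homotopic X Y b 0"
 then obtain s t where "s \<in> Hom (- 1) X Y" "t \<in> Hom (- 1) X Y" "a = dif Y * s + s * dif X" "b = dif Y * t + t * dif X"
  by (auto simp: dg.homotopic_def)
 then show ?thesis by (intro dg.homotopicI[of "s + t"]) (simp_all add: dg.H_add algebra_simps)
qed

lemma homotopic_uminus: "dg.homotopic X Y a 0 \<Longrightarrow> dg.homotopic X Y (- a) 0"
proof -
 assume "dg.homotopic X Y a 0"
 then obtain s where "s \<in> Hom (- 1) X Y" "a = dif Y * s + s * dif X" by (auto simp: dg.homotopic_def)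
 then show ?thesis by (intro dg.homotopicI[of "- s"]) (simp_all add: dg.H_uminus algebra_simps)
qed

lemma null_homotopic_subset: "null_homotopic B X Y \<subseteq> chain_maps B X Y"
 by (auto simp: null_homotopic_def)

lemma null_homotopic_normal:
 assumes X: "X \<in> \<C>" and Y: "Y \<in> \<C>" shows "null_homotopic B X Y \<lhd> hom_group (C_cat B) X Y"
proof -
 interpret G: comm_group "hom_group (C_cat B) X Y" by (rule C_group[OF X Y])
 have in_chain: "f \<in> chain_maps B X Y" if "f \<in> null_homotopic B X Y" for f using that null_homotopic_subset by blast
 have "subgroup (null_homotopic B X Y) (hom_group (C_cat B) X Y)"
 proof (rule subgroup.intro)
  show "null_homotopic B X Y \<subseteq> carrier (hom_group (C_cat B) X Y)" by (simp add: C_simps null_homotopic_subset)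
  show "\<one>\<^bsub>hom_group (C_cat B) X Y\<^esub> \<in> null_homotopic B X Y"
   using G.one_closed null_homotopic_iff[OF X Y] op_Nul(1)[OF X Y] dg.H_zero[OF X Y]
   by (auto simp: C_simps dg.homotopic_def intro!: bexI[of _ 0])
  show "f \<otimes>\<^bsub>hom_group (C_cat B) X Y\<^esub> g \<in> null_homotopic B X Y"
   if fg: "f \<in> null_homotopic B X Y" "g \<in> null_homotopic B X Y" for f g
  proof -
   have "f \<otimes>\<^bsub>hom_group (C_cat B) X Y\<^esub> g \<in> chain_maps B X Y" using fg[THEN in_chain] G.m_closed by (simp add: C_simps)
   then show ?thesis
    using null_homotopic_iff[OF X Y] fg fg[THEN in_chain] homotopic_add
     op_Add(1)[OF X Y chain_maps_arrows[OF in_chain[OF fg(1)]] chain_maps_arrows[OF in_chain[OF fg(2)]]]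
    by (simp add: C_simps)
  qed
  show "inv\<^bsub>hom_group (C_cat B) X Y\<^esub> f \<in> null_homotopic B X Y" if f: "f \<in> null_homotopic B X Y" for f
  proof -
   have "inv\<^bsub>hom_group (C_cat B) X Y\<^esub> f \<in> chain_maps B X Y" using in_chain[OF f] G.inv_closed by (simp add: C_simps)
   then show ?thesis
    using null_homotopic_iff[OF X Y] f in_chain[OF f] homotopic_uminus C_inv[OF X Y in_chain[OF f]] by simp
  qed
 qed
 then show ?thesis using G.subgroup_imp_normal by blast
qed

text \<open>Translates equality and membership of cosets, the language of the quotient category,
  into homotopies in the ring: a coset condition concerns the difference of representatives.\<close>

lemma homotopy_class_eq:
 assumes X: "X \<in> \<C>" and Y: "Y \<in> \<C>" and f: "f \<in> chain_maps B X Y" and g: "g \<in> chain_maps B X Y"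
 shows "\<H> X Y f = \<H> X Y g \<longleftrightarrow> dg.homotopic X Y (op X Y f) (op X Y g)"
  and "f \<in> \<H> X Y g \<longleftrightarrow> dg.homotopic X Y (op X Y f) (op X Y g)"
proof -
 interpret G: comm_group "hom_group (C_cat B) X Y" by (rule C_group[OF X Y])
 interpret N: normal "null_homotopic B X Y" "hom_group (C_cat B) X Y" by (rule null_homotopic_normal[OF X Y])
 let ?k = "f \<otimes>\<^bsub>hom_group (C_cat B) X Y\<^esub> inv\<^bsub>hom_group (C_cat B) X Y\<^esub> g"
 have ig: "inv\<^bsub>hom_group (C_cat B) X Y\<^esub> g \<in> chain_maps B X Y" using g G.inv_closed by (simp add: C_simps)
 then have k: "?k \<in> chain_maps B X Y" using f G.m_closed by (simp add: C_simps)
 have "f \<in> \<H> X Y g \<longleftrightarrow> ?k \<in> null_homotopic B X Y"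
  using N.rcos_module[OF G.is_group] f g by (simp add: ideal_class_def C_simps)
 also have "\<dots> \<longleftrightarrow> dg.homotopic X Y (op X Y f) (op X Y g)"
  using null_homotopic_iff[OF X Y k] op_Add(1)[OF X Y chain_maps_arrows[OF f] chain_maps_arrows[OF ig]] C_inv[OF X Y g]
   homotopic_diff[of X Y "op X Y f" "op X Y g"] by (simp add: C_simps)
 finally show 2: "f \<in> \<H> X Y g \<longleftrightarrow> dg.homotopic X Y (op X Y f) (op X Y g)" .
 have "f \<in> \<H> X Y f" unfolding ideal_class_def using G.rcos_self[OF _ N.subgroup_axioms] f by (simp add: C_simps)
 moreover have "\<H> X Y g = \<H> X Y f" if "f \<in> \<H> X Y g"
  using that unfolding ideal_class_def by (rule G.repr_independence) (use g N.subgroup_axioms in \<open>simp_all add: C_simps\<close>)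
 ultimately show "\<H> X Y f = \<H> X Y g \<longleftrightarrow> dg.homotopic X Y (op X Y f) (op X Y g)" using 2 by blast
qed

lemma homotopy_class_subset:
 assumes X: "X \<in> \<C>" and Y: "Y \<in> \<C>" and f: "f \<in> chain_maps B X Y" shows "\<H> X Y f \<subseteq> chain_maps B X Y"
proof -
 interpret G: comm_group "hom_group (C_cat B) X Y" by (rule C_group[OF X Y])
 interpret N: normal "null_homotopic B X Y" "hom_group (C_cat B) X Y" by (rule null_homotopic_normal[OF X Y])
 show ?thesis using G.r_coset_subset_G[OF N.subset] f by (simp add: ideal_class_def C_simps)
qed

lemma K_simps:
 "Ob (K_cat B) = \<C>" "Arr (K_cat B) = Arr (homotopy_category B)" "Ident (K_cat B) = Ident (homotopy_category B)"
 "Cmp (K_cat B) = Cmp (homotopy_category B)" "Add (K_cat B) = Add (homotopy_category B)"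
 "Nul (K_cat B) = Nul (homotopy_category B)" "Shift (K_cat B) = K_shift B"
 by (simp_all add: K_cat_def preadd_cat.extend_def tri_cat.fields_def homotopy_category_def quotient_category_def C_cat_def)

lemma K_Arr: assumes X: "X \<in> \<C>" and Y: "Y \<in> \<C>" shows "Arr (K_cat B) X Y = \<H> X Y ` chain_maps B X Y"
 by (auto simp: K_simps homotopy_category_def quotient_category_def FactGroup_def RCOSETS_def ideal_class_def C_simps)

lemma K_Ident: "Ident (K_cat B) X = \<H> X X (\<lambda>n. Ident B X$n)"
 by (simp add: K_simps homotopy_category_def quotient_category_def C_cat_def)

lemma K_Nul: assumes X: "X \<in> \<C>" and Y: "Y \<in> \<C>" shows "Nul (K_cat B) X Y = \<H> X Y (\<lambda>n. Nul B X$n Y$n)"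
proof -
 interpret G: comm_group "hom_group (C_cat B) X Y" by (rule C_group[OF X Y])
 have "null_homotopic B X Y #>\<^bsub>hom_group (C_cat B) X Y\<^esub> \<one>\<^bsub>hom_group (C_cat B) X Y\<^esub> = null_homotopic B X Y"
  using G.coset_mult_one null_homotopic_subset by (simp add: C_simps)
 then show ?thesis
  by (simp add: K_simps homotopy_category_def quotient_category_def FactGroup_def ideal_class_def C_simps)
qed

lemma K_Add:
 assumes X: "X \<in> \<C>" and Y: "Y \<in> \<C>" and f: "f \<in> chain_maps B X Y" and g: "g \<in> chain_maps B X Y"
 shows "Add (K_cat B) X Y (\<H> X Y f) (\<H> X Y g) = \<H> X Y (\<lambda>n. Add B X$n Y$n (f n) (g n))"
proof -
 interpret N: normal "null_homotopic B X Y" "hom_group (C_cat B) X Y" by (rule null_homotopic_normal[OF X Y])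
 show ?thesis using N.rcos_sum[of f g] f g
  by (simp add: K_simps homotopy_category_def quotient_category_def FactGroup_def ideal_class_def C_simps)
qed

lemma homotopic_mult:
 assumes f: "dg.homotopic X Y a a'" "a' \<in> dg.cyc X Y" "a \<in> dg.cyc X Y" and g: "dg.homotopic Y Z b b'" "b \<in> dg.cyc Y Z" "b' \<in> dg.cyc Y Z"
 shows "dg.homotopic X Z (b * a) (b' * a')"
proof -
 obtain s t where s: "s \<in> Hom (- 1) X Y" "a - a' = dif Y * s + s * dif X" and t: "t \<in> Hom (- 1) Y Z" "b - b' = dif Z * t + t * dif Y"
  using f g by (auto simp: dg.homotopic_def)
 have "b * a - b' * a' = (b - b') * a + b' * (a - a')" by (simp add: algebra_simps)
 also have "\<dots> = dif Z * (t * a + b' * s) + (t * a + b' * s) * dif X"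
  unfolding s(2) t(2) using dg.cyc_D[OF f(3)] dg.cyc_D[OF g(3), THEN mult_left_eq] by (simp add: algebra_simps)
 finally show ?thesis
  by (rule dg.homotopicI[rotated]) (use s(1) t(1) f(3) g(3) dg.cyc_H in \<open>blast intro: dg.H_mults dg.H_add\<close>)
qed

lemma chain_maps_Cmp:
 assumes O: "X \<in> \<C>" "Y \<in> \<C>" "Z \<in> \<C>" and f: "f \<in> chain_maps B X Y" and g: "g \<in> chain_maps B Y Z"
 shows "(\<lambda>n. Cmp B X$n Y$n Z$n (g n) (f n)) \<in> chain_maps B X Z"
 using op_Cmp[OF O chain_maps_arrows[OF f] chain_maps_arrows[OF g]] dg.cyc_mult[OF op_cyc[OF O(1,2) f] op_cyc[OF O(2,3) g]]
 by (simp add: chain_maps_iff[OF O(1,3)])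

text \<open>The union over all representatives collapses because homotopic factors have homotopic
  composites.\<close>

lemma K_Cmp:
 assumes O: "X \<in> \<C>" "Y \<in> \<C>" "Z \<in> \<C>" and f: "f \<in> chain_maps B X Y" and g: "g \<in> chain_maps B Y Z"
 shows "Cmp (K_cat B) X Y Z (\<H> Y Z g) (\<H> X Y f) = \<H> X Z (\<lambda>n. Cmp B X$n Y$n Z$n (g n) (f n))"
  (is "_ = \<H> X Z (?c g f)")
proof -
 have refl: "dg.homotopic X Y a a" if "X \<in> \<C>" "Y \<in> \<C>" for X Y a
  using that dg.H_zero by (intro dg.homotopicI[of 0]) auto
 have "\<H> X Z (?c g' f') = \<H> X Z (?c g f)" if g': "g' \<in> \<H> Y Z g" and f': "f' \<in> \<H> X Y f" for g' f'
 proof -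
  have fc: "f' \<in> chain_maps B X Y" "g' \<in> chain_maps B Y Z"
   using homotopy_class_subset[OF O(1,2) f] homotopy_class_subset[OF O(2,3) g] f' g' by auto
  have "dg.homotopic X Y (op X Y f') (op X Y f)" "dg.homotopic Y Z (op Y Z g') (op Y Z g)"
   using homotopy_class_eq(2)[OF O(1,2) fc(1) f] homotopy_class_eq(2)[OF O(2,3) fc(2) g] f' g' by auto
  then have "dg.homotopic X Z (op Y Z g' * op X Y f') (op Y Z g * op X Y f)"
   using homotopic_mult op_cyc O f g fc by blast
  then show ?thesis
   using homotopy_class_eq(1)[OF O(1,3) chain_maps_Cmp[OF O fc] chain_maps_Cmp[OF O f g]]
    op_Cmp(1)[OF O] chain_maps_arrows f g fc by simp
 qed
 moreover have "f \<in> \<H> X Y f" "g \<in> \<H> Y Z g"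
  using homotopy_class_eq(2)[OF O(1,2) f f] homotopy_class_eq(2)[OF O(2,3) g g] refl O by auto
 ultimately have "(\<Union>g'\<in>\<H> Y Z g. \<Union>f'\<in>\<H> X Y f. \<H> X Z (?c g' f')) = \<H> X Z (?c g f)" by blast
 then show ?thesis by (simp add: K_simps homotopy_category_def quotient_category_def C_cat_def)
qed

end

text \<open>In a mapping cone \<open>iX n\<close> starts at \<open>X$(n + 1)\<close>, whereas the
  component in degree \<open>n\<close> of a graded map starts at \<open>X$n\<close>; quantified
  equations are reindexed accordingly.\<close>

lemma all_int_shift: "(\<forall>m :: int. P m) \<longleftrightarrow> (\<forall>n. P (n + 1))"
 by (metis diff_add_cancel)

lemma (in graded_category) graded_op_eq_iff:
 assumes "objs X" "objs Y" "f \<in> graded_arrows C k X Y" "g \<in> graded_arrows C k X Y"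
 shows "graded_op C k X Y f = graded_op C k X Y g \<longleftrightarrow> (\<forall>n. f n = g n)"
 using graded_op_inject[OF assms] by (metis ext)

section \<open>Shift and mapping cones of complexes\<close>

context homotopy
begin

abbreviation "shft \<equiv> fob (K_shift B)"

lemma shft_simps: "(shft X)$n = X$(n + 1)"
 "cdiff (shft X) n = Neg B X$(n + 1) X$(n + 2) (cdiff X (n + 1))"
 by (simp_all add: K_shift_def)

lemmas closed = Cmp_closed Ident_closed Nul_closed Neg_closed hom_closed

lemma complexes_Arr: assumes "X \<in> \<C>" shows "X$n \<in> Ob B" "cdiff X n \<in> Arr B X$n X$(n + 1)"
 using assms by (auto simp: complexes_def)

lemma shft_complex: assumes X: "X \<in> \<C>" shows "shft X \<in> \<C>"
proof -
 have "cdiff X (n + 1) \<in> Arr B X$(n + 1) X$(n + 2)" "cdiff X (n + 2) \<in> Arr B X$(n + 2) X$(n + 3)" for n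
  using complexes_Arr(2)[OF X, of "n + 1"] complexes_Arr(2)[OF X, of "n + 2"] by (simp_all add: ac_simps)
 moreover have "Cmp B X$(n + 1) X$(n + 2) X$(n + 3) (cdiff X (n + 2)) (cdiff X (n + 1)) = Nul B X$(n + 1) X$(n + 3)" for n
  using complexesD(3)[OF X, of "n + 1"] by (simp add: ac_simps)
 ultimately show ?thesis using complexes_Arr(1)[OF X]
  by (simp add: complexes_def shft_simps closed Cmp_Neg_left Cmp_Neg_right Neg_Nul ac_simps)
qed

lemma shft_surj: assumes X: "X \<in> \<C>" shows "\<exists>Y\<in>\<C>. shft Y = X"
proof -
 let ?Y = "\<lparr>cob = \<lambda>n. X$(n - 1), cdiff = \<lambda>n. Neg B X$(n - 1) X$n (cdiff X (n - 1))\<rparr>"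
 have d: "cdiff X (n - 1) \<in> Arr B X$(n - 1) X$n" "cdiff X n \<in> Arr B X$n X$(n + 1)" for n
  using complexes_Arr(2)[OF X, of "n - 1"] complexes_Arr(2)[OF X, of n] by simp_all
 moreover have "Cmp B X$(n - 1) X$n X$(n + 1) (cdiff X n) (cdiff X (n - 1)) = Nul B X$(n - 1) X$(n + 1)" for n
  using complexesD(3)[OF X, of "n - 1"] by (simp add: ac_simps)
 ultimately have "?Y \<in> \<C>" using complexes_Arr(1)[OF X]
  by (simp add: complexes_def closed Cmp_Neg_left Cmp_Neg_right Neg_Nul ac_simps)
 moreover have "shft ?Y = X"
  using d complexes_Arr(1)[OF X] by (intro cpx.equality) (auto simp: shft_simps fun_eq_iff Neg_Neg ac_simps)
 ultimately show ?thesis by blast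
qed

text \<open>Identities regarded as a graded map of degree -1, since \<open>(shft X)$(n - 1)\<close>
  is \<open>X$n\<close>.\<close>

definition sgm :: "('o, 'm) cpx \<Rightarrow> (int \<Rightarrow> ('o, 'm) vec) endo" where
 "sgm X = graded_op B (- 1) (cob X) (cob (shft X)) (\<lambda>n. Ident B X$n)"

definition sgm' :: "('o, 'm) cpx \<Rightarrow> (int \<Rightarrow> ('o, 'm) vec) endo" where
 "sgm' X = graded_op B 1 (cob (shft X)) (cob X) (\<lambda>n. Ident B X$(n + 1))"

lemma sgm_arrows: assumes X: "X \<in> \<C>"
 shows "(\<lambda>n. Ident B X$n) \<in> graded_arrows B (- 1) (cob X) (cob (shft X))"
  "(\<lambda>n. Ident B X$(n + 1)) \<in> graded_arrows B 1 (cob (shft X)) (cob X)"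
 using complexes_Arr(1)[OF X] by (simp_all add: graded_arrows_def shft_simps Ident_closed)

lemma sgm_Hom: assumes X: "X \<in> \<C>" shows "sgm X \<in> Hom (- 1) X (shft X)" "sgm' X \<in> Hom 1 (shft X) X"
 using op_Hom sgm_arrows[OF X] shft_complex[OF X] X by (simp_all add: sgm_def sgm'_def)

lemma sgm_inverse: assumes X: "X \<in> \<C>" shows "sgm X * sgm' X = unit (shft X)" "sgm' X * sgm X = unit X"
proof -
 note c = complexesD(1)[OF X] complexesD(1)[OF shft_complex[OF X]]
 show "sgm X * sgm' X = unit (shft X)"
  using graded_op_Cmp(2)[OF c(2) c(1) c(2) sgm_arrows(2)[OF X] sgm_arrows(1)[OF X]] c
  by (simp add: sgm_def sgm'_def unit_def gid_def shft_simps Cmp_Ident_left Ident_closed)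
 show "sgm' X * sgm X = unit X"
  using graded_op_Cmp(2)[OF c(1) c(2) c(1) sgm_arrows(1)[OF X] sgm_arrows(2)[OF X]] c
  by (simp add: sgm_def sgm'_def unit_def gid_def shft_simps Cmp_Ident_left Ident_closed)
qed

lemma dif_sgm: assumes X: "X \<in> \<C>" shows "dif (shft X) * sgm X = - (sgm X * dif X)"
proof -
 note c = complexesD[OF X] and c' = complexesD[OF shft_complex[OF X]]
 have d: "(\<lambda>n. cdiff X n) \<in> graded_arrows B 0 (cob X) (cob (shft X))"
  using complexes_Arr[OF X] by (simp add: graded_arrows_def shft_simps)
 have "sgm X * dif X = graded_op B 0 (cob X) (cob (shft X)) (\<lambda>n. cdiff X n)"
  using graded_op_Cmp(2)[OF c(1,1) c'(1) c(2) sgm_arrows(1)[OF X]] complexes_Arr[OF X]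
  by (simp add: sgm_def dif_def shft_simps Cmp_Ident_left)
 moreover have "dif (shft X) * sgm X = graded_op B 0 (cob X) (cob (shft X)) (\<lambda>n. Neg B X$n X$(n + 1) (cdiff X n))"
  using graded_op_Cmp(2)[OF c(1) c'(1) c'(1) sgm_arrows(1)[OF X] c'(2)] complexes_Arr[OF X]
  by (simp add: sgm_def dif_def shft_simps Cmp_Ident_right Neg_closed ac_simps)
 ultimately show ?thesis using graded_op_Neg(2)[OF c(1) c'(1) d] by (simp add: shft_simps)
qed

lemma dif_sgm': assumes X: "X \<in> \<C>" shows "sgm' X * dif (shft X) = - (dif X * sgm' X)"
proof -
 note U = dg.units[OF sgm_Hom(1)[OF X]] dg.units[OF sgm_Hom(2)[OF X]] dg.units[OF dg.H_D[OF X]] dg.units[OF dg.H_D[OF shft_complex[OF X]]]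
 have "sgm' X * dif (shft X) = sgm' X * dif (shft X) * (sgm X * sgm' X)" by (simp add: U sgm_inverse[OF X] mult.assoc)
 then show ?thesis
  by (simp add: mult.assoc dif_sgm[OF X, THEN mult_left_eq] sgm_inverse[OF X, THEN mult_left_eq] U)
qed

lemma op_shift:
 assumes X: "X \<in> \<C>" and Y: "Y \<in> \<C>" and f: "f \<in> graded_arrows B 0 (cob X) (cob Y)"
 shows "(\<lambda>n. f (n + 1)) \<in> graded_arrows B 0 (cob (shft X)) (cob (shft Y))"
  "op (shft X) (shft Y) (\<lambda>n. f (n + 1)) = sgm Y * op X Y f * sgm' X"
proof -
 show "(\<lambda>n. f (n + 1)) \<in> graded_arrows B 0 (cob (shft X)) (cob (shft Y))"
  using f by (simp add: graded_arrows_def shft_simps)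
 note c = complexesD(1)[OF X] complexesD(1)[OF shft_complex[OF X]] complexesD(1)[OF Y] complexesD(1)[OF shft_complex[OF Y]]
 have f1: "(\<lambda>n. f (n + 1)) \<in> graded_arrows B 1 (cob (shft X)) (cob Y)"
  using f by (simp add: graded_arrows_def shft_simps)
 have fA: "f n \<in> Arr B X$n Y$n" for n using f by (simp add: graded_arrows_def)
 have "op X Y f * sgm' X = graded_op B 1 (cob (shft X)) (cob Y) (\<lambda>n. f (n + 1))"
  using graded_op_Cmp(2)[OF c(2) c(1) c(3) sgm_arrows(2)[OF X] f] c fA
  by (simp add: sgm'_def shft_simps Cmp_Ident_right)
 moreover have "sgm Y * graded_op B 1 (cob (shft X)) (cob Y) (\<lambda>n. f (n + 1)) = op (shft X) (shft Y) (\<lambda>n. f (n + 1))"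
  using graded_op_Cmp(2)[OF c(2) c(3) c(4) f1 sgm_arrows(1)[OF Y]] c fA
  by (simp add: sgm_def shft_simps Cmp_Ident_left)
 ultimately show "op (shft X) (shft Y) (\<lambda>n. f (n + 1)) = sgm Y * op X Y f * sgm' X" by (simp add: mult.assoc)
qed

lemma shift_cancel:
 assumes X: "X \<in> \<C>" and Y: "Y \<in> \<C>" and a: "a \<in> Hom k X Y" shows "sgm' Y * (sgm Y * a * sgm' X) * sgm X = a"
 by (simp add: mult.assoc sgm_inverse[OF X] sgm_inverse[OF Y] sgm_inverse[OF Y, THEN mult_left_eq] dg.units[OF a])

lemma shift_cyc_iff:
 assumes X: "X \<in> \<C>" and Y: "Y \<in> \<C>" and a: "a \<in> Hom 0 X Y"
 shows "sgm Y * a * sgm' X \<in> dg.cyc (shft X) (shft Y) \<longleftrightarrow> a \<in> dg.cyc X Y"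
proof -
 have s: "sgm Y * a * sgm' X \<in> Hom 0 (shft X) (shft Y)" using sgm_Hom[OF X] sgm_Hom[OF Y] a by (blast intro: dg.H_mults)
 have l: "dif (shft Y) * (sgm Y * a * sgm' X) = - (sgm Y * (dif Y * a) * sgm' X)"
  by (simp add: mult.assoc dif_sgm[OF Y, THEN mult_left_eq])
 have r: "sgm Y * a * sgm' X * dif (shft X) = - (sgm Y * (a * dif X) * sgm' X)"
  by (simp add: mult.assoc dif_sgm'[OF X])
 have da: "dif Y * a \<in> Hom 1 X Y" "a * dif X \<in> Hom 1 X Y" using a dg.H_D X Y by (blast intro: dg.H_mults)+
 have "sgm Y * (dif Y * a) * sgm' X = sgm Y * (a * dif X) * sgm' X \<longleftrightarrow> dif Y * a = a * dif X"
  using shift_cancel[OF X Y da(1)] shift_cancel[OF X Y da(2)] by metis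
 then show ?thesis using s a l r by (simp add: dg.cyc_def)
qed

lemma shift_homotopic_iff:
 assumes X: "X \<in> \<C>" and Y: "Y \<in> \<C>" and a: "a \<in> Hom 0 X Y" "b \<in> Hom 0 X Y"
 shows "dg.homotopic (shft X) (shft Y) (sgm Y * a * sgm' X) (sgm Y * b * sgm' X) \<longleftrightarrow> dg.homotopic X Y a b"
proof
 assume "dg.homotopic X Y a b"
 then obtain s where s: "s \<in> Hom (- 1) X Y" "a - b = dif Y * s + s * dif X" by (auto simp: dg.homotopic_def)
 have "sgm Y * a * sgm' X - sgm Y * b * sgm' X = sgm Y * (a - b) * sgm' X" by (simp add: algebra_simps)
 also have "\<dots> = dif (shft Y) * (- (sgm Y * (s * sgm' X))) + (- (sgm Y * (s * sgm' X))) * dif (shft X)"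
  unfolding s(2) by (simp add: algebra_simps dif_sgm[OF Y, THEN mult_left_eq] dif_sgm'[OF X])
 finally show "dg.homotopic (shft X) (shft Y) (sgm Y * a * sgm' X) (sgm Y * b * sgm' X)"
  by (rule dg.homotopicI[rotated]) (use s(1) sgm_Hom[OF X] sgm_Hom[OF Y] in \<open>intro dg.H_uminus dg.H_mults\<close>)
next
 assume "dg.homotopic (shft X) (shft Y) (sgm Y * a * sgm' X) (sgm Y * b * sgm' X)"
 then obtain s where s: "s \<in> Hom (- 1) (shft X) (shft Y)"
  "sgm Y * a * sgm' X - sgm Y * b * sgm' X = dif (shft Y) * s + s * dif (shft X)" by (auto simp: dg.homotopic_def)
 have "a - b = sgm' Y * (sgm Y * a * sgm' X - sgm Y * b * sgm' X) * sgm X"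
  using shift_cancel[OF X Y a(1)] shift_cancel[OF X Y a(2)] by (simp add: left_diff_distrib right_diff_distrib)
 also have "\<dots> = dif Y * (- (sgm' Y * s * sgm X)) + (- (sgm' Y * s * sgm X)) * dif X"
  unfolding s(2) by (simp add: algebra_simps dif_sgm'[OF Y, THEN mult_left_eq] dif_sgm[OF X])
 finally show "dg.homotopic X Y a b"
  by (rule dg.homotopicI[rotated]) (use s(1) sgm_Hom[OF X] sgm_Hom[OF Y] in \<open>intro dg.H_uminus dg.H_mults\<close>)
qed

text \<open>\<open>fmor\<close> shifts each representative. For the image of a class to be a whole
  class, every chain map in the target class has to be shifted back, and \<open>k (n - 1)\<close>
  does this.\<close>

lemma K_shift_class:
 assumes X: "X \<in> \<C>" and Y: "Y \<in> \<C>" and f: "f \<in> chain_maps B X Y"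
 shows "(\<lambda>n. f (n + 1)) \<in> chain_maps B (shft X) (shft Y)"
  "fmor (K_shift B) X Y (\<H> X Y f) = \<H> (shft X) (shft Y) (\<lambda>n. f (n + 1))"
proof -
 note SX = shft_complex[OF X] shft_complex[OF Y]
 have sh: "(\<lambda>n. g (n + 1)) \<in> chain_maps B (shft X) (shft Y) \<longleftrightarrow> g \<in> chain_maps B X Y"
  if "g \<in> graded_arrows B 0 (cob X) (cob Y)" for g
  using that op_shift[OF X Y that] shift_cyc_iff[OF X Y op_Hom[OF X Y that]] by (simp add: chain_maps_iff SX X Y)
 show f': "(\<lambda>n. f (n + 1)) \<in> chain_maps B (shft X) (shft Y)" using sh f chain_maps_arrows by blast
 have cl: "(\<lambda>n. g (n + 1)) \<in> \<H> (shft X) (shft Y) (\<lambda>n. f (n + 1)) \<longleftrightarrow> g \<in> \<H> X Y f" if g: "g \<in> chain_maps B X Y" for g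
  using homotopy_class_eq(2)[OF SX _ f', of "\<lambda>n. g (n + 1)"] homotopy_class_eq(2)[OF X Y g f] sh chain_maps_arrows g f
   shift_homotopic_iff[OF X Y op_Hom[OF X Y chain_maps_arrows[OF g]] op_Hom[OF X Y chain_maps_arrows[OF f]]]
   op_shift(2)[OF X Y] by simp
 have "(\<lambda>f n. f (n + 1)) ` \<H> X Y f = \<H> (shft X) (shft Y) (\<lambda>n. f (n + 1))"
 proof (intro equalityI subsetI)
  fix k assume "k \<in> (\<lambda>f n. f (n + 1)) ` \<H> X Y f"
  then show "k \<in> \<H> (shft X) (shft Y) (\<lambda>n. f (n + 1))" using cl homotopy_class_subset[OF X Y f] by blast
 next
  fix k assume k: "k \<in> \<H> (shft X) (shft Y) (\<lambda>n. f (n + 1))"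
  let ?g = "\<lambda>n. k (n - 1)"
  have kc: "k \<in> chain_maps B (shft X) (shft Y)" using k homotopy_class_subset[OF SX f'] by blast
  have "k (n - 1) \<in> Arr B X$n Y$n" for n
  proof -
   have "k (n - 1) \<in> Arr B (shft X)$(n - 1) (shft Y)$(n - 1)" using kc unfolding chain_maps_def by blast
   then show ?thesis by (simp add: shft_simps)
  qed
  then have "?g \<in> graded_arrows B 0 (cob X) (cob Y)" by (simp add: graded_arrows_def)
  then have "?g \<in> chain_maps B X Y" using sh[of ?g] kc by simp
  then have "?g \<in> \<H> X Y f" using cl[of ?g] k by simp
  then show "k \<in> (\<lambda>f n. f (n + 1)) ` \<H> X Y f" by (intro image_eqI[of _ _ ?g]) auto
 qed
 then show "fmor (K_shift B) X Y (\<H> X Y f) = \<H> (shft X) (shft Y) (\<lambda>n. f (n + 1))" by (simp add: K_shift_def)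
qed

lemma zero_complex: "\<exists>N\<in>\<C>. unit N = 0 \<and> (\<forall>n. is_zero B N$n)"
proof -
 obtain Z where Z: "is_zero B Z" using zero_object by blast
 then have ZO: "Z \<in> Ob B" by (simp add: is_zero_def)
 let ?N = "\<lparr>cob = \<lambda>_. Z, cdiff = \<lambda>_. Nul B Z Z\<rparr>"
 have "?N \<in> \<C>" using ZO by (simp add: complexes_def closed Cmp_Nul_right)
 moreover have "unit ?N = 0"
  using graded_op_Nul(2)[of "\<lambda>_. Z" "\<lambda>_. Z" 0] ZO is_zero_iff[OF ZO] Z by (simp add: unit_def gid_def)
 moreover have "\<forall>n. is_zero B ?N$n" using Z by simp
 ultimately show ?thesis by blast
qed

context
 fixes X Y :: "('o, 'm) cpx" and f :: "int \<Rightarrow> 'm" and zs :: "int \<Rightarrow> 'o" and iX iY pX pY :: "int \<Rightarrow> 'm"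
 assumes X: "X \<in> \<C>" and Y: "Y \<in> \<C>" and f: "f \<in> chain_maps B X Y" and zs: "objs zs"
  and A: "\<And>n. iX n \<in> Arr B X$(n + 1) (zs n)" "\<And>n. iY n \<in> Arr B Y$n (zs n)"
   "\<And>n. pX n \<in> Arr B (zs n) X$(n + 1)" "\<And>n. pY n \<in> Arr B (zs n) Y$n"
begin

lemmas c = complexesD(1)[OF X] complexesD(1)[OF Y] zs

text \<open>The four structure maps of a degreewise biproduct as ring elements, matching the data of
  \<open>dg.cone\<close>. The component of \<open>jj\<close> in degree \<open>n\<close> is
  \<open>iX (n - 1)\<close>, an arrow from \<open>X$n\<close> to \<open>zs (n - 1)\<close>.\<close>

definition "jj = graded_op B (- 1) (cob X) zs (\<lambda>n. iX (n - 1))"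
definition "ii = graded_op B 0 (cob Y) zs iY"
definition "pp = graded_op B 1 zs (cob X) pX"
definition "rr = graded_op B 0 zs (cob Y) pY"

lemma cone_arrows:
 "(\<lambda>n. iX (n - 1)) \<in> graded_arrows B (- 1) (cob X) zs" "iY \<in> graded_arrows B 0 (cob Y) zs"
 "pX \<in> graded_arrows B 1 zs (cob X)" "pY \<in> graded_arrows B 0 zs (cob Y)"
 using A A(1)[of "n - 1" for n] by (simp_all add: graded_arrows_def)

lemma biproduct_iff:
 "(\<forall>n. is_biproduct B X$(n + 1) Y$n (zs n) (iX n) (iY n) (pX n) (pY n)) \<longleftrightarrow>
  pp * jj = unit X \<and> rr * ii = unit Y \<and> pp * ii = 0 \<and> rr * jj = 0 \<and> jj * pp + ii * rr = gid zs"
proof -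
 note k = cone_arrows
 have iXm: "iX (n - 1) \<in> Arr B X$n (zs (n - 1))" "pX (n - 1) \<in> Arr B (zs (n - 1)) X$n" for n using A(1,3)[of "n - 1"] by simp_all
 have 1: "pp * jj = unit X \<longleftrightarrow> (\<forall>n. Cmp B X$(n + 1) (zs n) X$(n + 1) (pX n) (iX n) = Ident B X$(n + 1))"
  using graded_op_Cmp[OF c(1) c(3) c(1) k(1,3)] graded_op_eq_iff[OF c(1,1) _ gid_arrows[OF c(1)],
    of "\<lambda>n. Cmp B X$n (zs (n - 1)) X$n (pX (n - 1)) (iX (n - 1))"]
   all_int_shift[of "\<lambda>n. Cmp B X$n (zs (n - 1)) X$n (pX (n - 1)) (iX (n - 1)) = Ident B X$n"]
  by (simp add: pp_def jj_def unit_def gid_def)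
 have 2: "rr * ii = unit Y \<longleftrightarrow> (\<forall>n. Cmp B Y$n (zs n) Y$n (pY n) (iY n) = Ident B Y$n)"
  using graded_op_Cmp[OF c(2) c(3) c(2) k(2,4)] graded_op_eq_iff[OF c(2,2) _ gid_arrows[OF c(2)],
    of "\<lambda>n. Cmp B Y$n (zs n) Y$n (pY n) (iY n)"]
  by (simp add: rr_def ii_def unit_def gid_def)
 have 3: "pp * ii = 0 \<longleftrightarrow> (\<forall>n. Cmp B Y$n (zs n) X$(n + 1) (pX n) (iY n) = Nul B Y$n X$(n + 1))"
  using graded_op_Cmp[OF c(2) c(3) c(1) k(2,3)] graded_op_Nul[OF c(2) c(1), of 1] graded_op_eq_iff[OF c(2,1), of
    "\<lambda>n. Cmp B Y$n (zs n) X$(n + 1) (pX n) (iY n)" 1 "\<lambda>n. Nul B Y$n X$(n + 1)"]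
  by (simp add: pp_def ii_def)
 have 4: "rr * jj = 0 \<longleftrightarrow> (\<forall>n. Cmp B X$(n + 1) (zs n) Y$n (pY n) (iX n) = Nul B X$(n + 1) Y$n)"
  using graded_op_Cmp[OF c(1) c(3) c(2) k(1,4)] graded_op_Nul[OF c(1) c(2), of "- 1"] graded_op_eq_iff[OF c(1,2), of
    "\<lambda>n. Cmp B X$n (zs (n - 1)) Y$(n - 1) (pY (n - 1)) (iX (n - 1))" "- 1" "\<lambda>n. Nul B X$n Y$(n - 1)"]
   all_int_shift[of "\<lambda>n. Cmp B X$n (zs (n - 1)) Y$(n - 1) (pY (n - 1)) (iX (n - 1)) = Nul B X$n Y$(n - 1)"]
  by (simp add: rr_def jj_def)
 have 5: "jj * pp + ii * rr = gid zs \<longleftrightarrow> (\<forall>n. Add B (zs n) (zs n) (Cmp B (zs n) X$(n + 1) (zs n) (iX n) (pX n))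
   (Cmp B (zs n) Y$n (zs n) (iY n) (pY n)) = Ident B (zs n))"
 proof -
  have a: "(\<lambda>n. Cmp B (zs n) X$(n + 1) (zs n) (iX n) (pX n)) \<in> graded_arrows B 0 zs zs"
   "graded_op B 0 zs zs (\<lambda>n. Cmp B (zs n) X$(n + 1) (zs n) (iX n) (pX n)) = jj * pp"
   using graded_op_Cmp[OF c(3) c(1) c(3) k(3,1)] by (simp_all add: pp_def jj_def)
  have b: "(\<lambda>n. Cmp B (zs n) Y$n (zs n) (iY n) (pY n)) \<in> graded_arrows B 0 zs zs"
   "graded_op B 0 zs zs (\<lambda>n. Cmp B (zs n) Y$n (zs n) (iY n) (pY n)) = ii * rr"
   using graded_op_Cmp[OF c(3) c(2) c(3) k(4,2)] by (simp_all add: rr_def ii_def)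
  show ?thesis
   using graded_op_Add[OF c(3,3) a(1) b(1)] a(2) b(2) graded_op_eq_iff[OF c(3,3) _ gid_arrows[OF c(3)],
    of "\<lambda>n. Add B (zs n) (zs n) (Cmp B (zs n) X$(n + 1) (zs n) (iX n) (pX n)) (Cmp B (zs n) Y$n (zs n) (iY n) (pY n))"]
   by (simp add: gid_def)
 qed
 show ?thesis unfolding 1 2 3 4 5 is_biproduct_def using c A by auto
qed

lemma cone_dif_iff:
 assumes d: "d \<in> graded_arrows B 1 zs zs"
 shows "(\<forall>n. Cmp B X$(n + 1) (zs n) (zs (n + 1)) (d n) (iX n) =
     Add B X$(n + 1) (zs (n + 1))
      (Cmp B X$(n + 1) X$(n + 2) (zs (n + 1)) (iX (n + 1)) (Neg B X$(n + 1) X$(n + 2) (cdiff X (n + 1))))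
      (Cmp B X$(n + 1) Y$(n + 1) (zs (n + 1)) (iY (n + 1)) (f (n + 1)))) \<longleftrightarrow>
   graded_op B 1 zs zs d * jj = ii * op X Y f - jj * dif X" (is ?t1)
  and "(\<forall>n. Cmp B Y$n (zs n) (zs (n + 1)) (d n) (iY n) = Cmp B Y$n Y$(n + 1) (zs (n + 1)) (iY (n + 1)) (cdiff Y n)) \<longleftrightarrow>
   graded_op B 1 zs zs d * ii = ii * dif Y" (is ?t2)
proof -
 note k = cone_arrows
 have nd: "(\<lambda>n. Neg B X$n X$(n + 1) (cdiff X n)) \<in> graded_arrows B 1 (cob X) (cob X)"
  "graded_op B 1 (cob X) (cob X) (\<lambda>n. Neg B X$n X$(n + 1) (cdiff X n)) = - dif X"
  using graded_op_Neg[OF c(1,1) complexesD(2)[OF X]] by (simp_all add: dif_def)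
 let ?a = "\<lambda>n. Cmp B X$n X$(n + 1) (zs n) (iX n) (Neg B X$n X$(n + 1) (cdiff X n))"
 let ?b = "\<lambda>n. Cmp B X$n Y$n (zs n) (iY n) (f n)"
 let ?d = "\<lambda>n. Cmp B X$n (zs (n - 1)) (zs n) (d (n - 1)) (iX (n - 1))"
 have a: "?a \<in> graded_arrows B 0 (cob X) zs" "graded_op B 0 (cob X) zs ?a = - (jj * dif X)"
  using graded_op_Cmp[OF c(1) c(1) c(3) nd(1) k(1)] nd(2) by (simp_all add: jj_def)
 have b: "?b \<in> graded_arrows B 0 (cob X) zs" "graded_op B 0 (cob X) zs ?b = ii * op X Y f"
  using graded_op_Cmp[OF c(1) c(2) c(3) chain_maps_arrows[OF f] k(2)] by (simp_all add: ii_def)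
 have dd: "?d \<in> graded_arrows B 0 (cob X) zs" "graded_op B 0 (cob X) zs ?d = graded_op B 1 zs zs d * jj"
  using graded_op_Cmp[OF c(1) c(3) c(3) k(1) d] by (simp_all add: jj_def)
 have ab: "(\<lambda>n. Add B X$n (zs n) (?a n) (?b n)) \<in> graded_arrows B 0 (cob X) zs"
  "graded_op B 0 (cob X) zs (\<lambda>n. Add B X$n (zs n) (?a n) (?b n)) = ii * op X Y f - jj * dif X"
  using graded_op_Add[OF c(1) c(3) a(1) b(1)] a(2) b(2) by simp_all
 show ?t1
  using graded_op_eq_iff[OF c(1) c(3) dd(1) ab(1)] dd(2) ab(2)
   all_int_shift[of "\<lambda>n. ?d n = Add B X$n (zs n) (?a n) (?b n)"] by (simp add: add.assoc)
 have u: "(\<lambda>n. Cmp B Y$n (zs n) (zs (n + 1)) (d n) (iY n)) \<in> graded_arrows B 1 (cob Y) zs"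
  "graded_op B 1 (cob Y) zs (\<lambda>n. Cmp B Y$n (zs n) (zs (n + 1)) (d n) (iY n)) = graded_op B 1 zs zs d * ii"
  using graded_op_Cmp[OF c(2) c(3) c(3) k(2) d] by (simp_all add: ii_def)
 have v: "(\<lambda>n. Cmp B Y$n Y$(n + 1) (zs (n + 1)) (iY (n + 1)) (cdiff Y n)) \<in> graded_arrows B 1 (cob Y) zs"
  "graded_op B 1 (cob Y) zs (\<lambda>n. Cmp B Y$n Y$(n + 1) (zs (n + 1)) (iY (n + 1)) (cdiff Y n)) = ii * dif Y"
  using graded_op_Cmp[OF c(2) c(2) c(3) complexesD(2)[OF Y] k(2)] by (simp_all add: ii_def dif_def)
 show ?t2 using graded_op_eq_iff[OF c(2) c(3) u(1) v(1)] u(2) v(2) by simp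
qed

end

lemma mapping_cone_iff:
 assumes X: "X \<in> \<C>" and Y: "Y \<in> \<C>" and f: "f \<in> chain_maps B X Y" and Z: "Z \<in> \<C>"
  and A: "\<And>n. iX n \<in> Arr B X$(n + 1) Z$n" "\<And>n. iY n \<in> Arr B Y$n Z$n"
   "\<And>n. pX n \<in> Arr B Z$n X$(n + 1)" "\<And>n. pY n \<in> Arr B Z$n Y$n"
 shows "is_mapping_cone B X Y f Z iX iY pX pY \<longleftrightarrow>
  dg.cone X Y (op X Y f) Z (ii Y (cob Z) iY) (jj X (cob Z) iX) (pp X (cob Z) pX) (rr Y (cob Z) pY)"
proof -
 note zs = complexesD(1)[OF Z]
 note k = cone_arrows[OF X Y f zs A]
 have H: "ii Y (cob Z) iY \<in> Hom 0 Y Z" "jj X (cob Z) iX \<in> Hom (- 1) X Z" "pp X (cob Z) pX \<in> Hom 1 Z X" "rr Y (cob Z) pY \<in> Hom 0 Z Y"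
  using op_Hom X Y Z k by (simp_all add: ii_def[OF X Y f zs A] jj_def[OF X Y f zs A] pp_def[OF X Y f zs A] rr_def[OF X Y f zs A])
 show ?thesis
  unfolding is_mapping_cone_def dg.cone_def all_conj_distrib biproduct_iff[OF X Y f zs A]
   cone_dif_iff[OF X Y f zs A complexesD(2)[OF Z]]
  using H Z op_cyc[OF X Y f] by (auto simp: dif_def unit_def)
qed

end

context homotopy
begin

text \<open>Degreewise biproducts are chosen, and the matrix of the cone, written as
  \<open>i * a * p + i * dif Y * r - j * dif X * p\<close>, becomes the differential. That it
  squares to zero is a ring identity, which is read back in each degree.\<close>

lemma cone_exists:
 assumes a: "a \<in> dg.cyc X Y" shows "\<exists>Z i j p r. dg.cone X Y a Z i j p r"
proof -
 have X: "X \<in> \<C>" and Y: "Y \<in> \<C>" using dg.cyc_Ob[OF a] by auto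
 obtain f where f: "f \<in> chain_maps B X Y" "a = op X Y f" using cyc_op[OF a] .
 have "\<forall>n. \<exists>t. is_biproduct B X$(n + 1) Y$n (fst t) (fst (snd t)) (fst (snd (snd t))) (fst (snd (snd (snd t)))) (snd (snd (snd (snd t))))"
  using biproducts complexes_Arr(1)[OF X] complexes_Arr(1)[OF Y] by (metis fst_conv snd_conv)
 then obtain t where "\<forall>n. is_biproduct B X$(n + 1) Y$n (fst (t n)) (fst (snd (t n))) (fst (snd (snd (t n))))
   (fst (snd (snd (snd (t n))))) (snd (snd (snd (snd (t n)))))" by metis
 then obtain zs iX iY pX pY where b: "\<forall>n. is_biproduct B X$(n + 1) Y$n (zs n) (iX n) (iY n) (pX n) (pY n)"
  by (rule_tac zs = "\<lambda>n. fst (t n)" and iX = "\<lambda>n. fst (snd (t n))" and iY = "\<lambda>n. fst (snd (snd (t n)))" and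
   pX = "\<lambda>n. fst (snd (snd (snd (t n))))" and pY = "\<lambda>n. snd (snd (snd (snd (t n))))" in that) simp
 have zs: "objs zs"
  and A: "\<And>n. iX n \<in> Arr B X$(n + 1) (zs n)" "\<And>n. iY n \<in> Arr B Y$n (zs n)"
   "\<And>n. pX n \<in> Arr B (zs n) X$(n + 1)" "\<And>n. pY n \<in> Arr B (zs n) Y$n"
  using b by (auto simp: is_biproduct_def)
 note c = complexesD(1)[OF X] complexesD(1)[OF Y] zs
 define i j p r where "i = ii Y zs iY" and "j = jj X zs iX" and "p = pp X zs pX" and "r = rr Y zs pY"
 have e: "p * j = unit X" "r * i = unit Y" "p * i = 0" "r * j = 0" "j * p + i * r = gid zs"
  using biproduct_iff[OF X Y f(1) zs A] b by (simp_all add: i_def j_def p_def r_def)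
 note k = cone_arrows[OF X Y f(1) zs A]
 have G: "i \<in> graded_hom B 0 (cob Y) zs" "j \<in> graded_hom B (- 1) (cob X) zs" "p \<in> graded_hom B 1 zs (cob X)" "r \<in> graded_hom B 0 zs (cob Y)"
  using k by (simp_all add: i_def j_def p_def r_def ii_def[OF X Y f(1) zs A] jj_def[OF X Y f(1) zs A]
    pp_def[OF X Y f(1) zs A] rr_def[OF X Y f(1) zs A] graded_homI)
 have GD: "a \<in> graded_hom B 0 (cob X) (cob Y)" "dif X \<in> graded_hom B 1 (cob X) (cob X)" "dif Y \<in> graded_hom B 1 (cob Y) (cob Y)"
  using dg.cyc_H[OF a] dg.H_D[OF X] dg.H_D[OF Y] X Y by (simp_all add: Hom_def)
 have "a * p \<in> graded_hom B 1 zs (cob Y)" using graded_hom_mult[OF c(3) c(1) c(2) G(3) GD(1)] by simp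
 then have "i * (a * p) \<in> graded_hom B 1 zs zs" using graded_hom_mult[OF c(3) c(2) c(3) _ G(1)] by fastforce
 moreover have "i * (dif Y * r) \<in> graded_hom B 1 zs zs"
  using graded_hom_mult[OF c(3) c(2) c(3) graded_hom_mult[OF c(3) c(2) c(2) G(4) GD(3)] G(1)] by simp
 moreover have "- (j * (dif X * p)) \<in> graded_hom B 1 zs zs"
  using graded_hom_uminus[OF c(3) c(3) graded_hom_mult[OF c(3) c(1) c(3) graded_hom_mult[OF c(3) c(1) c(1) G(3) GD(2)] G(2)]] by simp
 ultimately have "i * (a * p) + i * (dif Y * r) + - (j * (dif X * p)) \<in> graded_hom B 1 zs zs"
  using graded_hom_add[OF c(3) c(3)] by blast
 then obtain d where d: "d \<in> graded_arrows B 1 zs zs" "graded_op B 1 zs zs d = i * (a * p) + i * (dif Y * r) + - (j * (dif X * p))"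
  by (auto simp: graded_hom_def)
 let ?Z = "\<lparr>cob = zs, cdiff = d\<rparr>"
 let ?D = "graded_op B 1 zs zs d"
 note U = dg.units[OF dg.cyc_H[OF a]] dg.units[OF dg.H_D[OF X]] dg.units[OF dg.H_D[OF Y]]
 note E = e(1-4) e(1-4)[THEN mult_left_eq] dg.cyc_D[OF a] dg.cyc_D[OF a, THEN mult_left_eq]
  dif_dif[OF X, THEN mult_left_eq] dif_dif[OF Y, THEN mult_left_eq]
 have Dj: "?D * j = i * a - j * dif X" and Di: "?D * i = i * dif Y"
  unfolding d(2) by (simp_all add: algebra_simps E U)
 have DD: "?D * ?D = 0"
  unfolding d(2) by (simp add: algebra_simps E U)
 have "Cmp B (zs n) (zs (n + 1)) (zs (n + 2)) (d (n + 1)) (d n) = Nul B (zs n) (zs (n + 2))" for n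
 proof -
  have "graded_op B 2 zs zs (\<lambda>n. Cmp B (zs n) (zs (n + 1)) (zs (n + 2)) (d (n + 1)) (d n)) = graded_op B 2 zs zs (\<lambda>n. Nul B (zs n) (zs (n + 2)))"
   using graded_op_Cmp(2)[OF zs zs zs d(1) d(1)] graded_op_Nul(2)[OF zs zs, of 2] DD by simp
  moreover have "(\<lambda>n. Cmp B (zs n) (zs (n + 1)) (zs (n + 2)) (d (n + 1)) (d n)) \<in> graded_arrows B 2 zs zs"
   using graded_op_Cmp(1)[OF zs zs zs d(1) d(1)] by simp
  ultimately show ?thesis using graded_op_eq_iff[OF zs zs] graded_op_Nul(1)[OF zs zs, of 2] by blast
 qed
 then have Z: "?Z \<in> \<C>" using zs d(1) by (simp add: complexes_def graded_arrows_def)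
 have "dg.cone X Y a ?Z i j p r"
  unfolding dg.cone_def using a G X Y Z e Dj Di by (simp add: Hom_def unit_def dif_def)
 then show ?thesis by blast
qed

text \<open>The quotient category is built from families of arrows, the homological algebra from
  ring elements; \<open>cls\<close> leads from a ring element back to the class of the chain map it
  represents.\<close>

definition cls :: "('o, 'm) cpx \<Rightarrow> ('o, 'm) cpx \<Rightarrow> (int \<Rightarrow> ('o, 'm) vec) endo \<Rightarrow> (int \<Rightarrow> 'm) set" where
 "cls X Y a = \<H> X Y (inv_into (chain_maps B X Y) (op X Y) a)"

lemma cls_op: assumes "X \<in> \<C>" "Y \<in> \<C>" "f \<in> chain_maps B X Y" shows "cls X Y (op X Y f) = \<H> X Y f"
proof -
 have "inj_on (op X Y) (chain_maps B X Y)" using op_inject[OF assms(1,2)] by (rule inj_onI)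
 then show ?thesis using assms by (simp add: cls_def)
qed

lemma K_is_triangle: "is_triangle (homotopy_category B) S t \<longleftrightarrow> is_triangle (K_cat B) S t"
 by (cases t) (simp add: K_simps, simp add: homotopy_category_def quotient_category_def C_cat_def)

lemma K_triangle_iso: "triangle_iso (homotopy_category B) S t t' \<longleftrightarrow> triangle_iso (K_cat B) S t t'"
 by (cases t, cases t') (simp add: K_simps isomorphism_def)

lemma shifted_projection:
 assumes X: "X \<in> \<C>" and Z: "Z \<in> \<C>" and p: "\<And>n. p n \<in> Arr B Z$n X$(n + 1)"
 shows "op Z (shft X) p = sgm X * graded_op B 1 (cob Z) (cob X) p"
proof -
 have p1: "p \<in> graded_arrows B 1 (cob Z) (cob X)" using p by (simp add: graded_arrows_def)
 then show ?thesis
  using graded_op_Cmp(2)[OF complexesD(1)[OF Z] complexesD(1)[OF X] complexesD(1)[OF shft_complex[OF X]] p1 sgm_arrows(1)[OF X]]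
   complexes_Arr(1)[OF X] complexes_Arr(1)[OF Z] p
  by (simp add: sgm_def shft_simps Cmp_Ident_left)
qed

lemma cone_maps:
 assumes c: "dg.cone X Y a Z i j p r" shows "i \<in> dg.cyc Y Z" "sgm X * p \<in> dg.cyc Z (shft X)"
proof -
 note cD = dg.coneD[OF c]
 show "i \<in> dg.cyc Y Z" using cD by (simp add: dg.cyc_def)
 have "sgm X * p \<in> Hom 0 Z (shft X)" using cD(4) sgm_Hom(1)[OF cD(16)] by (rule dg.H_mults)
 moreover have "dif (shft X) * (sgm X * p) = sgm X * p * dif Z"
  by (simp add: mult.assoc cD dif_sgm[OF cD(16), THEN mult_left_eq])
 ultimately show "sgm X * p \<in> dg.cyc Z (shft X)" by (simp add: dg.cyc_def)
qed

lemma cone_triangles_iff: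
 "t \<in> cone_triangles B \<longleftrightarrow> (\<exists>X Y a Z i j p r. dg.cone X Y a Z i j p r \<and>
   t = (X, Y, Z, cls X Y a, cls Y Z i, cls Z (shft X) (sgm X * p)))"
proof
 assume "t \<in> cone_triangles B"
 then obtain X Y Z f iX iY pX pY where t: "t = (X, Y, Z, \<H> X Y f, \<H> Y Z iY, \<H> Z (shft X) pX)"
  and X: "X \<in> \<C>" and Y: "Y \<in> \<C>" and f: "f \<in> chain_maps B X Y" and mc: "is_mapping_cone B X Y f Z iX iY pX pY"
  unfolding cone_triangles_def by blast
 have Z: "Z \<in> \<C>" and A: "\<And>n. iX n \<in> Arr B X$(n + 1) Z$n" "\<And>n. iY n \<in> Arr B Y$n Z$n"
   "\<And>n. pX n \<in> Arr B Z$n X$(n + 1)" "\<And>n. pY n \<in> Arr B Z$n Y$n"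
  using mc by (auto simp: is_mapping_cone_def is_biproduct_def)
 note zs = complexesD(1)[OF Z]
 have cone: "dg.cone X Y (op X Y f) Z (ii Y (cob Z) iY) (jj X (cob Z) iX) (pp X (cob Z) pX) (rr Y (cob Z) pY)"
  using mapping_cone_iff[OF X Y f Z A] mc by blast
 have ip: "ii Y (cob Z) iY = op Y Z iY" "sgm X * pp X (cob Z) pX = op Z (shft X) pX"
  using shifted_projection[OF X Z A(3)] by (simp_all add: ii_def[OF X Y f zs A] pp_def[OF X Y f zs A])
 have "iY \<in> chain_maps B Y Z" "pX \<in> chain_maps B Z (shft X)"
  using cone_maps[OF cone] A X Y Z shft_complex[OF X] unfolding ip
  by (simp_all add: chain_maps_iff graded_arrows_def shft_simps)
 then have "t = (X, Y, Z, cls X Y (op X Y f), cls Y Z (ii Y (cob Z) iY), cls Z (shft X) (sgm X * pp X (cob Z) pX))"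
  unfolding t ip using f X Y Z shft_complex[OF X] by (simp add: cls_op)
 with cone show "\<exists>X Y a Z i j p r. dg.cone X Y a Z i j p r \<and>
   t = (X, Y, Z, cls X Y a, cls Y Z i, cls Z (shft X) (sgm X * p))" by blast
next
 assume "\<exists>X Y a Z i j p r. dg.cone X Y a Z i j p r \<and> t = (X, Y, Z, cls X Y a, cls Y Z i, cls Z (shft X) (sgm X * p))"
 then obtain X Y a Z i j p r where cone: "dg.cone X Y a Z i j p r"
  and t: "t = (X, Y, Z, cls X Y a, cls Y Z i, cls Z (shft X) (sgm X * p))" by blast
 note cD = dg.coneD[OF cone]
 note X = cD(16) and Y = cD(17) and Z = cD(18)
 note zs = complexesD(1)[OF Z]
 obtain f where f: "f \<in> chain_maps B X Y" "a = op X Y f" using cyc_op[OF cD(1)] .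
 obtain iY where iY: "iY \<in> graded_arrows B 0 (cob Y) (cob Z)" "i = graded_op B 0 (cob Y) (cob Z) iY" using Hom_op[OF cD(2)] .
 obtain jX where jX: "jX \<in> graded_arrows B (- 1) (cob X) (cob Z)" "j = graded_op B (- 1) (cob X) (cob Z) jX" using Hom_op[OF cD(3)] .
 obtain pX where pX: "pX \<in> graded_arrows B 1 (cob Z) (cob X)" "p = graded_op B 1 (cob Z) (cob X) pX" using Hom_op[OF cD(4)] .
 obtain pY where pY: "pY \<in> graded_arrows B 0 (cob Z) (cob Y)" "r = graded_op B 0 (cob Z) (cob Y) pY" using Hom_op[OF cD(5)] .
 \<comment> \<open>Inverse to the reindexing in \<open>jj\<close>: the component of degree -1 that
   starts at \<open>X$(n + 1)\<close> ends at \<open>Z$n\<close>.\<close>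
 define iX where "iX n = jX (n + 1)" for n
 have "jX (n + 1) \<in> Arr B X$(n + 1) Z$(n + 1 - 1)" for n
  using jX(1) unfolding graded_arrows_def by (metis (mono_tags, lifting) mem_Collect_eq uminus_add_conv_diff add.commute)
 then have A: "\<And>n. iX n \<in> Arr B X$(n + 1) Z$n" "\<And>n. iY n \<in> Arr B Y$n Z$n"
   "\<And>n. pX n \<in> Arr B Z$n X$(n + 1)" "\<And>n. pY n \<in> Arr B Z$n Y$n"
  using iY(1) pX(1) pY(1) by (simp_all add: graded_arrows_def iX_def)
 have eqs: "ii Y (cob Z) iY = i" "jj X (cob Z) iX = j" "pp X (cob Z) pX = p" "rr Y (cob Z) pY = r"
  by (simp_all add: ii_def[OF X Y f(1) zs A] jj_def[OF X Y f(1) zs A] pp_def[OF X Y f(1) zs A] rr_def[OF X Y f(1) zs A]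
    iY jX pX pY iX_def)
 have mc: "is_mapping_cone B X Y f Z iX iY pX pY"
  using mapping_cone_iff[OF X Y f(1) Z A] cone f(2) eqs by simp
 have ip: "i = op Y Z iY" "sgm X * p = op Z (shft X) pX"
  using shifted_projection[OF X Z A(3)] iY pX by simp_all
 have "iY \<in> chain_maps B Y Z" "pX \<in> chain_maps B Z (shft X)"
  using cone_maps[OF cone] A X Y Z shft_complex[OF X] unfolding ip
  by (simp_all add: chain_maps_iff graded_arrows_def shft_simps)
 then have "t = (X, Y, Z, \<H> X Y f, \<H> Y Z iY, \<H> Z (shft X) pX)"
  unfolding t ip f(2) using f(1) X Y Z shft_complex[OF X] by (simp add: cls_op)
 then show "t \<in> cone_triangles B" unfolding cone_triangles_def using X Y f(1) mc by blast
qed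

lemma unit_op: assumes X: "X \<in> \<C>" shows "unit X = op X X (\<lambda>n. Ident B X$n)" "(\<lambda>n. Ident B X$n) \<in> chain_maps B X X"
proof -
 show 1: "unit X = op X X (\<lambda>n. Ident B X$n)" by (simp add: unit_def gid_def)
 show "(\<lambda>n. Ident B X$n) \<in> chain_maps B X X"
  using chain_maps_iff[OF X X] gid_arrows[OF complexesD(1)[OF X]] dg.cyc_e[OF X] 1 by simp
qed

text \<open>The bridge by which the ring computations yield the axioms of a triangulated category
  for \<open>K_cat B\<close>.\<close>

lemma is_dg_model: "dg_model (K_cat B) Hom unit dif sgm sgm' cls"
proof (intro dg_model.intro dg_model_axioms.intro)
 show "dg_category (Ob (K_cat B)) Hom unit dif" using dg.dg_category_axioms by (simp add: K_simps)
next
 show "Arr (K_cat B) X Y = cls X Y ` dg.cyc X Y" if "X \<in> Ob (K_cat B)" "Y \<in> Ob (K_cat B)" for X Y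
 proof -
  have O: "X \<in> \<C>" "Y \<in> \<C>" using that by (simp_all add: K_simps)
  have "dg.cyc X Y = op X Y ` chain_maps B X Y"
  proof (intro equalityI subsetI)
   fix a assume "a \<in> dg.cyc X Y"
   then show "a \<in> op X Y ` chain_maps B X Y" by (rule cyc_op) simp
  qed (auto intro: op_cyc[OF O])
  then have "cls X Y ` dg.cyc X Y = \<H> X Y ` chain_maps B X Y"
   using cls_op[OF O] by (simp add: image_image)
  then show ?thesis using K_Arr[OF O] by simp
 qed
 show "cls X Y a = cls X Y b \<longleftrightarrow> dg.homotopic X Y a b" if ab: "a \<in> dg.cyc X Y" "b \<in> dg.cyc X Y" for X Y a b
 proof -
  have O: "X \<in> \<C>" "Y \<in> \<C>" using dg.cyc_Ob[OF that(1)] by auto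
  obtain f where f: "f \<in> chain_maps B X Y" "a = op X Y f" using cyc_op[OF ab(1)] .
  obtain g where g: "g \<in> chain_maps B X Y" "b = op X Y g" using cyc_op[OF ab(2)] .
  show ?thesis using O f g by (simp add: cls_op homotopy_class_eq(1))
 qed
 show "Cmp (K_cat B) X Y Z (cls Y Z b) (cls X Y a) = cls X Z (b * a)" if ab: "a \<in> dg.cyc X Y" "b \<in> dg.cyc Y Z" for X Y Z a b
 proof -
  have O: "X \<in> \<C>" "Y \<in> \<C>" "Z \<in> \<C>" using dg.cyc_Ob that by blast+
  obtain f where "f \<in> chain_maps B X Y" "a = op X Y f" using cyc_op[OF ab(1)] .
  moreover obtain g where "g \<in> chain_maps B Y Z" "b = op Y Z g" using cyc_op[OF ab(2)] .
  ultimately have fg: "f \<in> chain_maps B X Y" "a = op X Y f" "g \<in> chain_maps B Y Z" "b = op Y Z g" by blast+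
  have "cls X Z (b * a) = cls X Z (op X Z (\<lambda>n. Cmp B X$n Y$n Z$n (g n) (f n)))"
   using op_Cmp(1)[OF O chain_maps_arrows chain_maps_arrows] fg by simp
  then show ?thesis using fg O by (simp add: cls_op K_Cmp chain_maps_Cmp)
 qed
 show "Ident (K_cat B) X = cls X X (unit X)" if "X \<in> Ob (K_cat B)" for X
  using that unit_op by (simp add: K_simps(1) K_Ident cls_op)
 show "Add (K_cat B) X Y (cls X Y a) (cls X Y b) = cls X Y (a + b)" if ab: "a \<in> dg.cyc X Y" "b \<in> dg.cyc X Y" for X Y a b
 proof -
  have O: "X \<in> \<C>" "Y \<in> \<C>" using dg.cyc_Ob[OF that(1)] by auto
  obtain f where "f \<in> chain_maps B X Y" "a = op X Y f" using cyc_op[OF ab(1)] .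
  moreover obtain g where "g \<in> chain_maps B X Y" "b = op X Y g" using cyc_op[OF ab(2)] .
  ultimately have fg: "f \<in> chain_maps B X Y" "a = op X Y f" "g \<in> chain_maps B X Y" "b = op X Y g" by blast+
  note s = op_Add[OF O chain_maps_arrows[OF fg(1)] chain_maps_arrows[OF fg(3)]]
  have "(\<lambda>n. Add B X$n Y$n (f n) (g n)) \<in> chain_maps B X Y"
   using s dg.cyc_add[OF that] fg by (simp add: chain_maps_iff[OF O])
  then show ?thesis using cls_op[OF O] K_Add[OF O fg(1,3)] s(1) fg by metis
 qed
 show "Nul (K_cat B) X Y = cls X Y 0" if "X \<in> Ob (K_cat B)" "Y \<in> Ob (K_cat B)" for X Y
 proof -
  have O: "X \<in> \<C>" "Y \<in> \<C>" using that by (simp_all add: K_simps)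
  have "(\<lambda>n. Nul B X$n Y$n) \<in> chain_maps B X Y"
   using op_Nul[OF O] dg.cyc_zero[OF O] by (simp add: chain_maps_iff[OF O])
  then show ?thesis using cls_op[OF O] K_Nul[OF O] op_Nul(1)[OF O] by metis
 qed
 show "fob (Shift (K_cat B)) X \<in> Ob (K_cat B)" if "X \<in> Ob (K_cat B)" for X
  using that shft_complex by (simp add: K_simps)
 show "\<exists>Y\<in>Ob (K_cat B). fob (Shift (K_cat B)) Y = X" if "X \<in> Ob (K_cat B)" for X
  using that shft_surj by (simp add: K_simps)
 show "sgm X \<in> Hom (- 1) X (fob (Shift (K_cat B)) X)" "sgm' X \<in> Hom 1 (fob (Shift (K_cat B)) X) X"
  "sgm X * sgm' X = unit (fob (Shift (K_cat B)) X)" "sgm' X * sgm X = unit X"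
  "dif (fob (Shift (K_cat B)) X) * sgm X = - (sgm X * dif X)" if "X \<in> Ob (K_cat B)" for X
  using that sgm_Hom sgm_inverse dif_sgm by (simp_all add: K_simps)
 show "fmor (Shift (K_cat B)) X Y (cls X Y a) = cls (fob (Shift (K_cat B)) X) (fob (Shift (K_cat B)) Y) (sgm Y * a * sgm' X)"
  if a: "a \<in> dg.cyc X Y" for X Y a
 proof -
  have O: "X \<in> \<C>" "Y \<in> \<C>" using dg.cyc_Ob[OF that(1)] by auto
  obtain f where f: "f \<in> chain_maps B X Y" "a = op X Y f" using cyc_op[OF a] .
  show ?thesis
   using cls_op[OF O f(1)] K_shift_class[OF O f(1)] op_shift(2)[OF O chain_maps_arrows[OF f(1)]]
    cls_op[OF shft_complex[OF O(1)] shft_complex[OF O(2)] K_shift_class(1)[OF O f(1)]] f(2) by (simp add: K_simps)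
 qed
 show "\<exists>N\<in>Ob (K_cat B). unit N = 0" using zero_complex by (auto simp: K_simps)
 show "\<exists>Z i j p r. dg.cone X Y a Z i j p r" if "a \<in> dg.cyc X Y" for X Y a using cone_exists[OF that] .
 show "Tri (K_cat B) = {t. is_triangle (K_cat B) (Shift (K_cat B)) t \<and> (\<exists>X Y f C i j p r. dg.cone X Y f C i j p r \<and>
   triangle_iso (K_cat B) (Shift (K_cat B)) (X, Y, C, cls X Y f, cls Y C i, cls C (fob (Shift (K_cat B)) X) (sgm X * p)) t)}"
 proof -
  have "Tri (K_cat B) = {t. is_triangle (homotopy_category B) (K_shift B) t \<and>
    (\<exists>t'\<in>cone_triangles B. triangle_iso (homotopy_category B) (K_shift B) t' t)}"
   by (simp add: K_cat_def preadd_cat.extend_def tri_cat.fields_def)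
  then show ?thesis unfolding K_is_triangle K_triangle_iso K_simps(7) Bex_def cone_triangles_iff by blast
 qed
qed

end

sublocale homotopy \<subseteq> K: dg_model "K_cat B" Hom unit dif sgm sgm' cls
 by (rule is_dg_model)

section \<open>Small complexes in the homotopy category\<close>

text \<open>\<kappa> exceeds \<open>|A|\<close> and the sizes of the groups \<open>B(a, b)\<close>,
  so that restricting fewer than \<kappa> elements along all arrows of \<open>A\<close> produces
  fewer than \<kappa> elements. It is uncountable because a complex has countably many degrees,
  closures are formed in countably many rounds, and finite subsets are counted as a countable
  union.\<close>

locale accessible_homotopy = finitely_accessible_category U B A + homotopy B + \<kappa>: regular_cardinal \<kappa>
 for U :: "'u set" and B :: "('o, 'u) preadd_cat" and A :: "'o set" and \<kappa> :: "'u rel" +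
 assumes \<kappa>_small: "\<kappa> <o |U|" and uncountable: "natLeq <o \<kappa>"
  and A_\<kappa>: "|A| <o \<kappa>" and A_hom_\<kappa>: "\<lbrakk>a \<in> A; b \<in> A\<rbrakk> \<Longrightarrow> |Arr B a b| <o \<kappa>"
begin

abbreviation "\<K> \<equiv> K_cat B"

lemma lt_\<kappa>_small: "|M| <o \<kappa> \<Longrightarrow> small U M"
 unfolding small_def using \<kappa>_small ordLess_transitive by blast

definition Sm :: "('o, 'u) cpx set" where
 "Sm = {X \<in> \<C>. \<forall>n. \<forall>a\<in>A. |Arr B a X$n| <o \<kappa>}"

lemma Sm_complex: "X \<in> Sm \<Longrightarrow> X \<in> \<C>"
 and Sm_lt: "\<lbrakk>X \<in> Sm; a \<in> A\<rbrakk> \<Longrightarrow> |Arr B a X$n| <o \<kappa>"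
 by (auto simp: Sm_def)

section \<open>Coproducts of complexes\<close>

definition complex_coproduct ::
 "'i set \<Rightarrow> ('i \<Rightarrow> ('o, 'u) cpx) \<Rightarrow> ('o, 'u) cpx \<Rightarrow> ('i \<Rightarrow> int \<Rightarrow> 'u) \<Rightarrow> ('i \<Rightarrow> int \<Rightarrow> 'u) \<Rightarrow> bool" where
 "complex_coproduct I X P \<iota> \<pi> \<longleftrightarrow> P \<in> \<C> \<and> (\<forall>i\<in>I. X i \<in> \<C> \<and> \<iota> i \<in> chain_maps B (X i) P) \<and>
   (\<forall>n. good_coproduct I (\<lambda>i. (X i)$n) P$n (\<lambda>i. \<iota> i n) (\<lambda>i. \<pi> i n))"

lemma chain_mapD:
 assumes "f \<in> chain_maps B X Y"
 shows "f n \<in> Arr B X$n Y$n"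
  "Cmp B X$n X$(n + 1) Y$(n + 1) (f (n + 1)) (cdiff X n) = Cmp B X$n Y$n Y$(n + 1) (cdiff Y n) (f n)"
 using assms by (auto simp: chain_maps_def)

lemma complex_coproduct_exists:
 assumes I: "small U (I :: 'u set)" and X: "\<And>i. i \<in> I \<Longrightarrow> X i \<in> \<C>"
 shows "\<exists>P \<iota> \<pi>. complex_coproduct I X P \<iota> \<pi>"
proof -
 have "\<forall>n. \<exists>P \<iota> \<pi>. good_coproduct I (\<lambda>i. (X i)$n) P \<iota> \<pi>"
 proof
  fix n show "\<exists>P \<iota> \<pi>. good_coproduct I (\<lambda>i. (X i)$n) P \<iota> \<pi>"
   using good_coproduct_exists[OF I, of "\<lambda>i. (X i)$n"] complexes_Arr(1)[OF X] by blast
 qed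
 then obtain P \<iota> \<pi> where P: "\<And>n. good_coproduct I (\<lambda>i. (X i)$n) (P n) (\<iota> n) (\<pi> n)" by metis
 note PD = good_coproductD[OF P]
 have O: "P n \<in> Ob B" "i \<in> I \<Longrightarrow> (X i)$n \<in> Ob B" for n i using PD(2) complexes_Arr(1)[OF X] by auto
 have d: "i \<in> I \<Longrightarrow> cdiff (X i) n \<in> Arr B (X i)$n (X i)$(n + 1)" for i n using complexes_Arr(2)[OF X] by auto
 have "\<exists>\<delta>. \<delta> \<in> Arr B (P n) (P (n + 1)) \<and> (\<forall>i\<in>I. Cmp B (X i)$n (P n) (P (n + 1)) \<delta> (\<iota> n i) =
   Cmp B (X i)$n (X i)$(n + 1) (P (n + 1)) (\<iota> (n + 1) i) (cdiff (X i) n))" for n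
 proof -
  obtain \<delta> where "\<delta> \<in> Arr B (P n) (P (n + 1))" "\<And>i. i \<in> I \<Longrightarrow> Cmp B (X i)$n (P n) (P (n + 1)) \<delta> (\<iota> n i) =
   Cmp B (X i)$n (X i)$(n + 1) (P (n + 1)) (\<iota> (n + 1) i) (cdiff (X i) n)"
   by (rule coproduct_map[OF PD(1) O(1), of "\<lambda>i. Cmp B (X i)$n (X i)$(n + 1) (P (n + 1)) (\<iota> (n + 1) i) (cdiff (X i) n)" n "n + 1"])
    (use O d PD(3) in \<open>simp_all add: Cmp_closed\<close>)
  then show ?thesis by blast
 qed
 then obtain \<delta> where \<delta>: "\<And>n. \<delta> n \<in> Arr B (P n) (P (n + 1))" "\<And>n i. i \<in> I \<Longrightarrow> Cmp B (X i)$n (P n) (P (n + 1)) (\<delta> n) (\<iota> n i) =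
   Cmp B (X i)$n (X i)$(n + 1) (P (n + 1)) (\<iota> (n + 1) i) (cdiff (X i) n)" by metis
 let ?P = "\<lparr>cob = P, cdiff = \<delta>\<rparr>"
 have "Cmp B (P n) (P (n + 1)) (P (n + 2)) (\<delta> (n + 1)) (\<delta> n) = Nul B (P n) (P (n + 2))" for n
 proof (rule coproduct_eq[OF PD(1)[of n]])
  have \<delta>1: "\<delta> (n + 1) \<in> Arr B (P (n + 1)) (P (n + 2))" using \<delta>(1)[of "n + 1"] by (simp add: ac_simps)
  then show "Cmp B (P n) (P (n + 1)) (P (n + 2)) (\<delta> (n + 1)) (\<delta> n) \<in> Arr B (P n) (P (n + 2))" using O \<delta>(1) by (simp add: Cmp_closed)
  fix i assume i: "i \<in> I"
  have \<iota>d: "Cmp B (X i)$(n + 1) (P (n + 1)) (P (n + 2)) (\<delta> (n + 1)) (\<iota> (n + 1) i) =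
    Cmp B (X i)$(n + 1) (X i)$(n + 2) (P (n + 2)) (\<iota> (n + 2) i) (cdiff (X i) (n + 1))"
   using \<delta>(2)[OF i, of "n + 1"] by (simp add: ac_simps)
  have d1: "cdiff (X i) (n + 1) \<in> Arr B (X i)$(n + 1) (X i)$(n + 2)" using d[OF i, of "n + 1"] by (simp add: ac_simps)
  have "Cmp B (X i)$n (P n) (P (n + 2)) (Cmp B (P n) (P (n + 1)) (P (n + 2)) (\<delta> (n + 1)) (\<delta> n)) (\<iota> n i) =
    Cmp B (X i)$n (X i)$(n + 1) (P (n + 2)) (Cmp B (X i)$(n + 1) (P (n + 1)) (P (n + 2)) (\<delta> (n + 1)) (\<iota> (n + 1) i)) (cdiff (X i) n)"
   using O i d[OF i] \<delta>(1) \<delta>1 PD(3)[OF i] by (simp add: Cmp_assoc[symmetric] \<delta>(2))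
  also have "\<dots> = Cmp B (X i)$n (X i)$(n + 2) (P (n + 2)) (\<iota> (n + 2) i) (Nul B (X i)$n (X i)$(n + 2))"
   unfolding \<iota>d complexesD(3)[OF X[OF i], symmetric] using O i d[OF i] d1 PD(3)[OF i] by (simp add: Cmp_assoc)
  finally show "Cmp B (X i)$n (P n) (P (n + 2)) (Cmp B (P n) (P (n + 1)) (P (n + 2)) (\<delta> (n + 1)) (\<delta> n)) (\<iota> n i) =
    Cmp B (X i)$n (P n) (P (n + 2)) (Nul B (P n) (P (n + 2))) (\<iota> n i)"
   using O i PD(3)[OF i] by (simp add: Cmp_Nul_left Cmp_Nul_right)
 qed (use O in \<open>simp_all add: Nul_closed\<close>)
 then have "?P \<in> \<C>" using O \<delta>(1) by (simp add: complexes_def)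
 moreover have "(\<lambda>n. \<iota> n i) \<in> chain_maps B (X i) ?P" if "i \<in> I" for i
  using PD(3)[OF that] \<delta>(2)[OF that] by (simp add: chain_maps_def)
 ultimately have "complex_coproduct I X ?P (\<lambda>i n. \<iota> n i) (\<lambda>i n. \<pi> n i)"
  using X P by (simp add: complex_coproduct_def)
 then show ?thesis by blast
qed

lemma complex_coproductD:
 assumes "complex_coproduct I X P \<iota> \<pi>"
 shows "P \<in> \<C>" "\<And>i. i \<in> I \<Longrightarrow> X i \<in> \<C>" "\<And>i. i \<in> I \<Longrightarrow> \<iota> i \<in> chain_maps B (X i) P"
  "\<And>n. good_coproduct I (\<lambda>i. (X i)$n) P$n (\<lambda>i. \<iota> i n) (\<lambda>i. \<pi> i n)"
 using assms by (auto simp: complex_coproduct_def)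

text \<open>Stated for every degree \<open>k\<close>: degree 0 assembles chain maps and degree -1
  assembles homotopies. The uniqueness counterpart \<open>complex_coproduct_eq\<close>, used in
  degree 1, shows that an assembled map commutes with the differentials.\<close>

lemma complex_coproduct_map:
 assumes P: "complex_coproduct I X P \<iota> \<pi>" and Z: "Z \<in> \<C>" and s: "\<And>i. i \<in> I \<Longrightarrow> s i \<in> Hom k (X i) Z"
 obtains w where "w \<in> Hom k P Z" "\<And>i. i \<in> I \<Longrightarrow> w * op (X i) P (\<iota> i) = s i"
proof -
 note PD = complex_coproductD[OF P]
 have "\<forall>i\<in>I. \<exists>f. f \<in> graded_arrows B k (cob (X i)) (cob Z) \<and> s i = graded_op B k (cob (X i)) (cob Z) f"
  using s Hom_op by (metis)
 then obtain f where f: "\<And>i. i \<in> I \<Longrightarrow> f i \<in> graded_arrows B k (cob (X i)) (cob Z)"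
  "\<And>i. i \<in> I \<Longrightarrow> s i = graded_op B k (cob (X i)) (cob Z) (f i)" by metis
 have "\<exists>h. h \<in> Arr B P$n Z$(n + k) \<and> (\<forall>i\<in>I. Cmp B (X i)$n P$n Z$(n + k) h (\<iota> i n) = f i n)" for n
 proof -
  obtain h where "h \<in> Arr B P$n Z$(n + k)" "\<And>i. i \<in> I \<Longrightarrow> Cmp B (X i)$n P$n Z$(n + k) h (\<iota> i n) = f i n"
   by (rule coproduct_map[OF good_coproductD(1)[OF PD(4)] complexes_Arr(1)[OF Z], of "\<lambda>i. f i n" n "n + k"])
    (use f(1) in \<open>auto simp: graded_arrows_def\<close>)
  then show ?thesis by blast
 qed
 then obtain h where h: "\<And>n. h n \<in> Arr B P$n Z$(n + k)"
  "\<And>n i. i \<in> I \<Longrightarrow> Cmp B (X i)$n P$n Z$(n + k) (h n) (\<iota> i n) = f i n" by metis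
 have hg: "h \<in> graded_arrows B k (cob P) (cob Z)" using h(1) by (simp add: graded_arrows_def)
 have "graded_op B k (cob P) (cob Z) h * op (X i) P (\<iota> i) = s i" if i: "i \<in> I" for i
  using graded_op_Cmp(2)[OF complexesD(1)[OF PD(2)[OF i]] complexesD(1)[OF PD(1)] complexesD(1)[OF Z] chain_maps_arrows[OF PD(3)[OF i]] hg]
   h(2)[OF i] f(2)[OF i] by simp
 with op_Hom[OF PD(1) Z hg] that show thesis by blast
qed

lemma complex_coproduct_eq:
 assumes P: "complex_coproduct I X P \<iota> \<pi>" and w: "w \<in> Hom k P Z" "w' \<in> Hom k P Z"
  and eq: "\<And>i. i \<in> I \<Longrightarrow> w * op (X i) P (\<iota> i) = w' * op (X i) P (\<iota> i)"
 shows "w = w'"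
proof -
 note PD = complex_coproductD[OF P]
 have Z: "Z \<in> \<C>" using w by (simp add: Hom_def split: if_splits)
 obtain h where h: "h \<in> graded_arrows B k (cob P) (cob Z)" "w = graded_op B k (cob P) (cob Z) h" using Hom_op[OF w(1)] .
 obtain h' where h': "h' \<in> graded_arrows B k (cob P) (cob Z)" "w' = graded_op B k (cob P) (cob Z) h'" using Hom_op[OF w(2)] .
 have "h n = h' n" for n
 proof (rule coproduct_eq[OF good_coproductD(1)[OF PD(4)[of n]]])
  show "h n \<in> Arr B P$n Z$(n + k)" "h' n \<in> Arr B P$n Z$(n + k)"
   using h(1) h'(1) by (simp_all add: graded_arrows_def)
  fix i assume i: "i \<in> I"
  note c = complexesD(1)[OF PD(2)[OF i]] complexesD(1)[OF PD(1)] complexesD(1)[OF Z]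
  note \<iota> = chain_maps_arrows[OF PD(3)[OF i]]
  have "graded_op B k (cob (X i)) (cob Z) (\<lambda>n. Cmp B (X i)$n P$n Z$(n + k) (h n) (\<iota> i n)) =
    graded_op B k (cob (X i)) (cob Z) (\<lambda>n. Cmp B (X i)$n P$n Z$(n + k) (h' n) (\<iota> i n))"
   using graded_op_Cmp(2)[OF c \<iota> h(1)] graded_op_Cmp(2)[OF c \<iota> h'(1)] eq[OF i] h(2) h'(2) by simp
  then show "Cmp B (X i)$n P$n Z$(n + k) (h n) (\<iota> i n) = Cmp B (X i)$n P$n Z$(n + k) (h' n) (\<iota> i n)"
   using graded_op_eq_iff[OF c(1,3)] graded_op_Cmp(1)[OF c \<iota> h(1)] graded_op_Cmp(1)[OF c \<iota> h'(1)] by simp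
 qed (use complexes_Arr(1)[OF PD(2)] complexes_Arr(1)[OF Z] in auto)
 then show ?thesis using h(2) h'(2) by (metis ext)
qed

lemma complex_coproduct_cyc:
 assumes P: "complex_coproduct I X P \<iota> \<pi>" and w: "w \<in> Hom 0 P Z"
  and cyc: "\<And>i. i \<in> I \<Longrightarrow> w * op (X i) P (\<iota> i) \<in> dg.cyc (X i) Z"
 shows "w \<in> dg.cyc P Z"
proof (rule dg.cycI[OF w])
 note PD = complex_coproductD[OF P]
 have Z: "Z \<in> \<C>" using w by (simp add: Hom_def split: if_splits)
 show "dif Z * w = w * dif P"
 proof (rule complex_coproduct_eq[OF P])
  show "dif Z * w \<in> Hom 1 P Z" "w * dif P \<in> Hom 1 P Z" using w dg.H_D Z PD(1) by (blast intro: dg.H_mults)+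
  fix i assume i: "i \<in> I"
  show "dif Z * w * op (X i) P (\<iota> i) = w * dif P * op (X i) P (\<iota> i)"
   using dg.cyc_D[OF cyc[OF i]] dg.cyc_D[OF op_cyc[OF PD(2)[OF i] PD(1) PD(3)[OF i]]] by (simp add: mult.assoc)
 qed
qed

text \<open>Degreewise coproducts remain coproducts up to homotopy, because homotopies given on the
  summands are arrows of degree -1 and assemble to one homotopy on the coproduct.\<close>

lemma complex_coproduct_K:
 assumes P: "complex_coproduct I X P \<iota> \<pi>"
 shows "is_coproduct \<K> I X P (\<lambda>i. cls (X i) P (op (X i) P (\<iota> i)))"
 unfolding is_coproduct_def
proof (intro conjI ballI allI impI)
 note PD = complex_coproductD[OF P]
 have u: "op (X i) P (\<iota> i) \<in> dg.cyc (X i) P" if "i \<in> I" for i using op_cyc PD that by blast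
 show "P \<in> Ob \<K>" using PD(1) by (simp add: K_simps)
 show "cls (X i) P (op (X i) P (\<iota> i)) \<in> Arr \<K> (X i) P" if "i \<in> I" for i using K.q_Arr[OF u[OF that]] .
 fix Z f assume "Z \<in> Ob \<K>" and f: "\<forall>i\<in>I. f i \<in> Arr \<K> (X i) Z"
 then have Z: "Z \<in> \<C>" by (simp add: K_simps)
 have "\<forall>i\<in>I. \<exists>g. g \<in> dg.cyc (X i) Z \<and> f i = cls (X i) Z g"
  using f K.Arr_q PD(2) Z unfolding K_simps(1) by metis
 then obtain g where g: "\<And>i. i \<in> I \<Longrightarrow> g i \<in> dg.cyc (X i) Z" "\<And>i. i \<in> I \<Longrightarrow> f i = cls (X i) Z (g i)" by metis
 obtain w where w: "w \<in> Hom 0 P Z" "\<And>i. i \<in> I \<Longrightarrow> w * op (X i) P (\<iota> i) = g i"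
  using complex_coproduct_map[OF P Z, of g 0] g(1) dg.cyc_H by metis
 have wc: "w \<in> dg.cyc P Z" by (rule complex_coproduct_cyc[OF P w(1)]) (use w(2) g(1) in simp)
 show "\<exists>!h. h \<in> Arr \<K> P Z \<and> (\<forall>i\<in>I. Cmp \<K> (X i) P Z h (cls (X i) P (op (X i) P (\<iota> i))) = f i)"
 proof (rule ex1I[of _ "cls P Z w"])
  show "cls P Z w \<in> Arr \<K> P Z \<and> (\<forall>i\<in>I. Cmp \<K> (X i) P Z (cls P Z w) (cls (X i) P (op (X i) P (\<iota> i))) = f i)"
   using K.q_Arr[OF wc] K.Cmp_K[OF u wc] w(2) g(2) by simp
  fix h assume h: "h \<in> Arr \<K> P Z \<and> (\<forall>i\<in>I. Cmp \<K> (X i) P Z h (cls (X i) P (op (X i) P (\<iota> i))) = f i)"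
  obtain v where v: "v \<in> dg.cyc P Z" "h = cls P Z v" using K.Arr_q[of P Z h] h PD(1) Z by (auto simp: K_simps(1))
  have "\<forall>i\<in>I. \<exists>s. s \<in> Hom (- 1) (X i) Z \<and> v * op (X i) P (\<iota> i) - g i = dif Z * s + s * dif (X i)"
  proof
   fix i assume i: "i \<in> I"
   have "cls (X i) Z (v * op (X i) P (\<iota> i)) = cls (X i) Z (g i)"
    using h v K.Cmp_K[OF u[OF i] v(1)] i g(2) by simp
   then have "dg.homotopic (X i) Z (v * op (X i) P (\<iota> i)) (g i)"
    using K.q_eq[OF dg.cyc_mult[OF u[OF i] v(1)] g(1)[OF i]] by simp
   then show "\<exists>s. s \<in> Hom (- 1) (X i) Z \<and> v * op (X i) P (\<iota> i) - g i = dif Z * s + s * dif (X i)"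
    by (auto simp: dg.homotopic_def)
  qed
  then obtain s where s: "\<And>i. i \<in> I \<Longrightarrow> s i \<in> Hom (- 1) (X i) Z"
   "\<And>i. i \<in> I \<Longrightarrow> v * op (X i) P (\<iota> i) - g i = dif Z * s i + s i * dif (X i)" by metis
  obtain t where t: "t \<in> Hom (- 1) P Z" "\<And>i. i \<in> I \<Longrightarrow> t * op (X i) P (\<iota> i) = s i"
   using complex_coproduct_map[OF P Z s(1)] by blast
  have "v - w = dif Z * t + t * dif P"
  proof (rule complex_coproduct_eq[OF P])
   show "v - w \<in> Hom 0 P Z" using dg.cyc_H[OF v(1)] w(1) by (rule dg.H_diff)
   show "dif Z * t + t * dif P \<in> Hom 0 P Z" using t(1) dg.H_D Z PD(1) by (blast intro: dg.H_mults dg.H_add)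
   fix i assume i: "i \<in> I"
   show "(v - w) * op (X i) P (\<iota> i) = (dif Z * t + t * dif P) * op (X i) P (\<iota> i)"
    using s(2)[OF i] t(2)[OF i] t(2)[OF i, THEN mult_left_eq] w(2)[OF i] dg.cyc_D[OF u[OF i]]
    by (simp add: algebra_simps)
  qed
  then have "dg.homotopic P Z v w" using t(1) by (auto simp: dg.homotopic_def)
  then show "h = cls P Z w" using K.q_homotopic v wc by simp
 qed
qed

lemma has_coproducts_K: "has_coproducts U \<K>"
 unfolding has_coproducts_def
proof (intro allI impI)
 fix I :: "'u set" and X :: "'u \<Rightarrow> ('o, 'u) cpx" assume I: "small U I" and "\<forall>i\<in>I. X i \<in> Ob \<K>"
 then have X: "\<And>i. i \<in> I \<Longrightarrow> X i \<in> \<C>" by (simp add: K_simps)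
 then show "\<exists>P \<iota>. is_coproduct \<K> I X P \<iota>"
  using complex_coproduct_exists[OF I, of X] complex_coproduct_K[of I X] by blast
qed

lemma locally_small_K: "locally_small U \<K>"
 unfolding locally_small_def
proof (intro ballI)
 fix X Y assume "X \<in> Ob \<K>" "Y \<in> Ob \<K>"
 then have O: "X \<in> \<C>" "Y \<in> \<C>" by (simp_all add: K_simps)
 let ?G = "SIGMA n : UNIV. Arr B X$n Y$n"
 have "|?G| <o |U|"
  using small_hom complexes_Arr(1) O by (intro lt_Sigma lt_countable(1)[OF natLeq_less]) (auto simp: small_def)
 then have "|Pow ?G| <o |U|" using small_Pow unfolding small_def by blast
 \<comment> \<open>A chain map is recorded by its graph; the subsets of a small set form a small set
   since \<open>U\<close> is inaccessible.\<close>
 moreover have "inj_on (\<lambda>f. range (\<lambda>n. (n, f n))) (chain_maps B X Y)"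
  by (rule inj_onI, rule ext) (auto simp: set_eq_iff image_iff)
 moreover have "(\<lambda>f. range (\<lambda>n. (n, f n))) ` chain_maps B X Y \<subseteq> Pow ?G"
  by (auto simp: chain_maps_def)
 ultimately have "|chain_maps B X Y| <o |U|" using lt_inj by blast
 then show "small U (Arr \<K> X Y)" unfolding K_Arr[OF O] small_def by (rule lt_image)
qed

sublocale KC: coproduct_triangulated U \<K>
 by (intro coproduct_triangulated.intro coproduct_triangulated_axioms.intro universe_axioms
   K.triangulated_category_axioms locally_small_K has_coproducts_K)

text \<open>
 Closing a small set of elements under the differential, precomposition and witnesses of
 filteredness gives a small subcomplex containing it.
\<close>

lemma small_subcomplex:
 assumes X: "X \<in> \<C>" and E: "|E| <o \<kappa>" "E \<subseteq> (SIGMA n : UNIV. elements X$n)"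
 shows "\<exists>Y\<in>Sm. \<exists>m\<in>chain_maps B Y X. (\<forall>n. embedding Y$n X$n (m n)) \<and>
  (\<forall>n a x. (n, a, x) \<in> E \<longrightarrow> (\<exists>y\<in>Arr B a Y$n. x = Cmp B a Y$n X$n (m n) y))"
proof -
 let ?M = "SIGMA n :: int : UNIV. elements X$n"
 have XO: "X$n \<in> Ob B" and d: "cdiff X n \<in> Arr B X$n X$(n + 1)" for n using complexes_Arr[OF X] by auto
 \<comment> \<open>\<open>join\<close> and \<open>coeq\<close> choose one witness of filteredness
   for each instance, so that each instance adds a single element to the closure.\<close>
 define join where "join n a x b y = (SOME t. (n, fst t, snd t) \<in> ?M \<and>
   (\<exists>u\<in>Arr B a (fst t). \<exists>v\<in>Arr B b (fst t). Cmp B a (fst t) X$n (snd t) u = x \<and> Cmp B b (fst t) X$n (snd t) v = y))"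
  for n a x b y
 define coeq where "coeq n b z a u v = (SOME t. (n, fst t, snd t) \<in> ?M \<and>
   (\<exists>w\<in>Arr B b (fst t). Cmp B b (fst t) X$n (snd t) w = z \<and> Cmp B a b (fst t) w u = Cmp B a b (fst t) w v))"
  for n b z a u v
 have join: "(n, fst (join n a x b y), snd (join n a x b y)) \<in> ?M \<and>
   (\<exists>u\<in>Arr B a (fst (join n a x b y)). \<exists>v\<in>Arr B b (fst (join n a x b y)).
    Cmp B a (fst (join n a x b y)) X$n (snd (join n a x b y)) u = x \<and>
    Cmp B b (fst (join n a x b y)) X$n (snd (join n a x b y)) v = y)"
  if ab: "(n, a, x) \<in> ?M" "(n, b, y) \<in> ?M" for n a x b y
  unfolding join_def
 proof (rule someI_ex)
  have "a \<in> A" "x \<in> Arr B a X$n" "b \<in> A" "y \<in> Arr B b X$n" using ab by (auto simp: elements_def)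
  from elements_directed[OF XO this] obtain c z u v where "c \<in> A" "z \<in> Arr B c X$n" "u \<in> Arr B a c" "v \<in> Arr B b c"
   "Cmp B a c X$n z u = x" "Cmp B b c X$n z v = y" by blast
  then show "\<exists>t. (n, fst t, snd t) \<in> ?M \<and> (\<exists>u\<in>Arr B a (fst t). \<exists>v\<in>Arr B b (fst t).
    Cmp B a (fst t) X$n (snd t) u = x \<and> Cmp B b (fst t) X$n (snd t) v = y)"
   by (intro exI[of _ "(c, z)"]) (auto simp: elements_def)
 qed
 have coeq: "(n, fst (coeq n b z a u v), snd (coeq n b z a u v)) \<in> ?M \<and>
   (\<exists>w\<in>Arr B b (fst (coeq n b z a u v)). Cmp B b (fst (coeq n b z a u v)) X$n (snd (coeq n b z a u v)) w = z \<and>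
    Cmp B a b (fst (coeq n b z a u v)) w u = Cmp B a b (fst (coeq n b z a u v)) w v)"
  if ab: "(n, b, z) \<in> ?M" "a \<in> A" "u \<in> Arr B a b" "v \<in> Arr B a b" "Cmp B a b X$n z u = Cmp B a b X$n z v"
  for n b z a u v
  unfolding coeq_def
 proof (rule someI_ex)
  have "b \<in> A" "z \<in> Arr B b X$n" using ab by (auto simp: elements_def)
  from elements_coequalize[OF XO ab(2) this ab(3,4,5)] obtain c z' w where "c \<in> A" "z' \<in> Arr B c X$n" "w \<in> Arr B b c"
   "Cmp B b c X$n z' w = z" "Cmp B a b c w u = Cmp B a b c w v" by blast
  then show "\<exists>t. (n, fst t, snd t) \<in> ?M \<and> (\<exists>w\<in>Arr B b (fst t). Cmp B b (fst t) X$n (snd t) w = z \<and>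
    Cmp B a b (fst t) w u = Cmp B a b (fst t) w v)"
   by (intro exI[of _ "(c, z')"]) (auto simp: elements_def)
 qed
 \<comment> \<open>The four operations under which the family is closed: \<open>pre\<close>
   restricts along arrows of \<open>A\<close>, \<open>dd\<close> applies the differential,
   \<open>jj\<close> adds upper bounds within one degree, \<open>cc\<close> adds coequalizing
   witnesses. Each yields fewer than \<kappa> elements, \<open>cc\<close> because its parameters
   range over pairs of arrows between objects of \<open>A\<close>.\<close>
 define pre where "pre = (\<lambda>(n, a, x). (\<lambda>(b, u). (n :: int, b, Cmp B b a X$n x u)) ` (SIGMA b : A. Arr B b a))"
 define dd where "dd = (\<lambda>(n, a, x). {(n + 1 :: int, a, Cmp B a X$n X$(n + 1) (cdiff X n) x)})"
 define jj where "jj = (\<lambda>(n, a, x) (n', b, y). if n = n' then {(n :: int, join n a x b y)} else {})"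
 define cc where "cc = (\<lambda>(n, b, z). (\<lambda>(a, u, v). (n :: int, coeq n b z a u v)) `
   (SIGMA a : A. {(u, v). u \<in> Arr B a b \<and> v \<in> Arr B a b \<and> Cmp B a b X$n z u = Cmp B a b X$n z v}))"
 define F where "F e e' = pre e \<union> dd e \<union> jj e e' \<union> cc e" for e e'
 have F: "F e e' \<subseteq> ?M \<and> |F e e'| <o \<kappa>" if e: "e \<in> ?M" "e' \<in> ?M" for e e'
 proof -
  obtain n a x where e1: "e = (n, a, x)" by (cases e)
  obtain n' b y where e2: "e' = (n', b, y)" by (cases e')
  have ax: "a \<in> A" "x \<in> Arr B a X$n" "a \<in> Ob B" using e(1) A_Ob by (auto simp: e1 elements_def)
  have "pre e \<subseteq> ?M" using ax A_Ob XO by (auto simp: pre_def e1 elements_def Cmp_closed)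
  moreover have "dd e \<subseteq> ?M" using ax XO d by (auto simp: dd_def e1 elements_def Cmp_closed)
  moreover have "jj e e' \<subseteq> ?M" using join[of n a x b y] e by (auto simp: jj_def e1 e2)
  moreover have "cc e \<subseteq> ?M"
  proof
   fix t assume "t \<in> cc e"
   then obtain a' u v where t: "t = (n, coeq n a x a' u v)" "a' \<in> A" "u \<in> Arr B a' a" "v \<in> Arr B a' a"
    "Cmp B a' a X$n x u = Cmp B a' a X$n x v" by (auto simp: cc_def e1)
   then show "t \<in> ?M" using coeq[of n a x a' u v] e(1) by (simp add: e1)
  qed
  moreover have "|pre e| <o \<kappa>" unfolding pre_def e1 prod.case
   by (intro \<kappa>.lt_image \<kappa>.lt_Sigma A_\<kappa> A_hom_\<kappa> ax)
  moreover have "|dd e| <o \<kappa>" "|jj e e'| <o \<kappa>" by (auto simp: dd_def jj_def e1 e2 intro: \<kappa>.lt_finite)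
  moreover have "|cc e| <o \<kappa>" unfolding cc_def e1 prod.case
  proof (intro \<kappa>.lt_image \<kappa>.lt_Sigma A_\<kappa>)
   fix a' assume a': "a' \<in> A"
   have "|Arr B a' a \<times> Arr B a' a| <o \<kappa>" by (intro \<kappa>.lt_Sigma A_hom_\<kappa> a' ax)
   then show "|{(u, v). u \<in> Arr B a' a \<and> v \<in> Arr B a' a \<and> Cmp B a' a X$n x u = Cmp B a' a X$n x v}| <o \<kappa>"
    by (rule \<kappa>.lt_subset[rotated]) auto
  qed
  ultimately show ?thesis unfolding F_def by (intro conjI Un_least \<kappa>.lt_Un)
 qed
 \<comment> \<open>A \<open>closed_family\<close> is nonempty, so one element is put into every
   degree; the zero arrow out of an object of \<open>A\<close> shows that there is one.\<close>
 have "\<forall>n. \<exists>t. t \<in> elements X$n"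
 proof
  fix n
  obtain J G c where "filtered_diagram U J B G" "\<forall>j\<in>Ob J. fob G j \<in> A" using A_colimits[OF XO] by blast
  then have "\<exists>a. a \<in> A" by (auto simp: filtered_diagram_def filtered_def)
  then obtain a where "a \<in> A" by blast
  then have "(a, Nul B a X$n) \<in> elements X$n" using A_Ob XO by (simp add: elements_def Nul_closed)
  then show "\<exists>t. t \<in> elements X$n" by blast
 qed
 then obtain b0 where b0: "\<And>n. b0 n \<in> elements X$n" by metis
 let ?E = "E \<union> range (\<lambda>n. (n, b0 n))"
 have "|?E| <o \<kappa>" by (intro \<kappa>.lt_Un E(1) \<kappa>.lt_image \<kappa>.lt_countable(1) uncountable)
 moreover have "?E \<subseteq> ?M" using E(2) b0 by auto
 ultimately have "\<exists>P. ?E \<subseteq> P \<and> P \<subseteq> ?M \<and> |P| <o \<kappa> \<and> (\<forall>e\<in>P. \<forall>e'\<in>P. F e e' \<subseteq> P)"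
  by (rule \<kappa>.closure_lt[OF uncountable _ _ F])
 then obtain P where P0: "?E \<subseteq> P \<and> P \<subseteq> ?M \<and> |P| <o \<kappa> \<and> (\<forall>e\<in>P. \<forall>e'\<in>P. F e e' \<subseteq> P)" ..
 note P = P0[THEN conjunct1] P0[THEN conjunct2, THEN conjunct1] P0[THEN conjunct2, THEN conjunct2, THEN conjunct1]
  P0[THEN conjunct2, THEN conjunct2, THEN conjunct2, rule_format]
 define Q where "Q n = {t. (n, t) \<in> P}" for n
 have Q_el: "a \<in> A" "x \<in> Arr B a X$n" if "(a, x) \<in> Q n" for a x n using that P(2) by (auto simp: Q_def elements_def)
 have QM: "(n, a, x) \<in> ?M" if "(a, x) \<in> Q n" for a x n using that P(2) by (auto simp: Q_def)
 have clos: "closed_family X$n (Q n)" for n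
  unfolding closed_family_def
 proof (intro conjI allI impI)
  show "Q n \<subseteq> elements X$n" using P(2) by (auto simp: Q_def)
  have "b0 n \<in> Q n" using P(1) by (auto simp: Q_def)
  then show "Q n \<noteq> {}" by blast
  show "(b, Cmp B b a X$n x u) \<in> Q n" if "(a, x) \<in> Q n" "b \<in> A" "u \<in> Arr B b a" for a x b u
  proof -
   have "(n, b, Cmp B b a X$n x u) \<in> pre (n, a, x)" using that by (force simp: pre_def)
   then show ?thesis using P(4)[of "(n, a, x)" "(n, a, x)"] that by (auto simp: Q_def F_def)
  qed
  show "\<exists>c z u v. (c, z) \<in> Q n \<and> u \<in> Arr B a c \<and> v \<in> Arr B b c \<and> Cmp B a c X$n z u = x \<and> Cmp B b c X$n z v = y"
   if "(a, x) \<in> Q n" "(b, y) \<in> Q n" for a x b y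
  proof -
   have "(n, join n a x b y) \<in> P" using P(4)[of "(n, a, x)" "(n, b, y)"] that by (auto simp: Q_def F_def jj_def)
   then show ?thesis using join[OF QM[OF that(1)] QM[OF that(2)]] by (cases "join n a x b y") (auto simp: Q_def)
  qed
  show "\<exists>c z' w. (c, z') \<in> Q n \<and> w \<in> Arr B b c \<and> Cmp B b c X$n z' w = z \<and> Cmp B a b c w u = Cmp B a b c w v"
   if "(b, z) \<in> Q n" "a \<in> A" "u \<in> Arr B a b" "v \<in> Arr B a b" "Cmp B a b X$n z u = Cmp B a b X$n z v" for a b z u v
  proof -
   have "(n, coeq n b z a u v) \<in> cc (n, b, z)" using that by (force simp: cc_def)
   then have "(n, coeq n b z a u v) \<in> P" using P(4)[of "(n, b, z)" "(n, b, z)"] that(1) by (auto simp: Q_def F_def)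
   then show ?thesis using coeq[OF QM[OF that(1)] that(2-5)] by (cases "coeq n b z a u v") (auto simp: Q_def)
  qed
 qed
 have "\<forall>n. \<exists>Y m. embedding Y X$n m \<and> (\<forall>a\<in>A. Cmp B a Y X$n m ` Arr B a Y = {x. (a, x) \<in> Q n})"
  using closed_family_embedding[OF XO clos] by blast
 then obtain Y m where m: "\<And>n. embedding (Y n) X$n (m n)"
  "\<And>n a. a \<in> A \<Longrightarrow> Cmp B a (Y n) X$n (m n) ` Arr B a (Y n) = {x. (a, x) \<in> Q n}" by metis
 have YO: "Y n \<in> Ob B" "m n \<in> Arr B (Y n) X$n" for n using m(1)[of n] by (auto simp: embedding_def)
 \<comment> \<open>The family is closed under the differential, so the differential of
   \<open>X\<close> carries the elements of \<open>Y n\<close> into the image of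
   \<open>m (n + 1)\<close>; \<open>embedding_factor\<close> turns this into an arrow.\<close>
 have "\<exists>\<delta>. \<delta> \<in> Arr B (Y n) (Y (n + 1)) \<and> Cmp B (Y n) X$n X$(n + 1) (cdiff X n) (m n) =
   Cmp B (Y n) (Y (n + 1)) X$(n + 1) (m (n + 1)) \<delta>" for n
 proof -
  have "\<exists>y\<in>Arr B a (Y (n + 1)). Cmp B a (Y n) X$(n + 1) (Cmp B (Y n) X$n X$(n + 1) (cdiff X n) (m n)) x =
    Cmp B a (Y (n + 1)) X$(n + 1) (m (n + 1)) y" if a: "a \<in> A" "x \<in> Arr B a (Y n)" for a x
  proof -
   have "(a, Cmp B a (Y n) X$n (m n) x) \<in> Q n" using m(2)[OF a(1), of n] a(2) by blast
   then have "(a, Cmp B a X$n X$(n + 1) (cdiff X n) (Cmp B a (Y n) X$n (m n) x)) \<in> Q (n + 1)"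
    using P(4)[of "(n, a, Cmp B a (Y n) X$n (m n) x)" "(n, a, Cmp B a (Y n) X$n (m n) x)"]
    by (auto simp: Q_def F_def dd_def)
   then obtain y where "y \<in> Arr B a (Y (n + 1))" "Cmp B a X$n X$(n + 1) (cdiff X n) (Cmp B a (Y n) X$n (m n) x) =
     Cmp B a (Y (n + 1)) X$(n + 1) (m (n + 1)) y" using m(2)[OF a(1), of "n + 1"] by blast
   then show ?thesis using a A_Ob XO YO d by (auto simp: Cmp_assoc)
  qed
  then show ?thesis
   using embedding_factor[OF m(1)[of "n + 1"] YO(1)[of n], of "Cmp B (Y n) X$n X$(n + 1) (cdiff X n) (m n)"]
    Cmp_closed[OF YO(1) XO XO YO(2) d] by metis
 qed
 then obtain \<delta> where \<delta>: "\<And>n. \<delta> n \<in> Arr B (Y n) (Y (n + 1))" "\<And>n. Cmp B (Y n) X$n X$(n + 1) (cdiff X n) (m n) =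
   Cmp B (Y n) (Y (n + 1)) X$(n + 1) (m (n + 1)) (\<delta> n)" by metis
 have "Cmp B (Y n) (Y (n + 1)) (Y (n + 2)) (\<delta> (n + 1)) (\<delta> n) = Nul B (Y n) (Y (n + 2))" for n
 proof (rule embedding_cancel[OF m(1)[of "n + 2"] YO(1)[of n]])
  have \<delta>1: "\<delta> (n + 1) \<in> Arr B (Y (n + 1)) (Y (n + 2))" "Cmp B (Y (n + 1)) X$(n + 1) X$(n + 2) (cdiff X (n + 1)) (m (n + 1)) =
   Cmp B (Y (n + 1)) (Y (n + 2)) X$(n + 2) (m (n + 2)) (\<delta> (n + 1))"
   using \<delta>(1)[of "n + 1"] \<delta>(2)[of "n + 1"] by (simp_all add: ac_simps)
  have d1: "cdiff X (n + 1) \<in> Arr B X$(n + 1) X$(n + 2)" using d[of "n + 1"] by (simp add: ac_simps)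
  show "Cmp B (Y n) (Y (n + 1)) (Y (n + 2)) (\<delta> (n + 1)) (\<delta> n) \<in> Arr B (Y n) (Y (n + 2))" "Nul B (Y n) (Y (n + 2)) \<in> Arr B (Y n) (Y (n + 2))"
   using YO \<delta>(1) \<delta>1(1) by (simp_all add: Cmp_closed Nul_closed)
  have "Cmp B (Y n) (Y (n + 2)) X$(n + 2) (m (n + 2)) (Cmp B (Y n) (Y (n + 1)) (Y (n + 2)) (\<delta> (n + 1)) (\<delta> n)) =
    Cmp B (Y n) (Y (n + 1)) X$(n + 2) (Cmp B (Y (n + 1)) X$(n + 1) X$(n + 2) (cdiff X (n + 1)) (m (n + 1))) (\<delta> n)"
   unfolding \<delta>1(2) using YO XO \<delta>(1) \<delta>1(1) by (simp add: Cmp_assoc)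
  also have "\<dots> = Cmp B (Y n) X$(n + 1) X$(n + 2) (cdiff X (n + 1)) (Cmp B (Y n) X$n X$(n + 1) (cdiff X n) (m n))"
   unfolding \<delta>(2) using YO XO d1 \<delta>(1) by (simp add: Cmp_assoc)
  also have "\<dots> = Cmp B (Y n) X$n X$(n + 2) (Nul B X$n X$(n + 2)) (m n)"
   unfolding complexesD(3)[OF X, symmetric] using YO XO d d1 by (simp add: Cmp_assoc)
  finally show "Cmp B (Y n) (Y (n + 2)) X$(n + 2) (m (n + 2)) (Cmp B (Y n) (Y (n + 1)) (Y (n + 2)) (\<delta> (n + 1)) (\<delta> n)) =
    Cmp B (Y n) (Y (n + 2)) X$(n + 2) (m (n + 2)) (Nul B (Y n) (Y (n + 2)))"
   using YO XO by (simp add: Cmp_Nul_left Cmp_Nul_right)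
 qed
 then have YC: "\<lparr>cob = Y, cdiff = \<delta>\<rparr> \<in> \<C>" using YO \<delta>(1) by (simp add: complexes_def)
 \<comment> \<open>Injectivity of \<open>m n\<close> on elements turns the bound on \<open>P\<close>
   into a bound on the elements of \<open>Y n\<close>.\<close>
 have "|Arr B a (Y n)| <o \<kappa>" if a: "a \<in> A" for a n
 proof -
  have "(\<lambda>y. (n, a, Cmp B a (Y n) X$n (m n) y)) ` Arr B a (Y n) \<subseteq> P" using m(2)[OF a, of n] by (auto simp: Q_def)
  moreover have "inj_on (\<lambda>y. (n, a, Cmp B a (Y n) X$n (m n) y)) (Arr B a (Y n))"
   using m(1)[of n] a by (auto simp: embedding_def inj_on_def)
  ultimately show ?thesis using \<kappa>.lt_inj P(3) by blast
 qed
 with YC have "\<lparr>cob = Y, cdiff = \<delta>\<rparr> \<in> Sm" by (simp add: Sm_def)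
 moreover have "m \<in> chain_maps B \<lparr>cob = Y, cdiff = \<delta>\<rparr> X" using YO \<delta>(2) by (simp add: chain_maps_def)
 moreover have "\<exists>y\<in>Arr B a (Y n). x = Cmp B a (Y n) X$n (m n) y" if "(n, a, x) \<in> E" for n a x
 proof -
  have "(a, x) \<in> Q n" using that P(1) by (auto simp: Q_def)
  then show ?thesis using m(2)[of a n] Q_el by blast
 qed
 ultimately show ?thesis using m(1) by (intro bexI[of _ "\<lparr>cob = Y, cdiff = \<delta>\<rparr>"] bexI[of _ m]) auto
qed

end

section \<open>Closure properties of the small complexes\<close>

context accessible_homotopy
begin

lemma SmI: "\<lbrakk>X \<in> \<C>; \<And>n a. a \<in> A \<Longrightarrow> |Arr B a X$n| <o \<kappa>\<rbrakk> \<Longrightarrow> X \<in> Sm"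
 by (simp add: Sm_def)

lemma Sm_zero: "\<exists>N\<in>Sm. is_zero \<K> N"
proof -
 obtain N where N: "N \<in> \<C>" "unit N = 0" "\<And>n. is_zero B N$n" using zero_complex by blast
 have "N \<in> Sm"
 proof (rule SmI[OF N(1)])
  fix n a assume "a \<in> A"
  then have "Arr B a N$n \<subseteq> {Nul B a N$n}" using is_zero_hom(1)[OF N(3)] A_Ob by blast
  then show "|Arr B a N$n| <o \<kappa>" using \<kappa>.lt_finite finite_subset by blast
 qed
 moreover have "is_zero \<K> N" using K.e_zero_is_zero N(1,2) by (simp add: K_simps)
 ultimately show ?thesis by blast
qed

lemma Sm_shft: "X \<in> Sm \<Longrightarrow> shft X \<in> Sm"
 by (rule SmI) (simp_all add: shft_complex Sm_complex shft_simps Sm_lt)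

lemma Sm_unshift:
 assumes X: "X \<in> Sm" shows "\<exists>Y\<in>Sm. \<exists>f. isomorphism \<K> (shft Y) X f"
proof -
 obtain Y where Y: "Y \<in> \<C>" "shft Y = X" using shft_surj[OF Sm_complex[OF X]] by blast
 have "Y$n = X$(n - 1)" for n using shft_simps(1)[of Y "n - 1"] Y(2) by simp
 then have "Y \<in> Sm" using SmI[OF Y(1)] Sm_lt[OF X] by simp
 moreover have "isomorphism \<K> (shft Y) X (Ident \<K> X)"
  unfolding Y(2) by (rule K.isomorphism_Ident) (simp add: K_simps Sm_complex X)
 ultimately show ?thesis by blast
qed

lemma biproduct_lt:
 assumes b: "is_biproduct B X Y Z iX iY pX pY" and O: "a \<in> Ob B" "X \<in> Ob B" "Y \<in> Ob B"
  and lt: "|Arr B a X| <o \<kappa>" "|Arr B a Y| <o \<kappa>"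
 shows "|Arr B a Z| <o \<kappa>"
proof -
 have Z: "Z \<in> Ob B" "iX \<in> Arr B X Z" "iY \<in> Arr B Y Z" "pX \<in> Arr B Z X" "pY \<in> Arr B Z Y"
  "Add B Z Z (Cmp B Z X Z iX pX) (Cmp B Z Y Z iY pY) = Ident B Z" using b by (auto simp: is_biproduct_def)
 have split: "z = Add B a Z (Cmp B a X Z iX (Cmp B a Z X pX z)) (Cmp B a Y Z iY (Cmp B a Z Y pY z))" if "z \<in> Arr B a Z" for z
 proof -
  have "z = Cmp B a Z Z (Add B Z Z (Cmp B Z X Z iX pX) (Cmp B Z Y Z iY pY)) z" using that O Z by (simp add: Cmp_Ident_left)
  also have "\<dots> = Add B a Z (Cmp B a X Z iX (Cmp B a Z X pX z)) (Cmp B a Y Z iY (Cmp B a Z Y pY z))"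
   using that O Z(1-5) by (simp add: Cmp_Add_left Cmp_assoc closed)
  finally show ?thesis .
 qed
 have "inj_on (\<lambda>z. (Cmp B a Z X pX z, Cmp B a Z Y pY z)) (Arr B a Z)"
  using split by (intro inj_onI) (metis prod.inject)
 moreover have "(\<lambda>z. (Cmp B a Z X pX z, Cmp B a Z Y pY z)) ` Arr B a Z \<subseteq> Arr B a X \<times> Arr B a Y"
  using O Z by (auto simp: Cmp_closed)
 ultimately show ?thesis using \<kappa>.lt_inj \<kappa>.lt_Sigma[OF lt(1), of "\<lambda>_. Arr B a Y"] lt(2) by blast
qed

lemma Sm_cone:
 assumes X: "X \<in> Sm" and Y: "Y \<in> Sm" and u: "u \<in> Arr \<K> X Y"
 shows "\<exists>Z\<in>Sm. \<exists>v w. (X, Y, Z, u, v, w) \<in> Tri \<K>"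
proof -
 note O = Sm_complex[OF X] Sm_complex[OF Y]
 obtain c where c: "c \<in> dg.cyc X Y" "u = cls X Y c" using K.Arr_q[of X Y u] u O by (auto simp: K_simps(1))
 obtain Z i j p r where Z: "dg.cone X Y c Z i j p r" using cone_exists[OF c(1)] by blast
 have "(X, Y, Z, cls X Y c, cls Y Z i, cls Z (shft X) (sgm X * p)) \<in> cone_triangles B"
  using Z cone_triangles_iff by blast
 then obtain f iX iY pX pY where mc: "is_mapping_cone B X Y f Z iX iY pX pY" unfolding cone_triangles_def by blast
 have "Z \<in> Sm"
 proof (rule SmI)
  show "Z \<in> \<C>" using mc by (simp add: is_mapping_cone_def)
  fix n a assume a: "a \<in> A"
  have "is_biproduct B X$(n + 1) Y$n Z$n (iX n) (iY n) (pX n) (pY n)"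
   using mc by (simp add: is_mapping_cone_def)
  then show "|Arr B a Z$n| <o \<kappa>"
   using biproduct_lt A_Ob[OF a] Sm_lt[OF X a] Sm_lt[OF Y a] complexes_Arr(1)[OF O(1)] complexes_Arr(1)[OF O(2)] by blast
 qed
 then show ?thesis using K.cone_triangle(2)[OF Z] c(2) by blast
qed

text \<open>An element is determined by the finite set of its nonzero components, tagged with their
  indices; \<open>lt_Fpow\<close> counts these sets.\<close>

lemma good_coproduct_lt:
 assumes P: "good_coproduct I X P \<iota> \<pi>" and X: "\<And>i. i \<in> I \<Longrightarrow> X i \<in> Ob B" and a: "a \<in> A"
  and lt: "|I| <o \<kappa>" "\<And>i. i \<in> I \<Longrightarrow> |Arr B a (X i)| <o \<kappa>"
 shows "|Arr B a P| <o \<kappa>"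
proof -
 note PD = good_coproductD[OF P]
 define s where "s x = {(i, Cmp B a P (X i) (\<pi> i) x) |i. i \<in> I \<and> Cmp B a P (X i) (\<pi> i) x \<noteq> Nul B a (X i)}" for x
 have "s ` Arr B a P \<subseteq> Fpow (Sigma I (\<lambda>i. Arr B a (X i)))"
 proof (intro image_subsetI)
  fix x assume x: "x \<in> Arr B a P"
  have "s x = (\<lambda>i. (i, Cmp B a P (X i) (\<pi> i) x)) ` {i \<in> I. Cmp B a P (X i) (\<pi> i) x \<noteq> Nul B a (X i)}"
   by (auto simp: s_def)
  moreover have "s x \<subseteq> Sigma I (\<lambda>i. Arr B a (X i))" using x PD(2,4) A_Ob[OF a] X by (auto simp: s_def Cmp_closed)
  ultimately show "s x \<in> Fpow (Sigma I (\<lambda>i. Arr B a (X i)))" using PD(6)[OF a x] by (simp add: Fpow_def)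
 qed
 moreover have "inj_on s (Arr B a P)"
 proof (rule inj_onI)
  fix x y assume xy: "x \<in> Arr B a P" "y \<in> Arr B a P" "s x = s y"
  show "x = y"
  proof (rule good_coproduct_element_eq[OF P X a xy(1,2)])
   fix i assume i: "i \<in> I"
   have sD: "(i, v) \<in> s z \<longleftrightarrow> v = Cmp B a P (X i) (\<pi> i) z \<and> v \<noteq> Nul B a (X i)" for v z using i by (auto simp: s_def)
   let ?c = "\<lambda>z. Cmp B a P (X i) (\<pi> i) z"
   show "?c x = ?c y"
   proof (cases "?c x = Nul B a (X i)")
    case True
    then have "(i, ?c y) \<notin> s x" by (simp add: sD)
    then have "(i, ?c y) \<notin> s y" by (simp only: xy(3) not_False_eq_True)
    then show ?thesis using True by (simp add: sD)
   next
    case False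
    then have "(i, ?c x) \<in> s x" by (simp add: sD)
    then have "(i, ?c x) \<in> s y" by (simp only: xy(3))
    then show ?thesis by (simp add: sD)
   qed
  qed
 qed
 moreover have "|Fpow (Sigma I (\<lambda>i. Arr B a (X i)))| <o \<kappa>"
  by (intro \<kappa>.lt_Fpow uncountable \<kappa>.lt_Sigma lt)
 ultimately show ?thesis using \<kappa>.lt_inj[of s "Arr B a P" "Fpow (Sigma I (\<lambda>i. Arr B a (X i)))"] by simp
qed

lemma complex_coproduct_H:
 assumes P: "complex_coproduct I X P \<iota> \<pi>"
 shows "is_coproduct \<K> I X P (\<lambda>i. \<H> (X i) P (\<iota> i))"
proof -
 have e: "cls (X i) P (op (X i) P (\<iota> i)) = \<H> (X i) P (\<iota> i)" if i: "i \<in> I" for i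
  using cls_op complex_coproductD[OF P] i by blast
 show ?thesis using complex_coproduct_K[OF P] by (simp add: is_coproduct_def e)
qed

lemma Sm_coproduct:
 assumes J: "|J :: 'u set| <o \<kappa>" and V: "\<And>i. i \<in> J \<Longrightarrow> V i \<in> Sm"
 shows "\<exists>P\<in>Sm. \<exists>\<iota>. is_coproduct \<K> J V P \<iota>"
proof -
 obtain P \<iota> \<pi> where P: "complex_coproduct J V P \<iota> \<pi>"
  using complex_coproduct_exists[OF lt_\<kappa>_small[OF J], of V] V Sm_complex by blast
 note PD = complex_coproductD[OF P]
 have "P \<in> Sm"
 proof (rule SmI[OF PD(1)])
  fix n a assume a: "a \<in> A"
  show "|Arr B a P$n| <o \<kappa>"
   by (rule good_coproduct_lt[OF PD(4) _ a J]) (use V Sm_lt a complexes_Arr(1) Sm_complex in auto)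
 qed
 then show ?thesis using complex_coproduct_H[OF P] by blast
qed

section \<open>Factorization of maps from small complexes into coproducts\<close>

lemma complex_coproduct_factor:
 assumes Q: "complex_coproduct J C Q \<iota>' \<pi>'" and P: "complex_coproduct I X P \<iota> \<pi>" and JI: "J \<subseteq> I"
  and m: "\<And>i. i \<in> J \<Longrightarrow> m i \<in> chain_maps B (C i) (X i)"
   "\<And>i n. i \<in> J \<Longrightarrow> embedding (C i)$n (X i)$n (m i n)"
  and Y: "Y \<in> \<C>" and f: "f \<in> chain_maps B Y P"
  and fac: "\<And>i n a x. \<lbrakk>i \<in> J; a \<in> A; x \<in> Arr B a Y$n\<rbrakk> \<Longrightarrow> \<exists>e\<in>Arr B a (C i)$n.
   Cmp B a P$n (X i)$n (\<pi> i n) (Cmp B a Y$n P$n (f n) x) = Cmp B a (C i)$n (X i)$n (m i n) e"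
  and nul: "\<And>i n a x. \<lbrakk>i \<in> I - J; a \<in> A; x \<in> Arr B a Y$n\<rbrakk> \<Longrightarrow>
   Cmp B a P$n (X i)$n (\<pi> i n) (Cmp B a Y$n P$n (f n) x) = Nul B a (X i)$n"
 obtains g h where "g \<in> chain_maps B Y Q" "h \<in> chain_maps B Q P"
  "\<And>i. i \<in> J \<Longrightarrow> (\<lambda>n. Cmp B (C i)$n Q$n P$n (h n) (\<iota>' i n)) =
   (\<lambda>n. Cmp B (C i)$n (X i)$n P$n (\<iota> i n) (m i n))"
  "f = (\<lambda>n. Cmp B Y$n Q$n P$n (h n) (g n))"
proof -
 note QD = complex_coproductD[OF Q] and PD = complex_coproductD[OF P]
 have \<iota>m: "(\<lambda>n. Cmp B (C i)$n (X i)$n P$n (\<iota> i n) (m i n)) \<in> chain_maps B (C i) P" (is "?s i \<in> _")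
  if i: "i \<in> J" for i using i JI by (intro chain_maps_Cmp QD PD m) auto
 have s: "\<And>i. i \<in> J \<Longrightarrow> op (C i) P (?s i) \<in> Hom 0 (C i) P"
  using dg.cyc_H op_cyc QD(2) PD(1) \<iota>m by blast
 obtain w where w: "w \<in> Hom 0 Q P" "\<And>i. i \<in> J \<Longrightarrow> w * op (C i) Q (\<iota>' i) = op (C i) P (?s i)"
  using complex_coproduct_map[OF Q PD(1) s] by blast
 have "w \<in> dg.cyc Q P"
  by (rule complex_coproduct_cyc[OF Q w(1)]) (simp add: w(2) op_cyc[OF QD(2) PD(1) \<iota>m])
 then obtain h where h: "h \<in> chain_maps B Q P" "w = op Q P h" by (rule cyc_op)
 have h\<iota>: "(\<lambda>n. Cmp B (C i)$n Q$n P$n (h n) (\<iota>' i n)) = ?s i" if i: "i \<in> J" for i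
  by (rule op_inject[OF QD(2)[OF i] PD(1) chain_maps_Cmp[OF QD(2)[OF i] QD(1) PD(1) QD(3)[OF i] h(1)] \<iota>m[OF i]])
   (use op_Cmp(1)[OF QD(2)[OF i] QD(1) PD(1) chain_maps_arrows[OF QD(3)[OF i]] chain_maps_arrows[OF h(1)]] w(2)[OF i] h(2) in simp)
 have h\<iota>n: "Cmp B (C i)$n Q$n P$n (h n) (\<iota>' i n) = Cmp B (C i)$n (X i)$n P$n (\<iota> i n) (m i n)"
  if "i \<in> J" for i n using fun_cong[OF h\<iota>[OF that], of n] by simp
 have CO: "\<And>i. i \<in> J \<Longrightarrow> (C i)$n \<in> Ob B" and XO: "\<And>i. i \<in> I \<Longrightarrow> (X i)$n \<in> Ob B" for n
  using complexes_Arr(1) QD(2) PD(2) by blast+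
 note emb = coproduct_embedding[OF QD(4) PD(4) JI, where m = "\<lambda>i. m i n" and h = "h n" for n, OF CO XO m(2) chain_mapD(1)[OF h(1)] h\<iota>n]
 note YO = complexes_Arr[OF Y] and QO = complexes_Arr[OF QD(1)] and PO = complexes_Arr[OF PD(1)]
 note fA = chain_mapD(1)[OF f] and hA = chain_mapD(1)[OF h(1)]
 have e: "embedding Q$n P$n (h n)" for n by (rule emb(1))
 \<comment> \<open>The images under \<open>f n\<close> of the elements of \<open>Y\<close> have
   liftable components, so they come from \<open>Q\<close>; since \<open>h n\<close> is an
   embedding, \<open>f n\<close> factors through it.\<close>
 have "\<exists>g. g \<in> Arr B Y$n Q$n \<and> f n = Cmp B Y$n Q$n P$n (h n) g" for n
 proof -
  have "\<exists>y\<in>Arr B a Q$n. Cmp B a Y$n P$n (f n) x = Cmp B a Q$n P$n (h n) y"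
   if ax: "a \<in> A" "x \<in> Arr B a Y$n" for a x
   by (rule emb(2)) (use fac nul ax A_Ob YO PO fA in \<open>auto simp: Cmp_closed\<close>)
  then show ?thesis using embedding_factor[OF e YO(1) fA] by metis
 qed
 then obtain g where g: "\<And>n. g n \<in> Arr B Y$n Q$n" "\<And>n. f n = Cmp B Y$n Q$n P$n (h n) (g n)"
  by metis
 \<comment> \<open>Both sides agree after the embedding \<open>h (n + 1)\<close>, as
   \<open>f\<close> and \<open>h\<close> are chain maps; hence the lifts found separately in each
   degree form a chain map.\<close>
 have "Cmp B Y$n Y$(n + 1) Q$(n + 1) (g (n + 1)) (cdiff Y n) =
   Cmp B Y$n Q$n Q$(n + 1) (cdiff Q n) (g n)" for n
 proof (rule embedding_cancel[OF e[of "n + 1"] YO(1)])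
  show "Cmp B Y$n Y$(n + 1) Q$(n + 1) (g (n + 1)) (cdiff Y n) \<in> Arr B Y$n Q$(n + 1)"
   "Cmp B Y$n Q$n Q$(n + 1) (cdiff Q n) (g n) \<in> Arr B Y$n Q$(n + 1)"
   using YO QO g(1) by (auto intro: Cmp_closed)
  have "Cmp B Y$n Q$(n + 1) P$(n + 1) (h (n + 1)) (Cmp B Y$n Y$(n + 1) Q$(n + 1) (g (n + 1)) (cdiff Y n)) =
    Cmp B Y$n Y$(n + 1) P$(n + 1) (f (n + 1)) (cdiff Y n)"
   using YO QO PO g hA by (simp add: Cmp_assoc)
  also have "\<dots> = Cmp B Y$n Q$n P$(n + 1) (Cmp B Q$n P$n P$(n + 1) (cdiff P n) (h n)) (g n)"
   unfolding chain_mapD(2)[OF f] g(2)[of n] using YO QO PO g(1) hA by (simp add: Cmp_assoc)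
  also have "\<dots> = Cmp B Y$n Q$(n + 1) P$(n + 1) (h (n + 1)) (Cmp B Y$n Q$n Q$(n + 1) (cdiff Q n) (g n))"
   unfolding chain_mapD(2)[OF h(1), symmetric] using YO QO PO g(1) hA by (simp add: Cmp_assoc)
  finally show "Cmp B Y$n Q$(n + 1) P$(n + 1) (h (n + 1)) (Cmp B Y$n Y$(n + 1) Q$(n + 1) (g (n + 1)) (cdiff Y n)) =
    Cmp B Y$n Q$(n + 1) P$(n + 1) (h (n + 1)) (Cmp B Y$n Q$n Q$(n + 1) (cdiff Q n) (g n))" .
 qed
 then have "g \<in> chain_maps B Y Q" using g(1) by (simp add: chain_maps_def)
 then show thesis using that h(1) h\<iota> g(2) by blast
qed

text \<open>Coproducts are unique up to isomorphism, so a map into an arbitrary one is represented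
  by a chain map \<open>f\<close> into the degreewise coproduct, followed by the isomorphism
  \<open>\<theta>\<close>. From here on \<open>f\<close> can be factored strictly.\<close>

lemma K_coproduct_canonical:
 assumes I: "small U (I :: 'u set)" and X: "\<And>i. i \<in> I \<Longrightarrow> X i \<in> \<C>" and P0: "is_coproduct \<K> I X P0 \<iota>0"
  and Y: "Y \<in> \<C>" and F: "F \<in> Arr \<K> Y P0"
 obtains P \<iota> \<pi> f \<theta> where "complex_coproduct I X P \<iota> \<pi>" "f \<in> chain_maps B Y P" "\<theta> \<in> Arr \<K> P P0"
  "F = Cmp \<K> Y P P0 \<theta> (\<H> Y P f)" "\<And>i. i \<in> I \<Longrightarrow> Cmp \<K> (X i) P P0 \<theta> (\<H> (X i) P (\<iota> i)) = \<iota>0 i"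
proof -
 obtain P \<iota> \<pi> where P: "complex_coproduct I X P \<iota> \<pi>"
  using complex_coproduct_exists[OF I, of X] X by blast
 note PD = complex_coproductD[OF P]
 have O: "P0 \<in> Ob \<K>" "P \<in> Ob \<K>" "Y \<in> Ob \<K>" "\<And>i. i \<in> I \<Longrightarrow> X i \<in> Ob \<K>"
  using P0 PD(1) Y X by (auto simp: is_coproduct_def K_simps(1))
 obtain \<theta>' \<theta> where t: "\<theta>' \<in> Arr \<K> P0 P" "\<theta> \<in> Arr \<K> P P0"
  "Cmp \<K> P0 P P0 \<theta> \<theta>' = Ident \<K> P0" "Cmp \<K> P P0 P \<theta>' \<theta> = Ident \<K> P"
  "\<And>i. i \<in> I \<Longrightarrow> Cmp \<K> (X i) P0 P \<theta>' (\<iota>0 i) = \<H> (X i) P (\<iota> i)"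
  "\<And>i. i \<in> I \<Longrightarrow> Cmp \<K> (X i) P P0 \<theta> (\<H> (X i) P (\<iota> i)) = \<iota>0 i"
  using K.coproduct_unique[OF P0 complex_coproduct_H[OF P] O(4)] by blast
 have "Cmp \<K> Y P0 P \<theta>' F \<in> Arr \<K> Y P" using O F t(1) by (simp add: K.Cmp_closed)
 then obtain f where f: "f \<in> chain_maps B Y P" "Cmp \<K> Y P0 P \<theta>' F = \<H> Y P f"
  unfolding K_Arr[OF Y PD(1)] by blast
 have "F = Cmp \<K> Y P P0 \<theta> (Cmp \<K> Y P0 P \<theta>' F)"
  using K.Cmp_assoc[OF O(3,1,2,1) F t(1,2)] K.Cmp_Ident_left[OF O(3,1) F] t(3) by simp
 then show thesis using that[OF P f(1) t(2) _ t(6)] f(2) by simp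
qed

text \<open>Returns from chain maps to the homotopy category: a strict factorization of
  \<open>f\<close> is pushed along \<open>\<theta>\<close> to the given coproduct.\<close>

lemma K_factor:
 assumes P: "complex_coproduct I X P \<iota> \<pi>" and Q: "complex_coproduct J C Q \<iota>' \<pi>'" and JI: "J \<subseteq> I"
  and Y: "Y \<in> \<C>" and m: "\<And>i. i \<in> J \<Longrightarrow> m i \<in> chain_maps B (C i) (X i)"
  and gh: "g \<in> chain_maps B Y Q" "h \<in> chain_maps B Q P"
   "\<And>i. i \<in> J \<Longrightarrow> (\<lambda>n. Cmp B (C i)$n Q$n P$n (h n) (\<iota>' i n)) =
    (\<lambda>n. Cmp B (C i)$n (X i)$n P$n (\<iota> i n) (m i n))"
   "f = (\<lambda>n. Cmp B Y$n Q$n P$n (h n) (g n))"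
  and \<theta>: "P0 \<in> \<C>" "\<theta> \<in> Arr \<K> P P0" "F = Cmp \<K> Y P P0 \<theta> (\<H> Y P f)"
   "\<And>i. i \<in> I \<Longrightarrow> Cmp \<K> (X i) P P0 \<theta> (\<H> (X i) P (\<iota> i)) = \<iota>0 i"
 shows "\<H> Y Q g \<in> Arr \<K> Y Q" "Cmp \<K> Q P P0 \<theta> (\<H> Q P h) \<in> Arr \<K> Q P0"
  "F = Cmp \<K> Y Q P0 (Cmp \<K> Q P P0 \<theta> (\<H> Q P h)) (\<H> Y Q g)"
  "\<And>i. i \<in> J \<Longrightarrow> Cmp \<K> (C i) Q P0 (Cmp \<K> Q P P0 \<theta> (\<H> Q P h)) (\<H> (C i) Q (\<iota>' i)) =
   Cmp \<K> (C i) (X i) P0 (\<iota>0 i) (\<H> (C i) (X i) (m i))"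
proof -
 note QD = complex_coproductD[OF Q] and PD = complex_coproductD[OF P]
 have O: "Y \<in> Ob \<K>" "Q \<in> Ob \<K>" "P \<in> Ob \<K>" "P0 \<in> Ob \<K>" "\<And>i. i \<in> J \<Longrightarrow> C i \<in> Ob \<K>"
  "\<And>i. i \<in> I \<Longrightarrow> X i \<in> Ob \<K>" using Y QD(1,2) PD(1,2) \<theta>(1) by (auto simp: K_simps(1))
 have A: "\<H> V W k \<in> Arr \<K> V W" if "V \<in> \<C>" "W \<in> \<C>" "k \<in> chain_maps B V W" for V W k
  using that by (simp add: K_Arr)
 note gA = A[OF Y QD(1) gh(1)] and hA = A[OF QD(1) PD(1) gh(2)]
 show "\<H> Y Q g \<in> Arr \<K> Y Q" by (rule gA)
 show "Cmp \<K> Q P P0 \<theta> (\<H> Q P h) \<in> Arr \<K> Q P0" using K.Cmp_closed[OF O(2,3,4) hA \<theta>(2)] .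
 show "F = Cmp \<K> Y Q P0 (Cmp \<K> Q P P0 \<theta> (\<H> Q P h)) (\<H> Y Q g)"
  using K.Cmp_assoc[OF O(1,2,3,4) gA hA \<theta>(2)] K_Cmp[OF Y QD(1) PD(1) gh(1,2)] \<theta>(3) gh(4) by simp
 fix i assume i: "i \<in> J"
 then have iI: "i \<in> I" using JI by blast
 note cA = A[OF QD(2)[OF i] QD(1) QD(3)[OF i]] and mA = A[OF QD(2)[OF i] PD(2)[OF iI] m[OF i]]
  and iA = A[OF PD(2)[OF iI] PD(1) PD(3)[OF iI]]
 have "Cmp \<K> (C i) Q P0 (Cmp \<K> Q P P0 \<theta> (\<H> Q P h)) (\<H> (C i) Q (\<iota>' i)) =
   Cmp \<K> (C i) P P0 \<theta> (Cmp \<K> (C i) Q P (\<H> Q P h) (\<H> (C i) Q (\<iota>' i)))"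
  using K.Cmp_assoc[OF O(5)[OF i] O(2,3,4) cA hA \<theta>(2)] by simp
 also have "Cmp \<K> (C i) Q P (\<H> Q P h) (\<H> (C i) Q (\<iota>' i)) =
   Cmp \<K> (C i) (X i) P (\<H> (X i) P (\<iota> i)) (\<H> (C i) (X i) (m i))"
  using K_Cmp[OF QD(2)[OF i] QD(1) PD(1) QD(3)[OF i] gh(2)] K_Cmp[OF QD(2)[OF i] PD(2)[OF iI] PD(1) m[OF i] PD(3)[OF iI]] gh(3)[OF i]
  by simp
 also have "Cmp \<K> (C i) P P0 \<theta> \<dots> = Cmp \<K> (C i) (X i) P0 (\<iota>0 i) (\<H> (C i) (X i) (m i))"
  using K.Cmp_assoc[OF O(5)[OF i] O(6)[OF iI] O(3,4) mA iA \<theta>(2)] \<theta>(4)[OF iI] by simp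
 finally show "Cmp \<K> (C i) Q P0 (Cmp \<K> Q P P0 \<theta> (\<H> Q P h)) (\<H> (C i) Q (\<iota>' i)) =
   Cmp \<K> (C i) (X i) P0 (\<iota>0 i) (\<H> (C i) (X i) (m i))" .
qed

lemma embedding_Ident: "X \<in> Ob B \<Longrightarrow> embedding X X (Ident B X)"
 unfolding embedding_def using A_Ob by (auto simp: inj_on_def Cmp_Ident_left closed)

text \<open>The indices seen by \<open>f\<close> are the supports of the images of all elements of
  \<open>Y\<close>: there are fewer than \<kappa> elements, each with finite support.
  \<open>complex_coproduct_factor\<close> then applies with \<open>X i\<close> itself in place of a
  subcomplex.\<close>

lemma Sm_small:
 assumes Y: "Y \<in> Sm" shows "\<kappa>_small_object U \<kappa> \<K> Y"
 unfolding \<kappa>_small_object_def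
proof (intro allI impI)
 fix I :: "'u set" and X P0 \<iota>0 F
 assume I: "small U I" and X0: "\<forall>i\<in>I. X i \<in> Ob \<K>" and P0: "is_coproduct \<K> I X P0 \<iota>0"
  and F: "F \<in> Arr \<K> Y P0"
 note YC = Sm_complex[OF Y]
 have X: "\<And>i. i \<in> I \<Longrightarrow> X i \<in> \<C>" using X0 by (simp add: K_simps(1))
 have P0C: "P0 \<in> \<C>" using P0 by (simp add: is_coproduct_def K_simps(1))
 obtain P \<iota> \<pi> f \<theta> where P: "complex_coproduct I X P \<iota> \<pi>" and f: "f \<in> chain_maps B Y P" and \<theta>: "\<theta> \<in> Arr \<K> P P0"
  "F = Cmp \<K> Y P P0 \<theta> (\<H> Y P f)" "\<And>i. i \<in> I \<Longrightarrow> Cmp \<K> (X i) P P0 \<theta> (\<H> (X i) P (\<iota> i)) = \<iota>0 i"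
  using K_coproduct_canonical[OF I X P0 YC F] by blast
 note PD = complex_coproductD[OF P]
 let ?c = "\<lambda>i n a x. Cmp B a P$n (X i)$n (\<pi> i n) (Cmp B a Y$n P$n (f n) x)"
 define s where "s = (\<lambda>(n, a, x). {i \<in> I. ?c i n a x \<noteq> Nul B a (X i)$n})"
 define J where "J = (\<Union>t\<in>(SIGMA n : UNIV. SIGMA a : A. Arr B a Y$n). s t)"
 have JI: "J \<subseteq> I" by (auto simp: J_def s_def)
 have YO: "Y$n \<in> Ob B" and PO: "P$n \<in> Ob B" for n using complexes_Arr(1) YC PD(1) by blast+
 have "|J| <o \<kappa>"
  unfolding J_def
 proof (rule \<kappa>.lt_UN)
  show "|SIGMA n : (UNIV :: int set). SIGMA a : A. Arr B a Y$n| <o \<kappa>"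
   by (intro \<kappa>.lt_Sigma \<kappa>.lt_countable(1) uncountable A_\<kappa> Sm_lt Y)
  fix t assume "t \<in> (SIGMA n : (UNIV :: int set). SIGMA a : A. Arr B a Y$n)"
  then obtain n a x where t: "t = (n, a, x)" "a \<in> A" "x \<in> Arr B a Y$n" by blast
  then have "Cmp B a Y$n P$n (f n) x \<in> Arr B a P$n" using A_Ob YO PO chain_mapD(1)[OF f] by (simp add: Cmp_closed)
  then show "|s t| <o \<kappa>" unfolding t(1) s_def prod.case by (rule \<kappa>.lt_finite[OF good_coproductD(6)[OF PD(4) t(2)]])
 qed
 obtain Q \<iota>' \<pi>' where Q: "complex_coproduct J X Q \<iota>' \<pi>'"
  using complex_coproduct_exists[OF lt_\<kappa>_small[OF \<open>|J| <o \<kappa>\<close>], of X] X JI by blast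
 let ?m = "\<lambda>i n. Ident B (X i)$n"
 have m: "?m i \<in> chain_maps B (X i) (X i)" if "i \<in> J" for i using unit_op(2) X JI that by blast
 obtain g h where gh: "g \<in> chain_maps B Y Q" "h \<in> chain_maps B Q P"
  "\<And>i. i \<in> J \<Longrightarrow> (\<lambda>n. Cmp B (X i)$n Q$n P$n (h n) (\<iota>' i n)) =
   (\<lambda>n. Cmp B (X i)$n (X i)$n P$n (\<iota> i n) (?m i n))"
  "f = (\<lambda>n. Cmp B Y$n Q$n P$n (h n) (g n))"
 proof (rule complex_coproduct_factor[OF Q P JI, where m = ?m, OF m _ YC f])
  show "embedding (X i)$n (X i)$n (Ident B (X i)$n)" if "i \<in> J" for i n
   using embedding_Ident complexes_Arr(1)[OF X] that JI by blast
  show "\<exists>e\<in>Arr B a (X i)$n. ?c i n a x = Cmp B a (X i)$n (X i)$n (Ident B (X i)$n) e"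
   if ix: "i \<in> J" "a \<in> A" "x \<in> Arr B a Y$n" for i n a x
  proof (rule bexI[of _ "?c i n a x"])
   have iI: "i \<in> I" using ix JI by blast
   show c: "?c i n a x \<in> Arr B a (X i)$n"
    using ix A_Ob YO PO chain_mapD(1)[OF f] complexes_Arr(1)[OF X[OF iI]] good_coproductD(4)[OF PD(4) iI] by (simp add: Cmp_closed)
   show "?c i n a x = Cmp B a (X i)$n (X i)$n (Ident B (X i)$n) (?c i n a x)"
    using Cmp_Ident_left[OF A_Ob[OF ix(2)] complexes_Arr(1)[OF X[OF iI]] c] by simp
  qed
  show "?c i n a x = Nul B a (X i)$n" if "i \<in> I - J" "a \<in> A" "x \<in> Arr B a Y$n" for i n a x
   using that unfolding J_def s_def by blast
 qed blast+
 note r = K_factor[OF P Q JI YC m gh P0C \<theta>]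
 have "Cmp \<K> (X i) (X i) P0 (\<iota>0 i) (\<H> (X i) (X i) (?m i)) = \<iota>0 i" if "i \<in> J" for i
 proof -
  have i: "i \<in> I" using that JI by blast
  show ?thesis using K.Cmp_Ident_right[of "X i" P0 "\<iota>0 i"] P0 i X[OF i] by (simp add: K_Ident is_coproduct_def K_simps(1))
 qed
 then show "\<exists>J Q \<iota>' g h. J \<subseteq> I \<and> |J| <o \<kappa> \<and> is_coproduct \<K> J X Q \<iota>' \<and> g \<in> Arr \<K> Y Q \<and>
   h \<in> Arr \<K> Q P0 \<and> (\<forall>i\<in>J. Cmp \<K> (X i) Q P0 h (\<iota>' i) = \<iota>0 i) \<and> F = Cmp \<K> Y Q P0 h g"
  using JI \<open>|J| <o \<kappa>\<close> complex_coproduct_H[OF Q] r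
  by (intro exI[of _ J] exI[of _ Q] exI[of _ "\<lambda>i. \<H> (X i) Q (\<iota>' i)"] exI[of _ "\<H> Y Q g"]
    exI[of _ "Cmp \<K> Q P P0 \<theta> (\<H> Q P h)"]) simp
qed

text \<open>For every \<open>i\<close> the \<open>i\<close>-th components of the images of all
  elements of \<open>Y\<close> are fewer than \<kappa> elements of \<open>X i\<close>, and
  \<open>small_subcomplex\<close> encloses them in a small complex \<open>C i\<close>. Indices
  outside the support of \<open>f\<close> are treated in the same way, so the index set stays
  \<open>I\<close>.\<close>

lemma Sm_factor:
 assumes Y: "Y \<in> Sm" and I: "small U (I :: 'u set)" and X0: "\<And>i. i \<in> I \<Longrightarrow> X i \<in> Ob \<K>"
  and P0: "is_coproduct \<K> I X P0 \<iota>0" and F: "F \<in> Arr \<K> Y P0"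
 shows "\<exists>Y' f' Q \<iota>' g h. (\<forall>i\<in>I. Y' i \<in> Sm \<and> f' i \<in> Arr \<K> (Y' i) (X i)) \<and> is_coproduct \<K> I Y' Q \<iota>' \<and>
  g \<in> Arr \<K> Y Q \<and> h \<in> Arr \<K> Q P0 \<and>
  (\<forall>i\<in>I. Cmp \<K> (Y' i) Q P0 h (\<iota>' i) = Cmp \<K> (Y' i) (X i) P0 (\<iota>0 i) (f' i)) \<and> F = Cmp \<K> Y Q P0 h g"
proof -
 note YC = Sm_complex[OF Y]
 have X: "\<And>i. i \<in> I \<Longrightarrow> X i \<in> \<C>" using X0 by (simp add: K_simps(1))
 have P0C: "P0 \<in> \<C>" using P0 by (simp add: is_coproduct_def K_simps(1))
 obtain P \<iota> \<pi> f \<theta> where P: "complex_coproduct I X P \<iota> \<pi>" and f: "f \<in> chain_maps B Y P" and \<theta>: "\<theta> \<in> Arr \<K> P P0"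
  "F = Cmp \<K> Y P P0 \<theta> (\<H> Y P f)" "\<And>i. i \<in> I \<Longrightarrow> Cmp \<K> (X i) P P0 \<theta> (\<H> (X i) P (\<iota> i)) = \<iota>0 i"
  using K_coproduct_canonical[OF I X P0 YC F] by blast
 note PD = complex_coproductD[OF P]
 let ?c = "\<lambda>i n a x. Cmp B a P$n (X i)$n (\<pi> i n) (Cmp B a Y$n P$n (f n) x)"
 have YO: "Y$n \<in> Ob B" and PO: "P$n \<in> Ob B" for n using complexes_Arr(1) YC PD(1) by blast+
 have "\<exists>C m. C \<in> Sm \<and> m \<in> chain_maps B C (X i) \<and> (\<forall>n. embedding C$n (X i)$n (m n)) \<and>
   (\<forall>n. \<forall>a\<in>A. \<forall>x\<in>Arr B a Y$n. \<exists>e\<in>Arr B a C$n. ?c i n a x = Cmp B a C$n (X i)$n (m n) e)"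
  if i: "i \<in> I" for i
 proof -
  define E where "E = (\<lambda>(n, a, x). (n, a, ?c i n a x)) ` (SIGMA n : UNIV. SIGMA a : A. Arr B a Y$n)"
  have "|E| <o \<kappa>" unfolding E_def
   by (intro \<kappa>.lt_image \<kappa>.lt_Sigma \<kappa>.lt_countable(1) uncountable A_\<kappa> Sm_lt Y)
  moreover have "E \<subseteq> (SIGMA n : UNIV. elements (X i)$n)"
   using A_Ob YO PO chain_mapD(1)[OF f] complexes_Arr(1)[OF X[OF i]] good_coproductD(4)[OF PD(4) i]
   by (auto simp: E_def elements_def Cmp_closed)
  ultimately obtain C m where C: "C \<in> Sm" "m \<in> chain_maps B C (X i)" "\<forall>n. embedding C$n (X i)$n (m n)"
   "\<forall>n a x. (n, a, x) \<in> E \<longrightarrow> (\<exists>y\<in>Arr B a C$n. x = Cmp B a C$n (X i)$n (m n) y)"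
   using small_subcomplex[OF X[OF i]] by meson
  have "(n, a, ?c i n a x) \<in> E" if "a \<in> A" "x \<in> Arr B a Y$n" for n a x
   unfolding E_def by (rule image_eqI[of _ _ "(n, a, x)"]) (use that in simp_all)
  with C show ?thesis by (intro exI[of _ C] exI[of _ m]) simp
 qed
 then obtain C m where C: "\<And>i. i \<in> I \<Longrightarrow> C i \<in> Sm" "\<And>i. i \<in> I \<Longrightarrow> m i \<in> chain_maps B (C i) (X i)"
  "\<And>i n. i \<in> I \<Longrightarrow> embedding (C i)$n (X i)$n (m i n)"
  "\<And>i n a x. \<lbrakk>i \<in> I; a \<in> A; x \<in> Arr B a Y$n\<rbrakk> \<Longrightarrow> \<exists>e\<in>Arr B a (C i)$n. ?c i n a x = Cmp B a (C i)$n (X i)$n (m i n) e"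
  by metis
 obtain Q \<iota>' \<pi>' where Q: "complex_coproduct I C Q \<iota>' \<pi>'"
  using complex_coproduct_exists[OF I, of C] C(1) Sm_complex by blast
 obtain g h where gh: "g \<in> chain_maps B Y Q" "h \<in> chain_maps B Q P"
  "\<And>i. i \<in> I \<Longrightarrow> (\<lambda>n. Cmp B (C i)$n Q$n P$n (h n) (\<iota>' i n)) =
   (\<lambda>n. Cmp B (C i)$n (X i)$n P$n (\<iota> i n) (m i n))"
  "f = (\<lambda>n. Cmp B Y$n Q$n P$n (h n) (g n))"
  by (rule complex_coproduct_factor[OF Q P order.refl C(2,3) YC f C(4)]) (blast | assumption)+
 note r = K_factor[OF P Q order.refl YC C(2) gh P0C \<theta>]
 have "\<H> (C i) (X i) (m i) \<in> Arr \<K> (C i) (X i)" if "i \<in> I" for i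
  using K_Arr[OF Sm_complex[OF C(1)[OF that]] X[OF that]] C(2)[OF that] by blast
 then show ?thesis
  using C(1) complex_coproduct_H[OF Q] r
  by (intro exI[of _ C] exI[of _ "\<lambda>i. \<H> (C i) (X i) (m i)"] exI[of _ Q] exI[of _ "\<lambda>i. \<H> (C i) Q (\<iota>' i)"] exI[of _ "\<H> Y Q g"]
    exI[of _ "Cmp \<K> Q P P0 \<theta> (\<H> Q P h)"]) simp
qed

text \<open>
 A complex in \<open>Sm\<close> is determined up to isomorphism by the structure transported to \<open>Field \<kappa>\<close>
 from its elements: precomposition with arrows of \<open>A\<close>, and the differential.
\<close>

definition label :: "('o, 'u) cpx \<Rightarrow> int \<Rightarrow> 'o \<Rightarrow> 'u \<Rightarrow> 'u" where
 "label X n a x = (SOME e. inj_on e (SIGMA n : UNIV. elements X$n) \<and>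
   e ` (SIGMA n : UNIV. elements X$n) \<subseteq> Field \<kappa>) (n, a, x)"

definition actions :: "('o, 'u) cpx \<Rightarrow> (int \<times> 'o \<times> 'u \<times> 'o \<times> 'u \<times> 'u) set" where
 "actions X = {(n, a, label X n a x, b, label X n b (Cmp B b a X$n x u), u) |n a x b u.
   a \<in> A \<and> x \<in> Arr B a X$n \<and> b \<in> A \<and> u \<in> Arr B b a}"

definition differentials :: "('o, 'u) cpx \<Rightarrow> (int \<times> 'o \<times> 'u \<times> 'u) set" where
 "differentials X = {(n, a, label X n a x, label X (n + 1) a (Cmp B a X$n X$(n + 1) (cdiff X n) x)) |n a x.
   a \<in> A \<and> x \<in> Arr B a X$n}"

lemma label:
 assumes X: "X \<in> Sm" and a: "a \<in> A" and x: "x \<in> Arr B a X$n"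
 shows "label X n a x \<in> Field \<kappa>"
  "\<lbrakk>y \<in> Arr B a X$n; label X n a x = label X n a y\<rbrakk> \<Longrightarrow> x = y"
proof -
 let ?M = "SIGMA n :: int : UNIV. elements X$n"
 have "|?M| <o \<kappa>" unfolding elements_def
  by (intro \<kappa>.lt_Sigma \<kappa>.lt_countable(1) uncountable A_\<kappa> Sm_lt X)
 then have "|?M| \<le>o |Field \<kappa>|"
  using card_of_Field_ordIso[OF \<kappa>.card_order] ordIso_symmetric ordLess_ordIso_trans ordLess_imp_ordLeq by blast
 then have ex: "\<exists>e. inj_on e ?M \<and> e ` ?M \<subseteq> Field \<kappa>" unfolding card_of_ordLeq[symmetric] .
 define e where "e = (SOME e. inj_on e ?M \<and> e ` ?M \<subseteq> Field \<kappa>)"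
 have "inj_on e ?M \<and> e ` ?M \<subseteq> Field \<kappa>" unfolding e_def by (rule someI_ex[OF ex])
 then have e: "inj_on e ?M" "e ` ?M \<subseteq> Field \<kappa>" by simp_all
 have l: "label X n a z = e (n, a, z)" for z by (simp add: label_def e_def)
 have el: "(n, a, z) \<in> ?M" if "z \<in> Arr B a X$n" for z using a that by (simp add: elements_def)
 show "label X n a x \<in> Field \<kappa>" using e(2) el[OF x] unfolding l by blast
 show "x = y" if y: "y \<in> Arr B a X$n" "label X n a x = label X n a y"
  using inj_onD[OF e(1) _ el[OF x] el[OF y(1)]] y(2) by (simp add: l)
qed

text \<open>The map sends an element of \<open>X\<close> to the element of \<open>Y\<close> with the
  same label. \<open>actions\<close> records the label of every restriction, which makes this
  natural in \<open>a\<close>; \<open>differentials\<close> makes it commute with the differentials;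
  \<open>natural_family\<close> turns it into arrows.\<close>

lemma label_map:
 assumes X: "X \<in> Sm" and Y: "Y \<in> Sm" and sub: "actions X \<subseteq> actions Y" "differentials X \<subseteq> differentials Y"
 shows "\<exists>f\<in>chain_maps B X Y. \<forall>n. \<forall>a\<in>A. \<forall>x\<in>Arr B a X$n. label Y n a (Cmp B a X$n Y$n (f n) x) = label X n a x"
proof -
 note XO = complexes_Arr[OF Sm_complex[OF X]] and YO = complexes_Arr[OF Sm_complex[OF Y]]
 have act: "\<exists>y\<in>Arr B a Y$n. label Y n a y = label X n a x \<and> label Y n b (Cmp B b a Y$n y u) = label X n b (Cmp B b a X$n x u)"
  if "a \<in> A" "x \<in> Arr B a X$n" "b \<in> A" "u \<in> Arr B b a" for n a x b u
 proof -
  have "(n, a, label X n a x, b, label X n b (Cmp B b a X$n x u), u) \<in> actions X" using that unfolding actions_def by blast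
  then have "(n, a, label X n a x, b, label X n b (Cmp B b a X$n x u), u) \<in> actions Y" using sub(1) by blast
  then show ?thesis unfolding actions_def by auto
 qed
 have diff: "\<exists>y\<in>Arr B a Y$n. label Y n a y = label X n a x \<and>
   label Y (n + 1) a (Cmp B a Y$n Y$(n + 1) (cdiff Y n) y) = label X (n + 1) a (Cmp B a X$n X$(n + 1) (cdiff X n) x)"
  if "a \<in> A" "x \<in> Arr B a X$n" for n a x
 proof -
  have "(n, a, label X n a x, label X (n + 1) a (Cmp B a X$n X$(n + 1) (cdiff X n) x)) \<in> differentials X"
   using that unfolding differentials_def by blast
  then have "(n, a, label X n a x, label X (n + 1) a (Cmp B a X$n X$(n + 1) (cdiff X n) x)) \<in> differentials Y" using sub(2) by blast
  then show ?thesis unfolding differentials_def by auto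
 qed
 define \<phi> where "\<phi> n a x = (SOME y. y \<in> Arr B a Y$n \<and> label Y n a y = label X n a x)" for n a x
 have \<phi>12: "\<phi> n a x \<in> Arr B a Y$n \<and> label Y n a (\<phi> n a x) = label X n a x" if "a \<in> A" "x \<in> Arr B a X$n" for n a x
  unfolding \<phi>_def by (rule someI_ex) (use diff[OF that] in blast)
 note \<phi> = \<phi>12[THEN conjunct1] \<phi>12[THEN conjunct2]
 have nat: "\<phi> n b (Cmp B b a X$n x u) = Cmp B b a Y$n (\<phi> n a x) u"
  if t: "a \<in> A" "b \<in> A" "x \<in> Arr B a X$n" "u \<in> Arr B b a" for n a b x u
 proof -
  obtain y where y: "y \<in> Arr B a Y$n" "label Y n a y = label X n a x"
   "label Y n b (Cmp B b a Y$n y u) = label X n b (Cmp B b a X$n x u)" using act[OF t(1,3,2,4)] by blast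
  have "y = \<phi> n a x" using label(2)[OF Y t(1) y(1) \<phi>(1)[OF t(1,3)]] y(2) \<phi>(2)[OF t(1,3)] by simp
  moreover have xu: "Cmp B b a X$n x u \<in> Arr B b X$n" "Cmp B b a Y$n y u \<in> Arr B b Y$n"
   using t A_Ob XO YO y(1) by (simp_all add: Cmp_closed)
  ultimately show ?thesis using label(2)[OF Y t(2) \<phi>(1)[OF t(2) xu(1)] xu(2)] y(3) \<phi>(2)[OF t(2) xu(1)] by simp
 qed
 have "\<exists>f. f \<in> Arr B X$n Y$n \<and> (\<forall>a\<in>A. \<forall>x\<in>Arr B a X$n. Cmp B a X$n Y$n f x = \<phi> n a x)" for n
 proof -
  obtain f where "f \<in> Arr B X$n Y$n" "\<And>a x. \<lbrakk>a \<in> A; x \<in> Arr B a X$n\<rbrakk> \<Longrightarrow> Cmp B a X$n Y$n f x = \<phi> n a x"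
   using natural_family[OF XO(1)[of n] YO(1)[of n], of "\<phi> n", OF \<phi>(1) nat] by blast
  then show ?thesis by blast
 qed
 then obtain f where f: "\<And>n. f n \<in> Arr B X$n Y$n"
  "\<And>n a x. \<lbrakk>a \<in> A; x \<in> Arr B a X$n\<rbrakk> \<Longrightarrow> Cmp B a X$n Y$n (f n) x = \<phi> n a x" by metis
 have "Cmp B X$n X$(n + 1) Y$(n + 1) (f (n + 1)) (cdiff X n) =
   Cmp B X$n Y$n Y$(n + 1) (cdiff Y n) (f n)" for n
 proof (rule joint_epi[OF XO(1) YO(1)])
  show "Cmp B X$n X$(n + 1) Y$(n + 1) (f (n + 1)) (cdiff X n) \<in> Arr B X$n Y$(n + 1)"
   "Cmp B X$n Y$n Y$(n + 1) (cdiff Y n) (f n) \<in> Arr B X$n Y$(n + 1)"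
   using XO YO f(1) by (auto intro: Cmp_closed)
  fix a x assume ax: "a \<in> A" "x \<in> Arr B a X$n"
  obtain y where y: "y \<in> Arr B a Y$n" "label Y n a y = label X n a x"
   "label Y (n + 1) a (Cmp B a Y$n Y$(n + 1) (cdiff Y n) y) = label X (n + 1) a (Cmp B a X$n X$(n + 1) (cdiff X n) x)"
   using diff[OF ax] by blast
  have "y = \<phi> n a x" using label(2)[OF Y ax(1) y(1) \<phi>(1)[OF ax]] y(2) \<phi>(2)[OF ax] by simp
  moreover have dx: "Cmp B a X$n X$(n + 1) (cdiff X n) x \<in> Arr B a X$(n + 1)"
   "Cmp B a Y$n Y$(n + 1) (cdiff Y n) y \<in> Arr B a Y$(n + 1)"
   using ax A_Ob XO YO y(1) by (simp_all add: Cmp_closed)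
  ultimately have "\<phi> (n + 1) a (Cmp B a X$n X$(n + 1) (cdiff X n) x) = Cmp B a Y$n Y$(n + 1) (cdiff Y n) (\<phi> n a x)"
   using label(2)[OF Y ax(1) \<phi>(1)[OF ax(1) dx(1)] dx(2)] y(3) \<phi>(2)[OF ax(1) dx(1)] by simp
  then show "Cmp B a X$n Y$(n + 1) (Cmp B X$n X$(n + 1) Y$(n + 1) (f (n + 1)) (cdiff X n)) x =
    Cmp B a X$n Y$(n + 1) (Cmp B X$n Y$n Y$(n + 1) (cdiff Y n) (f n)) x"
   using ax A_Ob XO YO f(1) f(2)[OF ax] f(2)[OF ax(1) dx(1)] by (simp add: Cmp_assoc[symmetric])
 qed
 then have "f \<in> chain_maps B X Y" using f(1) by (simp add: chain_maps_def)
 then show ?thesis by (rule bexI[of _ f, rotated]) (simp add: f(2) \<phi>(2))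
qed

lemma label_inverse:
 assumes X: "X \<in> Sm" and Y: "Y \<in> Sm" and f: "f \<in> chain_maps B X Y" and g: "g \<in> chain_maps B Y X"
  and lf: "\<And>n a x. \<lbrakk>a \<in> A; x \<in> Arr B a X$n\<rbrakk> \<Longrightarrow> label Y n a (Cmp B a X$n Y$n (f n) x) = label X n a x"
  and lg: "\<And>n a x. \<lbrakk>a \<in> A; x \<in> Arr B a Y$n\<rbrakk> \<Longrightarrow> label X n a (Cmp B a Y$n X$n (g n) x) = label Y n a x"
 shows "Cmp \<K> X Y X (\<H> Y X g) (\<H> X Y f) = Ident \<K> X"
proof -
 note XC = Sm_complex[OF X] and YC = Sm_complex[OF Y]
 note XO = complexes_Arr(1)[OF XC] and YO = complexes_Arr(1)[OF YC] and fA = chain_mapD(1)[OF f] and gA = chain_mapD(1)[OF g]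
 have "Cmp B X$n Y$n X$n (g n) (f n) = Ident B X$n" for n
 proof (rule joint_epi[OF XO XO])
  show "Cmp B X$n Y$n X$n (g n) (f n) \<in> Arr B X$n X$n" "Ident B X$n \<in> Arr B X$n X$n"
   using XO YO fA gA by (simp_all add: closed)
  fix a x assume ax: "a \<in> A" "x \<in> Arr B a X$n"
  let ?y = "Cmp B a X$n Y$n (f n) x" let ?z = "Cmp B a Y$n X$n (g n) ?y"
  have y: "?y \<in> Arr B a Y$n" "?z \<in> Arr B a X$n" using ax A_Ob XO YO fA gA by (simp_all add: Cmp_closed)
  have "?z = x" using label(2)[OF X ax(1) y(2) ax(2)] lg[OF ax(1) y(1)] lf[OF ax] by simp
  then show "Cmp B a X$n X$n (Cmp B X$n Y$n X$n (g n) (f n)) x = Cmp B a X$n X$n (Ident B X$n) x"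
   using ax A_Ob XO YO fA gA by (simp add: Cmp_assoc Cmp_Ident_left)
 qed
 then show ?thesis using K_Cmp[OF XC YC XC f g] by (simp add: K_Ident)
qed

lemma label_isomorphism:
 assumes X: "X \<in> Sm" and Y: "Y \<in> Sm" and eq: "actions X = actions Y" "differentials X = differentials Y"
 shows "\<exists>f. isomorphism \<K> X Y f"
proof -
 obtain f where f: "f \<in> chain_maps B X Y" "\<forall>n. \<forall>a\<in>A. \<forall>x\<in>Arr B a X$n. label Y n a (Cmp B a X$n Y$n (f n) x) = label X n a x"
  using label_map[OF X Y] eq by auto
 obtain g where g: "g \<in> chain_maps B Y X" "\<forall>n. \<forall>a\<in>A. \<forall>x\<in>Arr B a Y$n. label X n a (Cmp B a Y$n X$n (g n) x) = label Y n a x"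
  using label_map[OF Y X] eq by auto
 have "Cmp \<K> X Y X (\<H> Y X g) (\<H> X Y f) = Ident \<K> X" "Cmp \<K> Y X Y (\<H> X Y f) (\<H> Y X g) = Ident \<K> Y"
  using label_inverse[OF X Y f(1) g(1)] label_inverse[OF Y X g(1) f(1)] f(2) g(2) by simp_all
 moreover have "\<H> X Y f \<in> Arr \<K> X Y" "\<H> Y X g \<in> Arr \<K> Y X"
  using K_Arr[OF Sm_complex Sm_complex] X Y f(1) g(1) by blast+
 ultimately show ?thesis unfolding isomorphism_def by blast
qed

text \<open>Labels lie in \<open>Field \<kappa>\<close>, so \<open>actions\<close> and
  \<open>differentials\<close> are subsets of fixed small sets. There is only a small set of such
  pairs, and one complex is chosen for each pair that occurs.\<close>

lemma Sm_representatives: "\<exists>R. small U R \<and> R \<subseteq> Sm \<and> (\<forall>X\<in>Sm. \<exists>Y\<in>R. \<exists>f. isomorphism \<K> X Y f)"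
proof -
 let ?W = "Field \<kappa>" and ?H = "\<Union>b\<in>A. \<Union>a\<in>A. Arr B b a"
 let ?D1 = "(UNIV :: int set) \<times> A \<times> ?W \<times> A \<times> ?W \<times> ?H" and ?D2 = "(UNIV :: int set) \<times> A \<times> ?W \<times> ?W"
 let ?code = "\<lambda>X. (actions X, differentials X)"
 define rep where "rep c = (SOME X. X \<in> Sm \<and> ?code X = c)" for c
 have W: "|?W| <o |U|" using card_of_Field_ordIso[OF \<kappa>.card_order] \<kappa>_small ordIso_ordLess_trans by blast
 have A: "|A| <o |U|" and H: "|?H| <o |U|"
  using lt_\<kappa>_small[OF A_\<kappa>] lt_\<kappa>_small[OF A_hom_\<kappa>] unfolding small_def by (auto intro!: lt_UN)
 have "small U ?D1" "small U ?D2"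
  unfolding small_def by (intro lt_Sigma W A H lt_countable(1) natLeq_less)+
 then have "|Pow ?D1 \<times> Pow ?D2| <o |U|" by (intro lt_Sigma) (rule small_Pow[unfolded small_def], simp add: small_def)+
 moreover have "?code ` Sm \<subseteq> Pow ?D1 \<times> Pow ?D2"
 proof (intro image_subsetI SigmaI PowI)
  fix X assume X: "X \<in> Sm"
  note XO = complexes_Arr[OF Sm_complex[OF X]]
  show "actions X \<subseteq> ?D1" using label(1)[OF X] A_Ob XO by (fastforce simp: actions_def Cmp_closed)
  show "differentials X \<subseteq> ?D2" using label(1)[OF X] A_Ob XO by (fastforce simp: differentials_def Cmp_closed)
 qed
 ultimately have "|rep ` ?code ` Sm| <o |U|" using lt_image lt_subset by blast
 moreover have rep: "rep (?code X) \<in> Sm \<and> ?code (rep (?code X)) = ?code X" if "X \<in> Sm" for X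
  unfolding rep_def by (rule someI_ex) (use that in blast)
 then have "rep ` ?code ` Sm \<subseteq> Sm" by blast
 moreover have "\<exists>Y\<in>rep ` ?code ` Sm. \<exists>f. isomorphism \<K> X Y f" if X: "X \<in> Sm" for X
  using label_isomorphism[OF X, of "rep (?code X)"] rep[OF X] X by (intro bexI[of _ "rep (?code X)"]) auto
 ultimately show ?thesis unfolding small_def by (intro exI[of _ "rep ` ?code ` Sm"]) blast
qed

lemma small_objects_Sm: "small_objects U \<K> \<kappa> Sm"
proof (intro small_objects.intro small_objects_axioms.intro KC.coproduct_triangulated_axioms \<kappa>.regular_cardinal_axioms)
 show "\<kappa> <o |U|" by (rule \<kappa>_small)
 show "Sm \<subseteq> Ob \<K>" by (auto simp: Sm_def K_simps(1))
 show "\<exists>N\<in>Sm. is_zero \<K> N" by (rule Sm_zero)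
 show "X \<in> Sm \<Longrightarrow> fob (Shift \<K>) X \<in> Sm" for X using Sm_shft by (simp add: K_simps(7))
 show "X \<in> Sm \<Longrightarrow> \<exists>Y\<in>Sm. \<exists>f. isomorphism \<K> (fob (Shift \<K>) Y) X f" for X
  using Sm_unshift by (simp add: K_simps(7))
 show "\<exists>Z\<in>Sm. \<exists>v w. (X, Y, Z, u, v, w) \<in> Tri \<K>" if "X \<in> Sm" "Y \<in> Sm" "u \<in> Arr \<K> X Y" for X Y u
  using that by (rule Sm_cone)
 show "\<exists>P\<in>Sm. \<exists>\<iota>. is_coproduct \<K> J V P \<iota>" if "|J| <o \<kappa>" "\<And>i. i \<in> J \<Longrightarrow> V i \<in> Sm" for J :: "'u set" and V
  using that by (rule Sm_coproduct)
 show "Y \<in> Sm \<Longrightarrow> \<kappa>_small_object U \<kappa> \<K> Y" for Y by (rule Sm_small)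
 show "\<exists>Y' f' Q \<iota>' g h. (\<forall>i\<in>I. Y' i \<in> Sm \<and> f' i \<in> Arr \<K> (Y' i) (V i)) \<and> is_coproduct \<K> I Y' Q \<iota>' \<and>
    g \<in> Arr \<K> Y Q \<and> h \<in> Arr \<K> Q P \<and>
    (\<forall>i\<in>I. Cmp \<K> (Y' i) Q P h (\<iota>' i) = Cmp \<K> (Y' i) (V i) P (\<iota> i) (f' i)) \<and> f = Cmp \<K> Y Q P h g"
  if "Y \<in> Sm" "small U I" "\<And>i. i \<in> I \<Longrightarrow> V i \<in> Ob \<K>" "is_coproduct \<K> I V P \<iota>" "f \<in> Arr \<K> Y P"
  for Y and I :: "'u set" and V P \<iota> f using that by (rule Sm_factor)
 show "\<exists>R. small U R \<and> R \<subseteq> Sm \<and> (\<forall>X\<in>Sm. \<exists>Y\<in>R. \<exists>f. isomorphism \<K> X Y f)" by (rule Sm_representatives)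
qed

end


text \<open>The cardinal \<kappa> depends on \<open>S\<close>, since it has to exceed the sizes of
  the groups \<open>B(a, X n)\<close> for \<open>X\<close> in \<open>S\<close>. The argument thus
  gives each \<open>Loc S\<close> its own cardinal, which is exactly what the local form of well
  generation asks for.\<close>

theorem theorem4p3:
  fixes U :: "'u set" and B :: "('o, 'u) preadd_cat"
  assumes "inaccessible U"
    and "finitely_accessible U B"
  shows "locally_well_generated U (K_cat B)"
proof -
 interpret universe U by unfold_locales (rule assms(1))
 have B: "additive_category B" "locally_small U B" "has_filtered_colimits U B" using assms(2) by (simp_all add: finitely_accessible_def)
 obtain A where A: "small U A" "\<forall>a\<in>A. finitely_presentable U B a"
  "\<forall>X\<in>Ob B. \<exists>J F c. filtered_diagram U J B F \<and> (\<forall>j\<in>Ob J. fob F j \<in> A) \<and> is_colimit J B F X c"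
  using assms(2) unfolding finitely_accessible_def by blast
 interpret additive_category B by (rule B(1))
 interpret fa: finitely_accessible_category U B A
  by unfold_locales (use B(2,3) A in simp_all)
 have K: "\<exists>\<kappa> :: 'u rel. small_regular_cardinal U \<kappa> \<and> accessible_homotopy U B A \<kappa> \<and>
   (\<forall>X\<in>S. \<forall>n. \<forall>a\<in>A. |Arr B a X$n| <o \<kappa>)" if S: "S \<subseteq> complexes B" "small U S" for S
 proof -
  let ?H = "\<Union>a\<in>A. \<Union>b\<in>A. Arr B a b" and ?E = "\<Union>X\<in>S. \<Union>n. \<Union>a\<in>A. Arr B a X$n"
  have XO: "X$n \<in> Ob B" if "X \<in> S" for X n using S(1) that by (auto simp: complexes_def)
  \<comment> \<open>One small set dominates \<open>A\<close>, the groups between objects of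
    \<open>A\<close>, and the elements of the complexes in \<open>S\<close>, so that a single
    cardinal above it meets all bounds.\<close>
  have "|A <+> (?H \<union> ?E)| <o |U|"
  proof (rule card_of_Plus_ordLess_infinite_Field[OF inf_Field card_order])
   show "|A| <o |U|" using A(1) by (simp add: small_def)
   have "|?H| <o |U|"
    by (intro lt_UN fa.small_hom[unfolded small_def] fa.A_Ob) (use A(1) in \<open>simp_all add: small_def\<close>)
   moreover have "|?E| <o |U|"
    by (intro lt_UN fa.small_hom[unfolded small_def] lt_countable(1) natLeq_less) (use A(1) S XO fa.A_Ob in \<open>simp_all add: small_def\<close>)
   ultimately show "|?H \<union> ?E| <o |U|" by (rule lt_Un)
  qed
  then obtain \<kappa> :: "'u rel" where \<kappa>: "small_regular_cardinal U \<kappa>" "|A <+> (?H \<union> ?E)| <o \<kappa>" "natLeq <o \<kappa>"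
   using ex_regular_cardinal unfolding small_def by blast
  interpret \<kappa>: regular_cardinal \<kappa>
   using \<kappa>(1) by unfold_locales (simp_all add: small_regular_cardinal_def)
  have l: "|A| <o \<kappa>" "|?H \<union> ?E| <o \<kappa>"
   using card_of_Plus1 card_of_Plus2 \<kappa>(2) ordLeq_ordLess_trans by blast+
  have "accessible_homotopy U B A \<kappa>"
  proof (intro accessible_homotopy.intro accessible_homotopy_axioms.intro homotopy.intro graded_category.intro)
   show "\<kappa> <o |U|" using \<kappa>(1) by (simp add: small_regular_cardinal_def)
   show "|Arr B a b| <o \<kappa>" if "a \<in> A" "b \<in> A" for a b
    by (rule \<kappa>.lt_subset[OF _ l(2)]) (use that in blast)
  qed (use \<kappa>(3) l(1) fa.finitely_accessible_category_axioms \<kappa>.regular_cardinal_axioms additive_category_axioms preadditive_category_axioms in simp_all)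
  moreover have "|Arr B a X$n| <o \<kappa>" if "X \<in> S" "a \<in> A" for X n a
   by (rule \<kappa>.lt_subset[OF _ l(2)]) (use that in blast)
  ultimately show ?thesis using \<kappa>(1) by blast
 qed
 show ?thesis unfolding locally_well_generated_def
 proof (intro conjI allI impI)
  \<comment> \<open>The triangulated structure and the coproducts do not involve \<open>S\<close>;
    any admissible \<kappa> gives access to them, and the empty set provides one.\<close>
  have "small U ({} :: ('o, 'u) cpx set)" unfolding small_def by (rule lt_finite) simp
  then obtain \<kappa> :: "'u rel" where "accessible_homotopy U B A \<kappa>" using K[of "{}"] by blast
  then interpret accessible_homotopy U B A \<kappa> .
  show "triangulated_with_coproducts U (K_cat B)"
   unfolding triangulated_with_coproducts_def using K.triangulated_category_axioms locally_small_K has_coproducts_K by blast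
 next
  fix S assume S: "S \<subseteq> Ob (K_cat B) \<and> small U S"
  have "Ob (K_cat B) = complexes B"
   by (simp add: K_cat_def preadd_cat.extend_def tri_cat.fields_def homotopy_category_def quotient_category_def C_cat_def)
  then obtain \<kappa> :: "'u rel" where \<kappa>: "small_regular_cardinal U \<kappa>" "accessible_homotopy U B A \<kappa>"
   "\<forall>X\<in>S. \<forall>n. \<forall>a\<in>A. |Arr B a X$n| <o \<kappa>" and SC: "S \<subseteq> complexes B" using K[of S] S by auto
  interpret accessible_homotopy U B A \<kappa> by (rule \<kappa>(2))
  interpret so: small_objects U "K_cat B" \<kappa> Sm by (rule small_objects_Sm)
  have "S \<subseteq> Sm" using \<kappa>(3) SC by (auto simp: Sm_def)
  then show "well_generated U (full_subcategory (K_cat B) (Loc U (K_cat B) S))"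
   unfolding well_generated_def using \<kappa>(1) so.Loc_\<kappa>_well_generated by blast
 qed
qed

end
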